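(* Let $K$ be a field of characteristic $p>0$, let $n\geq 0$ be an integer, and let $X=X_{p,n}$ be the projective curve obtained from the numerical semigroup $\Gamma_{p,n}$. Then the action of the group scheme $\mathbb{G}_a\rtimes U_n\rtimes\mathbb{G}_m$ on the affine line $\mathbb{A}^1=\operatorname{Spec} K[T^{-1}]$ extends to an action on the compactification $X=X_{p,n}$.
   Context: For a commutative $K$-algebra $R$, let $R[F;\sigma]$ be the skew polynomial ring whose elements are polynomials $\sum\lambda_iF^i$ with $\lambda_i\in R$ and multiplication determined by $F\lambda=\lambda^pF$. The infinitesimal group scheme $U_n$ over $K$ is the functor $U_n(R)=\{1+\sum_{i=1}^n\lambda_iF^i \mid \lambda_i^{p^{n-i+1}}=0 \text{ for } 1\leq i\leq n\}$, a subgroup of the unit group $R[F;\sigma]^\times$. Put $x=T^{-1}$, so $\mathbb{A}^1=\operatorname{Spec}K[x]$. On $R$-valued points $\mu\in\mathbb{A}^1(R)=R$ one has left actions: of $U_n$ by $(\sum_{i=0}^n\lambda_iF^i)\ast\mu=\sum_{i=0}^n\lambda_i\mu^{p^i}$ (with $\lambda_0=1$), of $\mathbb{G}_m$ by $\lambda_0\ast\mu=\lambda_0\mu$, and of $\mathbb{G}_a$ by $\alpha\ast\mu=\mu+\alpha$. These actions are faithful; inside the sheaf $\operatorname{Aut}_{\mathbb{A}^1/K}$ the group $\mathbb{G}_a$ is normalized by $U_n$, both are normalized by $\mathbb{G}_m$, and the intersections $\mathbb{G}_a\cap U_n$ and $(\mathbb{G}_a\rtimes U_n)\cap\mathbb{G}_m$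 are trivial. The resulting subgroup is the iterated semidirect product $\mathbb{G}_a\rtimes U_n\rtimes\mathbb{G}_m$, acting on $\mathbb{A}^1$. $\Gamma_{p,n}\subset\mathbb{N}$ is the numerical semigroup (additive submonoid with finite complement) generated by $p^n$ and $p^n-p^j$ for $0\leq j\leq n-1$. For a numerical semigroup $\Gamma$, put $K[T^\Gamma]=K[T^a\mid a\in\Gamma]$. The curve is $X_{p,n}=\operatorname{Spec}K[T^{\Gamma_{p,n}}]\cup\operatorname{Spec}K[T^{-1}]$, glued along $\operatorname{Spec}K[T^{\pm1}]$. *)

theory Defs
  imports
    "HOL-Algebra.Module"
    "HOL-Algebra.Ideal"
    "HOL-Algebra.Multiplicative_Group"
    "HOL-Algebra.Group_Action"
    "HOL-Analysis.Abstract_Topology"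
begin

section \<open>Algebras over a base ring\<close>

text \<open>
  A commutative \<open>K\<close>-algebra is a record \<open>R\<close> of type \<open>module\<close> with \<^term>\<open>algebra K R\<close>.
  The argument \<open>K\<close> is only used through its carrier here.
\<close>

definition alg_hom ::
  "('k, 'm) ring_scheme \<Rightarrow> ('k, 'a) module \<Rightarrow> ('k, 'b) module \<Rightarrow> ('a \<Rightarrow> 'b) set" where
  "alg_hom K A B = {\<phi> \<in> ring_hom A B.
     \<forall>c \<in> carrier K. \<forall>x \<in> carrier A. \<phi> (c \<odot>\<^bsub>A\<^esub> x) = c \<odot>\<^bsub>B\<^esub> \<phi> x}"

text \<open>
  \<open>laurent_algebra K S\<close> is the algebra \<open>K[T\<^sup>a | a \<in> S]\<close> for a submonoid \<open>S\<close> of the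
  integers; \<open>f\<close> stands for the Laurent polynomial with coefficient \<open>f a\<close> at \<open>T\<^sup>a\<close>.
\<close>

definition laurent_algebra :: "('k, 'm) ring_scheme \<Rightarrow> int set \<Rightarrow> ('k, int \<Rightarrow> 'k) module" where
  "laurent_algebra K S = \<lparr>
     carrier = {f. (\<forall>a. f a \<in> carrier K) \<and> finite {a. f a \<noteq> \<zero>\<^bsub>K\<^esub>} \<and> (\<forall>a. a \<notin> S \<longrightarrow> f a = \<zero>\<^bsub>K\<^esub>)},
     monoid.mult = (\<lambda>f g a. \<Oplus>\<^bsub>K\<^esub>b \<in> {b. f b \<noteq> \<zero>\<^bsub>K\<^esub>}. f b \<otimes>\<^bsub>K\<^esub> g (a - b)),
     one = (\<lambda>a. if a = 0 then \<one>\<^bsub>K\<^esub> else \<zero>\<^bsub>K\<^esub>),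
     ring.zero = (\<lambda>a. \<zero>\<^bsub>K\<^esub>),
     ring.add = (\<lambda>f g a. f a \<oplus>\<^bsub>K\<^esub> g a),
     smult = (\<lambda>c f a. c \<otimes>\<^bsub>K\<^esub> f a) \<rparr>"

text \<open>
  Localization of \<open>A\<close> at a multiplicative set \<open>S\<close>.  The fraction \<open>a/s\<close> is the set of all
  pairs equivalent to \<open>(a, s)\<close>; the operations on such classes are written as unions over all
  representatives, which is a union of equal sets.
\<close>

definition fraction :: "('k, 'a) module \<Rightarrow> 'a set \<Rightarrow> 'a \<Rightarrow> 'a \<Rightarrow> ('a \<times> 'a) set" where
  "fraction A S a s = {(b, t). b \<in> carrier A \<and> t \<in> S \<and>
     (\<exists>w \<in> S. w \<otimes>\<^bsub>A\<^esub> (t \<otimes>\<^bsub>A\<^esub> a \<ominus>\<^bsub>A\<^esub> s \<otimes>\<^bsub>A\<^esub> b) = \<zero>\<^bsub>A\<^esub>)}"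

definition localization :: "('k, 'a) module \<Rightarrow> 'a set \<Rightarrow> ('k, ('a \<times> 'a) set) module" where
  "localization A S = \<lparr>
     carrier = {fraction A S a s | a s. a \<in> carrier A \<and> s \<in> S},
     monoid.mult = (\<lambda>X Y. \<Union>x \<in> X. \<Union>y \<in> Y.
       fraction A S (fst x \<otimes>\<^bsub>A\<^esub> fst y) (snd x \<otimes>\<^bsub>A\<^esub> snd y)),
     one = fraction A S \<one>\<^bsub>A\<^esub> \<one>\<^bsub>A\<^esub>,
     ring.zero = fraction A S \<zero>\<^bsub>A\<^esub> \<one>\<^bsub>A\<^esub>,
     ring.add = (\<lambda>X Y. \<Union>x \<in> X. \<Union>y \<in> Y.
       fraction A S (snd y \<otimes>\<^bsub>A\<^esub> fst x \<oplus>\<^bsub>A\<^esub> snd x \<otimes>\<^bsub>A\<^esub> fst y) (snd x \<otimes>\<^bsub>A\<^esub> snd y)),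
     smult = (\<lambda>c X. \<Union>x \<in> X. fraction A S (c \<odot>\<^bsub>A\<^esub> fst x) (snd x)) \<rparr>"

definition stalk_at :: "('k, 'a) module \<Rightarrow> 'a set \<Rightarrow> ('k, ('a \<times> 'a) set) module" where
  "stalk_at A P = localization A (carrier A - P)"


section \<open>Locally ringed spaces over \<open>K\<close> and their morphisms\<close>

text \<open>
  A \<open>K\<close>-scheme is represented by its underlying locally ringed space, the structure morphism to
  \<open>Spec K\<close> being recorded as a \<open>K\<close>-algebra structure on the sections.  Only the values of
  \<open>sections\<close> and \<open>restr\<close> at open sets are meaningful.
\<close>

record ('k, 'p, 's) rspace =
  top_of :: "'p topology"
  sections :: "'p set \<Rightarrow> ('k, 's) module"
  restr :: "'p set \<Rightarrow> 'p set \<Rightarrow> 's \<Rightarrow> 's"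

record ('p, 's, 'q, 't) rmor =
  pt :: "'p \<Rightarrow> 'q"
  comor :: "'q set \<Rightarrow> 't \<Rightarrow> 's"

definition preim ::
  "('k, 'p, 's) rspace \<Rightarrow> ('p, 's, 'q, 't) rmor \<Rightarrow> 'q set \<Rightarrow> 'p set" where
  "preim X f V = {x \<in> topspace (top_of X). pt f x \<in> V}"

text \<open>The germ of the section \<open>s\<close> over \<open>U\<close> at the point \<open>x\<close> is a unit of the stalk.\<close>

definition germ_unit :: "('k, 'p, 's) rspace \<Rightarrow> 'p set \<Rightarrow> 's \<Rightarrow> 'p \<Rightarrow> bool" where
  "germ_unit X U s x \<longleftrightarrow>
     (\<exists>W. openin (top_of X) W \<and> x \<in> W \<and> W \<subseteq> U \<and> restr X U W s \<in> Units (sections X W))"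

text \<open>
  \<open>rmors K X Y\<close> is the set of morphisms \<open>X \<rightarrow> Y\<close> of locally ringed spaces over \<open>K\<close>.  The last
  condition says that the maps on stalks are local, i.e. reflect units.  Everything is
  extensional, so that equal morphisms are equal as HOL objects.
\<close>

definition rmors ::
  "('k, 'm) ring_scheme \<Rightarrow> ('k, 'p, 's) rspace \<Rightarrow> ('k, 'q, 't) rspace \<Rightarrow> ('p, 's, 'q, 't) rmor set" where
  "rmors K X Y = {f.
     pt f \<in> extensional (topspace (top_of X)) \<and>
     continuous_map (top_of X) (top_of Y) (pt f) \<and>
     comor f \<in> extensional {V. openin (top_of Y) V} \<and>
     (\<forall>V. openin (top_of Y) V \<longrightarrow>
        comor f V \<in> alg_hom K (sections Y V) (sections X (preim X f V)) \<inter>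
                     extensional (carrier (sections Y V))) \<and>
     (\<forall>V V'. openin (top_of Y) V \<and> openin (top_of Y) V' \<and> V' \<subseteq> V \<longrightarrow>
        (\<forall>s \<in> carrier (sections Y V).
           comor f V' (restr Y V V' s) = restr X (preim X f V) (preim X f V') (comor f V s))) \<and>
     (\<forall>V. openin (top_of Y) V \<longrightarrow>
        (\<forall>s \<in> carrier (sections Y V). \<forall>x \<in> preim X f V.
           germ_unit X (preim X f V) (comor f V s) x \<longrightarrow> germ_unit Y V s (pt f x)))}"

definition rcomp ::
  "('k, 'p, 's) rspace \<Rightarrow> ('k, 'q, 't) rspace \<Rightarrow> ('k, 'r, 'v) rspace \<Rightarrow>
   ('q, 't, 'r, 'v) rmor \<Rightarrow> ('p, 's, 'q, 't) rmor \<Rightarrow> ('p, 's, 'r, 'v) rmor" where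
  "rcomp X Y Z g f = \<lparr>
     pt = (\<lambda>x \<in> topspace (top_of X). pt g (pt f x)),
     comor = (\<lambda>V \<in> {V. openin (top_of Z) V}. \<lambda>s \<in> carrier (sections Z V).
       comor f (preim Y g V) (comor g V s)) \<rparr>"


section \<open>Affine schemes\<close>

definition basic_open :: "('k, 'a) module \<Rightarrow> 'a \<Rightarrow> 'a set set" where
  "basic_open A a = {P. primeideal P A \<and> a \<notin> P}"

definition Spec :: "('k, 'a) module \<Rightarrow> ('k, 'a set, 'a set \<Rightarrow> ('a \<times> 'a) set) rspace" where
  "Spec A = \<lparr>
     top_of = topology_generated_by (basic_open A ` carrier A),
     sections = (\<lambda>U. \<lparr>
       carrier = {s \<in> (\<Pi>\<^sub>E P \<in> U. carrier (stalk_at A P)).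
         \<forall>P \<in> U. \<exists>a \<in> carrier A. \<exists>f \<in> carrier A. \<exists>V.
           openin (topology_generated_by (basic_open A ` carrier A)) V \<and> P \<in> V \<and> V \<subseteq> U \<and>
           (\<forall>Q \<in> V. f \<notin> Q \<and> s Q = fraction A (carrier A - Q) a f)},
       monoid.mult = (\<lambda>s t. \<lambda>P \<in> U. s P \<otimes>\<^bsub>stalk_at A P\<^esub> t P),
       one = (\<lambda>P \<in> U. \<one>\<^bsub>stalk_at A P\<^esub>),
       ring.zero = (\<lambda>P \<in> U. \<zero>\<^bsub>stalk_at A P\<^esub>),
       ring.add = (\<lambda>s t. \<lambda>P \<in> U. s P \<oplus>\<^bsub>stalk_at A P\<^esub> t P),
       smult = (\<lambda>c s. \<lambda>P \<in> U. c \<odot>\<^bsub>stalk_at A P\<^esub> s P) \<rparr>),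
     restr = (\<lambda>U V s. restrict s V) \<rparr>"

text \<open>The morphism \<open>Spec B \<rightarrow> Spec A\<close> induced by an algebra homomorphism \<open>\<phi>\<close> from \<open>A\<close> to \<open>B\<close>.\<close>

definition Spec_pt ::
  "('k, 'a) module \<Rightarrow> ('k, 'b) module \<Rightarrow> ('a \<Rightarrow> 'b) \<Rightarrow> 'b set \<Rightarrow> 'a set" where
  "Spec_pt A B \<phi> = (\<lambda>Q \<in> topspace (top_of (Spec B)). {a \<in> carrier A. \<phi> a \<in> Q})"

definition stalk_map ::
  "('k, 'b) module \<Rightarrow> ('a \<Rightarrow> 'b) \<Rightarrow> 'b set \<Rightarrow> ('a \<times> 'a) set \<Rightarrow> ('b \<times> 'b) set" where
  "stalk_map B \<phi> Q X = (\<Union>x \<in> X. fraction B (carrier B - Q) (\<phi> (fst x)) (\<phi> (snd x)))"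

definition Spec_map ::
  "('k, 'a) module \<Rightarrow> ('k, 'b) module \<Rightarrow> ('a \<Rightarrow> 'b) \<Rightarrow>
   ('b set, 'b set \<Rightarrow> ('b \<times> 'b) set, 'a set, 'a set \<Rightarrow> ('a \<times> 'a) set) rmor" where
  "Spec_map A B \<phi> = \<lparr>
     pt = Spec_pt A B \<phi>,
     comor = (\<lambda>V \<in> {V. openin (top_of (Spec A)) V}. \<lambda>s \<in> carrier (sections (Spec A) V).
       \<lambda>Q \<in> {Q \<in> topspace (top_of (Spec B)). Spec_pt A B \<phi> Q \<in> V}.
         stalk_map B \<phi> Q (s (Spec_pt A B \<phi> Q))) \<rparr>"


section \<open>Gluing two spaces\<close>

text \<open>
  \<open>glue X Y Z i j\<close> is the pushout \<open>X \<union>\<^sub>Z Y\<close> of ringed spaces along \<open>i\<close> from \<open>Z\<close> to \<open>X\<close> and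
  \<open>j\<close> from \<open>Z\<close> to \<open>Y\<close>; for open immersions \<open>i\<close> and \<open>j\<close> this is the usual gluing.  The points are
  the classes of the equivalence relation on the disjoint sum generated by \<open>i z \<sim> j z\<close>, and a
  section is a pair of sections that agree on \<open>Z\<close>.
\<close>

definition glue_rel ::
  "('k, 'r, 'v) rspace \<Rightarrow> ('r, 'v, 'p, 's) rmor \<Rightarrow> ('r, 'v, 'q, 't) rmor \<Rightarrow> ('p + 'q) rel" where
  "glue_rel Z i j =
     (let E = {(Inl (pt i z), Inr (pt j z)) | z. z \<in> topspace (top_of Z)} in (E \<union> E\<inverse>)\<^sup>*)"

definition glue_pts ::
  "('k, 'p, 's) rspace \<Rightarrow> ('k, 'q, 't) rspace \<Rightarrow> ('k, 'r, 'v) rspace \<Rightarrow>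
   ('r, 'v, 'p, 's) rmor \<Rightarrow> ('r, 'v, 'q, 't) rmor \<Rightarrow> ('p + 'q) set set" where
  "glue_pts X Y Z i j =
     {glue_rel Z i j `` {e} | e. e \<in> topspace (top_of X) <+> topspace (top_of Y)}"

definition left_part ::
  "('k, 'p, 's) rspace \<Rightarrow> ('k, 'r, 'v) rspace \<Rightarrow> ('r, 'v, 'p, 's) rmor \<Rightarrow> ('r, 'v, 'q, 't) rmor \<Rightarrow>
   ('p + 'q) set set \<Rightarrow> 'p set" where
  "left_part X Z i j W = {x \<in> topspace (top_of X). glue_rel Z i j `` {Inl x} \<in> W}"

definition right_part ::
  "('k, 'q, 't) rspace \<Rightarrow> ('k, 'r, 'v) rspace \<Rightarrow> ('r, 'v, 'p, 's) rmor \<Rightarrow> ('r, 'v, 'q, 't) rmor \<Rightarrow>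
   ('p + 'q) set set \<Rightarrow> 'q set" where
  "right_part Y Z i j W = {y \<in> topspace (top_of Y). glue_rel Z i j `` {Inr y} \<in> W}"

definition glue_open ::
  "('k, 'p, 's) rspace \<Rightarrow> ('k, 'q, 't) rspace \<Rightarrow> ('k, 'r, 'v) rspace \<Rightarrow>
   ('r, 'v, 'p, 's) rmor \<Rightarrow> ('r, 'v, 'q, 't) rmor \<Rightarrow> ('p + 'q) set set \<Rightarrow> bool" where
  "glue_open X Y Z i j W \<longleftrightarrow> W \<subseteq> glue_pts X Y Z i j \<and>
     openin (top_of X) (left_part X Z i j W) \<and> openin (top_of Y) (right_part Y Z i j W)"

lemma istopology_glue_open: "istopology (glue_open X Y Z i j)"
proof -
  have L: "left_part X Z i j (S \<inter> T) = left_part X Z i j S \<inter> left_part X Z i j T"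
          "left_part X Z i j (\<Union>\<K>) = (\<Union>W\<in>\<K>. left_part X Z i j W)" for S T \<K>
    by (auto simp: left_part_def)
  have R: "right_part Y Z i j (S \<inter> T) = right_part Y Z i j S \<inter> right_part Y Z i j T"
          "right_part Y Z i j (\<Union>\<K>) = (\<Union>W\<in>\<K>. right_part Y Z i j W)" for S T \<K>
    by (auto simp: right_part_def)
  show ?thesis
    unfolding istopology_def glue_open_def L R by blast
qed

definition glue ::
  "('k, 'p, 's) rspace \<Rightarrow> ('k, 'q, 't) rspace \<Rightarrow> ('k, 'r, 'v) rspace \<Rightarrow>
   ('r, 'v, 'p, 's) rmor \<Rightarrow> ('r, 'v, 'q, 't) rmor \<Rightarrow> ('k, ('p + 'q) set, 's \<times> 't) rspace" where
  "glue X Y Z i j = \<lparr>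
     top_of = topology (glue_open X Y Z i j),
     sections = (\<lambda>W. let A = sections X (left_part X Z i j W);
                         B = sections Y (right_part Y Z i j W) in \<lparr>
       carrier = {(s, t). s \<in> carrier A \<and> t \<in> carrier B \<and>
         comor i (left_part X Z i j W) s = comor j (right_part Y Z i j W) t},
       monoid.mult = (\<lambda>(s, t) (s', t'). (s \<otimes>\<^bsub>A\<^esub> s', t \<otimes>\<^bsub>B\<^esub> t')),
       one = (\<one>\<^bsub>A\<^esub>, \<one>\<^bsub>B\<^esub>),
       ring.zero = (\<zero>\<^bsub>A\<^esub>, \<zero>\<^bsub>B\<^esub>),
       ring.add = (\<lambda>(s, t) (s', t'). (s \<oplus>\<^bsub>A\<^esub> s', t \<oplus>\<^bsub>B\<^esub> t')),
       smult = (\<lambda>c (s, t). (c \<odot>\<^bsub>A\<^esub> s, c \<odot>\<^bsub>B\<^esub> t)) \<rparr>),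
     restr = (\<lambda>W W' (s, t).
       (restr X (left_part X Z i j W) (left_part X Z i j W') s,
        restr Y (right_part Y Z i j W) (right_part Y Z i j W') t)) \<rparr>"

definition glue_inr ::
  "('k, 'p, 's) rspace \<Rightarrow> ('k, 'q, 't) rspace \<Rightarrow> ('k, 'r, 'v) rspace \<Rightarrow>
   ('r, 'v, 'p, 's) rmor \<Rightarrow> ('r, 'v, 'q, 't) rmor \<Rightarrow> ('q, 't, ('p + 'q) set, 's \<times> 't) rmor" where
  "glue_inr X Y Z i j = \<lparr>
     pt = (\<lambda>y \<in> topspace (top_of Y). glue_rel Z i j `` {Inr y}),
     comor = (\<lambda>W \<in> {W. openin (top_of (glue X Y Z i j)) W}.
       \<lambda>s \<in> carrier (sections (glue X Y Z i j) W). snd s) \<rparr>"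


section \<open>The curve\<close>

inductive_set Gamma :: "nat \<Rightarrow> nat \<Rightarrow> nat set" for p n :: nat where
  zero: "0 \<in> Gamma p n"
| gen_top: "p ^ n \<in> Gamma p n"
| gen: "j < n \<Longrightarrow> p ^ n - p ^ j \<in> Gamma p n"
| add: "a \<in> Gamma p n \<Longrightarrow> b \<in> Gamma p n \<Longrightarrow> a + b \<in> Gamma p n"

type_synonym 'a aff_pt = "'a set"
type_synonym 'a aff_sec = "'a set \<Rightarrow> ('a \<times> 'a) set"
type_synonym 'k curve_pt = "((int \<Rightarrow> 'k) aff_pt + (int \<Rightarrow> 'k) aff_pt) set"
type_synonym 'k curve_sec = "(int \<Rightarrow> 'k) aff_sec \<times> (int \<Rightarrow> 'k) aff_sec"

definition semigroup_algebra :: "('k, 'm) ring_scheme \<Rightarrow> nat set \<Rightarrow> ('k, int \<Rightarrow> 'k) module" where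
  "semigroup_algebra K S = laurent_algebra K (int ` S)"

text \<open>The coordinate ring \<open>K[T\<^sup>-\<^sup>1]\<close> of the affine line, with coordinate \<open>x = T\<^sup>-\<^sup>1\<close>.\<close>

definition line_algebra :: "('k, 'm) ring_scheme \<Rightarrow> ('k, int \<Rightarrow> 'k) module" where
  "line_algebra K = laurent_algebra K {..0}"

definition torus_algebra :: "('k, 'm) ring_scheme \<Rightarrow> ('k, int \<Rightarrow> 'k) module" where
  "torus_algebra K = laurent_algebra K UNIV"

text \<open>
  The gluing maps are the ones induced by the inclusions of \<open>K[T\<^sup>\<Gamma>]\<close> and \<open>K[T\<^sup>-\<^sup>1]\<close> into the
  Laurent polynomial ring, which are the identity on coefficient functions.
\<close>

definition curve ::
  "('k, 'm) ring_scheme \<Rightarrow> nat \<Rightarrow> nat \<Rightarrow> ('k, 'k curve_pt, 'k curve_sec) rspace" where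
  "curve K p n =
     glue (Spec (semigroup_algebra K (Gamma p n))) (Spec (line_algebra K)) (Spec (torus_algebra K))
       (Spec_map (semigroup_algebra K (Gamma p n)) (torus_algebra K) (\<lambda>f. f))
       (Spec_map (line_algebra K) (torus_algebra K) (\<lambda>f. f))"

definition line_in_curve ::
  "('k, 'm) ring_scheme \<Rightarrow> nat \<Rightarrow> nat \<Rightarrow>
   ((int \<Rightarrow> 'k) aff_pt, (int \<Rightarrow> 'k) aff_sec, 'k curve_pt, 'k curve_sec) rmor" where
  "line_in_curve K p n =
     glue_inr (Spec (semigroup_algebra K (Gamma p n))) (Spec (line_algebra K)) (Spec (torus_algebra K))
       (Spec_map (semigroup_algebra K (Gamma p n)) (torus_algebra K) (\<lambda>f. f))
       (Spec_map (line_algebra K) (torus_algebra K) (\<lambda>f. f))"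


section \<open>The group scheme\<close>

text \<open>Skew polynomials \<open>\<Sum> a\<^sub>i F\<^sup>i\<close> with \<open>F a = a\<^sup>p F\<close>.\<close>

definition skew_poly :: "nat \<Rightarrow> ('k, 'u) module \<Rightarrow> (nat \<Rightarrow> 'u) ring" where
  "skew_poly p R = \<lparr>
     carrier = {u. (\<forall>i. u i \<in> carrier R) \<and> finite {i. u i \<noteq> \<zero>\<^bsub>R\<^esub>}},
     monoid.mult = (\<lambda>u v k. \<Oplus>\<^bsub>R\<^esub>i \<in> {..k}. u i \<otimes>\<^bsub>R\<^esub> (v (k - i) [^]\<^bsub>R\<^esub> (p ^ i))),
     one = (\<lambda>i. if i = 0 then \<one>\<^bsub>R\<^esub> else \<zero>\<^bsub>R\<^esub>),
     ring.zero = (\<lambda>i. \<zero>\<^bsub>R\<^esub>),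
     ring.add = (\<lambda>u v i. u i \<oplus>\<^bsub>R\<^esub> v i) \<rparr>"

definition U_set :: "nat \<Rightarrow> nat \<Rightarrow> ('k, 'u) module \<Rightarrow> (nat \<Rightarrow> 'u) set" where
  "U_set p n R = {u \<in> carrier (skew_poly p R). u 0 = \<one>\<^bsub>R\<^esub> \<and>
     (\<forall>i \<in> {1..n}. u i [^]\<^bsub>R\<^esub> (p ^ (n - i + 1)) = \<zero>\<^bsub>R\<^esub>) \<and> (\<forall>i > n. u i = \<zero>\<^bsub>R\<^esub>)}"

definition U_group :: "nat \<Rightarrow> nat \<Rightarrow> ('k, 'u) module \<Rightarrow> (nat \<Rightarrow> 'u) monoid" where
  "U_group p n R = (units_of (skew_poly p R))\<lparr>carrier := U_set p n R\<rparr>"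

definition U_act :: "nat \<Rightarrow> nat \<Rightarrow> ('k, 'u) module \<Rightarrow> (nat \<Rightarrow> 'u) \<Rightarrow> 'u \<Rightarrow> 'u" where
  "U_act p n R u \<mu> = (\<Oplus>\<^bsub>R\<^esub>i \<in> {..n}. u i \<otimes>\<^bsub>R\<^esub> (\<mu> [^]\<^bsub>R\<^esub> (p ^ i)))"

definition semidirect ::
  "('a, 'm) monoid_scheme \<Rightarrow> ('b, 'l) monoid_scheme \<Rightarrow> ('b \<Rightarrow> 'a \<Rightarrow> 'a) \<Rightarrow> ('a \<times> 'b) monoid" where
  "semidirect N H \<theta> = \<lparr>
     carrier = carrier N \<times> carrier H,
     monoid.mult = (\<lambda>(x, h) (y, k). (x \<otimes>\<^bsub>N\<^esub> \<theta> h y, h \<otimes>\<^bsub>H\<^esub> k)),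
     one = (\<one>\<^bsub>N\<^esub>, \<one>\<^bsub>H\<^esub>) \<rparr>"

text \<open>
  The \<open>R\<close>-valued points of \<open>\<bbbG>\<^sub>a \<rtimes> U\<^sub>n \<rtimes> \<bbbG>\<^sub>m\<close>.  The conjugation actions are those inside the
  automorphisms of the affine line: \<open>u \<circ> \<alpha> \<circ> u\<^sup>-\<^sup>1\<close> is translation by \<open>u * \<alpha>\<close>, \<open>t \<circ> \<alpha> \<circ> t\<^sup>-\<^sup>1\<close> is
  translation by \<open>t \<alpha>\<close>, and \<open>t \<circ> u \<circ> t\<^sup>-\<^sup>1\<close> is the skew polynomial
  \<open>t (\<Sum> u\<^sub>i F\<^sup>i) t\<^sup>-\<^sup>1\<close>; here \<open>F\<^sup>i t\<^sup>-\<^sup>1\<close> is \<open>s F\<^sup>i\<close> with \<open>s\<close> the \<open>p\<^sup>i\<close>-th power of \<open>t\<^sup>-\<^sup>1\<close>.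
\<close>

definition GUG ::
  "nat \<Rightarrow> nat \<Rightarrow> ('k, 'u) module \<Rightarrow> (('u \<times> (nat \<Rightarrow> 'u)) \<times> 'u) monoid" where
  "GUG p n R =
     semidirect
       (semidirect (add_monoid R) (U_group p n R) (U_act p n R))
       (units_of R)
       (\<lambda>t (\<alpha>, u). (t \<otimes>\<^bsub>R\<^esub> \<alpha>,
          \<lambda>i. t \<otimes>\<^bsub>R\<^esub> u i \<otimes>\<^bsub>R\<^esub> ((inv\<^bsub>R\<^esub> t) [^]\<^bsub>R\<^esub> (p ^ i))))"

definition GUG_map ::
  "('u \<Rightarrow> 'u) \<Rightarrow> ('u \<times> (nat \<Rightarrow> 'u)) \<times> 'u \<Rightarrow> ('u \<times> (nat \<Rightarrow> 'u)) \<times> 'u" where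
  "GUG_map \<phi> = (\<lambda>((\<alpha>, u), t). ((\<phi> \<alpha>, \<lambda>i. \<phi> (u i)), \<phi> t))"

text \<open>The action on \<open>R\<close>-valued points of the affine line: first scale, then apply \<open>u\<close>, then translate.\<close>

definition GUG_line_act ::
  "nat \<Rightarrow> nat \<Rightarrow> ('k, 'u) module \<Rightarrow> ('u \<times> (nat \<Rightarrow> 'u)) \<times> 'u \<Rightarrow> 'u \<Rightarrow> 'u" where
  "GUG_line_act p n R = (\<lambda>((\<alpha>, u), t) \<mu>. U_act p n R u (t \<otimes>\<^bsub>R\<^esub> \<mu>) \<oplus>\<^bsub>R\<^esub> \<alpha>)"


section \<open>Points with values in an algebra, and group scheme actions\<close>

definition points ::
  "('k, 'm) ring_scheme \<Rightarrow> ('k, 'p, 's) rspace \<Rightarrow> ('k, 'u) module \<Rightarrow> ('u aff_pt, 'u aff_sec, 'p, 's) rmor set" where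
  "points K X R = rmors K (Spec R) X"

definition points_map ::
  "('k, 'p, 's) rspace \<Rightarrow> ('k, 'u) module \<Rightarrow> ('k, 'u) module \<Rightarrow> ('u \<Rightarrow> 'u) \<Rightarrow>
   ('u aff_pt, 'u aff_sec, 'p, 's) rmor \<Rightarrow> ('u aff_pt, 'u aff_sec, 'p, 's) rmor" where
  "points_map X R R' \<phi> f = rcomp (Spec R') (Spec R) X f (Spec_map R R' \<phi>)"

text \<open>
  An action of a group functor on a \<open>K\<close>-scheme: group actions on the sets of \<open>R\<close>-valued points,
  natural in the commutative \<open>K\<close>-algebra \<open>R\<close>.  The algebras range over all those with carrier
  in the (arbitrary) type \<open>'u\<close>, which plays the role of the universe.
\<close>

definition group_functor_action ::
  "('k, 'm) ring_scheme \<Rightarrow> (('k, 'u) module \<Rightarrow> 'g monoid) \<Rightarrow> (('u \<Rightarrow> 'u) \<Rightarrow> 'g \<Rightarrow> 'g) \<Rightarrow>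
   ('k, 'p, 's) rspace \<Rightarrow>
   (('k, 'u) module \<Rightarrow> 'g \<Rightarrow> ('u aff_pt, 'u aff_sec, 'p, 's) rmor \<Rightarrow> ('u aff_pt, 'u aff_sec, 'p, 's) rmor) \<Rightarrow>
   bool" where
  "group_functor_action K G Gmap X \<rho> \<longleftrightarrow>
     (\<forall>R. algebra K R \<longrightarrow> group_action (G R) (points K X R) (\<rho> R)) \<and>
     (\<forall>R R'. algebra K R \<and> algebra K R' \<longrightarrow>
        (\<forall>\<phi> \<in> alg_hom K R R'. \<forall>g \<in> carrier (G R). \<forall>f \<in> points K X R.
           points_map X R R' \<phi> (\<rho> R g f) = \<rho> R' (Gmap \<phi> g) (points_map X R R' \<phi> f)))"

text \<open>
  The \<open>R\<close>-valued point of the curve given by \<open>\<mu> \<in> R\<close>: the point of the affine line that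
  corresponds to the algebra homomorphism \<open>T\<^sup>-\<^sup>1 \<mapsto> \<mu>\<close>, followed by the open immersion.
\<close>

definition line_eval :: "('k, 'm) ring_scheme \<Rightarrow> ('k, 'u) module \<Rightarrow> 'u \<Rightarrow> (int \<Rightarrow> 'k) \<Rightarrow> 'u" where
  "line_eval K R \<mu> f = (\<Oplus>\<^bsub>R\<^esub>a \<in> {a. f a \<noteq> \<zero>\<^bsub>K\<^esub>}. f a \<odot>\<^bsub>R\<^esub> (\<mu> [^]\<^bsub>R\<^esub> nat (- a)))"

definition line_point ::
  "('k, 'm) ring_scheme \<Rightarrow> ('k, 'u) module \<Rightarrow> 'u \<Rightarrow>
   ('u aff_pt, 'u aff_sec, (int \<Rightarrow> 'k) aff_pt, (int \<Rightarrow> 'k) aff_sec) rmor" where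
  "line_point K R \<mu> = Spec_map (line_algebra K) R (line_eval K R \<mu>)"

definition curve_point ::
  "('k, 'm) ring_scheme \<Rightarrow> nat \<Rightarrow> nat \<Rightarrow> ('k, 'u) module \<Rightarrow> 'u \<Rightarrow>
   ('u aff_pt, 'u aff_sec, 'k curve_pt, 'k curve_sec) rmor" where
  "curve_point K p n R \<mu> =
     rcomp (Spec R) (Spec (line_algebra K)) (curve K p n) (line_in_curve K p n) (line_point K R \<mu>)"

end

theory Submission
  imports Defs "HOL-Algebra.QuotRing" "HOL-Computational_Algebra.Primes"
begin

text \<open>
  The semigroup is generated by the differences of \<open>p\<^sup>n\<close> and the numbers \<open>0, 1, p, \<dots>, p\<^sup>n\<close>, so with
  \<open>x = T\<^sup>-\<^sup>1\<close> the curve lies in projective space as the closure of the points with homogeneous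
  coordinates 1, \<open>x\<close>, \<open>x\<^sup>p\<close>, and so on up to the \<open>p\<^sup>n\<close>-th power of \<open>x\<close>.  Locally, a morphism
  from \<open>Spec R\<close> to the curve is a vector \<open>(a, b\<^sub>0, \<dots>, b\<^sub>n)\<close>, unique up to units, in which \<open>a\<close> or
  \<open>b\<^sub>n\<close> is a unit and the \<open>p\<close>-th power of \<open>b\<^sub>l\<close> is \<open>a\<^sup>p\<^sup>-\<^sup>1 b\<^sub>l\<^sub>+\<^sub>1\<close>.  The group acts
  linearly on these vectors: raising the action on \<open>x\<close> to the \<open>p\<^sup>l\<close>-th power produces no powers of
  \<open>x\<close> beyond the \<open>p\<^sup>n\<close>-th, because the nilpotency conditions of \<open>U\<^sub>n\<close> kill their coefficients.
\<close>

text \<open>A point of the curve over \<open>R\<close> has homogeneous coordinates only locally on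
  \<open>Spec R\<close>, and only up to a unit. The vectors are therefore kept in the stalks: there
  the condition that \<open>a\<close> or \<open>b_n\<close> is a unit selects a chart, and the sum
  of a nonunit and a unit is a unit. The latter carries the action at infinity. The last coordinate
  becomes \<open>t^(p^n) b_n + \<alpha>^(p^n) a\<close>, because the \<open>p^n\<close>-th powers of
  the higher coefficients of an element of \<open>U_n\<close> vanish, and it has to stay a unit
  where \<open>a\<close> is not one.

  The relations \<open>b_l^p = a^(p-1) b_(l+1)\<close> are the equations
  \<open>(b_l / a)^p = b_(l+1) / a\<close> freed of denominators, so they make sense where
  \<open>a\<close> is not invertible. The obstacle is the chart at infinity: a vector normalized to
  \<open>b_n = 1\<close> has to define a homomorphism out of the semigroup algebra, which requires
  that the semigroup be presented by exactly these relations.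

  Once points are identified with locally regular families of such vectors up to units, the action
  axioms, naturality and agreement with the action on the line become identities between linear
  formulas over local rings.\<close>

lemma UN_const_eq: "x \<in> X \<Longrightarrow> (\<And>y. y \<in> X \<Longrightarrow> F y = c) \<Longrightarrow> (\<Union>y\<in>X. F y) = c"
  by blast

section \<open>Homomorphisms of algebras and units\<close>

lemma alg_homI:
  assumes "\<And>x. x \<in> carrier A \<Longrightarrow> h x \<in> carrier B"
    and "\<And>x y. x \<in> carrier A \<Longrightarrow> y \<in> carrier A \<Longrightarrow> h (x \<otimes>\<^bsub>A\<^esub> y) = h x \<otimes>\<^bsub>B\<^esub> h y"
    and "\<And>x y. x \<in> carrier A \<Longrightarrow> y \<in> carrier A \<Longrightarrow> h (x \<oplus>\<^bsub>A\<^esub> y) = h x \<oplus>\<^bsub>B\<^esub> h y"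
    and "h \<one>\<^bsub>A\<^esub> = \<one>\<^bsub>B\<^esub>"
    and "\<And>c x. c \<in> carrier K \<Longrightarrow> x \<in> carrier A \<Longrightarrow> h (c \<odot>\<^bsub>A\<^esub> x) = c \<odot>\<^bsub>B\<^esub> h x"
  shows "h \<in> alg_hom K A B"
  using assms by (auto simp: alg_hom_def intro!: ring_hom_memI)

lemma alg_hom_closed: "h \<in> alg_hom K A B \<Longrightarrow> x \<in> carrier A \<Longrightarrow> h x \<in> carrier B"
  by (auto simp: alg_hom_def ring_hom_closed)

lemma alg_hom_mult:
  "h \<in> alg_hom K A B \<Longrightarrow> x \<in> carrier A \<Longrightarrow> y \<in> carrier A \<Longrightarrow> h (x \<otimes>\<^bsub>A\<^esub> y) = h x \<otimes>\<^bsub>B\<^esub> h y"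
  by (auto simp: alg_hom_def ring_hom_mult)

lemma alg_hom_add:
  "h \<in> alg_hom K A B \<Longrightarrow> x \<in> carrier A \<Longrightarrow> y \<in> carrier A \<Longrightarrow> h (x \<oplus>\<^bsub>A\<^esub> y) = h x \<oplus>\<^bsub>B\<^esub> h y"
  by (auto simp: alg_hom_def ring_hom_add)

lemma alg_hom_one: "h \<in> alg_hom K A B \<Longrightarrow> h \<one>\<^bsub>A\<^esub> = \<one>\<^bsub>B\<^esub>"
  by (auto simp: alg_hom_def ring_hom_one)

lemma alg_hom_smult:
  "h \<in> alg_hom K A B \<Longrightarrow> c \<in> carrier K \<Longrightarrow> x \<in> carrier A \<Longrightarrow> h (c \<odot>\<^bsub>A\<^esub> x) = c \<odot>\<^bsub>B\<^esub> h x"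
  by (auto simp: alg_hom_def)

lemma alg_hom_ring_hom_cring:
  "h \<in> alg_hom K A B \<Longrightarrow> algebra K A \<Longrightarrow> algebra K B \<Longrightarrow> ring_hom_cring A B h"
  by (auto simp: alg_hom_def ring_hom_cring_def ring_hom_cring_axioms_def algebra.M_cring)

lemma alg_hom_zero:
  "h \<in> alg_hom K A B \<Longrightarrow> algebra K A \<Longrightarrow> algebra K B \<Longrightarrow> h \<zero>\<^bsub>A\<^esub> = \<zero>\<^bsub>B\<^esub>"
  by (rule ring_hom_cring.hom_zero[OF alg_hom_ring_hom_cring])

lemma alg_hom_comp:
  "g \<in> alg_hom K B C \<Longrightarrow> f \<in> alg_hom K A B \<Longrightarrow> (\<lambda>x. g (f x)) \<in> alg_hom K A C"
  by (rule alg_homI) (simp_all add: alg_hom_closed alg_hom_mult alg_hom_add alg_hom_one alg_hom_smult)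

lemma alg_hom_cong:
  assumes h: "h \<in> alg_hom K A B" and A: "algebra K A" and eq: "\<And>x. x \<in> carrier A \<Longrightarrow> h' x = h x"
  shows "h' \<in> alg_hom K A B"
proof -
  interpret algebra K A by fact
  show ?thesis
    by (rule alg_homI) (simp_all add: eq alg_hom_closed[OF h] alg_hom_mult[OF h] alg_hom_add[OF h]
        alg_hom_one[OF h] alg_hom_smult[OF h])
qed

lemma (in monoid) Units_mult_inv_unique:
  assumes "u \<in> carrier G" "v \<in> carrier G" "u \<otimes> v = \<one>" "v \<otimes> u = \<one>"
  shows "u \<in> Units G" "inv u = v"
  using assms by (auto simp: Units_def intro: inv_char)

text \<open>The element \<open>b \<otimes> inv (a \<otimes> b)\<close> inverts \<open>a\<close>.
  This makes the nonunits of a ring absorb multiplication, and it lets unit factors be dropped when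
  a scaled coordinate is tested for being a unit.\<close>

lemma (in cring) Units_prod_iff:
  assumes "a \<in> carrier R" "b \<in> carrier R"
  shows "a \<otimes> b \<in> Units R \<longleftrightarrow> a \<in> Units R \<and> b \<in> Units R"
  
proof
  assume u: "a \<otimes> b \<in> Units R"
  have "a \<otimes> (b \<otimes> inv (a \<otimes> b)) = \<one>" "b \<otimes> (a \<otimes> inv (a \<otimes> b)) = \<one>"
    using assms u Units_r_inv[OF u] by (simp_all add: m_assoc[symmetric]) (simp add: m_comm[of b])
  then show "a \<in> Units R \<and> b \<in> Units R"
    using assms u by (metis Units_inv_closed Units_mult_inv_unique(1) m_closed m_comm)
qed auto

lemma (in cring) Units_cancel:
  assumes "u \<in> Units R" "z \<in> carrier R"
  shows "u \<otimes> (inv u \<otimes> z) = z" "inv u \<otimes> (u \<otimes> z) = z" "u \<otimes> (z \<otimes> inv u) = z" "inv u \<otimes> (z \<otimes> u) = z"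
proof -
  show 1: "u \<otimes> (inv u \<otimes> z) = z" "inv u \<otimes> (u \<otimes> z) = z" using assms by (simp_all add: m_assoc[symmetric] Units_closed)
  show "u \<otimes> (z \<otimes> inv u) = z" "inv u \<otimes> (z \<otimes> u) = z" using assms 1 by (simp_all add: m_comm[of z] Units_closed)
qed

lemma alg_hom_Units:
  assumes h: "h \<in> alg_hom K A B" and A: "algebra K A" and B: "algebra K B" and u: "u \<in> Units A"
  shows "h u \<in> Units B" "h (inv\<^bsub>A\<^esub> u) = inv\<^bsub>B\<^esub> (h u)"
proof -
  interpret A: algebra K A by fact
  interpret B: algebra K B by fact
  have "h u \<otimes>\<^bsub>B\<^esub> h (inv\<^bsub>A\<^esub> u) = \<one>\<^bsub>B\<^esub>" "h (inv\<^bsub>A\<^esub> u) \<otimes>\<^bsub>B\<^esub> h u = \<one>\<^bsub>B\<^esub>"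
    using u alg_hom_mult[OF h, of u "inv\<^bsub>A\<^esub> u"] alg_hom_mult[OF h, of "inv\<^bsub>A\<^esub> u" u]
    by (simp_all add: alg_hom_one[OF h] A.Units_closed)
  moreover have "h u \<in> carrier B" "h (inv\<^bsub>A\<^esub> u) \<in> carrier B"
    using u by (auto intro: alg_hom_closed[OF h])
  ultimately show "h u \<in> Units B" "h (inv\<^bsub>A\<^esub> u) = inv\<^bsub>B\<^esub> (h u)"
    using B.Units_mult_inv_unique by auto
qed

section \<open>Localization\<close>

text \<open>For a stalk, \<open>S\<close> is the complement of a prime. An arbitrary multiplicative
  set keeps primality out of the calculus of fractions.\<close>

locale frac_ring = algebra K A for K :: "('k, 'm) ring_scheme" and A :: "('k, 'a) module" (structure) +
  fixes S :: "'a set"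
  assumes S_sub: "S \<subseteq> carrier A" and S_one: "\<one> \<in> S"
    and S_mult: "s \<in> S \<Longrightarrow> t \<in> S \<Longrightarrow> s \<otimes> t \<in> S"
begin

abbreviation "fr \<equiv> fraction A S"
abbreviation "L \<equiv> localization A S"

lemma S_carr [simp]: "s \<in> S \<Longrightarrow> s \<in> carrier A"
  using S_sub by auto

lemmas [simp] = S_one S_mult

lemma frac_mem:
  assumes "a \<in> carrier A" "s \<in> S"
  shows "(b, t) \<in> fr a s \<longleftrightarrow> b \<in> carrier A \<and> t \<in> S \<and> (\<exists>w \<in> S. w \<otimes> (t \<otimes> a) = w \<otimes> (s \<otimes> b))"
proof -
  have "w \<otimes> (t \<otimes> a \<ominus> s \<otimes> b) = \<zero> \<longleftrightarrow> w \<otimes> (t \<otimes> a) = w \<otimes> (s \<otimes> b)"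
    if "b \<in> carrier A" "t \<in> S" "w \<in> S" for w
  proof -
    have "w \<otimes> (t \<otimes> a \<ominus> s \<otimes> b) = w \<otimes> (t \<otimes> a) \<ominus> w \<otimes> (s \<otimes> b)"
      using assms that by (simp add: minus_eq r_distr r_minus)
    then show ?thesis using assms that by (simp add: r_right_minus_eq)
  qed
  then show ?thesis by (auto simp: fraction_def)
qed

lemma frac_self: "a \<in> carrier A \<Longrightarrow> s \<in> S \<Longrightarrow> (a, s) \<in> fr a s"
  by (auto simp: frac_mem intro: bexI[of _ \<one>])

lemma frac_eqI:
  assumes [simp]: "a \<in> carrier A" "s \<in> S" "b \<in> carrier A" "t \<in> S" "w \<in> S"
    and eq: "w \<otimes> (t \<otimes> a) = w \<otimes> (s \<otimes> b)"
  shows "fr a s = fr b t"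
proof -
  \<comment> \<open>One inclusion suffices, since the hypotheses are symmetric in the two fractions.
    The witness \<open>w \<otimes> v \<otimes> s\<close> multiplies the two given witnesses and the
    denominator of the middle fraction.\<close>
  have *: "(c, r) \<in> fr b t" if "(c, r) \<in> fr a s" and [simp]: "a \<in> carrier A" "s \<in> S" "b \<in> carrier A" "t \<in> S" "w \<in> S"
    and eq: "w \<otimes> (t \<otimes> a) = w \<otimes> (s \<otimes> b)" for a s b t w c r
  proof -
    from that(1) obtain v where [simp]: "c \<in> carrier A" "r \<in> S" "v \<in> S" and v: "v \<otimes> (r \<otimes> a) = v \<otimes> (s \<otimes> c)"
      by (auto simp: frac_mem)
    have "(w \<otimes> v \<otimes> s) \<otimes> (r \<otimes> b) = v \<otimes> r \<otimes> (w \<otimes> (s \<otimes> b))" by (simp add: m_ac)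
    also have "\<dots> = w \<otimes> t \<otimes> (v \<otimes> (r \<otimes> a))" by (simp add: eq[symmetric]) (simp add: m_ac)
    also have "\<dots> = (w \<otimes> v \<otimes> s) \<otimes> (t \<otimes> c)" by (simp add: v) (simp add: m_ac)
    finally show ?thesis by (auto simp: frac_mem intro!: bexI[of _ "w \<otimes> v \<otimes> s"])
  qed
  show ?thesis
    using *[of _ _ a s b t w] *[of _ _ b t a s w] eq by auto
qed

lemma frac_eq_iff:
  assumes "a \<in> carrier A" "s \<in> S" "b \<in> carrier A" "t \<in> S"
  shows "fr a s = fr b t \<longleftrightarrow> (\<exists>w \<in> S. w \<otimes> (t \<otimes> a) = w \<otimes> (s \<otimes> b))"
  using assms frac_eqI frac_self[of b t] frac_mem[of a s b t] by blast

lemma frac_cancel: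
  assumes "a \<in> carrier A" "s \<in> S" "t \<in> S"
  shows "fr (t \<otimes> a) (t \<otimes> s) = fr a s"
  using assms by (intro frac_eqI[where w=\<one>]) (auto simp: m_ac)

lemma L_carrier: "carrier L = {fr a s | a s. a \<in> carrier A \<and> s \<in> S}"
  by (simp add: localization_def)

lemma frac_carrier [simp]: "a \<in> carrier A \<Longrightarrow> s \<in> S \<Longrightarrow> fr a s \<in> carrier L"
  by (auto simp: L_carrier)

lemma L_cases:
  assumes "X \<in> carrier L"
  obtains a s where "a \<in> carrier A" "s \<in> S" "X = fr a s"
  using assms by (auto simp: L_carrier)

lemma L_one: "\<one>\<^bsub>L\<^esub> = fr \<one> \<one>" and L_zero: "\<zero>\<^bsub>L\<^esub> = fr \<zero> \<one>"
  by (simp_all add: localization_def)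

text \<open>All representatives of the two classes give the same product class, the product of the
  two witnesses being a witness. So the union in the definition collapses to the fraction formed
  from any chosen representatives.\<close>

lemma L_mult:
  assumes [simp]: "a \<in> carrier A" "s \<in> S" "b \<in> carrier A" "t \<in> S"
  shows "fr a s \<otimes>\<^bsub>L\<^esub> fr b t = fr (a \<otimes> b) (s \<otimes> t)"
proof -
  have "fr (fst x \<otimes> fst y) (snd x \<otimes> snd y) = fr (a \<otimes> b) (s \<otimes> t)"
    if x: "x \<in> fr a s" and y: "y \<in> fr b t" for x y
  proof -
    obtain c r w where [simp]: "x = (c, r)" "c \<in> carrier A" "r \<in> S" "w \<in> S"
      and w: "w \<otimes> (r \<otimes> a) = w \<otimes> (s \<otimes> c)"
      using x by (cases x) (auto simp: frac_mem)
    obtain d q v where [simp]: "y = (d, q)" "d \<in> carrier A" "q \<in> S" "v \<in> S"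
      and v: "v \<otimes> (q \<otimes> b) = v \<otimes> (t \<otimes> d)"
      using y by (cases y) (auto simp: frac_mem)
    have "(w \<otimes> v) \<otimes> (s \<otimes> t \<otimes> (c \<otimes> d)) = (w \<otimes> (s \<otimes> c)) \<otimes> (v \<otimes> (t \<otimes> d))" by (simp add: m_ac)
    also have "\<dots> = (w \<otimes> v) \<otimes> (r \<otimes> q \<otimes> (a \<otimes> b))" by (simp add: w[symmetric] v[symmetric]) (simp add: m_ac)
    finally show ?thesis by (intro frac_eqI[where w="w \<otimes> v"]) auto
  qed
  then show ?thesis
    unfolding localization_def monoid.simps
    by (intro UN_const_eq[OF frac_self[of a s]] UN_const_eq[OF frac_self[of b t]]) auto
qed

lemma L_add:
  assumes [simp]: "a \<in> carrier A" "s \<in> S" "b \<in> carrier A" "t \<in> S"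
  shows "fr a s \<oplus>\<^bsub>L\<^esub> fr b t = fr (t \<otimes> a \<oplus> s \<otimes> b) (s \<otimes> t)"
proof -
  have "fr (snd y \<otimes> fst x \<oplus> snd x \<otimes> fst y) (snd x \<otimes> snd y) = fr (t \<otimes> a \<oplus> s \<otimes> b) (s \<otimes> t)"
    if x: "x \<in> fr a s" and y: "y \<in> fr b t" for x y
  proof -
    obtain c r w where [simp]: "x = (c, r)" "c \<in> carrier A" "r \<in> S" "w \<in> S"
      and w: "w \<otimes> (r \<otimes> a) = w \<otimes> (s \<otimes> c)"
      using x by (cases x) (auto simp: frac_mem)
    obtain d q v where [simp]: "y = (d, q)" "d \<in> carrier A" "q \<in> S" "v \<in> S"
      and v: "v \<otimes> (q \<otimes> b) = v \<otimes> (t \<otimes> d)"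
      using y by (cases y) (auto simp: frac_mem)
    have "(w \<otimes> v) \<otimes> (s \<otimes> t \<otimes> (q \<otimes> c \<oplus> r \<otimes> d)) =
      v \<otimes> t \<otimes> q \<otimes> (w \<otimes> (s \<otimes> c)) \<oplus> w \<otimes> s \<otimes> r \<otimes> (v \<otimes> (t \<otimes> d))" by (simp add: m_ac r_distr)
    also have "\<dots> = (w \<otimes> v) \<otimes> (r \<otimes> q \<otimes> (t \<otimes> a \<oplus> s \<otimes> b))"
      by (simp add: w[symmetric] v[symmetric]) (simp add: m_ac r_distr)
    finally show ?thesis by (intro frac_eqI[where w="w \<otimes> v"]) auto
  qed
  then show ?thesis
    unfolding localization_def monoid.simps ring.simps
    by (intro UN_const_eq[OF frac_self[of a s]] UN_const_eq[OF frac_self[of b t]]) auto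
qed

lemma L_smult:
  assumes [simp]: "a \<in> carrier A" "s \<in> S" "c \<in> carrier K"
  shows "c \<odot>\<^bsub>L\<^esub> fr a s = fr (c \<odot> a) s"
proof -
  have "fr (c \<odot> fst x) (snd x) = fr (c \<odot> a) s"
    if x: "x \<in> fr a s" for x
  proof -
    obtain d r w where [simp]: "x = (d, r)" "d \<in> carrier A" "r \<in> S" "w \<in> S"
      and w: "w \<otimes> (r \<otimes> a) = w \<otimes> (s \<otimes> d)"
      using x by (cases x) (auto simp: frac_mem)
    have *: "w \<otimes> (u \<otimes> (c \<odot> x)) = c \<odot> (w \<otimes> (u \<otimes> x))" if "x \<in> carrier A" "u \<in> S" for u x
    proof -
      have "w \<otimes> (u \<otimes> (c \<odot> x)) = (c \<odot> x) \<otimes> (w \<otimes> u)" using that by (simp add: m_ac)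
      also have "\<dots> = c \<odot> (x \<otimes> (w \<otimes> u))" using that by (simp add: smult_assoc2)
      finally show ?thesis using that by (simp add: m_ac)
    qed
    have "w \<otimes> (s \<otimes> (c \<odot> d)) = w \<otimes> (r \<otimes> (c \<odot> a))" by (simp add: * w)
    then show ?thesis by (intro frac_eqI[where w="w"]) auto
  qed
  then show ?thesis
    unfolding localization_def module.simps
    by (intro UN_const_eq[OF frac_self[of a s]]) auto
qed

lemma L_cring: "cring L"
proof (rule cringI)
  show "abelian_group L"
  proof (rule abelian_groupI)
    fix X Y Z assume "X \<in> carrier L" "Y \<in> carrier L" "Z \<in> carrier L"
    then obtain a s b t c r where [simp]: "a \<in> carrier A" "s \<in> S" "X = fr a s" "b \<in> carrier A" "t \<in> S" "Y = fr b t"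
      "c \<in> carrier A" "r \<in> S" "Z = fr c r" by (metis L_cases)
    show "X \<oplus>\<^bsub>L\<^esub> Y \<oplus>\<^bsub>L\<^esub> Z = X \<oplus>\<^bsub>L\<^esub> (Y \<oplus>\<^bsub>L\<^esub> Z)" by (simp add: L_add r_distr m_ac a_ac)
  next
    fix X Y assume "X \<in> carrier L" "Y \<in> carrier L"
    then obtain a s b t where [simp]: "a \<in> carrier A" "s \<in> S" "X = fr a s" "b \<in> carrier A" "t \<in> S" "Y = fr b t"
      by (metis L_cases)
    show "X \<oplus>\<^bsub>L\<^esub> Y \<in> carrier L" by (simp add: L_add)
    show "X \<oplus>\<^bsub>L\<^esub> Y = Y \<oplus>\<^bsub>L\<^esub> X" by (simp add: L_add a_comm m_comm)
  next
    fix X assume "X \<in> carrier L"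
    then obtain a s where [simp]: "a \<in> carrier A" "s \<in> S" "X = fr a s" by (metis L_cases)
    show "\<zero>\<^bsub>L\<^esub> \<oplus>\<^bsub>L\<^esub> X = X" by (simp add: L_zero L_add)
    show "\<exists>Y\<in>carrier L. Y \<oplus>\<^bsub>L\<^esub> X = \<zero>\<^bsub>L\<^esub>"
    proof (rule bexI[of _ "fr (\<ominus> a) s"])
      have "s \<otimes> (\<ominus> a) \<oplus> s \<otimes> a = \<zero>" by (simp add: r_minus l_neg)
      then show "fr (\<ominus> a) s \<oplus>\<^bsub>L\<^esub> X = \<zero>\<^bsub>L\<^esub>"
        by (simp add: L_zero L_add) (rule frac_eqI[where w=\<one>], auto)
    qed simp
  qed (simp add: L_zero)
  show "comm_monoid L"
  proof (rule comm_monoidI)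
    fix X Y Z assume "X \<in> carrier L" "Y \<in> carrier L" "Z \<in> carrier L"
    then obtain a s b t c r where [simp]: "a \<in> carrier A" "s \<in> S" "X = fr a s" "b \<in> carrier A" "t \<in> S" "Y = fr b t"
      "c \<in> carrier A" "r \<in> S" "Z = fr c r" by (metis L_cases)
    show "X \<otimes>\<^bsub>L\<^esub> Y \<otimes>\<^bsub>L\<^esub> Z = X \<otimes>\<^bsub>L\<^esub> (Y \<otimes>\<^bsub>L\<^esub> Z)" by (simp add: L_mult m_ac)
  next
    fix X Y assume "X \<in> carrier L" "Y \<in> carrier L"
    then obtain a s b t where [simp]: "a \<in> carrier A" "s \<in> S" "X = fr a s" "b \<in> carrier A" "t \<in> S" "Y = fr b t"
      by (metis L_cases)
    show "X \<otimes>\<^bsub>L\<^esub> Y \<in> carrier L" by (simp add: L_mult)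
    show "X \<otimes>\<^bsub>L\<^esub> Y = Y \<otimes>\<^bsub>L\<^esub> X" by (simp add: L_mult m_comm)
  next
    fix X assume "X \<in> carrier L"
    then obtain a s where [simp]: "a \<in> carrier A" "s \<in> S" "X = fr a s" by (metis L_cases)
    show "\<one>\<^bsub>L\<^esub> \<otimes>\<^bsub>L\<^esub> X = X" by (simp add: L_one L_mult)
  qed (simp add: L_one)
  fix X Y Z assume "X \<in> carrier L" "Y \<in> carrier L" "Z \<in> carrier L"
  then obtain a s b t c r where [simp]: "a \<in> carrier A" "s \<in> S" "X = fr a s" "b \<in> carrier A" "t \<in> S" "Y = fr b t"
    "c \<in> carrier A" "r \<in> S" "Z = fr c r" by (metis L_cases)
  show "(X \<oplus>\<^bsub>L\<^esub> Y) \<otimes>\<^bsub>L\<^esub> Z = X \<otimes>\<^bsub>L\<^esub> Z \<oplus>\<^bsub>L\<^esub> Y \<otimes>\<^bsub>L\<^esub> Z"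
    by (simp add: L_mult L_add) (rule frac_eqI[where w=\<one>], auto simp: l_distr r_distr m_ac)
qed

lemma L_algebra: "algebra K L"
proof (rule algebraI)
  show "cring K" ..
  show "cring L" by (rule L_cring)
next
  fix c X assume [simp]: "c \<in> carrier K" and "X \<in> carrier L"
  then obtain a s where [simp]: "a \<in> carrier A" "s \<in> S" "X = fr a s" by (metis L_cases)
  show "c \<odot>\<^bsub>L\<^esub> X \<in> carrier L" by (simp add: L_smult)
  fix d assume [simp]: "d \<in> carrier K"
  show "(c \<oplus>\<^bsub>K\<^esub> d) \<odot>\<^bsub>L\<^esub> X = c \<odot>\<^bsub>L\<^esub> X \<oplus>\<^bsub>L\<^esub> d \<odot>\<^bsub>L\<^esub> X"
    by (simp add: L_smult L_add) (rule frac_eqI[where w=\<one>], auto simp: smult_l_distr r_distr m_ac)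
  show "c \<otimes>\<^bsub>K\<^esub> d \<odot>\<^bsub>L\<^esub> X = c \<odot>\<^bsub>L\<^esub> (d \<odot>\<^bsub>L\<^esub> X)" by (simp add: L_smult smult_assoc1)
next
  fix X assume "X \<in> carrier L"
  then obtain a s where [simp]: "a \<in> carrier A" "s \<in> S" "X = fr a s" by (metis L_cases)
  show "\<one>\<^bsub>K\<^esub> \<odot>\<^bsub>L\<^esub> X = X" by (simp add: L_smult)
next
  fix c X Y assume [simp]: "c \<in> carrier K" and "X \<in> carrier L" "Y \<in> carrier L"
  then obtain a s b t where [simp]: "a \<in> carrier A" "s \<in> S" "X = fr a s" "b \<in> carrier A" "t \<in> S" "Y = fr b t"
      by (metis L_cases)
  have *: "u \<otimes> (c \<odot> x) = c \<odot> (u \<otimes> x)" if "x \<in> carrier A" "u \<in> S" for u x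
    using that smult_assoc2[of c x u] by (simp add: m_comm)
  show "c \<odot>\<^bsub>L\<^esub> (X \<oplus>\<^bsub>L\<^esub> Y) = c \<odot>\<^bsub>L\<^esub> X \<oplus>\<^bsub>L\<^esub> c \<odot>\<^bsub>L\<^esub> Y"
    by (simp add: L_smult L_add * smult_r_distr)
  show "c \<odot>\<^bsub>L\<^esub> X \<otimes>\<^bsub>L\<^esub> Y = c \<odot>\<^bsub>L\<^esub> (X \<otimes>\<^bsub>L\<^esub> Y)" by (simp add: L_smult L_mult smult_assoc2)
qed

lemma frac_hom: "(\<lambda>a. fr a \<one>) \<in> alg_hom K A L"
  by (rule alg_homI) (simp_all add: L_mult L_add L_one L_smult)

lemma frac_unit:
  assumes "a \<in> S" "s \<in> S"
  shows "fr a s \<in> Units L" "inv\<^bsub>L\<^esub> (fr a s) = fr s a"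
proof -
  interpret L: cring L by (rule L_cring)
  have "fr a s \<otimes>\<^bsub>L\<^esub> fr s a = \<one>\<^bsub>L\<^esub>" "fr s a \<otimes>\<^bsub>L\<^esub> fr a s = \<one>\<^bsub>L\<^esub>"
    using assms by (simp_all add: L_mult L_one m_comm[of s a]) (rule frac_eqI[where w=\<one>]; simp)+
  then show "fr a s \<in> Units L" "inv\<^bsub>L\<^esub> (fr a s) = fr s a"
    using L.Units_mult_inv_unique[of "fr a s" "fr s a"] assms by simp_all
qed

declare S_carr [simp del]

end

section \<open>The universal property of localization\<close>

definition frac_lift :: "('b, 'n) monoid_scheme \<Rightarrow> ('a \<Rightarrow> 'b) \<Rightarrow> ('a \<times> 'a) set \<Rightarrow> 'b" where
  "frac_lift B \<theta> X = (let x = SOME x. x \<in> X in \<theta> (fst x) \<otimes>\<^bsub>B\<^esub> inv\<^bsub>B\<^esub> \<theta> (snd x))"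

locale frac_lift_hom = frac_ring K A S for K :: "('k, 'm) ring_scheme" and A :: "('k, 'a) module" (structure) and S +
  fixes B :: "('k, 'b) module" and \<theta>
  assumes B: "algebra K B" and \<theta>: "\<theta> \<in> alg_hom K A B" and unit: "s \<in> S \<Longrightarrow> \<theta> s \<in> Units B"
begin

declare S_carr [simp]

text \<open>The definition evaluates \<theta> on an arbitrary representative. The choice is
  harmless: two representatives satisfy an equation with a common factor \<open>w\<close> in
  \<open>S\<close>, and \<open>\<theta> w\<close> is a unit that cancels.\<close>

lemma lift_frac:
  assumes [simp]: "a \<in> carrier A" "s \<in> S"
  shows "frac_lift B \<theta> (fr a s) = \<theta> a \<otimes>\<^bsub>B\<^esub> inv\<^bsub>B\<^esub> \<theta> s"
proof -
  interpret B: algebra K B by (rule B)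
  define x where "x = (SOME x. x \<in> fr a s)"
  have "x \<in> fr a s" unfolding x_def by (rule someI[of _ "(a, s)"]) (simp add: frac_self)
  then obtain b t w where x: "x = (b, t)" and [simp]: "b \<in> carrier A" "t \<in> S" "w \<in> S"
    and w: "w \<otimes> (t \<otimes> a) = w \<otimes> (s \<otimes> b)"
    by (cases x) (auto simp: frac_mem)
  note [simp] = alg_hom_closed[OF \<theta>] unit
  have "\<theta> w \<otimes>\<^bsub>B\<^esub> (\<theta> t \<otimes>\<^bsub>B\<^esub> \<theta> a) = \<theta> w \<otimes>\<^bsub>B\<^esub> (\<theta> s \<otimes>\<^bsub>B\<^esub> \<theta> b)"
    using arg_cong[OF w, of \<theta>] by (simp add: alg_hom_mult[OF \<theta>])
  then have eq: "\<theta> t \<otimes>\<^bsub>B\<^esub> \<theta> a = \<theta> s \<otimes>\<^bsub>B\<^esub> \<theta> b" by simp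
  have "\<theta> b = inv\<^bsub>B\<^esub> \<theta> s \<otimes>\<^bsub>B\<^esub> (\<theta> t \<otimes>\<^bsub>B\<^esub> \<theta> a)" by (simp add: eq B.m_assoc[symmetric])
  then have b: "\<theta> b = \<theta> a \<otimes>\<^bsub>B\<^esub> inv\<^bsub>B\<^esub> \<theta> s \<otimes>\<^bsub>B\<^esub> \<theta> t" by (simp add: B.m_ac)
  have "\<theta> b \<otimes>\<^bsub>B\<^esub> inv\<^bsub>B\<^esub> \<theta> t = \<theta> a \<otimes>\<^bsub>B\<^esub> inv\<^bsub>B\<^esub> \<theta> s" by (subst b) (simp add: B.m_assoc)
  then show ?thesis by (simp add: frac_lift_def x_def[symmetric] x)
qed

text \<open>Describing the value by an equation without inverses reduces additivity and
  multiplicativity of the lift to clearing denominators.\<close>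

lemma lift_eq_iff:
  assumes [simp]: "a \<in> carrier A" "s \<in> S" "y \<in> carrier B"
  shows "frac_lift B \<theta> (fr a s) = y \<longleftrightarrow> \<theta> a = y \<otimes>\<^bsub>B\<^esub> \<theta> s"
proof -
  interpret B: algebra K B by (rule B)
  note [simp] = alg_hom_closed[OF \<theta>] unit
  show ?thesis
    by (auto simp: lift_frac B.m_assoc)
qed

lemma lift_hom: "frac_lift B \<theta> \<in> alg_hom K L B"
proof -
  interpret B: algebra K B by (rule B)
  note [simp] = alg_hom_closed[OF \<theta>] unit alg_hom_mult[OF \<theta>] alg_hom_add[OF \<theta>] alg_hom_smult[OF \<theta>] alg_hom_one[OF \<theta>]
  show ?thesis
  proof (rule alg_homI)
    fix X assume "X \<in> carrier L"
    then obtain a s where [simp]: "a \<in> carrier A" "s \<in> S" "X = fr a s" by (metis L_cases)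
    show "frac_lift B \<theta> X \<in> carrier B" by (simp add: lift_frac)
    fix c assume [simp]: "c \<in> carrier K"
    show "frac_lift B \<theta> (c \<odot>\<^bsub>L\<^esub> X) = c \<odot>\<^bsub>B\<^esub> frac_lift B \<theta> X"
      by (simp add: L_smult lift_frac B.smult_assoc2)
  next
    fix X Y assume "X \<in> carrier L" "Y \<in> carrier L"
    then obtain a s b t where [simp]: "a \<in> carrier A" "s \<in> S" "X = fr a s" "b \<in> carrier A" "t \<in> S" "Y = fr b t"
      by (metis L_cases)
    have [simp]: "frac_lift B \<theta> (fr a s) \<in> carrier B" if "a \<in> carrier A" "s \<in> S" for a s
      using that by (simp add: lift_frac)
    note i = B.Units_cancel
    show "frac_lift B \<theta> (X \<otimes>\<^bsub>L\<^esub> Y) = frac_lift B \<theta> X \<otimes>\<^bsub>B\<^esub> frac_lift B \<theta> Y"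
      by (simp add: L_mult lift_eq_iff) (simp add: lift_frac B.m_ac i)
    show "frac_lift B \<theta> (X \<oplus>\<^bsub>L\<^esub> Y) = frac_lift B \<theta> X \<oplus>\<^bsub>B\<^esub> frac_lift B \<theta> Y"
      by (simp add: L_add lift_eq_iff) (simp add: lift_frac B.m_ac i B.l_distr B.r_distr)
  qed (simp add: L_one lift_frac)
qed

declare S_carr [simp del]

end

section \<open>Stalks at prime ideals\<close>

lemma prime_frac_ring:
  assumes "algebra K A" "primeideal P A"
  shows "frac_ring K A (carrier A - P)"
proof -
  interpret algebra K A by fact
  interpret P: primeideal P A by fact
  show ?thesis
  proof
    show "\<one>\<^bsub>A\<^esub> \<in> carrier A - P" using P.I_notcarr P.one_imp_carrier by auto
  qed (auto dest: P.I_prime)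
qed

text \<open>If \<open>b/t\<close> inverts \<open>a/s\<close>, some \<open>w\<close> outside the
  prime satisfies \<open>w a b = w s t\<close>. The right side lies outside the prime, hence so does
  \<open>a\<close>. Conversely \<open>s/a\<close> is an inverse.\<close>

lemma stalk_unit_iff:
  assumes A: "algebra K A" and P: "primeideal P A" and [simp]: "a \<in> carrier A" and s: "s \<in> carrier A - P"
  shows "fraction A (carrier A - P) a s \<in> Units (stalk_at A P) \<longleftrightarrow> a \<notin> P"
proof -
  interpret frac_ring K A "carrier A - P" by (rule prime_frac_ring) fact+
  interpret P: primeideal P A by fact
  interpret L: cring L by (rule L_cring)
  show ?thesis
  proof
    assume "fraction A (carrier A - P) a s \<in> Units (stalk_at A P)"
    then obtain Y where Y: "Y \<in> carrier L" "fr a s \<otimes>\<^bsub>L\<^esub> Y = \<one>\<^bsub>L\<^esub>"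
      unfolding stalk_at_def by (metis L.Units_r_inv L.Units_inv_closed)
    then obtain b t where bt: "b \<in> carrier A" "t \<in> carrier A - P" "Y = fr b t" by (metis L_cases)
    with Y s have "fr (a \<otimes>\<^bsub>A\<^esub> b) (s \<otimes>\<^bsub>A\<^esub> t) = fr \<one>\<^bsub>A\<^esub> \<one>\<^bsub>A\<^esub>" by (simp add: L_mult L_one)
    then obtain w where w: "w \<in> carrier A - P" "w \<otimes>\<^bsub>A\<^esub> (\<one>\<^bsub>A\<^esub> \<otimes>\<^bsub>A\<^esub> (a \<otimes>\<^bsub>A\<^esub> b)) = w \<otimes>\<^bsub>A\<^esub> (s \<otimes>\<^bsub>A\<^esub> t \<otimes>\<^bsub>A\<^esub> \<one>\<^bsub>A\<^esub>)"
      by (subst (asm) frac_eq_iff) (use bt s S_mult S_one in auto)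
    have "w \<otimes>\<^bsub>A\<^esub> (s \<otimes>\<^bsub>A\<^esub> t \<otimes>\<^bsub>A\<^esub> \<one>\<^bsub>A\<^esub>) \<in> carrier A - P" by (intro S_mult w s bt S_one)
    then show "a \<notin> P" using w bt by (metis DiffD1 DiffD2 P.I_l_closed P.I_r_closed \<open>a \<in> carrier A\<close> l_one m_closed)
  next
    assume "a \<notin> P"
    then show "fraction A (carrier A - P) a s \<in> Units (stalk_at A P)"
      unfolding stalk_at_def using s by (intro frac_unit) auto
  qed
qed

lemma stalk_algebra: "algebra K A \<Longrightarrow> primeideal P A \<Longrightarrow> algebra K (stalk_at A P)"
  unfolding stalk_at_def by (intro frac_ring.L_algebra prime_frac_ring)

lemma alg_hom_vimage_prime:
  assumes h: "h \<in> alg_hom K A B" and A: "algebra K A" and B: "algebra K B" and P: "primeideal P B"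
  shows "primeideal {a \<in> carrier A. h a \<in> P} A"
proof (rule ring_hom_ring.primeideal_vimage[OF _ algebra.M_cring[OF A] P])
  interpret ring_hom_cring A B h using alg_hom_ring_hom_cring[OF h A B] .
  show "ring_hom_ring A B h"
    by (simp add: ring_hom_ring_def ring_hom_ring_axioms_def homh R.ring_axioms S.ring_axioms)
qed

section \<open>Affine schemes\<close>

abbreviation primes :: "('k, 'a) module \<Rightarrow> 'a set set" where
  "primes A \<equiv> {P. primeideal P A}"

abbreviation sec :: "('k, 'a) module \<Rightarrow> 'a set set \<Rightarrow> ('a set \<Rightarrow> ('a \<times> 'a) set) set" where
  "sec A U \<equiv> carrier (sections (Spec A) U)"

abbreviation germ :: "('k, 'a) module \<Rightarrow> 'a set \<Rightarrow> 'a \<Rightarrow> 'a \<Rightarrow> ('a \<times> 'a) set" where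
  "germ A P \<equiv> fraction A (carrier A - P)"

abbreviation spec_open :: "('k, 'a) module \<Rightarrow> 'a set set \<Rightarrow> bool" where
  "spec_open A \<equiv> openin (top_of (Spec A))"

lemma (in primeideal) one_notin: "\<one> \<notin> I"
  using I_notcarr one_imp_carrier by auto

lemma (in primeideal) mult_mem_iff: "a \<in> carrier R \<Longrightarrow> b \<in> carrier R \<Longrightarrow> a \<otimes> b \<in> I \<longleftrightarrow> a \<in> I \<or> b \<in> I"
  using I_prime I_l_closed I_r_closed by blast

lemma (in primeideal) pow_mem_iff: "a \<in> carrier R \<Longrightarrow> k > 0 \<Longrightarrow> a [^] (k::nat) \<in> I \<longleftrightarrow> a \<in> I"
proof (induction k)
  case (Suc k) then show ?case
    by (cases "k = 0") (auto simp: mult_mem_iff)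
qed simp

lemma basic_open_mult:
  "a \<in> carrier A \<Longrightarrow> b \<in> carrier A \<Longrightarrow> basic_open A (a \<otimes>\<^bsub>A\<^esub> b) = basic_open A a \<inter> basic_open A b"
  by (auto simp: basic_open_def primeideal.mult_mem_iff)

lemma top_Spec: "top_of (Spec A) = topology_generated_by (basic_open A ` carrier A)"
  by (simp add: Spec_def)

lemma topspace_Spec:
  assumes "cring A"
  shows "topspace (top_of (Spec A)) = primes A"
proof -
  interpret cring A by fact
  show ?thesis
    by (auto simp: top_Spec basic_open_def intro!: bexI[of _ "\<one>\<^bsub>A\<^esub>"] primeideal.one_notin)
qed

lemma spec_open_basic: "a \<in> carrier A \<Longrightarrow> spec_open A (basic_open A a)"
  by (simp add: top_Spec topology_generated_by_Basis)

text \<open>The topology is given by a generating family. This family is a base because an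
  intersection of two basic open sets is the basic open set of the product.\<close>

lemma spec_open_iff:
  assumes "cring A"
  shows "spec_open A U \<longleftrightarrow> U \<subseteq> primes A \<and> (\<forall>P\<in>U. \<exists>a\<in>carrier A. a \<notin> P \<and> basic_open A a \<subseteq> U)"
proof
  interpret cring A by fact
  assume U: "spec_open A U"
  have "\<forall>P\<in>U. \<exists>a\<in>carrier A. a \<notin> P \<and> basic_open A a \<subseteq> U"
    using U unfolding top_Spec openin_topology_generated_by_iff
  proof (induction rule: generate_topology_on.induct)
    case (Int U V)
    show ?case
    proof
      fix P assume "P \<in> U \<inter> V"
      then have "P \<in> U" "P \<in> V" by auto
      from bspec[OF Int.IH(1) this(1)] bspec[OF Int.IH(2) this(2)]
      obtain a b where "a \<in> carrier A" "a \<notin> P" "basic_open A a \<subseteq> U"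
        "b \<in> carrier A" "b \<notin> P" "basic_open A b \<subseteq> V" by auto
      moreover have "primeideal P A"
        using \<open>P \<in> U \<inter> V\<close> Int openin_subset[of "top_of (Spec A)" U] topspace_Spec[OF assms]
        by (auto simp: top_Spec openin_topology_generated_by_iff)
      ultimately show "\<exists>a\<in>carrier A. a \<notin> P \<and> basic_open A a \<subseteq> U \<inter> V"
        by (intro bexI[of _ "a \<otimes>\<^bsub>A\<^esub> b"]) (auto simp: basic_open_mult primeideal.mult_mem_iff)
    qed
  next
    case (UN \<K>)
    show ?case
    proof
      fix P assume "P \<in> \<Union>\<K>"
      then obtain k where "k \<in> \<K>" "P \<in> k" by blast
      from bspec[OF UN.IH[OF this(1)] this(2)] this(1)
      show "\<exists>a\<in>carrier A. a \<notin> P \<and> basic_open A a \<subseteq> \<Union>\<K>" by (auto intro: bexI)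
    qed
  qed (auto simp: basic_open_def)
  then show "U \<subseteq> primes A \<and> (\<forall>P\<in>U. \<exists>a\<in>carrier A. a \<notin> P \<and> basic_open A a \<subseteq> U)"
    using openin_subset[OF U] topspace_Spec[OF assms] by auto
next
  assume U: "U \<subseteq> primes A \<and> (\<forall>P\<in>U. \<exists>a\<in>carrier A. a \<notin> P \<and> basic_open A a \<subseteq> U)"
  show "spec_open A U"
  proof (subst openin_subopen, intro ballI)
    fix P assume "P \<in> U"
    from bspec[OF conjunct2[OF U] \<open>P \<in> U\<close>] obtain a where "a \<in> carrier A" "a \<notin> P" "basic_open A a \<subseteq> U" by (elim bexE conjE)
    moreover have "primeideal P A" using conjunct1[OF U] \<open>P \<in> U\<close> by blast
    ultimately have "P \<in> basic_open A a" "spec_open A (basic_open A a)" "basic_open A a \<subseteq> U"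
      unfolding basic_open_def by (simp, simp add: spec_open_basic[unfolded basic_open_def], simp)
    then show "\<exists>T. spec_open A T \<and> P \<in> T \<and> T \<subseteq> U" by blast
  qed
qed

lemma spec_open_primes: "spec_open A U \<Longrightarrow> cring A \<Longrightarrow> P \<in> U \<Longrightarrow> primeideal P A"
  using spec_open_iff by blast

lemma spec_open_UNIV: "cring A \<Longrightarrow> spec_open A (primes A)"
  using openin_topspace[of "top_of (Spec A)"] by (simp add: topspace_Spec)

lemma sec_iff:
  assumes A: "algebra K A" and U: "U \<subseteq> primes A"
  shows "s \<in> sec A U \<longleftrightarrow> s \<in> extensional U \<and> (\<forall>P\<in>U. \<exists>a\<in>carrier A. \<exists>f\<in>carrier A. \<exists>V.
     spec_open A V \<and> P \<in> V \<and> V \<subseteq> U \<and> (\<forall>Q\<in>V. f \<notin> Q \<and> s Q = germ A Q a f))"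
    (is "_ \<longleftrightarrow> ?r")
proof
  assume "s \<in> sec A U"
  then show ?r by (auto simp: Spec_def PiE_def)
next
  assume r: ?r
  have "s P \<in> carrier (stalk_at A P)" if P: "P \<in> U" for P
  proof -
    interpret frac_ring K A "carrier A - P" using A U P by (auto intro: prime_frac_ring)
    obtain a f V where "a\<in>carrier A" "f\<in>carrier A" "P \<in> V" "\<forall>Q\<in>V. f \<notin> Q \<and> s Q = germ A Q a f"
      using r P by blast
    then show ?thesis by (auto simp: stalk_at_def)
  qed
  with r show "s \<in> sec A U" by (auto simp: Spec_def PiE_def)
qed

lemma sec_ext: "s \<in> sec A U \<Longrightarrow> s \<in> extensional U"
  by (simp add: Spec_def PiE_def)

lemma sec_stalk: "s \<in> sec A U \<Longrightarrow> P \<in> U \<Longrightarrow> s P \<in> carrier (stalk_at A P)"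
  by (auto simp: Spec_def PiE_def)

lemma sec_local:
  assumes "s \<in> sec A U" "P \<in> U"
  obtains a f V where "a \<in> carrier A" "f \<in> carrier A" "spec_open A V" "P \<in> V" "V \<subseteq> U"
    "\<And>Q. Q \<in> V \<Longrightarrow> f \<notin> Q" "\<And>Q. Q \<in> V \<Longrightarrow> s Q = germ A Q a f"
proof -
  have "\<exists>a\<in>carrier A. \<exists>f\<in>carrier A. \<exists>V. spec_open A V \<and> P \<in> V \<and> V \<subseteq> U \<and> (\<forall>Q\<in>V. f \<notin> Q \<and> s Q = germ A Q a f)"
    using assms by (simp add: Spec_def)
  then show thesis using that by meson
qed

lemma sections_simps:
  "P \<in> U \<Longrightarrow> (s \<otimes>\<^bsub>sections (Spec A) U\<^esub> t) P = s P \<otimes>\<^bsub>stalk_at A P\<^esub> t P"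
  "P \<in> U \<Longrightarrow> (s \<oplus>\<^bsub>sections (Spec A) U\<^esub> t) P = s P \<oplus>\<^bsub>stalk_at A P\<^esub> t P"
  "P \<in> U \<Longrightarrow> (c \<odot>\<^bsub>sections (Spec A) U\<^esub> t) P = c \<odot>\<^bsub>stalk_at A P\<^esub> t P"
  "P \<in> U \<Longrightarrow> \<one>\<^bsub>sections (Spec A) U\<^esub> P = \<one>\<^bsub>stalk_at A P\<^esub>"
  "s \<otimes>\<^bsub>sections (Spec A) U\<^esub> t \<in> extensional U"
  "s \<oplus>\<^bsub>sections (Spec A) U\<^esub> t \<in> extensional U"
  "c \<odot>\<^bsub>sections (Spec A) U\<^esub> t \<in> extensional U"
  "\<one>\<^bsub>sections (Spec A) U\<^esub> \<in> extensional U"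
  by (simp_all add: Spec_def)

lemma restr_Spec: "restr (Spec A) U V s = restrict s V"
  by (simp add: Spec_def)

text \<open>A name for an algebra whose spectrum is studied, so that later locales can import
  several of them under separate qualifiers. The general facts on fractions are restated here for
  its stalks.\<close>

locale spec_ring = algebra K A for K :: "('k, 'm) ring_scheme" and A :: "('k, 'a) module" (structure)
begin

lemma cring_A: "cring A" ..

lemma frac_ring: "primeideal P A \<Longrightarrow> frac_ring K A (carrier A - P)"
  by (rule prime_frac_ring[OF algebra_axioms])

lemmas alg = algebra_axioms

lemmas st_mult = frac_ring.L_mult[OF frac_ring, folded stalk_at_def]
lemmas st_add = frac_ring.L_add[OF frac_ring, folded stalk_at_def]
lemmas st_smult = frac_ring.L_smult[OF frac_ring, folded stalk_at_def]
lemmas st_one = frac_ring.L_one[OF frac_ring, folded stalk_at_def]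
lemmas st_zero = frac_ring.L_zero[OF frac_ring, folded stalk_at_def]
lemmas st_cases = frac_ring.L_cases[OF frac_ring, folded stalk_at_def]
lemmas germ_carrier = frac_ring.frac_carrier[OF frac_ring, folded stalk_at_def]
lemmas germ_eqI = frac_ring.frac_eqI[OF frac_ring]
lemmas germ_inv = frac_ring.frac_unit(2)[OF frac_ring, folded stalk_at_def]
lemmas germ_hom = frac_ring.frac_hom[OF frac_ring, folded stalk_at_def]
lemmas st_alg = stalk_algebra[OF alg]
lemmas st_cring = algebra.M_cring[OF st_alg]
lemmas st_unit_iff = stalk_unit_iff[OF alg]
lemmas topspace = topspace_Spec[OF cring_A]
lemmas open_iff = spec_open_iff[OF cring_A]
lemmas open_prime = spec_open_primes[OF _ cring_A]

lemma open_sub: "spec_open A U \<Longrightarrow> U \<subseteq> primes A"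
  using open_prime by blast

lemmas secI = sec_iff[OF alg open_sub, THEN iffD2]

text \<open>Serves to recognize as sections those families that are defined prime by prime: near
  each prime they coincide with an expression already known to be a section.\<close>

lemma sec_locI:
  assumes U: "spec_open A U" and e: "s \<in> extensional U"
    and l: "\<And>P. P \<in> U \<Longrightarrow> \<exists>V t. spec_open A V \<and> P \<in> V \<and> V \<subseteq> U \<and> t \<in> sec A V \<and> (\<forall>Q\<in>V. s Q = t Q)"
  shows "s \<in> sec A U"
proof (rule secI[OF U], intro conjI e ballI)
  fix P assume "P \<in> U"
  then obtain V t where V: "spec_open A V" "P \<in> V" "V \<subseteq> U" "t \<in> sec A V" "\<forall>Q\<in>V. s Q = t Q"
    using l[OF \<open>P \<in> U\<close>] by (elim exE conjE)
  from V(4,2) obtain a f W where "a \<in> carrier A" "f \<in> carrier A" "spec_open A W" "P \<in> W" "W \<subseteq> V"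
    "\<And>Q. Q \<in> W \<Longrightarrow> f \<notin> Q" "\<And>Q. Q \<in> W \<Longrightarrow> t Q = germ A Q a f"
    by (rule sec_local) auto
  then show "\<exists>a\<in>carrier A. \<exists>f\<in>carrier A. \<exists>V.
     spec_open A V \<and> P \<in> V \<and> V \<subseteq> U \<and> (\<forall>Q\<in>V. f \<notin> Q \<and> s Q = germ A Q a f)"
    using V by (intro bexI[of _ a] bexI[of _ f] exI[of _ W]) auto
qed

lemma sec_fracI:
  assumes U: "spec_open A U" and e: "s \<in> extensional U" and af: "a \<in> carrier A" "f \<in> carrier A"
    and eq: "\<And>Q. Q \<in> U \<Longrightarrow> f \<notin> Q" "\<And>Q. Q \<in> U \<Longrightarrow> s Q = germ A Q a f"
  shows "s \<in> sec A U"
proof (rule secI[OF U], intro conjI e ballI)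
  fix P assume "P \<in> U"
  then show "\<exists>a\<in>carrier A. \<exists>f\<in>carrier A. \<exists>V. spec_open A V \<and> P \<in> V \<and> V \<subseteq> U \<and> (\<forall>Q\<in>V. f \<notin> Q \<and> s Q = germ A Q a f)"
    by (intro bexI[of _ a] bexI[of _ f] exI[of _ U]) (simp_all add: U af eq)
qed

lemma sec_const: "spec_open A U \<Longrightarrow> a \<in> carrier A \<Longrightarrow> (\<lambda>P\<in>U. germ A P a \<one>) \<in> sec A U"
  by (rule sec_fracI[where a=a and f=\<one>]) (simp_all add: primeideal.one_notin[OF open_prime])

lemma sec_restrict:
  assumes "s \<in> sec A U" "spec_open A V" "V \<subseteq> U" shows "restrict s V \<in> sec A V"
proof (rule secI[OF assms(2)], intro conjI ballI)
  fix P assume P: "P \<in> V"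
  then have "P \<in> U" using assms by auto
  with assms(1) obtain a f W where "a \<in> carrier A" "f \<in> carrier A" "spec_open A W" "P \<in> W" "W \<subseteq> U"
    "\<And>Q. Q \<in> W \<Longrightarrow> f \<notin> Q" "\<And>Q. Q \<in> W \<Longrightarrow> s Q = germ A Q a f"
    by (rule sec_local) auto
  then show "\<exists>a\<in>carrier A. \<exists>f\<in>carrier A. \<exists>W.
     spec_open A W \<and> P \<in> W \<and> W \<subseteq> V \<and> (\<forall>Q\<in>W. f \<notin> Q \<and> restrict s V Q = germ A Q a f)"
    using P assms(2) by (intro bexI[of _ a] bexI[of _ f] exI[of _ "W \<inter> V"]) auto
qed simp

text \<open>Common to sums, products and scalar multiples: two local fractions are combined on the
  intersection of their neighbourhoods, over the product of the denominators.\<close>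

lemma sec_binop:
  assumes U: "spec_open A U" and s: "s \<in> sec A U" and t: "t \<in> sec A U"
    and op: "\<And>a f b g. a \<in> carrier A \<Longrightarrow> f \<in> carrier A \<Longrightarrow> b \<in> carrier A \<Longrightarrow> g \<in> carrier A \<Longrightarrow> h a f b g \<in> carrier A"
    and eq: "\<And>a f b g Q. primeideal Q A \<Longrightarrow> a \<in> carrier A \<Longrightarrow> f \<in> carrier A - Q \<Longrightarrow> b \<in> carrier A \<Longrightarrow> g \<in> carrier A - Q \<Longrightarrow>
      F Q (germ A Q a f) (germ A Q b g) = germ A Q (h a f b g) (f \<otimes> g)"
  shows "(\<lambda>P\<in>U. F P (s P) (t P)) \<in> sec A U"
proof (rule secI[OF U], intro conjI ballI)
  fix P assume P: "P \<in> U"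
  from s P obtain a f V where 1: "a \<in> carrier A" "f \<in> carrier A" "spec_open A V" "P \<in> V" "V \<subseteq> U"
    "\<And>Q. Q \<in> V \<Longrightarrow> f \<notin> Q" "\<And>Q. Q \<in> V \<Longrightarrow> s Q = germ A Q a f"
    by (rule sec_local) auto
  from t P obtain b g W where 2: "b \<in> carrier A" "g \<in> carrier A" "spec_open A W" "P \<in> W" "W \<subseteq> U"
    "\<And>Q. Q \<in> W \<Longrightarrow> g \<notin> Q" "\<And>Q. Q \<in> W \<Longrightarrow> t Q = germ A Q b g"
    by (rule sec_local) auto
  have pr: "primeideal Q A" if "Q \<in> V \<inter> W" for Q using that 1(3) open_prime by auto
  have "f \<otimes> g \<notin> Q \<and> (\<lambda>P\<in>U. F P (s P) (t P)) Q = germ A Q (h a f b g) (f \<otimes> g)" if Q: "Q \<in> V \<inter> W" for Q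
    using pr[OF Q] Q 1 2 by (auto simp: primeideal.mult_mem_iff eq)
  then show "\<exists>c\<in>carrier A. \<exists>d\<in>carrier A. \<exists>X.
     spec_open A X \<and> P \<in> X \<and> X \<subseteq> U \<and> (\<forall>Q\<in>X. d \<notin> Q \<and> (\<lambda>P\<in>U. F P (s P) (t P)) Q = germ A Q c d)"
    using 1 2 by (intro bexI[of _ "h a f b g"] bexI[of _ "f \<otimes> g"] exI[of _ "V \<inter> W"]) (auto intro: op)
qed simp

lemma sec_mult: "spec_open A U \<Longrightarrow> s \<in> sec A U \<Longrightarrow> t \<in> sec A U \<Longrightarrow> (\<lambda>P\<in>U. s P \<otimes>\<^bsub>stalk_at A P\<^esub> t P) \<in> sec A U"
  by (rule sec_binop[where h="\<lambda>a f b g. a \<otimes> b"]) (auto simp: st_mult)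

lemma sec_add: "spec_open A U \<Longrightarrow> s \<in> sec A U \<Longrightarrow> t \<in> sec A U \<Longrightarrow> (\<lambda>P\<in>U. s P \<oplus>\<^bsub>stalk_at A P\<^esub> t P) \<in> sec A U"
  by (rule sec_binop[where h="\<lambda>a f b g. g \<otimes> a \<oplus> f \<otimes> b"]) (auto simp: st_add)

lemma sec_smult:
  assumes U: "spec_open A U" and s: "s \<in> sec A U" and c: "c \<in> carrier K"
  shows "(\<lambda>P\<in>U. c \<odot>\<^bsub>stalk_at A P\<^esub> s P) \<in> sec A U"
\<comment> \<open>The binary scheme is applied to \<open>s\<close> twice. Its second denominator
  \<open>g\<close> is compensated by multiplying the numerator by \<open>g\<close>.\<close>
proof (rule sec_binop[OF U s s, where F="\<lambda>P x y. c \<odot>\<^bsub>stalk_at A P\<^esub> x" and h="\<lambda>a f b g. g \<otimes> (c \<odot> a)"])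
  fix a f b g Q assume pr: "primeideal Q A" and a: "a \<in> carrier A" "f \<in> carrier A - Q" "b \<in> carrier A" "g \<in> carrier A - Q"
  show "c \<odot>\<^bsub>stalk_at A Q\<^esub> germ A Q a f = germ A Q (g \<otimes> (c \<odot> a)) (f \<otimes> g)"
    using a c frac_ring.frac_cancel[OF frac_ring, OF pr, of "c \<odot> a" f g] st_smult[OF pr a(1,2) c] by (simp add: m_comm)
qed (use c in auto)

text \<open>Where the section is a unit, its local numerator avoids the primes in question, so
  numerator and denominator can be exchanged.\<close>

lemma sec_inv:
  assumes U: "spec_open A U" and s: "s \<in> sec A U" and u: "\<And>P. P \<in> U \<Longrightarrow> s P \<in> Units (stalk_at A P)"
  shows "(\<lambda>P\<in>U. inv\<^bsub>stalk_at A P\<^esub> s P) \<in> sec A U"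
proof (rule secI[OF U], intro conjI ballI)
  fix P assume P: "P \<in> U"
  from s P obtain a f V where 1: "a \<in> carrier A" "f \<in> carrier A" "spec_open A V" "P \<in> V" "V \<subseteq> U"
    "\<And>Q. Q \<in> V \<Longrightarrow> f \<notin> Q" "\<And>Q. Q \<in> V \<Longrightarrow> s Q = germ A Q a f"
    by (rule sec_local) auto
  have pr: "primeideal Q A" if "Q \<in> V" for Q using that 1(3) open_prime by auto
  have a: "a \<notin> Q" if "Q \<in> V" for Q
    using u[of Q] 1 pr[OF that] that by (auto simp: st_unit_iff)
  then show "\<exists>c\<in>carrier A. \<exists>d\<in>carrier A. \<exists>X.
     spec_open A X \<and> P \<in> X \<and> X \<subseteq> U \<and> (\<forall>Q\<in>X. d \<notin> Q \<and> (\<lambda>P\<in>U. inv\<^bsub>stalk_at A P\<^esub> s P) Q = germ A Q c d)"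
    using 1 pr by (intro bexI[of _ f] bexI[of _ a] exI[of _ V]) (auto simp: germ_inv)
qed simp

text \<open>On a neighbourhood where the section is \<open>a/f\<close>, the unit locus is cut out by
  the basic open set of \<open>a\<close>.\<close>

lemma open_unit:
  assumes U: "spec_open A U" and s: "s \<in> sec A U"
  shows "spec_open A {P \<in> U. s P \<in> Units (stalk_at A P)}"
proof (subst openin_subopen, intro ballI)
  fix P assume "P \<in> {P \<in> U. s P \<in> Units (stalk_at A P)}"
  then have P: "P \<in> U" "s P \<in> Units (stalk_at A P)" by auto
  from s P(1) obtain a f V where 1: "a \<in> carrier A" "f \<in> carrier A" "spec_open A V" "P \<in> V" "V \<subseteq> U"
    "\<And>Q. Q \<in> V \<Longrightarrow> f \<notin> Q" "\<And>Q. Q \<in> V \<Longrightarrow> s Q = germ A Q a f"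
    by (rule sec_local) auto
  have pr: "primeideal Q A" if "Q \<in> V" for Q using that 1(3) open_prime by auto
  have "Q \<in> V \<Longrightarrow> s Q \<in> Units (stalk_at A Q) \<longleftrightarrow> a \<notin> Q" for Q
    using 1 pr by (auto simp: st_unit_iff)
  then show "\<exists>T. spec_open A T \<and> P \<in> T \<and> T \<subseteq> {P \<in> U. s P \<in> Units (stalk_at A P)}"
    using 1 P pr by (intro exI[of _ "V \<inter> basic_open A a"]) (auto simp: spec_open_basic, auto simp: basic_open_def)
qed

lemma sec_Units:
  assumes U: "spec_open A U" and s: "s \<in> sec A U" and u: "\<And>P. P \<in> U \<Longrightarrow> s P \<in> Units (stalk_at A P)"
  shows "s \<in> Units (sections (Spec A) U)"
proof -
  have c: "monoid (stalk_at A P)" if "P \<in> U" for P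
    using open_prime[OF U that] by (metis algebra.M_cring cring.axioms(1) ring.axioms(2) st_alg)
  let ?t = "\<lambda>P\<in>U. inv\<^bsub>stalk_at A P\<^esub> s P"
  have "s \<otimes>\<^bsub>sections (Spec A) U\<^esub> ?t = \<one>\<^bsub>sections (Spec A) U\<^esub>" "?t \<otimes>\<^bsub>sections (Spec A) U\<^esub> s = \<one>\<^bsub>sections (Spec A) U\<^esub>"
    by (rule extensionalityI[of _ U]; simp add: sections_simps u c monoid.Units_r_inv monoid.Units_l_inv)+
  then show ?thesis using sec_inv[OF assms] s by (auto simp: Units_def)
qed

text \<open>Translates invertibility on some neighbourhood into invertibility in the stalk. For the
  converse the unit locus itself serves as the neighbourhood: it is open, and the pointwise inverse
  is a section over it.\<close>

lemma germ_unit_iff: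
  assumes U: "spec_open A U" and s: "s \<in> sec A U" and P: "P \<in> U"
  shows "germ_unit (Spec A) U s P \<longleftrightarrow> s P \<in> Units (stalk_at A P)"
proof
  assume "germ_unit (Spec A) U s P"
  then obtain W where W: "spec_open A W" "P \<in> W" "W \<subseteq> U" "restrict s W \<in> Units (sections (Spec A) W)"
    by (auto simp: germ_unit_def restr_Spec)
  then obtain t where t: "t \<in> sec A W" "restrict s W \<otimes>\<^bsub>sections (Spec A) W\<^esub> t = \<one>\<^bsub>sections (Spec A) W\<^esub>"
    "t \<otimes>\<^bsub>sections (Spec A) W\<^esub> restrict s W = \<one>\<^bsub>sections (Spec A) W\<^esub>" by (auto simp: Units_def)
  then have "s P \<otimes>\<^bsub>stalk_at A P\<^esub> t P = \<one>\<^bsub>stalk_at A P\<^esub>" "t P \<otimes>\<^bsub>stalk_at A P\<^esub> s P = \<one>\<^bsub>stalk_at A P\<^esub>"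
    using W(2) by (metis restrict_apply' sections_simps(1,4))+
  then show "s P \<in> Units (stalk_at A P)"
    using sec_stalk[OF s P] sec_stalk[OF t(1) W(2)] by (auto simp: Units_def)
next
  assume u: "s P \<in> Units (stalk_at A P)"
  let ?W = "{P \<in> U. s P \<in> Units (stalk_at A P)}"
  have W: "spec_open A ?W" by (rule open_unit[OF U s])
  have "restrict s ?W \<in> Units (sections (Spec A) ?W)"
    by (rule sec_Units[OF W sec_restrict[OF s W]]) auto
  then show "germ_unit (Spec A) U s P"
    using W u P by (auto simp: germ_unit_def restr_Spec intro!: exI[of _ ?W])
qed

text \<open>Nonunits are the fractions with numerator in \<open>P\<close>, and
  \<open>t a + s b\<close> stays in \<open>P\<close> when \<open>a\<close> and \<open>b\<close> do.
  The local ring property is stated as primeness so that \<open>alg_hom_vimage_prime\<close> can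
  pull the maximal ideal back along a homomorphism into the stalk.\<close>

lemma stalk_nonunits:
  assumes P: "primeideal P A"
  shows "primeideal {X \<in> carrier (stalk_at A P). X \<notin> Units (stalk_at A P)} (stalk_at A P)" (is "primeideal ?M ?L")
proof -
  interpret P: primeideal P A by fact
  interpret F: frac_ring K A "carrier A - P" by (rule frac_ring) fact
  interpret L: cring ?L using st_alg[OF P] by (rule algebra.M_cring)
  note st = F.L_mult[folded stalk_at_def] F.L_add[folded stalk_at_def] F.L_zero[folded stalk_at_def] F.L_one[folded stalk_at_def]
  note unit = st_unit_iff[OF P]
  show ?thesis
  proof (rule primeidealI)
    show "ideal ?M ?L"
    proof (rule idealI)
      show "ring ?L" ..
      show "subgroup ?M (add_monoid ?L)"
      proof (rule L.add.subgroupI)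
        show "?M \<noteq> {}" using unit[of "\<zero>" \<one>] by (auto simp: st P.one_notin intro!: exI[of _ "germ A P \<zero> \<one>"] germ_carrier P)
      next
        fix X assume "X \<in> ?M"
        then show "\<ominus>\<^bsub>?L\<^esub> X \<in> ?M"
          using L.Units_prod_iff[of "\<ominus>\<^bsub>?L\<^esub> \<one>\<^bsub>?L\<^esub>" X] by (simp add: L.l_minus)
      next
        fix X Y assume "X \<in> ?M" "Y \<in> ?M"
        moreover from this obtain a s b t where [simp]: "a \<in> carrier A" "s \<in> carrier A" "s \<notin> P" "b \<in> carrier A" "t \<in> carrier A" "t \<notin> P"
          "X = germ A P a s" "Y = germ A P b t" using F.L_cases[folded stalk_at_def] by (metis (no_types, lifting) DiffE mem_Collect_eq)
        ultimately show "X \<oplus>\<^bsub>?L\<^esub> Y \<in> ?M"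
          by (auto simp: unit st P.mult_mem_iff intro!: germ_carrier P P.a_closed)
      qed auto
    qed (auto simp: L.Units_prod_iff)
    show "cring ?L" ..
    show "carrier ?L \<noteq> ?M" using L.Units_one_closed by blast
  qed (auto simp: L.Units_prod_iff)
qed

end

section \<open>Morphisms of locally ringed spaces and their composition\<close>

lemma rmorsD:
  assumes "f \<in> rmors K X Y"
  shows "pt f \<in> extensional (topspace (top_of X))"
    "continuous_map (top_of X) (top_of Y) (pt f)"
    "comor f \<in> extensional {V. openin (top_of Y) V}"
    "openin (top_of Y) V \<Longrightarrow> comor f V \<in> alg_hom K (sections Y V) (sections X (preim X f V))"
    "openin (top_of Y) V \<Longrightarrow> comor f V \<in> extensional (carrier (sections Y V))"
    "openin (top_of Y) V \<Longrightarrow> openin (top_of Y) V' \<Longrightarrow> V' \<subseteq> V \<Longrightarrow> s \<in> carrier (sections Y V) \<Longrightarrow>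
       comor f V' (restr Y V V' s) = restr X (preim X f V) (preim X f V') (comor f V s)"
    "openin (top_of Y) V \<Longrightarrow> s \<in> carrier (sections Y V) \<Longrightarrow> x \<in> preim X f V \<Longrightarrow>
       germ_unit X (preim X f V) (comor f V s) x \<Longrightarrow> germ_unit Y V s (pt f x)"
  using assms by (auto simp: rmors_def)

lemma rmorsI:
  assumes "pt f \<in> extensional (topspace (top_of X))"
    "continuous_map (top_of X) (top_of Y) (pt f)"
    "comor f \<in> extensional {V. openin (top_of Y) V}"
    "\<And>V. openin (top_of Y) V \<Longrightarrow> comor f V \<in> alg_hom K (sections Y V) (sections X (preim X f V))"
    "\<And>V. openin (top_of Y) V \<Longrightarrow> comor f V \<in> extensional (carrier (sections Y V))"
    "\<And>V V' s. openin (top_of Y) V \<Longrightarrow> openin (top_of Y) V' \<Longrightarrow> V' \<subseteq> V \<Longrightarrow> s \<in> carrier (sections Y V) \<Longrightarrow>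
       comor f V' (restr Y V V' s) = restr X (preim X f V) (preim X f V') (comor f V s)"
    "\<And>V s x. openin (top_of Y) V \<Longrightarrow> s \<in> carrier (sections Y V) \<Longrightarrow> x \<in> preim X f V \<Longrightarrow>
       germ_unit X (preim X f V) (comor f V s) x \<Longrightarrow> germ_unit Y V s (pt f x)"
  shows "f \<in> rmors K X Y"
  unfolding rmors_def using assms by (simp add: Ball_def)

lemma preim_open: "f \<in> rmors K X Y \<Longrightarrow> openin (top_of Y) V \<Longrightarrow> openin (top_of X) (preim X f V)"
  using rmorsD(2) by (fastforce simp: preim_def continuous_map_def)

text \<open>Closure under the operations is what allows a homomorphism to be replaced by a map that
  agrees with it on the carrier only, see \<open>alg_hom_restrict\<close>. Comorphisms are
  extensional, so such replacements are frequent.\<close>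

definition sections_closed :: "('k, 'm) ring_scheme \<Rightarrow> ('k, 's) module \<Rightarrow> bool" where
  "sections_closed K A \<longleftrightarrow> \<one>\<^bsub>A\<^esub> \<in> carrier A \<and>
     (\<forall>s \<in> carrier A. \<forall>t \<in> carrier A. s \<otimes>\<^bsub>A\<^esub> t \<in> carrier A \<and> s \<oplus>\<^bsub>A\<^esub> t \<in> carrier A) \<and>
     (\<forall>c \<in> carrier K. \<forall>s \<in> carrier A. c \<odot>\<^bsub>A\<^esub> s \<in> carrier A)"

definition presheaf :: "('k, 'm) ring_scheme \<Rightarrow> ('k, 'p, 's) rspace \<Rightarrow> bool" where
  "presheaf K X \<longleftrightarrow> (\<forall>V. openin (top_of X) V \<longrightarrow> sections_closed K (sections X V) \<and>
     (\<forall>V' s. openin (top_of X) V' \<longrightarrow> V' \<subseteq> V \<longrightarrow> s \<in> carrier (sections X V) \<longrightarrow> restr X V V' s \<in> carrier (sections X V')))"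

lemma alg_hom_restrict:
  assumes h: "h \<in> alg_hom K A B" and A: "sections_closed K A" and eq: "\<And>x. x \<in> carrier A \<Longrightarrow> h' x = h x"
  shows "h' \<in> alg_hom K A B"
  by (rule alg_homI) (use A in \<open>simp_all add: eq sections_closed_def alg_hom_closed[OF h] alg_hom_mult[OF h] alg_hom_add[OF h]
        alg_hom_one[OF h] alg_hom_smult[OF h]\<close>)

text \<open>The comorphism of a composite is restricted to the carriers of sections. The presheaf
  property of \<open>Z\<close> keeps sums, products and restrictions inside these carriers, where
  the two comorphisms can be composed.\<close>

lemma rcomp_rmors:
  assumes f: "f \<in> rmors K X Y" and g: "g \<in> rmors K Y Z" and Z: "presheaf K Z"
  shows "rcomp X Y Z g f \<in> rmors K X Z"
proof -
  have pre: "preim X (rcomp X Y Z g f) V = preim X f (preim Y g V)" for V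
    using rmorsD(2)[OF f] by (auto simp: preim_def rcomp_def continuous_map_def)
  note [simp] = pre
  have sub: "V' \<subseteq> V \<Longrightarrow> preim Y g V' \<subseteq> preim Y g V" for V V' by (auto simp: preim_def)
  have cl: "openin (top_of Z) V \<Longrightarrow> s \<in> carrier (sections Z V) \<Longrightarrow> comor g V s \<in> carrier (sections Y (preim Y g V))" for V s
    by (rule alg_hom_closed[OF rmorsD(4)[OF g]])
  show ?thesis
  proof (rule rmorsI)
    show "pt (rcomp X Y Z g f) \<in> extensional (topspace (top_of X))" by (simp add: rcomp_def)
    have "continuous_map (top_of X) (top_of Z) (pt g \<circ> pt f)"
      using rmorsD(2)[OF f] rmorsD(2)[OF g] by (rule continuous_map_compose)
    then show "continuous_map (top_of X) (top_of Z) (pt (rcomp X Y Z g f))"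
      by (rule continuous_map_eq) (simp add: rcomp_def)
    show "comor (rcomp X Y Z g f) \<in> extensional {V. openin (top_of Z) V}" by (simp add: rcomp_def)
  next
    fix V assume V: "openin (top_of Z) V"
    note pV = preim_open[OF g V]
    note G = rmorsD(4)[OF g V] and F = rmorsD(4)[OF f pV]
    show "comor (rcomp X Y Z g f) V \<in> extensional (carrier (sections Z V))"
      using V by (simp add: rcomp_def)
    fix V' s
    assume V': "openin (top_of Z) V'" "V' \<subseteq> V" and s: "s \<in> carrier (sections Z V)"
    show "comor (rcomp X Y Z g f) V' (restr Z V V' s) =
      restr X (preim X (rcomp X Y Z g f) V) (preim X (rcomp X Y Z g f) V') (comor (rcomp X Y Z g f) V s)"
      using V V' s rmorsD(6)[OF f pV preim_open[OF g V'(1)] sub[OF V'(2)] cl[OF V s]] Z unfolding pre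
      by (simp add: rcomp_def rmorsD(6)[OF g V V' s] presheaf_def)
  next
    fix V s x assume V: "openin (top_of Z) V" and s: "s \<in> carrier (sections Z V)"
      and x: "x \<in> preim X (rcomp X Y Z g f) V"
      and u: "germ_unit X (preim X (rcomp X Y Z g f) V) (comor (rcomp X Y Z g f) V s) x"
    have "comor (rcomp X Y Z g f) V s = comor f (preim Y g V) (comor g V s)" using V s by (simp add: rcomp_def)
    from rmorsD(7)[OF f preim_open[OF g V] cl[OF V s] x[unfolded pre] u[unfolded pre this]]
    have "germ_unit Y (preim Y g V) (comor g V s) (pt f x)" .
    then have "germ_unit Z V s (pt g (pt f x))"
      by (rule rmorsD(7)[OF g V s, rotated]) (use x[unfolded pre] in \<open>simp add: preim_def\<close>)
    then show "germ_unit Z V s (pt (rcomp X Y Z g f) x)"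
      using x by (auto simp: rcomp_def preim_def)
  next
    fix V assume V: "openin (top_of Z) V"
    note pV = preim_open[OF g V]
    note G = rmorsD(4)[OF g V] and F = rmorsD(4)[OF f pV]
    have "(\<lambda>s. comor f (preim Y g V) (comor g V s)) \<in> alg_hom K (sections Z V) (sections X (preim X (rcomp X Y Z g f) V))"
      unfolding pre by (rule alg_hom_comp[OF F G])
    then show "comor (rcomp X Y Z g f) V \<in> alg_hom K (sections Z V) (sections X (preim X (rcomp X Y Z g f) V))"
      by (rule alg_hom_restrict) (use V Z in \<open>simp_all add: rcomp_def presheaf_def\<close>)
  qed
qed

lemma Spec_presheaf:
  assumes "algebra K A" shows "presheaf K (Spec A)"
proof -
  interpret spec_ring K A using assms by (rule spec_ring.intro)
  have cr: "cring (stalk_at A P)" if "spec_open A U" "P \<in> U" for U P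
    by (rule st_cring[OF open_prime[OF that]])
  have e: "s = restrict s U" if "s \<in> extensional U" for s :: "'b set \<Rightarrow> ('b \<times> 'b) set" and U
    using that by (simp add: extensional_restrict)
  have 1: "\<one>\<^bsub>sections (Spec A) U\<^esub> = (\<lambda>P\<in>U. germ A P \<one>\<^bsub>A\<^esub> \<one>\<^bsub>A\<^esub>)" if "spec_open A U" for U
    using that by (intro extensionalityI[of _ U]) (simp_all add: sections_simps st_one[OF open_prime])
  have 2: "s \<otimes>\<^bsub>sections (Spec A) U\<^esub> t = (\<lambda>P\<in>U. s P \<otimes>\<^bsub>stalk_at A P\<^esub> t P)"
    "s \<oplus>\<^bsub>sections (Spec A) U\<^esub> t = (\<lambda>P\<in>U. s P \<oplus>\<^bsub>stalk_at A P\<^esub> t P)"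
    "c \<odot>\<^bsub>sections (Spec A) U\<^esub> t = (\<lambda>P\<in>U. c \<odot>\<^bsub>stalk_at A P\<^esub> t P)" for s t c U
    by (rule extensionalityI[of _ U]; simp add: sections_simps)+
  show ?thesis
    by (auto simp: presheaf_def sections_closed_def 1 2 restr_Spec intro: sec_const sec_mult sec_add sec_smult sec_restrict)
qed

section \<open>Morphisms given by homomorphisms into the stalks\<close>

text \<open>When \<open>L\<close> is local and \<theta> a homomorphism, this is the contraction of
  the maximal ideal: the point of \<open>Spec A\<close> that is the image of the closed point of
  \<open>Spec L\<close>.\<close>

definition contr :: "('k, 'a) module \<Rightarrow> ('b, 'n) monoid_scheme \<Rightarrow> ('a \<Rightarrow> 'b) \<Rightarrow> 'a set" where
  "contr A L \<theta> = {a \<in> carrier A. \<theta> a \<notin> Units L}"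

text \<open>A morphism from the open set \<open>D\<close> to \<open>Spec A\<close>, recorded as one
  homomorphism into each stalk. The coherence between different primes is the single requirement
  that every element of \<open>A\<close> yields a section over \<open>D\<close>. This form suits
  coordinate vectors, which exist only in stalks.\<close>

locale germ_hom = A: spec_ring K A + R: spec_ring K R
  for K :: "('k, 'm) ring_scheme" and A :: "('k, 'a) module" and R :: "('k, 'r) module" +
  fixes D :: "'r set set" and th :: "'r set \<Rightarrow> 'a \<Rightarrow> ('r \<times> 'r) set"
  assumes D: "spec_open R D"
    and th: "Q \<in> D \<Longrightarrow> th Q \<in> alg_hom K A (stalk_at R Q)"
    and th_sec: "a \<in> carrier A \<Longrightarrow> (\<lambda>Q\<in>D. th Q a) \<in> sec R D"
begin

abbreviation "ctr Q \<equiv> contr A (stalk_at R Q) (th Q)"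
abbreviation "pull Q \<equiv> frac_lift (stalk_at R Q) (th Q)"

lemma D_prime: "Q \<in> D \<Longrightarrow> primeideal Q R"
  by (rule R.open_prime[OF D])

lemma ctr_prime: assumes "Q \<in> D" shows "primeideal (ctr Q) A"
proof -
  have "ctr Q = {a \<in> carrier A. th Q a \<in> {X \<in> carrier (stalk_at R Q). X \<notin> Units (stalk_at R Q)}}"
    using alg_hom_closed[OF th[OF assms]] by (auto simp: contr_def)
  then show ?thesis
    using alg_hom_vimage_prime[OF th[OF assms] A.alg R.st_alg[OF D_prime[OF assms]] R.stalk_nonunits[OF D_prime[OF assms]]]
    by simp
qed

lemma lift: assumes "Q \<in> D" shows "frac_lift_hom K A (carrier A - ctr Q) (stalk_at R Q) (th Q)"
proof -
  interpret F: frac_ring K A "carrier A - ctr Q" by (rule A.frac_ring[OF ctr_prime[OF assms]])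
  show ?thesis
  proof (intro frac_lift_hom.intro frac_lift_hom_axioms.intro)
    show "frac_ring K A (carrier A - ctr Q)" ..
    show "algebra K (stalk_at R Q)" by (rule R.st_alg[OF D_prime[OF assms]])
    show "th Q \<in> alg_hom K A (stalk_at R Q)" by (rule th[OF assms])
    show "th Q s \<in> Units (stalk_at R Q)" if "s \<in> carrier A - ctr Q" for s using that by (simp add: contr_def)
  qed
qed

lemma pull_germ:
  "Q \<in> D \<Longrightarrow> a \<in> carrier A \<Longrightarrow> s \<in> carrier A - ctr Q \<Longrightarrow>
   pull Q (germ A (ctr Q) a s) = th Q a \<otimes>\<^bsub>stalk_at R Q\<^esub> inv\<^bsub>stalk_at R Q\<^esub> (th Q s)"
  by (rule frac_lift_hom.lift_frac[OF lift])

lemma pull_hom: "Q \<in> D \<Longrightarrow> pull Q \<in> alg_hom K (stalk_at A (ctr Q)) (stalk_at R Q)"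
  unfolding stalk_at_def[of A] by (rule frac_lift_hom.lift_hom[OF lift])

text \<open>The induced map of stalks is local: if the image of \<open>a/s\<close> is a unit, then
  so is the image of \<open>a\<close>, which puts \<open>a\<close> outside the contraction by its
  very definition.\<close>

lemma pull_unit:
  assumes Q: "Q \<in> D" and X: "X \<in> carrier (stalk_at A (ctr Q))" and u: "pull Q X \<in> Units (stalk_at R Q)"
  shows "X \<in> Units (stalk_at A (ctr Q))"
proof -
  interpret L: cring "stalk_at R Q" by (rule R.st_cring[OF D_prime[OF Q]])
  from X obtain a s where as: "a \<in> carrier A" "s \<in> carrier A - ctr Q" "X = germ A (ctr Q) a s"
    by (rule A.st_cases[OF ctr_prime[OF Q]])
  have s: "th Q s \<in> Units (stalk_at R Q)" using as by (auto simp: contr_def)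
  then have a: "th Q a \<in> Units (stalk_at R Q)"
    using u as L.Units_prod_iff[of "th Q a" "inv\<^bsub>stalk_at R Q\<^esub> (th Q s)"] alg_hom_closed[OF th[OF Q]]
    by (auto simp: pull_germ[OF Q])
  then show ?thesis
    using as(1) unfolding as(3) A.st_unit_iff[OF ctr_prime[OF Q] as(1,2)] by (simp add: contr_def)
qed

text \<open>Continuity: the primes of \<open>D\<close> sent into the basic open set of
  \<open>a\<close> form the unit locus of the section attached to \<open>a\<close>, and unit loci
  are open.\<close>

lemma ctr_open:
  assumes V: "spec_open A V" shows "spec_open R {Q \<in> D. ctr Q \<in> V}"
proof (subst openin_subopen, intro ballI)
  fix Q assume "Q \<in> {Q \<in> D. ctr Q \<in> V}"
  then have Q: "Q \<in> D" "ctr Q \<in> V" by auto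
  with V obtain a where a: "a \<in> carrier A" "a \<notin> ctr Q" "basic_open A a \<subseteq> V"
    unfolding A.open_iff by blast
  let ?T = "{Q' \<in> D. (\<lambda>Q\<in>D. th Q a) Q' \<in> Units (stalk_at R Q')}"
  have "spec_open R ?T" by (rule R.open_unit[OF D th_sec[OF a(1)]])
  moreover have "Q \<in> ?T" using Q a by (auto simp: contr_def)
  moreover have "ctr Q' \<in> basic_open A a" if "Q' \<in> ?T" for Q'
    using that ctr_prime a(1) by (auto simp: basic_open_def contr_def)
  then have "?T \<subseteq> {Q \<in> D. ctr Q \<in> V}" using a(3) by auto
  ultimately show "\<exists>T. spec_open R T \<and> Q \<in> T \<and> T \<subseteq> {Q \<in> D. ctr Q \<in> V}" by blast
qed

text \<open>Where \<open>t\<close> is a fraction \<open>a/g\<close>, its pullback is the quotient of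
  the sections attached to \<open>a\<close> and \<open>g\<close>. The second of these is a unit
  there, because \<open>g\<close> avoids the image points.\<close>

lemma pull_sec:
  assumes V: "spec_open A V" and t: "t \<in> sec A V"
  shows "(\<lambda>Q\<in>{Q \<in> D. ctr Q \<in> V}. pull Q (t (ctr Q))) \<in> sec R {Q \<in> D. ctr Q \<in> V}" (is "?s \<in> sec R ?E")
proof (rule R.sec_locI[OF ctr_open[OF V]])
  fix Q assume "Q \<in> ?E"
  then have Q: "Q \<in> D" "ctr Q \<in> V" by auto
  from t Q(2) obtain a g W where W: "a \<in> carrier A" "g \<in> carrier A" "spec_open A W" "ctr Q \<in> W" "W \<subseteq> V"
    "\<And>P. P \<in> W \<Longrightarrow> g \<notin> P" "\<And>P. P \<in> W \<Longrightarrow> t P = germ A P a g"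
    by (rule sec_local) auto
  let ?T = "{Q \<in> D. ctr Q \<in> W}"
  have T: "spec_open R ?T" "?T \<subseteq> D" by (rule ctr_open[OF W(3)]) auto
  have sa: "(\<lambda>Q\<in>?T. th Q b) \<in> sec R ?T" if "b \<in> carrier A" for b
  proof -
    have "restrict (\<lambda>Q\<in>D. th Q b) ?T \<in> sec R ?T" by (rule R.sec_restrict[OF th_sec[OF that] T])
    moreover have "restrict (\<lambda>Q\<in>D. th Q b) ?T = (\<lambda>Q\<in>?T. th Q b)" by auto
    ultimately show ?thesis by simp
  qed
  have u: "(\<lambda>Q\<in>?T. th Q g) Q' \<in> Units (stalk_at R Q')" if "Q' \<in> ?T" for Q'
    using that W(2) W(6)[of "ctr Q'"] by (auto simp: contr_def)
  have "(\<lambda>Q\<in>?T. (\<lambda>Q\<in>?T. th Q a) Q \<otimes>\<^bsub>stalk_at R Q\<^esub> (\<lambda>Q\<in>?T. inv\<^bsub>stalk_at R Q\<^esub> ((\<lambda>Q\<in>?T. th Q g) Q)) Q) \<in> sec R ?T"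
    by (rule R.sec_mult[OF T(1) sa[OF W(1)] R.sec_inv[OF T(1) sa[OF W(2)] u]])
  moreover have "?s Q' = (\<lambda>Q\<in>?T. (\<lambda>Q\<in>?T. th Q a) Q \<otimes>\<^bsub>stalk_at R Q\<^esub> (\<lambda>Q\<in>?T. inv\<^bsub>stalk_at R Q\<^esub> ((\<lambda>Q\<in>?T. th Q g) Q)) Q) Q'"
    if "Q' \<in> ?T" for Q'
    using that W(5) W(1,2) W(6,7)[of "ctr Q'"] by (auto simp: pull_germ)
  ultimately show "\<exists>T t. spec_open R T \<and> Q \<in> T \<and> T \<subseteq> ?E \<and> t \<in> sec R T \<and> (\<forall>Q\<in>T. ?s Q = t Q)"
    using T(1) Q W(4,5) by (intro exI[of _ ?T] exI conjI) auto
qed simp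

end

section \<open>Maps between affine schemes as families of stalk homomorphisms\<close>

lemma Spec_germ_hom:
  assumes A: "algebra K A" and R: "algebra K R" and \<phi>: "\<phi> \<in> alg_hom K A R"
  shows "germ_hom K A R (primes R) (\<lambda>Q a. germ R Q (\<phi> a) \<one>\<^bsub>R\<^esub>)"
proof -
  interpret A: spec_ring K A using A by (rule spec_ring.intro)
  interpret R: spec_ring K R using R by (rule spec_ring.intro)
  have U: "spec_open R (primes R)" by (rule spec_open_UNIV[OF R.cring_A])
  show ?thesis
  proof
    show "spec_open R (primes R)" by (rule U)
    show "(\<lambda>a. germ R Q (\<phi> a) \<one>\<^bsub>R\<^esub>) \<in> alg_hom K A (stalk_at R Q)" if "Q \<in> primes R" for Q
      by (rule alg_hom_comp[OF R.germ_hom \<phi>]) (use that in simp)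
    show "(\<lambda>Q\<in>primes R. germ R Q (\<phi> a) \<one>\<^bsub>R\<^esub>) \<in> sec R (primes R)" if "a \<in> carrier A" for a
      by (rule R.sec_const[OF U alg_hom_closed[OF \<phi> that]])
  qed
qed

lemma Spec_contr:
  assumes R: "algebra K R" and \<phi>: "\<phi> \<in> alg_hom K A R" and Q: "primeideal Q R"
  shows "contr A (stalk_at R Q) (\<lambda>a. germ R Q (\<phi> a) \<one>\<^bsub>R\<^esub>) = {a \<in> carrier A. \<phi> a \<in> Q}"
proof -
  interpret Q: primeideal Q R by fact
  show ?thesis
    by (auto simp: contr_def stalk_unit_iff[OF R Q alg_hom_closed[OF \<phi>]] Q.one_notin)
qed

lemma Spec_map_pt:
  "cring R \<Longrightarrow> primeideal Q R \<Longrightarrow> pt (Spec_map A R \<phi>) Q = {a \<in> carrier A. \<phi> a \<in> Q}"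
  by (simp add: Spec_map_def Spec_pt_def topspace_Spec)

lemma Spec_map_comor:
  assumes "cring R" "spec_open A V" "s \<in> sec A V" "primeideal Q R" "{a \<in> carrier A. \<phi> a \<in> Q} \<in> V"
  shows "comor (Spec_map A R \<phi>) V s Q = stalk_map R \<phi> Q (s {a \<in> carrier A. \<phi> a \<in> Q})"
  using assms by (simp add: Spec_map_def Spec_pt_def topspace_Spec)

lemma stalk_map_germ:
  assumes A: "algebra K A" and R: "algebra K R" and \<phi>: "\<phi> \<in> alg_hom K A R" and Q: "primeideal Q R"
    and a: "a \<in> carrier A" and s: "s \<in> carrier A" "\<phi> s \<notin> Q"
  shows "stalk_map R \<phi> Q (germ A {a \<in> carrier A. \<phi> a \<in> Q} a s) = germ R Q (\<phi> a) (\<phi> s)"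
proof -
  have P: "primeideal {a \<in> carrier A. \<phi> a \<in> Q} A" by (rule alg_hom_vimage_prime[OF \<phi> A R Q])
  interpret FA: frac_ring K A "carrier A - {a \<in> carrier A. \<phi> a \<in> Q}" by (rule prime_frac_ring[OF A P])
  interpret FR: frac_ring K R "carrier R - Q" by (rule prime_frac_ring[OF R Q])
  have s': "s \<in> carrier A - {a \<in> carrier A. \<phi> a \<in> Q}" using s by auto
  note c = alg_hom_closed[OF \<phi>]
  show ?thesis unfolding stalk_map_def
  proof (rule UN_const_eq[OF FA.frac_self[OF a s']])
    fix y assume "y \<in> FA.fr a s"
    then obtain b t w where y: "y = (b, t)" "b \<in> carrier A" "t \<in> carrier A" "\<phi> t \<notin> Q" "w \<in> carrier A" "\<phi> w \<notin> Q"
      and eq: "w \<otimes>\<^bsub>A\<^esub> (t \<otimes>\<^bsub>A\<^esub> a) = w \<otimes>\<^bsub>A\<^esub> (s \<otimes>\<^bsub>A\<^esub> b)"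
    proof -
      obtain b t where y: "y = (b, t)" by (cases y)
      show thesis
        using \<open>y \<in> FA.fr a s\<close> unfolding y FA.frac_mem[OF a s'] by (elim conjE bexE) (rule that[OF y]; simp)
    qed
    have "\<phi> w \<otimes>\<^bsub>R\<^esub> (\<phi> t \<otimes>\<^bsub>R\<^esub> \<phi> a) = \<phi> w \<otimes>\<^bsub>R\<^esub> (\<phi> s \<otimes>\<^bsub>R\<^esub> \<phi> b)"
      using arg_cong[OF eq, of \<phi>] y a s by (simp add: alg_hom_mult[OF \<phi>])
    then have "FR.fr (\<phi> a) (\<phi> s) = FR.fr (\<phi> b) (\<phi> t)"
      using y a s by (intro FR.frac_eqI[where w="\<phi> w"]) (auto simp: c)
    then show "FR.fr (\<phi> (fst y)) (\<phi> (snd y)) = FR.fr (\<phi> a) (\<phi> s)" by (simp add: y(1))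
  qed
qed

text \<open>Identifies the union in \<open>stalk_map\<close> with the universal lift of \<phi>
  followed by the canonical map, which makes the results of \<open>germ_hom\<close> available for
  \<open>Spec_map\<close>.\<close>

lemma stalk_map_lift:
  assumes A: "algebra K A" and R: "algebra K R" and \<phi>: "\<phi> \<in> alg_hom K A R" and Q: "primeideal Q R"
    and X: "X \<in> carrier (stalk_at A {a \<in> carrier A. \<phi> a \<in> Q})"
  shows "stalk_map R \<phi> Q X = frac_lift (stalk_at R Q) (\<lambda>a. germ R Q (\<phi> a) \<one>\<^bsub>R\<^esub>) X"
proof -
  interpret G: germ_hom K A R "primes R" "\<lambda>Q a. germ R Q (\<phi> a) \<one>\<^bsub>R\<^esub>" by (rule Spec_germ_hom[OF A R \<phi>])
  interpret Q: primeideal Q R by fact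
  note ctr = Spec_contr[OF R \<phi> Q]
  have P: "primeideal {a \<in> carrier A. \<phi> a \<in> Q} A" by (rule alg_hom_vimage_prime[OF \<phi> A R Q])
  obtain a s where as: "a \<in> carrier A" "s \<in> carrier A - {a \<in> carrier A. \<phi> a \<in> Q}" "X = germ A {a \<in> carrier A. \<phi> a \<in> Q} a s"
    by (rule G.A.st_cases[OF P X])
  note c = alg_hom_closed[OF \<phi>]
  have "frac_lift (stalk_at R Q) (\<lambda>a. germ R Q (\<phi> a) \<one>\<^bsub>R\<^esub>) X = germ R Q (\<phi> a) \<one>\<^bsub>R\<^esub> \<otimes>\<^bsub>stalk_at R Q\<^esub> inv\<^bsub>stalk_at R Q\<^esub> germ R Q (\<phi> s) \<one>\<^bsub>R\<^esub>"
    using G.pull_germ[of Q a s] Q as by (simp add: ctr)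
  also have "\<dots> = germ R Q (\<phi> a) (\<phi> s)"
    using as by (simp add: G.R.germ_inv[OF Q] G.R.st_mult[OF Q] c Q.one_notin)
  also have "\<dots> = stalk_map R \<phi> Q X"
    using as by (simp add: stalk_map_germ[OF A R \<phi> Q])
  finally show ?thesis by simp
qed

lemma stalk_map_hom:
  assumes A: "algebra K A" and R: "algebra K R" and \<phi>: "\<phi> \<in> alg_hom K A R" and Q: "primeideal Q R"
  shows "stalk_map R \<phi> Q \<in> alg_hom K (stalk_at A {a \<in> carrier A. \<phi> a \<in> Q}) (stalk_at R Q)"
proof -
  interpret G: germ_hom K A R "primes R" "\<lambda>Q a. germ R Q (\<phi> a) \<one>\<^bsub>R\<^esub>" by (rule Spec_germ_hom[OF A R \<phi>])
  have P: "primeideal {a \<in> carrier A. \<phi> a \<in> Q} A" by (rule alg_hom_vimage_prime[OF \<phi> A R Q])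
  show ?thesis
    using G.pull_hom[of Q] Q
    by (intro alg_hom_cong[OF _ G.A.st_alg[OF P] stalk_map_lift[OF A R \<phi> Q]]) (auto simp: Spec_contr[OF R \<phi> Q])
qed

text \<open>Continuity, regularity of the pulled back sections and locality are
  \<open>ctr_open\<close>, \<open>pull_sec\<close> and \<open>pull_unit\<close> for the family of
  \<open>Spec_germ_hom\<close>, whose domain is the whole spectrum.\<close>

lemma Spec_map_rmors:
  assumes A: "algebra K A" and R: "algebra K R" and \<phi>: "\<phi> \<in> alg_hom K A R"
  shows "Spec_map A R \<phi> \<in> rmors K (Spec R) (Spec A)"
proof -
  interpret G: germ_hom K A R "primes R" "\<lambda>Q a. germ R Q (\<phi> a) \<one>\<^bsub>R\<^esub>" by (rule Spec_germ_hom[OF A R \<phi>])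
  let ?c = "\<lambda>Q. {a \<in> carrier A. \<phi> a \<in> Q}"
  have ctr: "G.ctr Q = ?c Q" if "primeideal Q R" for Q using Spec_contr[OF R \<phi> that] .
  have pre: "preim (Spec R) (Spec_map A R \<phi>) V = {Q \<in> primes R. ?c Q \<in> V}" for V
    by (auto simp: preim_def G.R.topspace Spec_map_pt[OF G.R.cring_A])
  have pre': "{Q \<in> primes R. ?c Q \<in> V} = {Q \<in> primes R. G.ctr Q \<in> V}" for V
    using ctr by auto
  have com: "comor (Spec_map A R \<phi>) V s = (\<lambda>Q\<in>{Q \<in> primes R. ?c Q \<in> V}. G.pull Q (s (G.ctr Q)))"
    if "spec_open A V" "s \<in> sec A V" for V s
    using that by (auto simp: Spec_map_def Spec_pt_def fun_eq_iff G.R.topspace ctr intro!: stalk_map_lift[OF A R \<phi>] sec_stalk[OF that(2)])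
  have pst: "primeideal (?c Q) A" if "primeideal Q R" for Q by (rule alg_hom_vimage_prime[OF \<phi> A R that])
  show ?thesis
  proof (rule rmorsI)
    show "pt (Spec_map A R \<phi>) \<in> extensional (topspace (top_of (Spec R)))" by (simp add: Spec_map_def Spec_pt_def)
    show "comor (Spec_map A R \<phi>) \<in> extensional {V. spec_open A V}" by (simp add: Spec_map_def)
    show "continuous_map (top_of (Spec R)) (top_of (Spec A)) (pt (Spec_map A R \<phi>))"
      unfolding continuous_map_def
    proof (intro conjI allI impI)
      show "pt (Spec_map A R \<phi>) \<in> topspace (top_of (Spec R)) \<rightarrow> topspace (top_of (Spec A))"
        using pst by (auto simp: G.R.topspace G.A.topspace Spec_map_pt[OF G.R.cring_A])
      fix V assume "spec_open A V"
      from G.ctr_open[OF this] pre'[of V] pre[of V]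
      show "spec_open R {x \<in> topspace (top_of (Spec R)). pt (Spec_map A R \<phi>) x \<in> V}"
        by (simp add: preim_def)
    qed
  next
    fix V assume V: "spec_open A V"
    show "comor (Spec_map A R \<phi>) V \<in> extensional (carrier (sections (Spec A) V))"
      using V by (simp add: Spec_map_def)
    show "comor (Spec_map A R \<phi>) V \<in> alg_hom K (sections (Spec A) V) (sections (Spec R) (preim (Spec R) (Spec_map A R \<phi>) V))"
    proof (rule alg_homI)
      have ps: "sections_closed K (sections (Spec A) V)" using Spec_presheaf[OF A] V by (simp add: presheaf_def)
      have cs: "comor (Spec_map A R \<phi>) V s \<in> sec R (preim (Spec R) (Spec_map A R \<phi>) V)" if "s \<in> sec A V" for s
        unfolding pre com[OF V that] unfolding pre' by (rule G.pull_sec[OF V that])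
      have ext: "x = y" if "x \<in> extensional {Q \<in> primes R. ?c Q \<in> V}" "y \<in> extensional {Q \<in> primes R. ?c Q \<in> V}"
        "\<And>Q. primeideal Q R \<Longrightarrow> ?c Q \<in> V \<Longrightarrow> x Q = y Q" for x y
        using that by (intro extensionalityI[of x _ y]) auto
      have hom: "G.pull Q \<in> alg_hom K (stalk_at A (?c Q)) (stalk_at R Q)" if "primeideal Q R" for Q
        using G.pull_hom[of Q] that by (simp add: ctr)
      fix s assume s: "s \<in> sec A V"
      show "comor (Spec_map A R \<phi>) V s \<in> sec R (preim (Spec R) (Spec_map A R \<phi>) V)" by (rule cs[OF s])
      fix t assume t: "t \<in> sec A V"
      have st: "s \<otimes>\<^bsub>sections (Spec A) V\<^esub> t \<in> sec A V" "s \<oplus>\<^bsub>sections (Spec A) V\<^esub> t \<in> sec A V"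
        using s t ps by (auto simp: sections_closed_def)
      show "comor (Spec_map A R \<phi>) V (s \<otimes>\<^bsub>sections (Spec A) V\<^esub> t) = comor (Spec_map A R \<phi>) V s
        \<otimes>\<^bsub>sections (Spec R) (preim (Spec R) (Spec_map A R \<phi>) V)\<^esub> comor (Spec_map A R \<phi>) V t"
        unfolding com[OF V s] com[OF V t] com[OF V st(1)] pre
        by (rule ext) (simp_all add: sections_simps ctr alg_hom_mult[OF hom] sec_stalk[OF s] sec_stalk[OF t])
      show "comor (Spec_map A R \<phi>) V (s \<oplus>\<^bsub>sections (Spec A) V\<^esub> t) = comor (Spec_map A R \<phi>) V s
        \<oplus>\<^bsub>sections (Spec R) (preim (Spec R) (Spec_map A R \<phi>) V)\<^esub> comor (Spec_map A R \<phi>) V t"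
        unfolding com[OF V s] com[OF V t] com[OF V st(2)] pre
        by (rule ext) (simp_all add: sections_simps ctr alg_hom_add[OF hom] sec_stalk[OF s] sec_stalk[OF t])
    next
      have ps: "sections_closed K (sections (Spec A) V)" using Spec_presheaf[OF A] V by (simp add: presheaf_def)
      have ext: "x = y" if "x \<in> extensional {Q \<in> primes R. ?c Q \<in> V}" "y \<in> extensional {Q \<in> primes R. ?c Q \<in> V}"
        "\<And>Q. primeideal Q R \<Longrightarrow> ?c Q \<in> V \<Longrightarrow> x Q = y Q" for x y
        using that by (intro extensionalityI[of x _ y]) auto
      have hom: "G.pull Q \<in> alg_hom K (stalk_at A (?c Q)) (stalk_at R Q)" if "primeideal Q R" for Q
        using G.pull_hom[of Q] that by (simp add: ctr)
      have o: "\<one>\<^bsub>sections (Spec A) V\<^esub> \<in> sec A V" using ps by (simp add: sections_closed_def)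
      show "comor (Spec_map A R \<phi>) V \<one>\<^bsub>sections (Spec A) V\<^esub> = \<one>\<^bsub>sections (Spec R) (preim (Spec R) (Spec_map A R \<phi>) V)\<^esub>"
        unfolding com[OF V o] pre
        by (rule ext) (simp_all add: sections_simps ctr alg_hom_one[OF hom])
      fix c s assume c: "c \<in> carrier K" and s: "s \<in> sec A V"
      have cs: "c \<odot>\<^bsub>sections (Spec A) V\<^esub> s \<in> sec A V" using ps c s by (simp add: sections_closed_def)
      show "comor (Spec_map A R \<phi>) V (c \<odot>\<^bsub>sections (Spec A) V\<^esub> s) =
        c \<odot>\<^bsub>sections (Spec R) (preim (Spec R) (Spec_map A R \<phi>) V)\<^esub> comor (Spec_map A R \<phi>) V s"
        unfolding com[OF V s] com[OF V cs] pre
        by (rule ext) (simp_all add: sections_simps ctr c alg_hom_smult[OF hom] sec_stalk[OF s])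
    qed
    fix V' s assume V': "spec_open A V'" "V' \<subseteq> V" and s: "s \<in> sec A V"
    show "comor (Spec_map A R \<phi>) V' (restr (Spec A) V V' s) =
      restr (Spec R) (preim (Spec R) (Spec_map A R \<phi>) V) (preim (Spec R) (Spec_map A R \<phi>) V') (comor (Spec_map A R \<phi>) V s)"
      using V' s G.A.sec_restrict[OF s V'] unfolding pre restr_Spec
      by (auto simp: com[OF V s] com[OF V'(1)] fun_eq_iff ctr)
  next
    fix V s x assume V: "spec_open A V" and s: "s \<in> sec A V" and x: "x \<in> preim (Spec R) (Spec_map A R \<phi>) V"
      and u: "germ_unit (Spec R) (preim (Spec R) (Spec_map A R \<phi>) V) (comor (Spec_map A R \<phi>) V s) x"
    have x': "primeideal x R" "?c x \<in> V" using x by (auto simp: pre)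
    have o: "spec_open R (preim (Spec R) (Spec_map A R \<phi>) V)"
      unfolding pre pre' by (rule G.ctr_open[OF V])
    have cs: "comor (Spec_map A R \<phi>) V s \<in> sec R (preim (Spec R) (Spec_map A R \<phi>) V)"
      unfolding pre com[OF V s] unfolding pre' by (rule G.pull_sec[OF V s])
    have "G.pull x (s (G.ctr x)) \<in> Units (stalk_at R x)"
      using u x' unfolding G.R.germ_unit_iff[OF o cs x] by (simp add: com[OF V s])
    then have "s (?c x) \<in> Units (stalk_at A (?c x))"
      using G.pull_unit[of x "s (G.ctr x)"] x' sec_stalk[OF s x'(2)] by (simp add: ctr)
    then show "germ_unit (Spec A) V s (pt (Spec_map A R \<phi>) x)"
      using x' by (simp add: G.A.germ_unit_iff[OF V s] Spec_map_pt[OF G.R.cring_A])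
  qed
qed

section \<open>Affine charts\<close>

text \<open>From left to right this is locality of the morphism. From right to left, an inverse over
  a smaller neighbourhood is carried along by the comorphism, which preserves products and the unit
  element.\<close>

lemma rmors_preserve_unit:
  assumes R: "algebra K R" and X: "presheaf K X" and f: "f \<in> rmors K (Spec R) X"
    and W: "openin (top_of X) W" and s: "s \<in> carrier (sections X W)"
    and Q: "primeideal Q R" "pt f Q \<in> W"
  shows "comor f W s Q \<in> Units (stalk_at R Q) \<longleftrightarrow> germ_unit X W s (pt f Q)"
proof -
  interpret R: spec_ring K R using R by (rule spec_ring.intro)
  have Q': "Q \<in> preim (Spec R) f W" using Q by (simp add: preim_def R.topspace)
  have o: "spec_open R (preim (Spec R) f V)" if "openin (top_of X) V" for V using f that by (rule preim_open)
  note hom = rmorsD(4)[OF f]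
  have cs: "comor f V t \<in> sec R (preim (Spec R) f V)" if "openin (top_of X) V" "t \<in> carrier (sections X V)" for V t
    using that alg_hom_closed[OF hom] by blast
  show ?thesis
  proof
    assume "comor f W s Q \<in> Units (stalk_at R Q)"
    then have "germ_unit (Spec R) (preim (Spec R) f W) (comor f W s) Q"
      using R.germ_unit_iff[OF o[OF W] cs[OF W s] Q'] by simp
    then show "germ_unit X W s (pt f Q)" by (rule rmorsD(7)[OF f W s Q'])
  next
    assume "germ_unit X W s (pt f Q)"
    then obtain V where V: "openin (top_of X) V" "pt f Q \<in> V" "V \<subseteq> W" "restr X W V s \<in> Units (sections X V)"
      by (auto simp: germ_unit_def)
    then obtain t where t: "t \<in> carrier (sections X V)" "restr X W V s \<otimes>\<^bsub>sections X V\<^esub> t = \<one>\<^bsub>sections X V\<^esub>"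
      and r: "restr X W V s \<in> carrier (sections X V)"
      by (auto simp: Units_def)
    have QV: "Q \<in> preim (Spec R) f V" using Q V by (simp add: preim_def R.topspace)
    interpret L: cring "stalk_at R Q" using R.st_cring[OF Q(1)] .
    have "comor f V (restr X W V s) \<otimes>\<^bsub>sections (Spec R) (preim (Spec R) f V)\<^esub> comor f V t = \<one>\<^bsub>sections (Spec R) (preim (Spec R) f V)\<^esub>"
      using alg_hom_mult[OF hom[OF V(1)] r t(1)] alg_hom_one[OF hom[OF V(1)]] t(2) by simp
    from fun_cong[OF this, of Q]
    have "comor f V (restr X W V s) Q \<otimes>\<^bsub>stalk_at R Q\<^esub> comor f V t Q = \<one>\<^bsub>stalk_at R Q\<^esub>"
      using QV by (simp add: sections_simps)
    moreover have "comor f V (restr X W V s) Q = comor f W s Q"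
      using rmorsD(6)[OF f W V(1,3) s] QV by (simp add: restr_Spec)
    ultimately have "comor f W s Q \<otimes>\<^bsub>stalk_at R Q\<^esub> comor f V t Q = \<one>\<^bsub>stalk_at R Q\<^esub>" by simp
    moreover have "comor f W s Q \<in> carrier (stalk_at R Q)" "comor f V t Q \<in> carrier (stalk_at R Q)"
      using sec_stalk[OF cs[OF W s] Q'] sec_stalk[OF cs[OF V(1) t(1)] QV] by auto
    ultimately show "comor f W s Q \<in> Units (stalk_at R Q)"
      using L.Units_mult_inv_unique(1) L.m_comm by metis
  qed
qed

text \<open>Morphisms are extensional and sections over \<open>Spec R\<close> are functions on
  primes, so equality can be tested one prime at a time.\<close>

lemma rmors_eqI:
  assumes R: "cring R" and f: "f \<in> rmors K (Spec R) X" and g: "g \<in> rmors K (Spec R) X"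
    and pt: "\<And>Q. primeideal Q R \<Longrightarrow> pt f Q = pt g Q"
    and com: "\<And>Q W s. primeideal Q R \<Longrightarrow> openin (top_of X) W \<Longrightarrow> pt f Q \<in> W \<Longrightarrow> s \<in> carrier (sections X W) \<Longrightarrow>
      comor f W s Q = comor g W s Q"
  shows "f = g"
proof -
  have p: "pt f = pt g"
    by (rule extensionalityI[OF rmorsD(1)[OF f] rmorsD(1)[OF g]]) (simp add: topspace_Spec[OF R] pt)
  then have pre: "preim (Spec R) f W = preim (Spec R) g W" for W by (simp add: preim_def)
  have "comor f W s = comor g W s" if W: "openin (top_of X) W" and s: "s \<in> carrier (sections X W)" for W s
  proof (rule extensionalityI[of _ "preim (Spec R) f W"])
    show "comor f W s \<in> extensional (preim (Spec R) f W)"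
      by (rule sec_ext[OF alg_hom_closed[OF rmorsD(4)[OF f W] s]])
    show "comor g W s \<in> extensional (preim (Spec R) f W)"
      unfolding pre by (rule sec_ext[OF alg_hom_closed[OF rmorsD(4)[OF g W] s]])
    show "comor f W s Q = comor g W s Q" if "Q \<in> preim (Spec R) f W" for Q
      using that W s by (intro com) (auto simp: preim_def topspace_Spec[OF R])
  qed
  then have "comor f W = comor g W" if W: "openin (top_of X) W" for W
    by (rule extensionalityI[OF rmorsD(5)[OF f W] rmorsD(5)[OF g W]]) (rule W)
  then have "comor f = comor g"
    by (intro extensionalityI[OF rmorsD(3)[OF f] rmorsD(3)[OF g]]) simp
  with p show ?thesis by simp
qed

text \<open>An affine open part of \<open>X\<close>: \<iota> embeds \<open>Spec A\<close> as an open
  subset and \<sigma> reads a section in the coordinates of \<open>A\<close>. One function \<sigma>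
  serves all open sets because on a glued space it will be a projection of pairs.\<close>

locale chart = A: spec_ring K A for K :: "('k, 'm) ring_scheme" and A :: "('k, 'a) module" +
  fixes X :: "('k, 'p, 's) rspace" and \<iota> :: "'a set \<Rightarrow> 'p" and \<sigma> :: "'s \<Rightarrow> 'a set \<Rightarrow> ('a \<times> 'a) set"
  assumes X: "presheaf K X"
    and inj: "inj_on \<iota> (primes A)"
    and open_im: "spec_open A V \<Longrightarrow> openin (top_of X) (\<iota> ` V)"
    and open_pre: "openin (top_of X) W \<Longrightarrow> spec_open A {P \<in> primes A. \<iota> P \<in> W}"
    and \<sigma>_hom: "openin (top_of X) W \<Longrightarrow> \<sigma> \<in> alg_hom K (sections X W) (sections (Spec A) {P \<in> primes A. \<iota> P \<in> W})"
    and \<sigma>_restr: "openin (top_of X) W \<Longrightarrow> openin (top_of X) W' \<Longrightarrow> W' \<subseteq> W \<Longrightarrow> s \<in> carrier (sections X W) \<Longrightarrow>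
      \<sigma> (restr X W W' s) = restrict (\<sigma> s) {P \<in> primes A. \<iota> P \<in> W'}"
    and \<sigma>_bij: "openin (top_of X) W \<Longrightarrow> W \<subseteq> \<iota> ` primes A \<Longrightarrow>
      bij_betw \<sigma> (carrier (sections X W)) (sec A {P \<in> primes A. \<iota> P \<in> W})"
begin

abbreviation "pre W \<equiv> {P \<in> primes A. \<iota> P \<in> W}"
abbreviation "patch \<equiv> \<iota> ` primes A"

lemma patch_open: "openin (top_of X) patch"
  by (rule open_im[OF spec_open_UNIV[OF A.cring_A]])

lemma pre_image: "V \<subseteq> primes A \<Longrightarrow> pre (\<iota> ` V) = V"
  using inj by (auto dest: inj_onD)

lemma restr_closed:
  "openin (top_of X) W \<Longrightarrow> openin (top_of X) W' \<Longrightarrow> W' \<subseteq> W \<Longrightarrow> s \<in> carrier (sections X W) \<Longrightarrow>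
   restr X W W' s \<in> carrier (sections X W')"
  using X by (simp add: presheaf_def)

lemma sec_closed: "openin (top_of X) W \<Longrightarrow> sections_closed K (sections X W)"
  using X by (simp add: presheaf_def)

lemma \<sigma>_sec: "openin (top_of X) W \<Longrightarrow> s \<in> carrier (sections X W) \<Longrightarrow> \<sigma> s \<in> sec A (pre W)"
  by (rule alg_hom_closed[OF \<sigma>_hom])

lemma \<sigma>_inj:
  assumes "openin (top_of X) W" "W \<subseteq> patch" "s \<in> carrier (sections X W)" "t \<in> carrier (sections X W)"
    and "\<And>P. P \<in> pre W \<Longrightarrow> \<sigma> s P = \<sigma> t P"
  shows "s = t"
proof -
  have "\<sigma> s = \<sigma> t"
    by (rule extensionalityI[of _ "pre W"]) (use assms \<sigma>_sec sec_ext in blast)+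
  then show ?thesis using \<sigma>_bij[OF assms(1,2)] assms(3,4) by (auto simp: bij_betw_def dest: inj_onD)
qed

text \<open>A unit near the point is mapped to a unit because \<sigma> is a homomorphism compatible
  with restriction. For the converse the inverse is formed over the unit locus in
  \<open>Spec A\<close> and brought back to \<open>X\<close> by the bijectivity of \<sigma> inside
  the patch.\<close>

lemma chart_unit:
  assumes W: "openin (top_of X) W" and s: "s \<in> carrier (sections X W)" and P: "P \<in> pre W"
  shows "germ_unit X W s (\<iota> P) \<longleftrightarrow> \<sigma> s P \<in> Units (stalk_at A P)"
proof
  assume "germ_unit X W s (\<iota> P)"
  then obtain V where V: "openin (top_of X) V" "\<iota> P \<in> V" "V \<subseteq> W" "restr X W V s \<in> Units (sections X V)"
    by (auto simp: germ_unit_def)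
  then obtain t where t: "t \<in> carrier (sections X V)" "restr X W V s \<otimes>\<^bsub>sections X V\<^esub> t = \<one>\<^bsub>sections X V\<^esub>"
    and r: "restr X W V s \<in> carrier (sections X V)"
    by (auto simp: Units_def)
  interpret L: cring "stalk_at A P" using A.st_cring P by simp
  have PV: "P \<in> pre V" using P V by simp
  have "\<sigma> (restr X W V s) \<otimes>\<^bsub>sections (Spec A) (pre V)\<^esub> \<sigma> t = \<one>\<^bsub>sections (Spec A) (pre V)\<^esub>"
    using alg_hom_mult[OF \<sigma>_hom[OF V(1)] r t(1)] alg_hom_one[OF \<sigma>_hom[OF V(1)]] t(2) by simp
  from fun_cong[OF this, of P]
  have "\<sigma> s P \<otimes>\<^bsub>stalk_at A P\<^esub> \<sigma> t P = \<one>\<^bsub>stalk_at A P\<^esub>"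
    using PV by (simp add: sections_simps \<sigma>_restr[OF W V(1,3) s])
  moreover have "\<sigma> s P \<in> carrier (stalk_at A P)" "\<sigma> t P \<in> carrier (stalk_at A P)"
    using sec_stalk[OF \<sigma>_sec[OF W s] P] sec_stalk[OF \<sigma>_sec[OF V(1) t(1)] PV] by auto
  ultimately show "\<sigma> s P \<in> Units (stalk_at A P)"
    using L.Units_mult_inv_unique(1) L.m_comm by metis
next
  assume u: "\<sigma> s P \<in> Units (stalk_at A P)"
  let ?T = "{P \<in> pre W. \<sigma> s P \<in> Units (stalk_at A P)}"
  let ?V = "\<iota> ` ?T"
  have T: "spec_open A ?T" by (rule A.open_unit[OF open_pre[OF W] \<sigma>_sec[OF W s]])
  have V: "openin (top_of X) ?V" "?V \<subseteq> W" "?V \<subseteq> patch" using open_im[OF T] by auto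
  have pV: "pre ?V = ?T" by (rule pre_image) auto
  let ?t = "\<lambda>P\<in>?T. inv\<^bsub>stalk_at A P\<^esub> (restrict (\<sigma> s) ?T P)"
  have sT: "restrict (\<sigma> s) ?T \<in> sec A ?T" by (rule A.sec_restrict[OF \<sigma>_sec[OF W s] T]) auto
  have "?t \<in> sec A ?T"
    by (rule A.sec_inv[OF T sT]) auto
  then obtain t where t: "t \<in> carrier (sections X ?V)" "\<sigma> t = ?t"
    using \<sigma>_bij[OF V(1,3)] unfolding pV bij_betw_def by (metis (no_types, lifting) imageE)
  let ?r = "restr X W ?V s"
  have r: "?r \<in> carrier (sections X ?V)" by (rule restr_closed[OF W V(1,2) s])
  have \<sigma>r: "\<sigma> ?r = restrict (\<sigma> s) ?T" using \<sigma>_restr[OF W V(1,2) s] by (simp only: pV)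
  have c: "\<one>\<^bsub>sections X ?V\<^esub> \<in> carrier (sections X ?V)"
    "?r \<otimes>\<^bsub>sections X ?V\<^esub> t \<in> carrier (sections X ?V)" "t \<otimes>\<^bsub>sections X ?V\<^esub> ?r \<in> carrier (sections X ?V)"
    using sec_closed[OF V(1)] r t(1) unfolding sections_closed_def by blast+
  have mon: "monoid (stalk_at A P)" if "primeideal P A" for P
    using A.st_cring[OF that] by (simp add: cring_def ring_def)
  have "?r \<otimes>\<^bsub>sections X ?V\<^esub> t = \<one>\<^bsub>sections X ?V\<^esub>"
    by (rule \<sigma>_inj[OF V(1,3) c(2,1)], unfold pV alg_hom_mult[OF \<sigma>_hom[OF V(1)] r t(1)] alg_hom_one[OF \<sigma>_hom[OF V(1)]] t(2) \<sigma>r)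
       (simp add: sections_simps monoid.Units_r_inv[OF mon])
  moreover have "t \<otimes>\<^bsub>sections X ?V\<^esub> ?r = \<one>\<^bsub>sections X ?V\<^esub>"
    by (rule \<sigma>_inj[OF V(1,3) c(3,1)], unfold pV alg_hom_mult[OF \<sigma>_hom[OF V(1)] t(1) r] alg_hom_one[OF \<sigma>_hom[OF V(1)]] t(2) \<sigma>r)
       (simp add: sections_simps monoid.Units_l_inv[OF mon])
  ultimately have "?r \<in> Units (sections X ?V)" using r t(1) by (auto simp: Units_def)
  then show "germ_unit X W s (\<iota> P)"
    using V P u unfolding germ_unit_def by (intro exI[of _ ?V]) auto
qed

text \<open>The element \<open>a\<close> as a regular function on the patch, that is, as a section
  of \<open>X\<close> over an open subset.\<close>

definition chart_sec :: "'a \<Rightarrow> 's" where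
  "chart_sec a = inv_into (carrier (sections X patch)) \<sigma> (\<lambda>P\<in>primes A. germ A P a \<one>\<^bsub>A\<^esub>)"

lemma pre_patch: "pre patch = primes A"
  by auto

lemma chart_sec:
  assumes "a \<in> carrier A"
  shows "chart_sec a \<in> carrier (sections X patch)" "\<sigma> (chart_sec a) = (\<lambda>P\<in>primes A. germ A P a \<one>\<^bsub>A\<^esub>)"
proof -
  have "(\<lambda>P\<in>primes A. germ A P a \<one>\<^bsub>A\<^esub>) \<in> \<sigma> ` carrier (sections X patch)"
    using \<sigma>_bij[OF patch_open] A.sec_const[OF spec_open_UNIV[OF A.cring_A] assms]
    unfolding pre_patch by (simp add: bij_betw_def)
  then show "chart_sec a \<in> carrier (sections X patch)" "\<sigma> (chart_sec a) = (\<lambda>P\<in>primes A. germ A P a \<one>\<^bsub>A\<^esub>)"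
    unfolding chart_sec_def by (auto intro: inv_into_into f_inv_into_f)
qed

lemma chart_sec_hom: "chart_sec \<in> alg_hom K A (sections X patch)"
proof -
  note S = sec_closed[OF patch_open, unfolded sections_closed_def]
  note H = \<sigma>_hom[OF patch_open, unfolded pre_patch]
  note G = A.germ_hom
  have eq: "chart_sec a = t" if "a \<in> carrier A" "t \<in> carrier (sections X patch)"
    "\<And>P. primeideal P A \<Longrightarrow> \<sigma> t P = germ A P a \<one>\<^bsub>A\<^esub>" for a t
    using that by (intro \<sigma>_inj[OF patch_open _ chart_sec(1)]) (auto simp: chart_sec)
  show ?thesis
  proof (rule alg_homI)
    fix x y c assume [simp]: "x \<in> carrier A"
    show "chart_sec x \<in> carrier (sections X patch)" by (rule chart_sec) simp
    show "c \<in> carrier K \<Longrightarrow> chart_sec (c \<odot>\<^bsub>A\<^esub> x) = c \<odot>\<^bsub>sections X patch\<^esub> chart_sec x"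
      by (intro eq) (use S in \<open>simp_all add: chart_sec alg_hom_smult[OF H] sections_simps alg_hom_smult[OF G]\<close>)
    assume [simp]: "y \<in> carrier A"
    show "chart_sec (x \<otimes>\<^bsub>A\<^esub> y) = chart_sec x \<otimes>\<^bsub>sections X patch\<^esub> chart_sec y"
      by (intro eq) (use S in \<open>simp_all add: chart_sec alg_hom_mult[OF H] sections_simps alg_hom_mult[OF G]\<close>)
    show "chart_sec (x \<oplus>\<^bsub>A\<^esub> y) = chart_sec x \<oplus>\<^bsub>sections X patch\<^esub> chart_sec y"
      by (intro eq) (use S in \<open>simp_all add: chart_sec alg_hom_add[OF H] sections_simps alg_hom_add[OF G]\<close>)
  next
    show "chart_sec \<one>\<^bsub>A\<^esub> = \<one>\<^bsub>sections X patch\<^esub>"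
      by (intro eq) (use S in \<open>simp_all add: alg_hom_one[OF H] sections_simps alg_hom_one[OF G]\<close>)
  qed
qed

text \<open>The pullback along \<open>f\<close> of the function \<open>a\<close>, taken in the stalk
  at \<open>Q\<close>. It is meant for primes that \<open>f\<close> sends into the patch.\<close>

definition chart_hom :: "('r set, 'r set \<Rightarrow> ('r \<times> 'r) set, 'p, 's) rmor \<Rightarrow> 'r set \<Rightarrow> 'a \<Rightarrow> ('r \<times> 'r) set" where
  "chart_hom f Q a = comor f patch (chart_sec a) Q"

end

locale chart_pt = chart K A X \<iota> \<sigma> + R: spec_ring K R
  for K :: "('k, 'm) ring_scheme" and A :: "('k, 'a) module" and X :: "('k, 'p, 's) rspace" and \<iota> \<sigma>
    and R :: "('k, 'r) module" +
  fixes f assumes f: "f \<in> rmors K (Spec R) X"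
begin

abbreviation "dmn \<equiv> {Q \<in> primes R. pt f Q \<in> patch}"

lemma preim_eq: "preim (Spec R) f W = {Q \<in> primes R. pt f Q \<in> W}"
  by (auto simp: preim_def R.topspace)

lemma preim_opn: "openin (top_of X) W \<Longrightarrow> spec_open R {Q \<in> primes R. pt f Q \<in> W}"
  using preim_open[OF f] by (simp add: preim_eq)

lemma comor_hom: "openin (top_of X) W \<Longrightarrow>
    comor f W \<in> alg_hom K (sections X W) (sections (Spec R) {Q \<in> primes R. pt f Q \<in> W})"
  using rmorsD(4)[OF f] by (simp add: preim_eq)

lemma eval_hom:
  assumes W: "openin (top_of X) W" and Q: "primeideal Q R" "pt f Q \<in> W"
  shows "(\<lambda>s. comor f W s Q) \<in> alg_hom K (sections X W) (stalk_at R Q)"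
proof -
  note h = comor_hom[OF W]
  show ?thesis
    by (rule alg_homI)
       (use Q alg_hom_closed[OF h] in \<open>auto simp: alg_hom_mult[OF h] alg_hom_add[OF h] alg_hom_one[OF h] alg_hom_smult[OF h]
          sections_simps intro: sec_stalk\<close>)
qed

lemma comor_restr:
  assumes "openin (top_of X) W" "openin (top_of X) W'" "W' \<subseteq> W" "s \<in> carrier (sections X W)" "primeideal Q R" "pt f Q \<in> W'"
  shows "comor f W' (restr X W W' s) Q = comor f W s Q"
  using rmorsD(6)[OF f assms(1-4)] assms by (simp add: restr_Spec preim_eq)

text \<open>Turns a given morphism back into stalk homomorphisms, over the preimage of the patch.
  \<open>pt_eq\<close> and \<open>comor_eq\<close> show that nothing is lost.\<close>

sublocale G: germ_hom K A R dmn "chart_hom f"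
proof
  show "spec_open R dmn" by (rule preim_opn[OF patch_open])
  show "chart_hom f Q \<in> alg_hom K A (stalk_at R Q)" if "Q \<in> dmn" for Q
    unfolding chart_hom_def using that by (intro alg_hom_comp[OF eval_hom[OF patch_open] chart_sec_hom]) auto
  fix a assume a: "a \<in> carrier A"
  have c: "comor f patch (chart_sec a) \<in> sec R dmn"
    by (rule alg_hom_closed[OF comor_hom[OF patch_open] chart_sec(1)[OF a]])
  moreover have "(\<lambda>Q\<in>dmn. chart_hom f Q a) = comor f patch (chart_sec a)"
    using sec_ext[OF c] by (intro extensionalityI[of _ dmn]) (auto simp: chart_hom_def)
  ultimately show "(\<lambda>Q\<in>dmn. chart_hom f Q a) \<in> sec R dmn" by simp
qed

text \<open>A prime of \<open>A\<close> is known once it is known which elements become units in its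
  stalk, and a morphism both preserves and reflects units of germs.\<close>

lemma pt_eq: assumes "Q \<in> dmn" shows "pt f Q = \<iota> (G.ctr Q)"
proof -
  from assms obtain P where P: "primeideal P A" "pt f Q = \<iota> P" and Q: "primeideal Q R" by auto
  have "a \<notin> P \<longleftrightarrow> chart_hom f Q a \<in> Units (stalk_at R Q)" if a: "a \<in> carrier A" for a
  proof -
    interpret P: primeideal P A by fact
    have "chart_hom f Q a \<in> Units (stalk_at R Q) \<longleftrightarrow> germ_unit X patch (chart_sec a) (\<iota> P)"
      unfolding chart_hom_def
      using rmors_preserve_unit[OF R.alg X f patch_open chart_sec(1)[OF a] Q] P by simp
    also have "\<dots> \<longleftrightarrow> germ A P a \<one>\<^bsub>A\<^esub> \<in> Units (stalk_at A P)"
      using P chart_unit[OF patch_open chart_sec(1)[OF a], of P] by (simp add: chart_sec(2)[OF a])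
    also have "\<dots> \<longleftrightarrow> a \<notin> P"
      using A.st_unit_iff[OF P(1) a] P.one_notin by simp
    finally show ?thesis by simp
  qed
  moreover have "P \<subseteq> carrier A" using P(1) by (rule additive_subgroup.a_subset[OF ideal.axioms(1)[OF primeideal.axioms(1)]])
  ultimately have "P = G.ctr Q" by (auto simp: contr_def)
  then show ?thesis using P by simp
qed

text \<open>Near the image point the section is \<open>a/g\<close>, so over a small neighbourhood
  inside the patch it satisfies an equation of sections with \<open>a\<close> and \<open>g\<close>.
  The comorphism carries the equation to the stalk at \<open>Q\<close>, where it characterizes the
  lifted value.\<close>

lemma comor_eq:
  assumes Q: "Q \<in> dmn" and W: "openin (top_of X) W" "pt f Q \<in> W" and s: "s \<in> carrier (sections X W)"
  shows "comor f W s Q = G.pull Q (\<sigma> s (G.ctr Q))"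
proof -
  let ?P = "G.ctr Q"
  have Qp: "primeideal Q R" using Q by simp
  have P: "?P \<in> pre W" using G.ctr_prime[OF Q] W pt_eq[OF Q] by simp
  from \<sigma>_sec[OF W(1) s] P obtain a g V where V: "a \<in> carrier A" "g \<in> carrier A" "spec_open A V" "?P \<in> V" "V \<subseteq> pre W"
    "\<And>P. P \<in> V \<Longrightarrow> g \<notin> P" "\<And>P. P \<in> V \<Longrightarrow> \<sigma> s P = germ A P a g"
    by (rule sec_local) auto
  let ?V = "\<iota> ` V"
  have V': "openin (top_of X) ?V" "?V \<subseteq> W" "?V \<subseteq> patch" using open_im[OF V(3)] V(5) by auto
  have pV: "pre ?V = V" by (rule pre_image) (use V(5) in auto)
  have ptV: "pt f Q \<in> ?V" using V(4) pt_eq[OF Q] by simp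
  let ?r = "restr X W ?V s" and ?a = "restr X patch ?V (chart_sec a)" and ?g = "restr X patch ?V (chart_sec g)"
  have c: "?r \<in> carrier (sections X ?V)" "?a \<in> carrier (sections X ?V)" "?g \<in> carrier (sections X ?V)"
    using restr_closed[OF W(1) V'(1,2) s] restr_closed[OF patch_open V'(1,3)] chart_sec(1) V(1,2) by auto
  have rr: "\<sigma> ?r = restrict (\<sigma> s) V" "\<sigma> ?a = restrict (\<lambda>P\<in>primes A. germ A P a \<one>\<^bsub>A\<^esub>) V" "\<sigma> ?g = restrict (\<lambda>P\<in>primes A. germ A P g \<one>\<^bsub>A\<^esub>) V"
    using \<sigma>_restr[OF W(1) V'(1,2) s] \<sigma>_restr[OF patch_open V'(1,3) chart_sec(1)] chart_sec(2) V(1,2) by (simp_all only: pV)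
  have "?r \<otimes>\<^bsub>sections X ?V\<^esub> ?g = ?a"
  proof (rule \<sigma>_inj[OF V'(1,3) _ c(2)])
    show "?r \<otimes>\<^bsub>sections X ?V\<^esub> ?g \<in> carrier (sections X ?V)"
      using sec_closed[OF V'(1)] c by (simp add: sections_closed_def)
    fix P assume "P \<in> pre ?V"
    then have PV: "P \<in> V" by (simp only: pV)
    then have Pp: "primeideal P A" using V(5) by auto
    interpret P: primeideal P A by fact
    have "\<sigma> (?r \<otimes>\<^bsub>sections X ?V\<^esub> ?g) P = germ A P a g \<otimes>\<^bsub>stalk_at A P\<^esub> germ A P g \<one>\<^bsub>A\<^esub>"
      unfolding alg_hom_mult[OF \<sigma>_hom[OF V'(1)] c(1,3)] pV rr using PV Pp V(7) by (simp add: sections_simps)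
    also have "\<dots> = germ A P a \<one>\<^bsub>A\<^esub>"
      using V(1,2) V(6)[OF PV] P.one_notin
      by (simp add: A.st_mult[OF Pp]) (rule A.germ_eqI[OF Pp, where w="\<one>\<^bsub>A\<^esub>"], auto simp: A.m_ac)
    finally show "\<sigma> (?r \<otimes>\<^bsub>sections X ?V\<^esub> ?g) P = \<sigma> ?a P" unfolding rr using PV Pp by simp
  qed
  from arg_cong[OF this, of "\<lambda>s. comor f ?V s Q"]
  have "comor f W s Q \<otimes>\<^bsub>stalk_at R Q\<^esub> chart_hom f Q g = chart_hom f Q a"
    unfolding alg_hom_mult[OF eval_hom[OF V'(1) Qp ptV] c(1,3)]
    by (simp add: comor_restr[OF W(1) V'(1,2) s Qp ptV] comor_restr[OF patch_open V'(1,3) chart_sec(1) Qp ptV] V(1,2) chart_hom_def)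
  moreover have "comor f W s Q \<in> carrier (stalk_at R Q)"
    by (rule alg_hom_closed[OF eval_hom[OF W(1) Qp W(2)] s])
  ultimately have "G.pull Q (germ A ?P a g) = comor f W s Q"
    using frac_lift_hom.lift_eq_iff[OF G.lift[OF Q] V(1), of g] V(2) V(6)[OF V(4)] by simp
  then show ?thesis by (simp add: V(7)[OF V(4)])
qed

end

text \<open>\<open>pt_eq\<close> and \<open>comor_eq\<close> express image point and values at
  \<open>Q\<close> through the chart homomorphism alone. Comparing two points thus becomes comparing
  two homomorphisms out of \<open>A\<close>.\<close>

lemma (in chart) chart_unique:
  assumes R: "algebra K R" and f: "f \<in> rmors K (Spec R) X" and g: "g \<in> rmors K (Spec R) X"
    and Q: "primeideal Q R" "pt f Q \<in> patch" "pt g Q \<in> patch"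
    and eq: "\<And>a. a \<in> carrier A \<Longrightarrow> chart_hom f Q a = chart_hom g Q a"
  shows "pt f Q = pt g Q"
    "openin (top_of X) W \<Longrightarrow> pt f Q \<in> W \<Longrightarrow> s \<in> carrier (sections X W) \<Longrightarrow> comor f W s Q = comor g W s Q"
proof -
  interpret F: chart_pt K A X \<iota> \<sigma> R f by (intro chart_pt.intro chart_pt_axioms.intro spec_ring.intro chart_axioms R f)
  interpret G: chart_pt K A X \<iota> \<sigma> R g by (intro chart_pt.intro chart_pt_axioms.intro spec_ring.intro chart_axioms R g)
  have ctr: "F.G.ctr Q = G.G.ctr Q" by (auto simp: contr_def eq)
  have QF: "Q \<in> F.dmn" and QG: "Q \<in> G.dmn" using Q by auto
  show p: "pt f Q = pt g Q" using F.pt_eq[OF QF] G.pt_eq[OF QG] ctr by simp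
  assume W: "openin (top_of X) W" "pt f Q \<in> W" and s: "s \<in> carrier (sections X W)"
  have "F.G.ctr Q \<in> pre W" using F.pt_eq[OF QF] F.G.ctr_prime[OF QF] W by simp
  then have "\<sigma> s (F.G.ctr Q) \<in> carrier (stalk_at A (F.G.ctr Q))" by (rule sec_stalk[OF \<sigma>_sec[OF W(1) s]])
  then obtain a t where at: "a \<in> carrier A" "t \<in> carrier A - F.G.ctr Q" "\<sigma> s (F.G.ctr Q) = germ A (F.G.ctr Q) a t"
    by (rule A.st_cases[OF F.G.ctr_prime[OF QF]])
  have at': "t \<in> carrier A - G.G.ctr Q" using at ctr by simp
  have "comor f W s Q = F.G.pull Q (germ A (F.G.ctr Q) a t)" using F.comor_eq[OF QF W s] at(3) by simp
  also have "\<dots> = G.G.pull Q (germ A (G.G.ctr Q) a t)"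
    unfolding F.G.pull_germ[OF QF at(1,2)] G.G.pull_germ[OF QG at(1) at'] using at eq by simp
  also have "\<dots> = comor g W s Q" using G.comor_eq[OF QG W(1) _ s] W(2) p at(3) ctr by simp
  finally show "comor f W s Q = comor g W s Q" .
qed

section \<open>Gluing two affine schemes along a common localization\<close>

text \<open>\<open>C\<close> is the localization of \<open>A\<close> at the powers of
  \<open>e\<close>, realized as a ring that contains \<open>A\<close>. Having the inclusion be the
  identity function fits Laurent polynomials, which are coefficient functions in either
  ring.\<close>

locale loc_sub = A: spec_ring K A + C: spec_ring K C
  for K :: "('k, 'm) ring_scheme" and A :: "('k, 'a) module" and C :: "('k, 'a) module" +
  fixes e :: 'a
  assumes incl: "(\<lambda>f. f) \<in> alg_hom K A C"
    and e_A: "e \<in> carrier A" and e_unit: "e \<in> Units C"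
    and den: "c \<in> carrier C \<Longrightarrow> \<exists>k::nat. e [^]\<^bsub>C\<^esub> k \<otimes>\<^bsub>C\<^esub> c \<in> carrier A"
begin

abbreviation "trc Q \<equiv> {a \<in> carrier A. a \<in> Q}"

lemma A_C [simp]: "a \<in> carrier A \<Longrightarrow> a \<in> carrier C"
  using alg_hom_closed[OF incl] .

lemma A_mult: "a \<in> carrier A \<Longrightarrow> b \<in> carrier A \<Longrightarrow> a \<otimes>\<^bsub>A\<^esub> b = a \<otimes>\<^bsub>C\<^esub> b"
  using alg_hom_mult[OF incl] .

lemma A_one: "\<one>\<^bsub>A\<^esub> = \<one>\<^bsub>C\<^esub>"
  using alg_hom_one[OF incl] .

lemma A_add: "a \<in> carrier A \<Longrightarrow> b \<in> carrier A \<Longrightarrow> a \<oplus>\<^bsub>A\<^esub> b = a \<oplus>\<^bsub>C\<^esub> b"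
  using alg_hom_add[OF incl] .

lemma e_pow_A: "e [^]\<^bsub>C\<^esub> (k::nat) \<in> carrier A"
proof (induction k)
  case 0 show ?case using A.one_closed by (simp add: A_one)
next
  case (Suc k) then show ?case using A.m_closed[OF Suc e_A] by (simp add: A_mult e_A)
qed

lemma e_notin: assumes "primeideal Q C" shows "e \<notin> Q"
proof
  assume "e \<in> Q"
  interpret Q: primeideal Q C by fact
  have "inv\<^bsub>C\<^esub> e \<otimes>\<^bsub>C\<^esub> e \<in> Q" by (rule Q.I_l_closed) (use \<open>e \<in> Q\<close> e_unit in auto)
  then show False using e_unit Q.one_notin by simp
qed

lemma e_pow_notin: "primeideal Q C \<Longrightarrow> e [^]\<^bsub>C\<^esub> (k::nat) \<notin> Q"
  using e_notin[of Q] primeideal.pow_mem_iff[of Q C e k] primeideal.one_notin[of Q C] e_A by (cases "k = 0") auto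

lemma e_pow_mem_iff: "primeideal Q C \<Longrightarrow> c \<in> carrier C \<Longrightarrow> e [^]\<^bsub>C\<^esub> (k::nat) \<otimes>\<^bsub>C\<^esub> c \<in> Q \<longleftrightarrow> c \<in> Q"
  using e_pow_notin[of Q k] e_A by (simp add: primeideal.mult_mem_iff)

lemma cut_prime: "primeideal Q C \<Longrightarrow> primeideal (trc Q) A"
  by (rule alg_hom_vimage_prime[OF incl A.alg C.alg])

lemma prime_sub: "primeideal Q C \<Longrightarrow> Q \<subseteq> carrier C"
  by (rule additive_subgroup.a_subset[OF ideal.axioms(1)[OF primeideal.axioms(1)]])

lemma cut_inj: "inj_on trc (primes C)"
proof (rule inj_onI)
  have *: "Q \<subseteq> Q'" if Q: "primeideal Q C" "primeideal Q' C" and eq: "trc Q = trc Q'" for Q Q'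
  proof
    fix c assume c: "c \<in> Q"
    then have cC: "c \<in> carrier C" using prime_sub[OF Q(1)] by auto
    obtain k :: nat where "e [^]\<^bsub>C\<^esub> k \<otimes>\<^bsub>C\<^esub> c \<in> carrier A" using den[OF cC] by blast
    moreover have "e [^]\<^bsub>C\<^esub> k \<otimes>\<^bsub>C\<^esub> c \<in> Q" using c e_pow_mem_iff[OF Q(1) cC] by simp
    ultimately have "e [^]\<^bsub>C\<^esub> k \<otimes>\<^bsub>C\<^esub> c \<in> trc Q'" using eq by auto
    then show "c \<in> Q'" using e_pow_mem_iff[OF Q(2) cC] by simp
  qed
  fix Q Q' assume "Q \<in> primes C" "Q' \<in> primes C" "trc Q = trc Q'"
  then show "Q = Q'" using *[of Q Q'] *[of Q' Q] by auto
qed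

text \<open>The prime of \<open>C\<close> is the extension of \<open>P\<close>: all elements that
  some power of \<open>e\<close> multiplies into \<open>P\<close>.\<close>

lemma cut_surj:
  assumes P: "primeideal P A" and e: "e \<notin> P"
  shows "\<exists>Q. primeideal Q C \<and> trc Q = P"
proof -
  interpret P: primeideal P A by fact
  have PA: "x \<in> carrier A" if "x \<in> P" for x using that by (rule P.a_Hcarr)
  have pe: "e [^]\<^bsub>C\<^esub> (k::nat) \<notin> P" for k
  proof (induction k)
    case 0 show ?case using P.one_notin by (simp add: A_one)
  next
    case (Suc k)
    then show ?case using P.mult_mem_iff[OF e_pow_A[of k] e_A] e by (simp add: A_mult e_pow_A e_A)
  qed
  \<comment> \<open>Larger exponents work as well, so two elements can be given a common
    one.\<close>
  have shift: "e [^]\<^bsub>C\<^esub> (k + l) \<otimes>\<^bsub>C\<^esub> c \<in> P" if "e [^]\<^bsub>C\<^esub> (k::nat) \<otimes>\<^bsub>C\<^esub> c \<in> P" "c \<in> carrier C" for k l c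
  proof -
    have "e [^]\<^bsub>C\<^esub> l \<otimes>\<^bsub>A\<^esub> (e [^]\<^bsub>C\<^esub> k \<otimes>\<^bsub>C\<^esub> c) \<in> P" by (rule P.I_l_closed[OF that(1) e_pow_A])
    then show ?thesis using that PA[OF that(1)] e_A
      by (simp add: A_mult e_pow_A C.nat_pow_mult[symmetric] C.m_ac)
  qed
  let ?Q = "{c \<in> carrier C. \<exists>k::nat. e [^]\<^bsub>C\<^esub> k \<otimes>\<^bsub>C\<^esub> c \<in> P}"
  have "primeideal ?Q C"
  proof (rule primeidealI)
    show "cring C" ..
    show "ideal ?Q C"
    proof (rule idealI)
      show "ring C" ..
      show "subgroup ?Q (add_monoid C)"
      proof (rule C.add.subgroupI)
        have "\<zero>\<^bsub>C\<^esub> = \<zero>\<^bsub>A\<^esub>" using alg_hom_zero[OF incl A.alg C.alg] by simp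
        then have "\<zero>\<^bsub>C\<^esub> \<in> ?Q" using e_A P.zero_closed by (auto intro!: exI[of _ "0::nat"])
        then show "?Q \<noteq> {}" by auto
        show "\<ominus>\<^bsub>C\<^esub> c \<in> ?Q" if "c \<in> ?Q" for c
        proof -
          from that obtain k :: nat where k: "c \<in> carrier C" "e [^]\<^bsub>C\<^esub> k \<otimes>\<^bsub>C\<^esub> c \<in> P" by auto
          interpret h: ring_hom_cring A C "\<lambda>f. f" by (rule alg_hom_ring_hom_cring[OF incl A.alg C.alg])
          have "\<ominus>\<^bsub>A\<^esub> (e [^]\<^bsub>C\<^esub> k \<otimes>\<^bsub>C\<^esub> c) \<in> P" using k(2) by (rule P.a_inv_closed)
          then have "e [^]\<^bsub>C\<^esub> k \<otimes>\<^bsub>C\<^esub> (\<ominus>\<^bsub>C\<^esub> c) \<in> P"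
            using k(1) PA[OF k(2)] e_A by (simp add: h.hom_a_inv C.r_minus)
          then show ?thesis using k by auto
        qed
        show "c \<oplus>\<^bsub>C\<^esub> d \<in> ?Q" if "c \<in> ?Q" "d \<in> ?Q" for c d
        proof -
          from that obtain k l :: nat where k: "c \<in> carrier C" "e [^]\<^bsub>C\<^esub> k \<otimes>\<^bsub>C\<^esub> c \<in> P"
            and l: "d \<in> carrier C" "e [^]\<^bsub>C\<^esub> l \<otimes>\<^bsub>C\<^esub> d \<in> P" by auto
          from shift[OF k(2,1), of l] shift[OF l(2,1), of k]
          have m: "e [^]\<^bsub>C\<^esub> (k + l) \<otimes>\<^bsub>C\<^esub> c \<in> P" "e [^]\<^bsub>C\<^esub> (k + l) \<otimes>\<^bsub>C\<^esub> d \<in> P" by (simp_all add: add.commute)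
          from P.a_closed[OF m] have "e [^]\<^bsub>C\<^esub> (k + l) \<otimes>\<^bsub>C\<^esub> (c \<oplus>\<^bsub>C\<^esub> d) \<in> P"
            using PA[OF m(1)] PA[OF m(2)] k(1) l(1) e_A by (simp add: A_add C.r_distr)
          then show ?thesis using k(1) l(1) by auto
        qed
      qed auto
      show 1: "x \<otimes>\<^bsub>C\<^esub> c \<in> ?Q" if "c \<in> ?Q" and x: "x \<in> carrier C" for c x
      proof -
        from that obtain k :: nat where k: "c \<in> carrier C" "e [^]\<^bsub>C\<^esub> k \<otimes>\<^bsub>C\<^esub> c \<in> P" by auto
        from den[OF x] obtain l :: nat where l: "e [^]\<^bsub>C\<^esub> l \<otimes>\<^bsub>C\<^esub> x \<in> carrier A" by blast
        have "(e [^]\<^bsub>C\<^esub> l \<otimes>\<^bsub>C\<^esub> x) \<otimes>\<^bsub>A\<^esub> (e [^]\<^bsub>C\<^esub> k \<otimes>\<^bsub>C\<^esub> c) \<in> P" by (rule P.I_l_closed[OF k(2) l])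
        then have "e [^]\<^bsub>C\<^esub> (k + l) \<otimes>\<^bsub>C\<^esub> (x \<otimes>\<^bsub>C\<^esub> c) \<in> P"
          using PA[OF k(2)] l k(1) x e_A by (simp add: A_mult C.nat_pow_mult[symmetric] C.m_ac)
        then show ?thesis using k(1) x by auto
      qed
      show "c \<otimes>\<^bsub>C\<^esub> x \<in> ?Q" if "c \<in> ?Q" "x \<in> carrier C" for c x
        using 1[OF that] that by (simp add: C.m_comm)
    qed
    show "carrier C \<noteq> ?Q"
    proof
      assume "carrier C = ?Q"
      then have "\<one>\<^bsub>C\<^esub> \<in> ?Q" using C.one_closed by simp
      then show False using pe e_A by auto
    qed
    show "a \<in> ?Q \<or> b \<in> ?Q" if ab: "a \<in> carrier C" "b \<in> carrier C" "a \<otimes>\<^bsub>C\<^esub> b \<in> ?Q" for a b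
    proof -
      from den[OF ab(1)] obtain k :: nat where k: "e [^]\<^bsub>C\<^esub> k \<otimes>\<^bsub>C\<^esub> a \<in> carrier A" by blast
      from den[OF ab(2)] obtain l :: nat where l: "e [^]\<^bsub>C\<^esub> l \<otimes>\<^bsub>C\<^esub> b \<in> carrier A" by blast
      from ab obtain m :: nat where m: "e [^]\<^bsub>C\<^esub> m \<otimes>\<^bsub>C\<^esub> (a \<otimes>\<^bsub>C\<^esub> b) \<in> P" by auto
      have "e [^]\<^bsub>C\<^esub> m \<otimes>\<^bsub>A\<^esub> ((e [^]\<^bsub>C\<^esub> k \<otimes>\<^bsub>C\<^esub> a) \<otimes>\<^bsub>A\<^esub> (e [^]\<^bsub>C\<^esub> l \<otimes>\<^bsub>C\<^esub> b)) = e [^]\<^bsub>C\<^esub> (m + (k + l)) \<otimes>\<^bsub>C\<^esub> (a \<otimes>\<^bsub>C\<^esub> b)"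
        using A.m_closed[OF k l] k l ab(1,2) e_A by (simp add: A_mult e_pow_A C.nat_pow_mult[symmetric] C.m_ac)
      then have "e [^]\<^bsub>C\<^esub> m \<otimes>\<^bsub>A\<^esub> ((e [^]\<^bsub>C\<^esub> k \<otimes>\<^bsub>C\<^esub> a) \<otimes>\<^bsub>A\<^esub> (e [^]\<^bsub>C\<^esub> l \<otimes>\<^bsub>C\<^esub> b)) \<in> P"
        using shift[OF m, of "k + l"] ab by simp
      then have "e [^]\<^bsub>C\<^esub> k \<otimes>\<^bsub>C\<^esub> a \<in> P \<or> e [^]\<^bsub>C\<^esub> l \<otimes>\<^bsub>C\<^esub> b \<in> P"
        using P.mult_mem_iff e_pow_A k l A.m_closed[OF k l] pe by metis
      then show ?thesis using ab by auto
    qed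
  qed
  moreover have "trc ?Q = P"
  proof
    show "P \<subseteq> trc ?Q" using PA by (auto intro!: exI[of _ "0::nat"])
    have "a \<in> P" if "a \<in> carrier A" "e [^]\<^bsub>C\<^esub> (k::nat) \<otimes>\<^bsub>C\<^esub> a \<in> P" for a k
      using that P.mult_mem_iff[OF e_pow_A[of k] that(1)] pe[of k] by (simp add: A_mult e_pow_A)
    then show "trc ?Q \<subseteq> P" by auto
  qed
  ultimately show ?thesis by blast
qed

lemma cut_image_iff: "primeideal P A \<Longrightarrow> P \<in> trc ` primes C \<longleftrightarrow> e \<notin> P"
  using cut_surj[of P] e_notin by auto

text \<open>A power of \<open>e\<close> moves the element \<open>c\<close> of \<open>C\<close> into
  \<open>A\<close>. The additional factor \<open>e\<close> forces the primes of the resulting basic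
  open set to come from \<open>C\<close>.\<close>

lemma cut_open:
  assumes T: "spec_open C T" shows "spec_open A (trc ` T)"
  unfolding A.open_iff
proof (intro conjI subsetI ballI)
  show "P \<in> primes A" if "P \<in> trc ` T" for P using that C.open_prime[OF T] cut_prime by auto
  fix P assume "P \<in> trc ` T"
  then obtain Q where Q: "Q \<in> T" "P = trc Q" by auto
  then have Qp: "primeideal Q C" using C.open_prime[OF T] by auto
  obtain c where c: "c \<in> carrier C" "c \<notin> Q" "basic_open C c \<subseteq> T" using T Q(1) unfolding C.open_iff by blast
  obtain k :: nat where k: "e [^]\<^bsub>C\<^esub> k \<otimes>\<^bsub>C\<^esub> c \<in> carrier A" using den[OF c(1)] by blast
  let ?a = "e \<otimes>\<^bsub>A\<^esub> (e [^]\<^bsub>C\<^esub> k \<otimes>\<^bsub>C\<^esub> c)"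
  have "?a \<in> carrier A" using k e_A by simp
  moreover have "?a \<notin> P" unfolding Q(2) primeideal.mult_mem_iff[OF cut_prime[OF Qp] e_A k]
    by (simp add: e_notin[OF Qp] e_pow_mem_iff[OF Qp c(1)] c(2))
  moreover have "basic_open A ?a \<subseteq> trc ` T"
  proof
    fix P' assume "P' \<in> basic_open A ?a"
    then have P': "primeideal P' A" "e \<notin> P'" "e [^]\<^bsub>C\<^esub> k \<otimes>\<^bsub>C\<^esub> c \<notin> P'"
      by (auto simp: basic_open_def primeideal.mult_mem_iff e_A k)
    then obtain Q' where Q': "primeideal Q' C" "trc Q' = P'" using cut_surj by blast
    then have "c \<notin> Q'" using P'(3) e_pow_mem_iff[OF Q'(1) c(1)] k by auto
    then have "Q' \<in> T" using Q'(1) c(3) by (auto simp: basic_open_def)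
    then show "P' \<in> trc ` T" using Q' by auto
  qed
  ultimately show "\<exists>a\<in>carrier A. a \<notin> P \<and> basic_open A a \<subseteq> trc ` T" by blast
qed

abbreviation "smap Q \<equiv> stalk_map C (\<lambda>f. f) Q"

lemma smap_germ:
  "primeideal Q C \<Longrightarrow> a \<in> carrier A \<Longrightarrow> s \<in> carrier A - trc Q \<Longrightarrow> smap Q (germ A (trc Q) a s) = germ C Q a s"
  using stalk_map_germ[OF A.alg C.alg incl] by auto

text \<open>Passing from \<open>A\<close> to \<open>C\<close> does not change stalks: powers of
  \<open>e\<close> avoid every prime of \<open>C\<close>, so they can be used to move witnesses,
  numerators and denominators into \<open>A\<close>.\<close>

lemma smap_bij:
  assumes Q: "primeideal Q C"
  shows "bij_betw (smap Q) (carrier (stalk_at A (trc Q))) (carrier (stalk_at C Q))"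
proof -
  note P = cut_prime[OF Q]
  interpret FA: frac_ring K A "carrier A - trc Q" by (rule A.frac_ring[OF P])
  interpret FC: frac_ring K C "carrier C - Q" by (rule C.frac_ring[OF Q])
  show ?thesis
  proof (rule bij_betw_imageI)
    show "inj_on (smap Q) (carrier (stalk_at A (trc Q)))"
    proof (rule inj_onI)
      fix X Y assume "X \<in> carrier (stalk_at A (trc Q))" "Y \<in> carrier (stalk_at A (trc Q))" and eq: "smap Q X = smap Q Y"
      from A.st_cases[OF P this(1)] obtain a s where X: "a \<in> carrier A" "s \<in> carrier A - trc Q" "X = germ A (trc Q) a s" .
      from A.st_cases[OF P \<open>Y \<in> _\<close>] obtain b t where Y: "b \<in> carrier A" "t \<in> carrier A - trc Q" "Y = germ A (trc Q) b t" .
      have st: "s \<in> carrier C - Q" "t \<in> carrier C - Q" using X Y by auto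
      from eq have "FC.fr a s = FC.fr b t" using X Y by (simp add: smap_germ[OF Q])
      then obtain w where w: "w \<in> carrier C" "w \<notin> Q" "w \<otimes>\<^bsub>C\<^esub> (t \<otimes>\<^bsub>C\<^esub> a) = w \<otimes>\<^bsub>C\<^esub> (s \<otimes>\<^bsub>C\<^esub> b)"
        using X Y st by (subst (asm) FC.frac_eq_iff) auto
      obtain k :: nat where k: "e [^]\<^bsub>C\<^esub> k \<otimes>\<^bsub>C\<^esub> w \<in> carrier A" using den[OF w(1)] by blast
      show "X = Y" unfolding X(3) Y(3)
      proof (rule FA.frac_eqI)
        show "e [^]\<^bsub>C\<^esub> k \<otimes>\<^bsub>C\<^esub> w \<in> carrier A - trc Q" using k w e_pow_mem_iff[OF Q w(1)] by auto
        have "(e [^]\<^bsub>C\<^esub> k \<otimes>\<^bsub>C\<^esub> w) \<otimes>\<^bsub>A\<^esub> (x \<otimes>\<^bsub>A\<^esub> y) = e [^]\<^bsub>C\<^esub> k \<otimes>\<^bsub>C\<^esub> (w \<otimes>\<^bsub>C\<^esub> (x \<otimes>\<^bsub>C\<^esub> y))"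
          if "x \<in> carrier A" "y \<in> carrier A" for x y
          using that k w e_A A.m_closed[OF that] by (simp add: A_mult C.m_assoc)
        then show "(e [^]\<^bsub>C\<^esub> k \<otimes>\<^bsub>C\<^esub> w) \<otimes>\<^bsub>A\<^esub> (t \<otimes>\<^bsub>A\<^esub> a) = (e [^]\<^bsub>C\<^esub> k \<otimes>\<^bsub>C\<^esub> w) \<otimes>\<^bsub>A\<^esub> (s \<otimes>\<^bsub>A\<^esub> b)"
          using X Y w(3) by simp
      qed (use X Y in auto)
    qed
    show "smap Q ` carrier (stalk_at A (trc Q)) = carrier (stalk_at C Q)"
    proof
      show "smap Q ` carrier (stalk_at A (trc Q)) \<subseteq> carrier (stalk_at C Q)"
        using alg_hom_closed[OF stalk_map_hom[OF A.alg C.alg incl Q]] by auto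
      show "carrier (stalk_at C Q) \<subseteq> smap Q ` carrier (stalk_at A (trc Q))"
      proof
        fix Y assume "Y \<in> carrier (stalk_at C Q)"
        then obtain c t where c: "c \<in> carrier C" "t \<in> carrier C - Q" "Y = germ C Q c t" by (rule C.st_cases[OF Q])
        obtain k :: nat where k: "e [^]\<^bsub>C\<^esub> k \<otimes>\<^bsub>C\<^esub> c \<in> carrier A" using den[OF c(1)] by blast
        obtain l :: nat where l: "e [^]\<^bsub>C\<^esub> l \<otimes>\<^bsub>C\<^esub> t \<in> carrier A" using den[of t] c(2) by blast
        \<comment> \<open>Numerator and denominator have to be multiplied by the same power, hence
          the sum of the two exponents.\<close>
        have kl: "e [^]\<^bsub>C\<^esub> (k + l) \<otimes>\<^bsub>C\<^esub> c \<in> carrier A" "e [^]\<^bsub>C\<^esub> (k + l) \<otimes>\<^bsub>C\<^esub> t \<in> carrier A"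
        proof -
          show "e [^]\<^bsub>C\<^esub> (k + l) \<otimes>\<^bsub>C\<^esub> c \<in> carrier A"
            using A.m_closed[OF e_pow_A[of l] k] c e_A k by (simp add: A_mult e_pow_A C.nat_pow_mult[symmetric] C.m_ac)
          show "e [^]\<^bsub>C\<^esub> (k + l) \<otimes>\<^bsub>C\<^esub> t \<in> carrier A"
            using A.m_closed[OF e_pow_A[of k] l] c e_A l by (simp add: A_mult e_pow_A C.nat_pow_mult[symmetric] C.m_ac)
        qed
        have t: "e [^]\<^bsub>C\<^esub> (k + l) \<otimes>\<^bsub>C\<^esub> t \<in> carrier A - trc Q"
          using kl(2) c(2) e_pow_mem_iff[OF Q] by auto
        have "smap Q (germ A (trc Q) (e [^]\<^bsub>C\<^esub> (k + l) \<otimes>\<^bsub>C\<^esub> c) (e [^]\<^bsub>C\<^esub> (k + l) \<otimes>\<^bsub>C\<^esub> t)) = Y"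
          unfolding smap_germ[OF Q kl(1) t] c(3)
          by (rule FC.frac_cancel) (use c e_pow_notin[OF Q] e_A in auto)
        moreover have "germ A (trc Q) (e [^]\<^bsub>C\<^esub> (k + l) \<otimes>\<^bsub>C\<^esub> c) (e [^]\<^bsub>C\<^esub> (k + l) \<otimes>\<^bsub>C\<^esub> t) \<in> carrier (stalk_at A (trc Q))"
          by (rule A.germ_carrier[OF P kl(1) t])
        ultimately show "Y \<in> smap Q ` carrier (stalk_at A (trc Q))" by blast
      qed
    qed
  qed
qed

text \<open>The inverse stalk maps carry a section over \<open>T\<close> to the image of
  \<open>T\<close>. The result is regular, since a local fraction over \<open>C\<close> becomes one
  over \<open>A\<close> when both parts are multiplied by a power of \<open>e\<close>. This supplies
  the missing component when a section of one chart is extended to the glued space.\<close>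

lemma sec_transfer:
  assumes T: "spec_open C T" and r: "r \<in> sec C T"
  shows "\<exists>s \<in> sec A (trc ` T). \<forall>Q\<in>T. smap Q (s (trc Q)) = r Q"
proof -
  have Tp: "primeideal Q C" if "Q \<in> T" for Q using C.open_prime[OF T that] .
  have TT: "T \<subseteq> primes C" using Tp by auto
  define s where "s = (\<lambda>P\<in>trc ` T. the_inv_into (carrier (stalk_at A P)) (smap (the_inv_into T trc P)) (r (the_inv_into T trc P)))"
  have inj: "inj_on trc T" by (rule inj_on_subset[OF cut_inj TT])
  have s: "s (trc Q) = the_inv_into (carrier (stalk_at A (trc Q))) (smap Q) (r Q)" if "Q \<in> T" for Q
    using that by (auto simp: s_def the_inv_into_f_f[OF inj])
  have s1: "smap Q (s (trc Q)) = r Q" if "Q \<in> T" for Q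
    unfolding s[OF that] using smap_bij[OF Tp[OF that]] sec_stalk[OF r that]
    by (rule f_the_inv_into_f_bij_betw)
  have s2: "s (trc Q) = X" if "Q \<in> T" "X \<in> carrier (stalk_at A (trc Q))" "smap Q X = r Q" for Q X
    unfolding s[OF that(1)] that(3)[symmetric]
    using smap_bij[OF Tp[OF that(1)]] that(2) by (simp add: bij_betw_def the_inv_into_f_f)
  have "s \<in> sec A (trc ` T)"
  proof (rule A.sec_locI[OF cut_open[OF T]])
    show "s \<in> extensional (trc ` T)" by (simp add: s_def)
    fix P assume "P \<in> trc ` T"
    then obtain Q where Q: "Q \<in> T" "P = trc Q" by auto
    from r Q(1) obtain c g W where W: "c \<in> carrier C" "g \<in> carrier C" "spec_open C W" "Q \<in> W" "W \<subseteq> T"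
      "\<And>Q. Q \<in> W \<Longrightarrow> g \<notin> Q" "\<And>Q. Q \<in> W \<Longrightarrow> r Q = germ C Q c g"
      by (rule sec_local) auto
    obtain k :: nat where k: "e [^]\<^bsub>C\<^esub> k \<otimes>\<^bsub>C\<^esub> c \<in> carrier A" using den[OF W(1)] by blast
    obtain l :: nat where l: "e [^]\<^bsub>C\<^esub> l \<otimes>\<^bsub>C\<^esub> g \<in> carrier A" using den[OF W(2)] by blast
    let ?a = "e [^]\<^bsub>C\<^esub> (k + l) \<otimes>\<^bsub>C\<^esub> c" and ?g = "e [^]\<^bsub>C\<^esub> (k + l) \<otimes>\<^bsub>C\<^esub> g"
    have a: "?a \<in> carrier A"
      using A.m_closed[OF e_pow_A[of l] k] W e_A k by (simp add: A_mult e_pow_A C.nat_pow_mult[symmetric] C.m_ac)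
    have g: "?g \<in> carrier A"
      using A.m_closed[OF e_pow_A[of k] l] W e_A l by (simp add: A_mult e_pow_A C.nat_pow_mult[symmetric] C.m_ac)
    have gn: "?g \<in> carrier A - trc Q'" if "Q' \<in> W" for Q'
      using g that W(5) W(6)[OF that] Tp e_pow_mem_iff[of Q' g] W(2) by auto
    have sW: "s (trc Q') = germ A (trc Q') ?a ?g" if "Q' \<in> W" for Q'
    proof (rule s2)
      have Q': "primeideal Q' C" using that W(5) Tp by auto
      show "Q' \<in> T" using that W(5) by auto
      show "germ A (trc Q') ?a ?g \<in> carrier (stalk_at A (trc Q'))" by (rule A.germ_carrier[OF cut_prime[OF Q'] a gn[OF that]])
      show "smap Q' (germ A (trc Q') ?a ?g) = r Q'"
        unfolding smap_germ[OF Q' a gn[OF that]] W(7)[OF that]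
        by (rule frac_ring.frac_cancel[OF C.frac_ring[OF Q']]) (use W e_pow_notin[OF Q'] e_A that in auto)
    qed
    have t: "restrict s (trc ` W) \<in> sec A (trc ` W)"
      by (rule A.sec_fracI[OF cut_open[OF W(3)] _ a g]) (use gn sW in auto)
    show "\<exists>V t. spec_open A V \<and> P \<in> V \<and> V \<subseteq> trc ` T \<and> t \<in> sec A V \<and> (\<forall>Q\<in>V. s Q = t Q)"
      using cut_open[OF W(3)] W(4,5) Q t by (intro exI[of _ "trc ` W"] exI[of _ "restrict s (trc ` W)"]) auto
  qed
  with s1 show ?thesis by blast
qed

lemma smap_inj:
  "primeideal Q C \<Longrightarrow> X \<in> carrier (stalk_at A (trc Q)) \<Longrightarrow> Y \<in> carrier (stalk_at A (trc Q)) \<Longrightarrow> smap Q X = smap Q Y \<Longrightarrow> X = Y"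
  using smap_bij[of Q] by (auto simp: bij_betw_def dest: inj_onD)

end

section \<open>The space glued from two affine schemes along a common localization\<close>

locale glue_aff = SA: loc_sub K A C e + SB: loc_sub K B C d
  for K :: "('k, 'm) ring_scheme" and A :: "('k, 'a) module" and B :: "('k, 'a) module" and C :: "('k, 'a) module"
    and e d :: 'a
begin

abbreviation "i \<equiv> Spec_map A C (\<lambda>f. f)"
abbreviation "j \<equiv> Spec_map B C (\<lambda>f. f)"
abbreviation "X \<equiv> glue (Spec A) (Spec B) (Spec C) i j"
abbreviation "rel \<equiv> glue_rel (Spec C) i j"
abbreviation "cA \<equiv> SA.trc"
abbreviation "cB \<equiv> SB.trc"
abbreviation "inl P \<equiv> rel `` {Inl P}"
abbreviation "inr P \<equiv> rel `` {Inr P}"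
abbreviation "pA W \<equiv> {P \<in> primes A. inl P \<in> W}"
abbreviation "pB W \<equiv> {P \<in> primes B. inr P \<in> W}"

text \<open>Both immersions are injective on points, so a chain of identifications that leaves a
  chart and returns ends where it began. The reflexive transitive closure therefore adds only the
  identity.\<close>

lemma rel_eq: "rel = Id \<union> {(Inl (cA Q), Inr (cB Q)) | Q. primeideal Q C} \<union> {(Inr (cB Q), Inl (cA Q)) | Q. primeideal Q C}"
  (is "_ = ?R")
proof -
  let ?E = "{(Inl (cA Q), Inr (cB Q)) | Q. primeideal Q C} :: ('a set + 'a set) rel"
  have inv: "?E\<inverse> = {(Inr (cB Q), Inl (cA Q)) | Q. primeideal Q C}" by auto
  have E: "rel = (?E \<union> ?E\<inverse>)\<^sup>*"
  proof -
    have "{(Inl (pt i z), Inr (pt j z)) | z. z \<in> topspace (top_of (Spec C))} = ?E"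
      by (rule Collect_cong, rule ex_cong1) (auto simp: SA.C.topspace Spec_map_pt[OF SA.C.cring_A])
    then show ?thesis by (simp only: glue_rel_def Let_def)
  qed
  have iA: "cA Q = cA Q' \<Longrightarrow> Q = Q'" if "primeideal Q C" "primeideal Q' C" for Q Q'
    using inj_onD[OF SA.cut_inj, of Q Q'] that by simp
  have iB: "cB Q = cB Q' \<Longrightarrow> Q = Q'" if "primeideal Q C" "primeideal Q' C" for Q Q'
    using inj_onD[OF SB.cut_inj, of Q Q'] that by simp
  have "(x, y) \<in> ?R" if "(x, y) \<in> (?E \<union> ?E\<inverse>)\<^sup>*" for x y
    using that
  proof (induction rule: rtrancl_induct)
    case (step y z)
    from step.hyps(2) consider Q where "y = Inl (cA Q)" "z = Inr (cB Q)" "primeideal Q C"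
      | Q where "y = Inr (cB Q)" "z = Inl (cA Q)" "primeideal Q C" by blast
    then show ?case
    proof cases
      case 1
      from step.IH 1 consider "x = y" | Q' where "x = Inr (cB Q')" "y = Inl (cA Q')" "primeideal Q' C" by auto
      then show ?thesis
      proof cases
        case 2 then have "cA Q = cA Q'" using 1 by simp
        then have "Q = Q'" using iA 1 2 by blast
        then show ?thesis using 1 2 by simp
      qed (use 1 in auto)
    next
      case 2
      from step.IH 2 consider "x = y" | Q' where "x = Inl (cA Q')" "y = Inr (cB Q')" "primeideal Q' C" by auto
      then show ?thesis
      proof cases
        case 2: 2 then have "cB Q = cB Q'" using \<open>y = Inr (cB Q)\<close> by simp
        then have "Q = Q'" using iB \<open>primeideal Q C\<close> 2 by blast
        then show ?thesis using \<open>z = Inl (cA Q)\<close> 2 by simp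
      qed (use 2 in auto)
    qed
  qed simp
  then have "(?E \<union> ?E\<inverse>)\<^sup>* \<subseteq> ?R" by (rule subrelI)
  moreover have "?R \<subseteq> (?E \<union> ?E\<inverse>)\<^sup>*" unfolding inv[symmetric] by auto
  ultimately show ?thesis unfolding E by (rule subset_antisym)
qed

lemma rel_class: "(x, y) \<in> rel \<Longrightarrow> rel `` {x} = rel `` {y}"
proof -
  have t: "trans rel" and s: "sym rel"
    by (auto simp: glue_rel_def Let_def intro!: trans_rtrancl sym_rtrancl sym_Un_converse)
  show "(x, y) \<in> rel \<Longrightarrow> rel `` {x} = rel `` {y}"
    using t s by (auto dest: transD symD)
qed

lemma inl_self: "Inl P \<in> inl P" and inr_self: "Inr P \<in> inr P"
  by (auto simp: rel_eq)

lemma inl_eq: "inl P = inl P' \<longleftrightarrow> P = P'"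
  using inl_self[of P'] by (auto simp: rel_eq)

lemma inr_eq: "inr P = inr P' \<longleftrightarrow> P = P'"
  using inr_self[of P'] by (auto simp: rel_eq)

lemma inl_inr: "inr P' = inl P \<longleftrightarrow> (\<exists>Q. primeideal Q C \<and> P' = cB Q \<and> P = cA Q)"
proof
  assume "inr P' = inl P"
  then have "(Inl P, Inr P') \<in> rel" using inr_self[of P'] by auto
  then show "\<exists>Q. primeideal Q C \<and> P' = cB Q \<and> P = cA Q" by (auto simp: rel_eq)
next
  assume "\<exists>Q. primeideal Q C \<and> P' = cB Q \<and> P = cA Q"
  then have "(Inr P', Inl P) \<in> rel" by (auto simp: rel_eq)
  then show "inr P' = inl P" by (rule rel_class)
qed

lemma inr_inl: "inl P' = inr P \<longleftrightarrow> (\<exists>Q. primeideal Q C \<and> P' = cA Q \<and> P = cB Q)"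
  using inl_inr[of P P'] by auto

lemma inl_cA: "primeideal Q C \<Longrightarrow> inl (cA Q) = inr (cB Q)"
  by (auto simp only: inr_inl)

lemma same: "primeideal Q C \<Longrightarrow> cA Q \<in> pA W \<longleftrightarrow> cB Q \<in> pB W"
  using SA.cut_prime[of Q] SB.cut_prime[of Q] inl_cA[of Q] by (simp only: mem_Collect_eq) 

lemma parts: "left_part (Spec A) (Spec C) i j W = pA W" "right_part (Spec B) (Spec C) i j W = pB W"
  by (auto simp: left_part_def right_part_def SA.A.topspace SB.A.topspace)

lemma pts: "glue_pts (Spec A) (Spec B) (Spec C) i j = inl ` primes A \<union> inr ` primes B"
  by (auto simp: glue_pts_def SA.A.topspace SB.A.topspace)

lemma open_X: "openin (top_of X) W \<longleftrightarrow> W \<subseteq> inl ` primes A \<union> inr ` primes B \<and> spec_open A (pA W) \<and> spec_open B (pB W)"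
proof -
  have "openin (top_of X) W \<longleftrightarrow> glue_open (Spec A) (Spec B) (Spec C) i j W"
    by (simp add: glue_def topology_inverse'[OF istopology_glue_open])
  then show ?thesis by (simp add: glue_open_def parts pts)
qed

lemma topspace_X: "topspace (top_of X) = inl ` primes A \<union> inr ` primes B"
proof -
  have "pA (inl ` primes A \<union> inr ` primes B) = primes A" "pB (inl ` primes A \<union> inr ` primes B) = primes B" by auto
  then have "openin (top_of X) (inl ` primes A \<union> inr ` primes B)"
    by (simp only: open_X spec_open_UNIV[OF SA.A.cring_A] spec_open_UNIV[OF SB.A.cring_A] subset_refl simp_thms)
  then have "inl ` primes A \<union> inr ` primes B \<subseteq> topspace (top_of X)" by (rule openin_subset)
  moreover have "topspace (top_of X) \<subseteq> inl ` primes A \<union> inr ` primes B"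
    using openin_topspace[of "top_of X"] unfolding open_X by blast
  ultimately show ?thesis by blast
qed

lemma X_restr: "restr X W W' S = (restrict (fst S) (pA W'), restrict (snd S) (pB W'))"
  by (simp add: glue_def parts restr_Spec split: prod.split)

lemma X_ops:
  "fst (S \<otimes>\<^bsub>sections X W\<^esub> S') = fst S \<otimes>\<^bsub>sections (Spec A) (pA W)\<^esub> fst S'"
  "snd (S \<otimes>\<^bsub>sections X W\<^esub> S') = snd S \<otimes>\<^bsub>sections (Spec B) (pB W)\<^esub> snd S'"
  "fst (S \<oplus>\<^bsub>sections X W\<^esub> S') = fst S \<oplus>\<^bsub>sections (Spec A) (pA W)\<^esub> fst S'"
  "snd (S \<oplus>\<^bsub>sections X W\<^esub> S') = snd S \<oplus>\<^bsub>sections (Spec B) (pB W)\<^esub> snd S'"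
  "fst (c \<odot>\<^bsub>sections X W\<^esub> S) = c \<odot>\<^bsub>sections (Spec A) (pA W)\<^esub> fst S"
  "snd (c \<odot>\<^bsub>sections X W\<^esub> S) = c \<odot>\<^bsub>sections (Spec B) (pB W)\<^esub> snd S"
  "fst \<one>\<^bsub>sections X W\<^esub> = \<one>\<^bsub>sections (Spec A) (pA W)\<^esub>"
  "snd \<one>\<^bsub>sections X W\<^esub> = \<one>\<^bsub>sections (Spec B) (pB W)\<^esub>"
  by (simp_all add: glue_def Let_def parts split: prod.split)

lemma i_rmors: "i \<in> rmors K (Spec C) (Spec A)" and j_rmors: "j \<in> rmors K (Spec C) (Spec B)"
  by (rule Spec_map_rmors[OF SA.A.alg SA.C.alg SA.incl], rule Spec_map_rmors[OF SB.A.alg SA.C.alg SB.incl])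

lemma i_preim: "preim (Spec C) i V = {Q \<in> primes C. cA Q \<in> V}" and j_preim: "preim (Spec C) j V = {Q \<in> primes C. cB Q \<in> V}"
  by (auto simp: preim_def SA.C.topspace Spec_map_pt[OF SA.C.cring_A])

lemma i_open: "spec_open A V \<Longrightarrow> spec_open C {Q \<in> primes C. cA Q \<in> V}"
  and j_open: "spec_open B V \<Longrightarrow> spec_open C {Q \<in> primes C. cB Q \<in> V}"
  using preim_open[OF i_rmors] preim_open[OF j_rmors] by (simp_all add: i_preim j_preim)

lemma i_sec: "spec_open A V \<Longrightarrow> s \<in> sec A V \<Longrightarrow> comor i V s \<in> sec C {Q \<in> primes C. cA Q \<in> V}"
  and j_sec: "spec_open B V \<Longrightarrow> s' \<in> sec B V \<Longrightarrow> comor j V s' \<in> sec C {Q \<in> primes C. cB Q \<in> V}"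
  using alg_hom_closed[OF rmorsD(4)[OF i_rmors]] alg_hom_closed[OF rmorsD(4)[OF j_rmors]] by (simp_all add: i_preim j_preim)

lemma i_comor: "spec_open A V \<Longrightarrow> s \<in> sec A V \<Longrightarrow> primeideal Q C \<Longrightarrow> cA Q \<in> V \<Longrightarrow> comor i V s Q = SA.smap Q (s (cA Q))"
  and j_comor: "spec_open B V \<Longrightarrow> s' \<in> sec B V \<Longrightarrow> primeideal Q C \<Longrightarrow> cB Q \<in> V \<Longrightarrow> comor j V s' Q = SB.smap Q (s' (cB Q))"
  by (rule Spec_map_comor[OF SA.C.cring_A]; assumption)+

text \<open>The agreement condition compares two sections over \<open>Spec C\<close>, that is, two
  functions on primes. It can be tested in the stalks of \<open>C\<close>, which is the form used
  below.\<close>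

lemma secX_iff:
  assumes W: "openin (top_of X) W"
  shows "S \<in> carrier (sections X W) \<longleftrightarrow> fst S \<in> sec A (pA W) \<and> snd S \<in> sec B (pB W) \<and>
     (\<forall>Q. primeideal Q C \<longrightarrow> cA Q \<in> pA W \<longrightarrow> SA.smap Q (fst S (cA Q)) = SB.smap Q (snd S (cB Q)))"
proof -
  have oA: "spec_open A (pA W)" and oB: "spec_open B (pB W)" using W by (simp_all add: open_X)
  have T: "{Q \<in> primes C. cA Q \<in> pA W} = {Q \<in> primes C. cB Q \<in> pB W}" using same by blast
  have "comor i (pA W) s = comor j (pB W) t \<longleftrightarrow>
     (\<forall>Q. primeideal Q C \<longrightarrow> cA Q \<in> pA W \<longrightarrow> SA.smap Q (s (cA Q)) = SB.smap Q (t (cB Q)))"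
    if s: "s \<in> sec A (pA W)" and t: "t \<in> sec B (pB W)" for s t
  proof
    assume eq: "comor i (pA W) s = comor j (pB W) t"
    show "\<forall>Q. primeideal Q C \<longrightarrow> cA Q \<in> pA W \<longrightarrow> SA.smap Q (s (cA Q)) = SB.smap Q (t (cB Q))"
    proof (intro allI impI)
      fix Q assume Q: "primeideal Q C" "cA Q \<in> pA W"
      show "SA.smap Q (s (cA Q)) = SB.smap Q (t (cB Q))"
        using fun_cong[OF eq, of Q] i_comor[OF oA s Q] j_comor[OF oB t Q(1)] Q same[OF Q(1)] by simp
    qed
  next
    assume eq: "\<forall>Q. primeideal Q C \<longrightarrow> cA Q \<in> pA W \<longrightarrow> SA.smap Q (s (cA Q)) = SB.smap Q (t (cB Q))"
    show "comor i (pA W) s = comor j (pB W) t"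
    proof (rule extensionalityI[OF sec_ext[OF i_sec[OF oA s]]])
      show "comor j (pB W) t \<in> extensional {Q \<in> primes C. cA Q \<in> pA W}"
        unfolding T by (rule sec_ext[OF j_sec[OF oB t]])
      fix Q assume "Q \<in> {Q \<in> primes C. cA Q \<in> pA W}"
      then have Q: "primeideal Q C" "cA Q \<in> pA W" by blast+
      show "comor i (pA W) s Q = comor j (pB W) t Q"
        unfolding i_comor[OF oA s Q] j_comor[OF oB t Q(1) Q(2)[unfolded same[OF Q(1)]]]
        by (rule eq[rule_format, OF Q])
    qed
  qed
  moreover have "S \<in> carrier (sections X W) \<longleftrightarrow> fst S \<in> sec A (pA W) \<and> snd S \<in> sec B (pB W) \<and> comor i (pA W) (fst S) = comor j (pB W) (snd S)"
    by (cases S) (simp add: glue_def Let_def parts)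
  ultimately show ?thesis by (simp only: cong: conj_cong)
qed

lemma secX_fst: "openin (top_of X) W \<Longrightarrow> S \<in> carrier (sections X W) \<Longrightarrow> fst S \<in> sec A (pA W)"
  and secX_snd: "openin (top_of X) W \<Longrightarrow> S \<in> carrier (sections X W) \<Longrightarrow> snd S \<in> sec B (pB W)"
  and secX_agree: "openin (top_of X) W \<Longrightarrow> S \<in> carrier (sections X W) \<Longrightarrow> primeideal Q C \<Longrightarrow> cA Q \<in> pA W \<Longrightarrow>
    SA.smap Q (fst S (cA Q)) = SB.smap Q (snd S (cB Q))"
  by (simp_all only: secX_iff)

lemma X_presheaf: "presheaf K X"
  unfolding presheaf_def
proof (intro allI impI conjI)
  fix W assume W: "openin (top_of X) W"
  have o: "spec_open A (pA W)" "spec_open B (pB W)" using W by (simp_all add: open_X)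
  have c: "sections_closed K (sections (Spec A) (pA W))" "sections_closed K (sections (Spec B) (pB W))"
    using Spec_presheaf[OF SA.A.alg] Spec_presheaf[OF SB.A.alg] o by (auto simp: presheaf_def)
  note hA = stalk_map_hom[OF SA.A.alg SA.C.alg SA.incl] and hB = stalk_map_hom[OF SB.A.alg SA.C.alg SB.incl]
  show "sections_closed K (sections X W)"
    unfolding sections_closed_def
  proof (intro conjI ballI)
    show "\<one>\<^bsub>sections X W\<^esub> \<in> carrier (sections X W)"
      unfolding secX_iff[OF W] X_ops
    proof (intro conjI allI impI)
      show "\<one>\<^bsub>sections (Spec A) (pA W)\<^esub> \<in> sec A (pA W)" "\<one>\<^bsub>sections (Spec B) (pB W)\<^esub> \<in> sec B (pB W)"
        using c by (auto simp only: sections_closed_def)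
      fix Q assume Q: "primeideal Q C" "cA Q \<in> pA W"
      note Q' = Q(2)[unfolded same[OF Q(1)]]
      show "SA.smap Q (\<one>\<^bsub>sections (Spec A) (pA W)\<^esub> (cA Q)) = SB.smap Q (\<one>\<^bsub>sections (Spec B) (pB W)\<^esub> (cB Q))"
        unfolding sections_simps(4)[OF Q(2)] sections_simps(4)[OF Q'] alg_hom_one[OF hA[OF Q(1)]] alg_hom_one[OF hB[OF Q(1)]] ..
    qed
    fix S S' c' assume S: "S \<in> carrier (sections X W)"
    note f = secX_fst[OF W S] secX_snd[OF W S]
    show "c' \<in> carrier K \<Longrightarrow> c' \<odot>\<^bsub>sections X W\<^esub> S \<in> carrier (sections X W)"
      unfolding secX_iff[OF W] X_ops
    proof (intro conjI allI impI)
      assume k: "c' \<in> carrier K"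
      show "c' \<odot>\<^bsub>sections (Spec A) (pA W)\<^esub> fst S \<in> sec A (pA W)" "c' \<odot>\<^bsub>sections (Spec B) (pB W)\<^esub> snd S \<in> sec B (pB W)"
        using c f k by (auto simp only: sections_closed_def)
      fix Q assume Q: "primeideal Q C" "cA Q \<in> pA W"
      note Q' = Q(2)[unfolded same[OF Q(1)]]
      show "SA.smap Q ((c' \<odot>\<^bsub>sections (Spec A) (pA W)\<^esub> fst S) (cA Q)) = SB.smap Q ((c' \<odot>\<^bsub>sections (Spec B) (pB W)\<^esub> snd S) (cB Q))"
        unfolding sections_simps(3)[OF Q(2)] sections_simps(3)[OF Q'] alg_hom_smult[OF hA[OF Q(1)] k sec_stalk[OF f(1) Q(2)]]
          alg_hom_smult[OF hB[OF Q(1)] k sec_stalk[OF f(2) Q']] secX_agree[OF W S Q] ..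
    qed
    assume S': "S' \<in> carrier (sections X W)"
    note f' = secX_fst[OF W S'] secX_snd[OF W S']
    show "S \<otimes>\<^bsub>sections X W\<^esub> S' \<in> carrier (sections X W)"
      unfolding secX_iff[OF W] X_ops
    proof (intro conjI allI impI)
      show "fst S \<otimes>\<^bsub>sections (Spec A) (pA W)\<^esub> fst S' \<in> sec A (pA W)" "snd S \<otimes>\<^bsub>sections (Spec B) (pB W)\<^esub> snd S' \<in> sec B (pB W)"
        using c f f' by (auto simp only: sections_closed_def)
      fix Q assume Q: "primeideal Q C" "cA Q \<in> pA W"
      note Q' = Q(2)[unfolded same[OF Q(1)]]
      show "SA.smap Q ((fst S \<otimes>\<^bsub>sections (Spec A) (pA W)\<^esub> fst S') (cA Q)) = SB.smap Q ((snd S \<otimes>\<^bsub>sections (Spec B) (pB W)\<^esub> snd S') (cB Q))"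
        unfolding sections_simps(1)[OF Q(2)] sections_simps(1)[OF Q'] alg_hom_mult[OF hA[OF Q(1)] sec_stalk[OF f(1) Q(2)] sec_stalk[OF f'(1) Q(2)]]
          alg_hom_mult[OF hB[OF Q(1)] sec_stalk[OF f(2) Q'] sec_stalk[OF f'(2) Q']] secX_agree[OF W S Q] secX_agree[OF W S' Q] ..
    qed
    show "S \<oplus>\<^bsub>sections X W\<^esub> S' \<in> carrier (sections X W)"
      unfolding secX_iff[OF W] X_ops
    proof (intro conjI allI impI)
      show "fst S \<oplus>\<^bsub>sections (Spec A) (pA W)\<^esub> fst S' \<in> sec A (pA W)" "snd S \<oplus>\<^bsub>sections (Spec B) (pB W)\<^esub> snd S' \<in> sec B (pB W)"
        using c f f' by (auto simp only: sections_closed_def)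
      fix Q assume Q: "primeideal Q C" "cA Q \<in> pA W"
      note Q' = Q(2)[unfolded same[OF Q(1)]]
      show "SA.smap Q ((fst S \<oplus>\<^bsub>sections (Spec A) (pA W)\<^esub> fst S') (cA Q)) = SB.smap Q ((snd S \<oplus>\<^bsub>sections (Spec B) (pB W)\<^esub> snd S') (cB Q))"
        unfolding sections_simps(2)[OF Q(2)] sections_simps(2)[OF Q'] alg_hom_add[OF hA[OF Q(1)] sec_stalk[OF f(1) Q(2)] sec_stalk[OF f'(1) Q(2)]]
          alg_hom_add[OF hB[OF Q(1)] sec_stalk[OF f(2) Q'] sec_stalk[OF f'(2) Q']] secX_agree[OF W S Q] secX_agree[OF W S' Q] ..
    qed
  qed
  fix W' S assume W': "openin (top_of X) W'" "W' \<subseteq> W" and S: "S \<in> carrier (sections X W)"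
  have o': "spec_open A (pA W')" "spec_open B (pB W')" using W' by (simp_all add: open_X)
  have sub: "pA W' \<subseteq> pA W" "pB W' \<subseteq> pB W" using W' by auto
  show "restr X W W' S \<in> carrier (sections X W')"
    unfolding secX_iff[OF W'(1)] X_restr fst_conv snd_conv
  proof (intro conjI allI impI)
    show "restrict (fst S) (pA W') \<in> sec A (pA W')" by (rule SA.A.sec_restrict[OF secX_fst[OF W S] o'(1) sub(1)])
    show "restrict (snd S) (pB W') \<in> sec B (pB W')" by (rule SB.A.sec_restrict[OF secX_snd[OF W S] o'(2) sub(2)])
    fix Q assume Q: "primeideal Q C" "cA Q \<in> pA W'"
    note Q' = Q(2)[unfolded same[OF Q(1)]]
    show "SA.smap Q (restrict (fst S) (pA W') (cA Q)) = SB.smap Q (restrict (snd S) (pB W') (cB Q))"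
      unfolding restrict_apply'[OF Q(2)] restrict_apply'[OF Q'] by (rule secX_agree[OF W S Q(1) subsetD[OF sub(1) Q(2)]])
  qed
qed

text \<open>In the other chart the set becomes the image of an open set of \<open>Spec C\<close>,
  and such images are open by \<open>cut_open\<close>.\<close>

lemma open_image_inl: "spec_open A V \<Longrightarrow> openin (top_of X) (inl ` V)"
proof -
  assume V: "spec_open A V"
  have Vp: "V \<subseteq> primes A" using SA.A.open_sub[OF V] .
  have 1: "{P \<in> primes A. inl P \<in> inl ` V} = V" using Vp by (auto simp: inl_eq)
  have 2: "{P \<in> primes B. inr P \<in> inl ` V} = cB ` {Q \<in> primes C. cA Q \<in> V}"
    using Vp by (auto simp: inl_inr image_iff dest: SB.cut_prime)
  have "spec_open C {Q \<in> primes C. cA Q \<in> V}" by (rule i_open[OF V])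
  then have 3: "spec_open B {P \<in> primes B. inr P \<in> inl ` V}" unfolding 2 by (rule SB.cut_open)
  show "openin (top_of X) (inl ` V)"
    unfolding open_X using Vp V 3 1 by auto
qed

text \<open>An open set inside the left patch meets the right chart only in the overlap. There the
  second component is forced by the first one through injectivity of the stalk maps, and it exists
  by \<open>sec_transfer\<close>.\<close>

lemma fst_bij:
  assumes W: "openin (top_of X) W" and sub: "W \<subseteq> inl ` primes A"
  shows "bij_betw fst (carrier (sections X W)) (sec A (pA W))"
proof (rule bij_betw_imageI)
  have cover: "\<exists>Q. primeideal Q C \<and> P = cB Q \<and> cA Q \<in> pA W \<and> cB Q \<in> pB W" if "P \<in> pB W" for P
  proof -
    from that sub obtain P' where "primeideal P' A" "inr P = inl P'" by auto
    then obtain Q where "primeideal Q C" "P = cB Q" by (auto simp: inl_inr)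
    then show ?thesis using that same by auto
  qed
  show "inj_on fst (carrier (sections X W))"
  proof (rule inj_onI)
    fix S S' assume S: "S \<in> carrier (sections X W)" "S' \<in> carrier (sections X W)" and eq: "fst S = fst S'"
    have "snd S P = snd S' P" if P: "P \<in> pB W" for P
    proof -
      from cover[OF P] obtain Q where Q: "primeideal Q C" "P = cB Q" "cA Q \<in> pA W" "cB Q \<in> pB W" by blast
      have "SB.smap Q (snd S (cB Q)) = SB.smap Q (snd S' (cB Q))"
        using secX_agree[OF W S(1) Q(1)] secX_agree[OF W S(2) Q(1)] Q(3,4) eq by simp
      then show ?thesis unfolding Q(2)
        by (rule SB.smap_inj[OF Q(1) sec_stalk[OF secX_snd[OF W S(1)] Q(4)] sec_stalk[OF secX_snd[OF W S(2)] Q(4)]])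
    qed
    then have "snd S = snd S'"
      by (rule extensionalityI[OF sec_ext[OF secX_snd[OF W S(1)]] sec_ext[OF secX_snd[OF W S(2)]]])
    with eq show "S = S'" by (simp add: prod_eq_iff)
  qed
  show "fst ` carrier (sections X W) = sec A (pA W)"
  proof
    show "fst ` carrier (sections X W) \<subseteq> sec A (pA W)" using secX_fst[OF W] by auto
    show "sec A (pA W) \<subseteq> fst ` carrier (sections X W)"
    proof
      fix s assume s: "s \<in> sec A (pA W)"
      have oA: "spec_open A (pA W)" using W by (simp add: open_X)
      let ?T = "{Q \<in> primes C. cA Q \<in> pA W}"
      have T: "spec_open C ?T" by (rule i_open[OF oA])
      have "comor i (pA W) s \<in> sec C ?T" by (rule i_sec[OF oA s])
      from SB.sec_transfer[OF T this] obtain t where t: "t \<in> sec B (cB ` ?T)"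
        "\<forall>Q\<in>?T. SB.smap Q (t (cB Q)) = comor i (pA W) s Q" by blast
      have "cB ` ?T = pB W" using cover same SB.cut_prime by (auto simp: image_iff)
      then have tB: "t \<in> sec B (pB W)" using t(1) by simp
      have "(s, t) \<in> carrier (sections X W)"
        unfolding secX_iff[OF W] fst_conv snd_conv
      proof (intro conjI allI impI)
        fix Q assume Q: "primeideal Q C" "cA Q \<in> pA W"
        then have Q': "cA Q \<in> pA W" by (simp only: same[OF Q(1)])
        then have "SB.smap Q (t (cB Q)) = SA.smap Q (s (cA Q))"
          using t(2) Q(1) unfolding i_comor[OF oA s Q(1) Q', symmetric] by blast
        then show "SA.smap Q (s (cA Q)) = SB.smap Q (t (cB Q))" by (simp only:)
      qed (rule s tB)+
      then show "s \<in> fst ` carrier (sections X W)" by (auto simp: image_iff intro!: bexI[of _ "(s, t)"])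
    qed
  qed
qed

lemma chart_left: "chart K A X inl fst"
proof
  show "presheaf K X" by (rule X_presheaf)
  show "inj_on inl (primes A)" by (auto simp: inj_on_def inl_eq)
  show "spec_open A V \<Longrightarrow> openin (top_of X) (inl ` V)" for V by (rule open_image_inl)
  show "openin (top_of X) W \<Longrightarrow> spec_open A (pA W)" for W by (simp add: open_X)
  show "fst \<in> alg_hom K (sections X W) (sections (Spec A) (pA W))" if W: "openin (top_of X) W" for W
    by (rule alg_homI) (erule secX_fst[OF W] | simp only: X_ops)+
  show "fst (restr X W W' s) = restrict (fst s) (pA W')" for W W' s by (simp add: X_restr)
  show "openin (top_of X) W \<Longrightarrow> W \<subseteq> inl ` primes A \<Longrightarrow> bij_betw fst (carrier (sections X W)) (sec A (pA W))" for W
    by (rule fst_bij)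
qed

lemma open_image_inr: "spec_open B V \<Longrightarrow> openin (top_of X) (inr ` V)"
proof -
  assume V: "spec_open B V"
  have Vp: "V \<subseteq> primes B" using SB.A.open_sub[OF V] .
  have 1: "{P \<in> primes B. inr P \<in> inr ` V} = V" using Vp by (auto simp: inr_eq)
  have 2: "{P \<in> primes A. inl P \<in> inr ` V} = cA ` {Q \<in> primes C. cB Q \<in> V}"
    using Vp by (auto simp: inr_inl image_iff dest: SA.cut_prime)
  have "spec_open C {Q \<in> primes C. cB Q \<in> V}" by (rule j_open[OF V])
  then have 3: "spec_open A {P \<in> primes A. inl P \<in> inr ` V}" unfolding 2 by (rule SA.cut_open)
  show "openin (top_of X) (inr ` V)"
    unfolding open_X using Vp V 3 1 by auto
qed

lemma snd_bij:
  assumes W: "openin (top_of X) W" and sub: "W \<subseteq> inr ` primes B"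
  shows "bij_betw snd (carrier (sections X W)) (sec B (pB W))"
proof (rule bij_betw_imageI)
  have cover: "\<exists>Q. primeideal Q C \<and> P = cA Q \<and> cB Q \<in> pB W \<and> cA Q \<in> pA W" if "P \<in> pA W" for P
  proof -
    from that sub obtain P' where "primeideal P' B" "inl P = inr P'" by auto
    then obtain Q where "primeideal Q C" "P = cA Q" by (auto simp: inr_inl)
    then show ?thesis using that same by auto
  qed
  show "inj_on snd (carrier (sections X W))"
  proof (rule inj_onI)
    fix S S' assume S: "S \<in> carrier (sections X W)" "S' \<in> carrier (sections X W)" and eq: "snd S = snd S'"
    have "fst S P = fst S' P" if P: "P \<in> pA W" for P
    proof -
      from cover[OF P] obtain Q where Q: "primeideal Q C" "P = cA Q" "cB Q \<in> pB W" "cA Q \<in> pA W" by blast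
      have "SA.smap Q (fst S (cA Q)) = SA.smap Q (fst S' (cA Q))"
        using secX_agree[OF W S(1) Q(1)] secX_agree[OF W S(2) Q(1)] Q(3,4) eq by simp
      then show ?thesis unfolding Q(2)
        by (rule SA.smap_inj[OF Q(1) sec_stalk[OF secX_fst[OF W S(1)] Q(4)] sec_stalk[OF secX_fst[OF W S(2)] Q(4)]])
    qed
    then have "fst S = fst S'"
      by (rule extensionalityI[OF sec_ext[OF secX_fst[OF W S(1)]] sec_ext[OF secX_fst[OF W S(2)]]])
    with eq show "S = S'" by (simp add: prod_eq_iff)
  qed
  show "snd ` carrier (sections X W) = sec B (pB W)"
  proof
    show "snd ` carrier (sections X W) \<subseteq> sec B (pB W)" using secX_snd[OF W] by auto
    show "sec B (pB W) \<subseteq> snd ` carrier (sections X W)"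
    proof
      fix s assume s: "s \<in> sec B (pB W)"
      have oA: "spec_open B (pB W)" using W by (simp add: open_X)
      let ?T = "{Q \<in> primes C. cB Q \<in> pB W}"
      have T: "spec_open C ?T" by (rule j_open[OF oA])
      have "comor j (pB W) s \<in> sec C ?T" by (rule j_sec[OF oA s])
      from SA.sec_transfer[OF T this] obtain t where t: "t \<in> sec A (cA ` ?T)"
        "\<forall>Q\<in>?T. SA.smap Q (t (cA Q)) = comor j (pB W) s Q" by blast
      have "cA ` ?T = pA W" using cover same SA.cut_prime by (auto simp: image_iff)
      then have tB: "t \<in> sec A (pA W)" using t(1) by simp
      have "(t, s) \<in> carrier (sections X W)"
        unfolding secX_iff[OF W] fst_conv snd_conv
      proof (intro conjI allI impI)
        fix Q assume Q: "primeideal Q C" "cA Q \<in> pA W"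
        then have Q': "cB Q \<in> pB W" by (simp only: same[OF Q(1)])
        then have "SA.smap Q (t (cA Q)) = SB.smap Q (s (cB Q))"
          using t(2) Q(1) unfolding j_comor[OF oA s Q(1) Q', symmetric] by blast
        then show "SA.smap Q (t (cA Q)) = SB.smap Q (s (cB Q))" by (simp only:)
      qed (rule s tB)+
      then show "s \<in> snd ` carrier (sections X W)" by (auto simp: image_iff intro!: bexI[of _ "(t, s)"])
    qed
  qed
qed

lemma chart_right: "chart K B X inr snd"
proof
  show "presheaf K X" by (rule X_presheaf)
  show "inj_on inr (primes B)" by (auto simp: inj_on_def inr_eq)
  show "spec_open B V \<Longrightarrow> openin (top_of X) (inr ` V)" for V by (rule open_image_inr)
  show "openin (top_of X) W \<Longrightarrow> spec_open B (pB W)" for W by (simp add: open_X)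
  show "snd \<in> alg_hom K (sections X W) (sections (Spec B) (pB W))" if W: "openin (top_of X) W" for W
    by (rule alg_homI) (erule secX_snd[OF W] | simp only: X_ops)+
  show "snd (restr X W W' s) = restrict (snd s) (pB W')" for W W' s by (simp add: X_restr)
  show "openin (top_of X) W \<Longrightarrow> W \<subseteq> inr ` primes B \<Longrightarrow> bij_betw snd (carrier (sections X W)) (sec B (pB W))" for W
    by (rule snd_bij)
qed

end

section \<open>Gluing morphisms given on two open sets\<close>

lemma (in spec_ring) eval_hom:
  assumes "P \<in> U"
  shows "(\<lambda>s. s P) \<in> alg_hom K (sections (Spec A) U) (stalk_at A P)"
  by (rule alg_homI) (simp_all add: sections_simps assms sec_stalk[OF _ assms])

text \<open>Image point and values are computed in the first chart wherever \<open>D1\<close>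
  permits, and in the second chart elsewhere. The hypotheses \<open>pts\<close> and
  \<open>secs\<close> say that the preference for the first chart does not matter on the
  intersection.\<close>

lemma glue_morphisms:
  assumes C1: "chart K A X \<iota>1 \<sigma>1" and C2: "chart K B X \<iota>2 \<sigma>2"
    and G1: "germ_hom K A R D1 th1" and G2: "germ_hom K B R D2 th2"
    and cover: "D1 \<union> D2 = primes R"
    and pts: "\<And>Q. Q \<in> D1 \<Longrightarrow> Q \<in> D2 \<Longrightarrow> \<iota>1 (contr A (stalk_at R Q) (th1 Q)) = \<iota>2 (contr B (stalk_at R Q) (th2 Q))"
    and secs: "\<And>Q W S. Q \<in> D1 \<Longrightarrow> Q \<in> D2 \<Longrightarrow> openin (top_of X) W \<Longrightarrow> S \<in> carrier (sections X W) \<Longrightarrow>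
      \<iota>1 (contr A (stalk_at R Q) (th1 Q)) \<in> W \<Longrightarrow>
      frac_lift (stalk_at R Q) (th1 Q) (\<sigma>1 S (contr A (stalk_at R Q) (th1 Q))) =
      frac_lift (stalk_at R Q) (th2 Q) (\<sigma>2 S (contr B (stalk_at R Q) (th2 Q)))"
  shows "\<exists>f \<in> rmors K (Spec R) X.
    (\<forall>Q\<in>D1. pt f Q \<in> \<iota>1 ` primes A \<and> (\<forall>a\<in>carrier A. chart.chart_hom A X \<iota>1 \<sigma>1 f Q a = th1 Q a)) \<and>
    (\<forall>Q\<in>D2. pt f Q \<in> \<iota>2 ` primes B \<and> (\<forall>b\<in>carrier B. chart.chart_hom B X \<iota>2 \<sigma>2 f Q b = th2 Q b))"
proof -
  interpret C1: chart K A X \<iota>1 \<sigma>1 by fact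
  interpret C2: chart K B X \<iota>2 \<sigma>2 by fact
  interpret G1: germ_hom K A R D1 th1 by fact
  interpret G2: germ_hom K B R D2 th2 by fact
  define p where "p Q = (if Q \<in> D1 then \<iota>1 (G1.ctr Q) else \<iota>2 (G2.ctr Q))" for Q
  define c where "c S Q = (if Q \<in> D1 then G1.pull Q (\<sigma>1 S (G1.ctr Q)) else G2.pull Q (\<sigma>2 S (G2.ctr Q)))" for S Q
  have p1: "p Q = \<iota>1 (G1.ctr Q)" if "Q \<in> D1" for Q using that by (simp add: p_def)
  have p2: "p Q = \<iota>2 (G2.ctr Q)" if "Q \<in> D2" for Q using that pts by (simp add: p_def)
  have c1: "c S Q = G1.pull Q (\<sigma>1 S (G1.ctr Q))" if "Q \<in> D1" for S Q using that by (simp add: c_def)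
  \<comment> \<open>Unlike \<open>c1\<close>, this requires a section defined near the image point,
    because the two charts are assumed to agree only for such sections.\<close>
  have c2: "c S Q = G2.pull Q (\<sigma>2 S (G2.ctr Q))"
    if "Q \<in> D2" "openin (top_of X) W" "S \<in> carrier (sections X W)" "p Q \<in> W" for S Q W
  proof (cases "Q \<in> D1")
    case True
    have "\<iota>1 (G1.ctr Q) \<in> W" using that(4) unfolding p1[OF True] .
    from secs[OF True that(1-3) this] show ?thesis using True by (simp add: c_def)
  qed (simp add: c_def)
  have m1: "G1.ctr Q \<in> C1.pre W" if "Q \<in> D1" "p Q \<in> W" for Q W using that G1.ctr_prime p1 by simp
  have m2: "G2.ctr Q \<in> C2.pre W" if "Q \<in> D2" "p Q \<in> W" for Q W using that G2.ctr_prime p2 by simp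
  \<comment> \<open>The preimage of an open set is the union of the preimages computed in the two
    charts, so openness and regularity can be checked on the two parts.\<close>
  have split: "{Q \<in> primes R. p Q \<in> W} = {Q \<in> D1. G1.ctr Q \<in> C1.pre W} \<union> {Q \<in> D2. G2.ctr Q \<in> C2.pre W}" (is "_ = ?E1 W \<union> ?E2 W") for W
  proof
    show "{Q \<in> primes R. p Q \<in> W} \<subseteq> ?E1 W \<union> ?E2 W"
    proof
      fix Q assume "Q \<in> {Q \<in> primes R. p Q \<in> W}"
      then have "Q \<in> D1 \<or> Q \<in> D2" "p Q \<in> W" using cover by blast+
      then show "Q \<in> ?E1 W \<union> ?E2 W" using m1[of Q W] m2[of Q W] by blast
    qed
    show "?E1 W \<union> ?E2 W \<subseteq> {Q \<in> primes R. p Q \<in> W}"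
    proof
      fix Q assume "Q \<in> ?E1 W \<union> ?E2 W"
      then show "Q \<in> {Q \<in> primes R. p Q \<in> W}" using p1[of Q] p2[of Q] G1.D_prime[of Q] G2.D_prime[of Q] by auto
    qed
  qed
  have o1: "spec_open R (?E1 W)" if "openin (top_of X) W" for W by (rule G1.ctr_open[OF C1.open_pre[OF that]])
  have o2: "spec_open R (?E2 W)" if "openin (top_of X) W" for W by (rule G2.ctr_open[OF C2.open_pre[OF that]])
  have o: "spec_open R {Q \<in> primes R. p Q \<in> W}" if "openin (top_of X) W" for W
    unfolding split using o1[OF that] o2[OF that] by (rule openin_Un)
  have hom: "(\<lambda>S. c S Q) \<in> alg_hom K (sections X W) (stalk_at R Q)"
    if W: "openin (top_of X) W" and Q: "primeideal Q R" "p Q \<in> W" for W Q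
  proof (cases "Q \<in> D1")
    case True
    have "(\<lambda>S. G1.pull Q (\<sigma>1 S (G1.ctr Q))) \<in> alg_hom K (sections X W) (stalk_at R Q)"
      by (rule alg_hom_comp[OF G1.pull_hom[OF True] alg_hom_comp[OF C1.A.eval_hom[OF m1[OF True Q(2)]] C1.\<sigma>_hom[OF W]]])
    then show ?thesis using True by (simp add: c_def)
  next
    case False
    then have D2: "Q \<in> D2" using Q cover by blast
    have "(\<lambda>S. G2.pull Q (\<sigma>2 S (G2.ctr Q))) \<in> alg_hom K (sections X W) (stalk_at R Q)"
      by (rule alg_hom_comp[OF G2.pull_hom[OF D2] alg_hom_comp[OF C2.A.eval_hom[OF m2[OF D2 Q(2)]] C2.\<sigma>_hom[OF W]]])
    then show ?thesis using False by (simp add: c_def)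
  qed
  have csec: "(\<lambda>Q\<in>{Q \<in> primes R. p Q \<in> W}. c S Q) \<in> sec R {Q \<in> primes R. p Q \<in> W}"
    if W: "openin (top_of X) W" and S: "S \<in> carrier (sections X W)" for W S
  proof (rule G1.R.sec_locI[OF o[OF W]])
    fix Q assume "Q \<in> {Q \<in> primes R. p Q \<in> W}"
    then consider "Q \<in> ?E1 W" | "Q \<in> ?E2 W" unfolding split by blast
    then show "\<exists>V t. spec_open R V \<and> Q \<in> V \<and> V \<subseteq> {Q \<in> primes R. p Q \<in> W} \<and> t \<in> sec R V \<and>
      (\<forall>Q\<in>V. (\<lambda>Q\<in>{Q \<in> primes R. p Q \<in> W}. c S Q) Q = t Q)"
    proof cases
      case 1
      have "?E1 W \<subseteq> {Q \<in> primes R. p Q \<in> W}" unfolding split by blast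
      then show ?thesis
        using 1 o1[OF W] G1.pull_sec[OF C1.open_pre[OF W] C1.\<sigma>_sec[OF W S]]
        by (intro exI[of _ "?E1 W"] exI conjI) (auto simp: c1)
    next
      case 2
      have s: "?E2 W \<subseteq> {Q \<in> primes R. p Q \<in> W}" unfolding split by blast
      then have "c S Q = G2.pull Q (\<sigma>2 S (G2.ctr Q))" if "Q \<in> ?E2 W" for Q
        using that by (intro c2[OF _ W S]) blast+
      then show ?thesis
        using 2 s o2[OF W] G2.pull_sec[OF C2.open_pre[OF W] C2.\<sigma>_sec[OF W S]]
        by (intro exI[of _ "?E2 W"] exI conjI) auto
    qed
  qed simp
  define f where "f = \<lparr>pt = (\<lambda>Q\<in>primes R. p Q),
     comor = (\<lambda>W\<in>{W. openin (top_of X) W}. \<lambda>S\<in>carrier (sections X W). \<lambda>Q\<in>{Q \<in> primes R. p Q \<in> W}. c S Q)\<rparr>"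
  have fp: "pt f Q = p Q" if "primeideal Q R" for Q using that by (simp add: f_def)
  have fc: "comor f W S = (\<lambda>Q\<in>{Q \<in> primes R. p Q \<in> W}. c S Q)"
    if "openin (top_of X) W" "S \<in> carrier (sections X W)" for W S using that by (simp add: f_def)
  have pre: "preim (Spec R) f W = {Q \<in> primes R. p Q \<in> W}" for W
    by (auto simp: preim_def G1.R.topspace fp)
  have ptop: "p Q \<in> topspace (top_of X)" if "primeideal Q R" for Q
    using that cover p1[of Q] p2[of Q] G1.ctr_prime[of Q] G2.ctr_prime[of Q]
      openin_subset[OF C1.patch_open] openin_subset[OF C2.patch_open] by blast
  have f: "f \<in> rmors K (Spec R) X"
  proof (rule rmorsI)
    show "pt f \<in> extensional (topspace (top_of (Spec R)))" by (simp add: f_def G1.R.topspace)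
    show "comor f \<in> extensional {V. openin (top_of X) V}" by (simp add: f_def)
    show "continuous_map (top_of (Spec R)) (top_of X) (pt f)"
      unfolding continuous_map_def
    proof (intro conjI allI impI)
      show "pt f \<in> topspace (top_of (Spec R)) \<rightarrow> topspace (top_of X)"
        using ptop by (auto simp: G1.R.topspace fp)
      fix W assume "openin (top_of X) W"
      from o[OF this] pre[of W] show "spec_open R {x \<in> topspace (top_of (Spec R)). pt f x \<in> W}"
        by (simp add: preim_def)
    qed
  next
    fix W assume W: "openin (top_of X) W"
    show "comor f W \<in> extensional (carrier (sections X W))" using W by (simp add: f_def)
    have cl: "sections_closed K (sections X W)" using C1.sec_closed[OF W] .
    have ext: "x = y" if "x \<in> extensional {Q \<in> primes R. p Q \<in> W}" "y \<in> extensional {Q \<in> primes R. p Q \<in> W}"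
      "\<And>Q. primeideal Q R \<Longrightarrow> p Q \<in> W \<Longrightarrow> x Q = y Q" for x y
      using that by (intro extensionalityI[of x _ y]) auto
    show "comor f W \<in> alg_hom K (sections X W) (sections (Spec R) (preim (Spec R) f W))"
    proof (rule alg_homI)
      fix S c' assume S: "S \<in> carrier (sections X W)"
      show "comor f W S \<in> sec R (preim (Spec R) f W)" unfolding pre fc[OF W S] by (rule csec[OF W S])
      have "c' \<odot>\<^bsub>sections X W\<^esub> S \<in> carrier (sections X W)" if "c' \<in> carrier K" using cl S that by (simp add: sections_closed_def)
      then show "c' \<in> carrier K \<Longrightarrow> comor f W (c' \<odot>\<^bsub>sections X W\<^esub> S) = c' \<odot>\<^bsub>sections (Spec R) (preim (Spec R) f W)\<^esub> comor f W S"
        using alg_hom_smult[OF hom[OF W] _ S] unfolding pre by (intro ext) (simp_all add: fc[OF W] S sections_simps)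
      fix S' assume S': "S' \<in> carrier (sections X W)"
      have m: "S \<otimes>\<^bsub>sections X W\<^esub> S' \<in> carrier (sections X W)" "S \<oplus>\<^bsub>sections X W\<^esub> S' \<in> carrier (sections X W)"
        using cl S S' by (simp_all add: sections_closed_def)
      show "comor f W (S \<otimes>\<^bsub>sections X W\<^esub> S') = comor f W S \<otimes>\<^bsub>sections (Spec R) (preim (Spec R) f W)\<^esub> comor f W S'"
        using alg_hom_mult[OF hom[OF W] S S'] m unfolding pre by (intro ext) (simp_all add: fc[OF W] S S' sections_simps)
      show "comor f W (S \<oplus>\<^bsub>sections X W\<^esub> S') = comor f W S \<oplus>\<^bsub>sections (Spec R) (preim (Spec R) f W)\<^esub> comor f W S'"
        using alg_hom_add[OF hom[OF W] S S'] m unfolding pre by (intro ext) (simp_all add: fc[OF W] S S' sections_simps)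
    next
      have m: "\<one>\<^bsub>sections X W\<^esub> \<in> carrier (sections X W)" using cl by (simp add: sections_closed_def)
      show "comor f W \<one>\<^bsub>sections X W\<^esub> = \<one>\<^bsub>sections (Spec R) (preim (Spec R) f W)\<^esub>"
        using alg_hom_one[OF hom[OF W]] m unfolding pre by (intro ext) (simp_all add: fc[OF W] sections_simps)
    qed
    fix W' S assume W': "openin (top_of X) W'" "W' \<subseteq> W" and S: "S \<in> carrier (sections X W)"
    have r: "restr X W W' S \<in> carrier (sections X W')" by (rule C1.restr_closed[OF W W' S])
    have "c (restr X W W' S) Q = c S Q" if "primeideal Q R" "p Q \<in> W'" for Q
    proof (cases "Q \<in> D1")
      case True
      then show ?thesis using m1[OF True that(2)] by (simp add: c_def C1.\<sigma>_restr[OF W W' S])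
    next
      case False
      then have "Q \<in> D2" using that(1) cover by blast
      then show ?thesis using False m2[OF _ that(2)] by (simp add: c_def C2.\<sigma>_restr[OF W W' S])
    qed
    then show "comor f W' (restr X W W' S) = restr (Spec R) (preim (Spec R) f W) (preim (Spec R) f W') (comor f W S)"
      unfolding pre restr_Spec fc[OF W S] fc[OF W'(1) r] using W'(2) by (auto simp: fun_eq_iff)
  next
    fix W S Q assume W: "openin (top_of X) W" and S: "S \<in> carrier (sections X W)" and Q: "Q \<in> preim (Spec R) f W"
      and u: "germ_unit (Spec R) (preim (Spec R) f W) (comor f W S) Q"
    have Q': "primeideal Q R" "p Q \<in> W" using Q by (auto simp: pre)
    have "comor f W S Q \<in> Units (stalk_at R Q)"
      using u unfolding pre fc[OF W S] by (subst (asm) G1.R.germ_unit_iff[OF o[OF W] csec[OF W S]]) (use Q' in auto)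
    then have cu: "c S Q \<in> Units (stalk_at R Q)" using Q' by (simp add: fc[OF W S])
    show "germ_unit X W S (pt f Q)"
    proof (cases "Q \<in> D1")
      case True
      have "\<sigma>1 S (G1.ctr Q) \<in> Units (stalk_at A (G1.ctr Q))"
        by (rule G1.pull_unit[OF True sec_stalk[OF C1.\<sigma>_sec[OF W S] m1[OF True Q'(2)]]]) (use cu c1[OF True] in simp)
      then show ?thesis using C1.chart_unit[OF W S m1[OF True Q'(2)]] by (simp add: fp[OF Q'(1)] p1[OF True])
    next
      case False
      then have D2: "Q \<in> D2" using Q' cover by blast
      have "\<sigma>2 S (G2.ctr Q) \<in> Units (stalk_at B (G2.ctr Q))"
        by (rule G2.pull_unit[OF D2 sec_stalk[OF C2.\<sigma>_sec[OF W S] m2[OF D2 Q'(2)]]]) (use cu c2[OF D2 W S Q'(2)] in simp)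
      then show ?thesis using C2.chart_unit[OF W S m2[OF D2 Q'(2)]] by (simp add: fp[OF Q'(1)] p2[OF D2])
    qed
  qed
  have d1: "pt f Q \<in> C1.patch \<and> (\<forall>a\<in>carrier A. C1.chart_hom f Q a = th1 Q a)" if Q: "Q \<in> D1" for Q
  proof (intro conjI ballI)
    have Qp: "primeideal Q R" using G1.D_prime[OF Q] .
    interpret L: cring "stalk_at R Q" by (rule G1.R.st_cring[OF Qp])
    interpret P: primeideal "G1.ctr Q" A by (rule G1.ctr_prime[OF Q])
    show pp: "pt f Q \<in> C1.patch" using G1.ctr_prime[OF Q] p1[OF Q] fp[OF Qp] by simp
    fix a assume a: "a \<in> carrier A"
    have "C1.chart_hom f Q a = G1.pull Q (germ A (G1.ctr Q) a \<one>\<^bsub>A\<^esub>)"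
      unfolding C1.chart_hom_def fc[OF C1.patch_open C1.chart_sec(1)[OF a]]
      using pp fp[OF Qp] Qp G1.ctr_prime[OF Q] by (simp add: c1[OF Q] C1.chart_sec(2)[OF a])
    also have "\<dots> = th1 Q a"
      using G1.pull_germ[OF Q a, of "\<one>\<^bsub>A\<^esub>"] alg_hom_one[OF G1.th[OF Q]] alg_hom_closed[OF G1.th[OF Q] a] P.one_notin by simp
    finally show "C1.chart_hom f Q a = th1 Q a" .
  qed
  have d2: "pt f Q \<in> C2.patch \<and> (\<forall>a\<in>carrier B. C2.chart_hom f Q a = th2 Q a)" if Q: "Q \<in> D2" for Q
  proof (intro conjI ballI)
    have Qp: "primeideal Q R" using G2.D_prime[OF Q] .
    interpret L: cring "stalk_at R Q" by (rule G1.R.st_cring[OF Qp])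
    interpret P: primeideal "G2.ctr Q" B by (rule G2.ctr_prime[OF Q])
    show pp: "pt f Q \<in> C2.patch" using G2.ctr_prime[OF Q] p2[OF Q] fp[OF Qp] by simp
    fix a assume a: "a \<in> carrier B"
    have pp': "p Q \<in> C2.patch" using pp fp[OF Qp] by simp
    have "C2.chart_hom f Q a = G2.pull Q (germ B (G2.ctr Q) a \<one>\<^bsub>B\<^esub>)"
      unfolding C2.chart_hom_def fc[OF C2.patch_open C2.chart_sec(1)[OF a]]
      using pp' Qp G2.ctr_prime[OF Q] by (simp add: c2[OF Q C2.patch_open C2.chart_sec(1)[OF a] pp'] C2.chart_sec(2)[OF a])
    also have "\<dots> = th2 Q a"
      using G2.pull_germ[OF Q a, of "\<one>\<^bsub>B\<^esub>"] alg_hom_one[OF G2.th[OF Q]] alg_hom_closed[OF G2.th[OF Q] a] P.one_notin by simp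
    finally show "C2.chart_hom f Q a = th2 Q a" .
  qed
  show ?thesis using f d1 d2 by blast
qed

context glue_aff
begin

sublocale CA: chart K A X inl fst by (rule chart_left)
sublocale CB: chart K B X inr snd by (rule chart_right)

lemma inl_patch: "primeideal P A \<Longrightarrow> inl P \<in> CB.patch \<longleftrightarrow> e \<notin> P"
  using SA.cut_image_iff[of P] SB.cut_prime by (auto simp: inr_inl image_iff)

text \<open>On the intersection both families extend to one homomorphism \<theta> out of
  \<open>C\<close>. Then both image points are traces of the same prime of \<open>C\<close>, and
  both lifts factor through the lift of \<theta>, which gives the compatibility required for
  gluing.\<close>

lemma glue_exists:
  assumes G1: "germ_hom K A R D1 th1" and G2: "germ_hom K B R D2 th2"
    and cover: "D1 \<union> D2 = primes R"
    and compat: "\<And>Q. Q \<in> D1 \<Longrightarrow> Q \<in> D2 \<Longrightarrow> \<exists>\<theta> \<in> alg_hom K C (stalk_at R Q).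
      (\<forall>a\<in>carrier A. \<theta> a = th1 Q a) \<and> (\<forall>b\<in>carrier B. \<theta> b = th2 Q b)"
  shows "\<exists>f \<in> rmors K (Spec R) X.
    (\<forall>Q\<in>D1. pt f Q \<in> CA.patch \<and> (\<forall>a\<in>carrier A. CA.chart_hom f Q a = th1 Q a)) \<and>
    (\<forall>Q\<in>D2. pt f Q \<in> CB.patch \<and> (\<forall>b\<in>carrier B. CB.chart_hom f Q b = th2 Q b))"
proof -
  interpret G1: germ_hom K A R D1 th1 by fact
  interpret G2: germ_hom K B R D2 th2 by fact
  have key: "\<exists>P. primeideal P C \<and> G1.ctr Q = cA P \<and> G2.ctr Q = cB P \<and>
      (\<forall>x\<in>carrier (stalk_at A (cA P)). \<forall>y\<in>carrier (stalk_at B (cB P)). SA.smap P x = SB.smap P y \<longrightarrow> G1.pull Q x = G2.pull Q y)"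
    if Q: "Q \<in> D1" "Q \<in> D2" for Q
  proof -
    have Qp: "primeideal Q R" using G1.D_prime[OF Q(1)] .
    obtain \<theta> where \<theta>: "\<theta> \<in> alg_hom K C (stalk_at R Q)" and \<theta>A: "\<And>a. a \<in> carrier A \<Longrightarrow> \<theta> a = th1 Q a"
      and \<theta>B: "\<And>b. b \<in> carrier B \<Longrightarrow> \<theta> b = th2 Q b" using compat[OF Q] by blast
    \<comment> \<open>The common image point in \<open>Spec C\<close>: the contraction of the
      maximal ideal of the stalk along \<theta>.\<close>
    let ?P = "{c \<in> carrier C. \<theta> c \<in> {X \<in> carrier (stalk_at R Q). X \<notin> Units (stalk_at R Q)}}"
    have P: "primeideal ?P C"
      by (rule alg_hom_vimage_prime[OF \<theta> SA.C.alg G1.R.st_alg[OF Qp] G1.R.stalk_nonunits[OF Qp]])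
    have cP: "c \<in> ?P \<longleftrightarrow> \<theta> c \<notin> Units (stalk_at R Q)" if "c \<in> carrier C" for c
      using that alg_hom_closed[OF \<theta>] by blast
    have 1: "G1.ctr Q = cA ?P" unfolding contr_def
      by (rule Collect_cong, rule conj_cong[OF refl]) (subst cP, simp_all add: \<theta>A)
    have 2: "G2.ctr Q = cB ?P" unfolding contr_def
      by (rule Collect_cong, rule conj_cong[OF refl]) (subst cP, simp_all add: \<theta>B)
    obtain P where P: "primeideal P C" "G1.ctr Q = cA P" "G2.ctr Q = cB P"
      and cP: "\<And>c. c \<in> carrier C \<Longrightarrow> c \<in> P \<longleftrightarrow> \<theta> c \<notin> Units (stalk_at R Q)"
      using that[OF P 1 2 cP] by metis
    have F: "frac_lift_hom K C (carrier C - P) (stalk_at R Q) \<theta>"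
    proof (intro frac_lift_hom.intro frac_lift_hom_axioms.intro)
      show "frac_ring K C (carrier C - P)" by (rule SA.C.frac_ring[OF P(1)])
      show "algebra K (stalk_at R Q)" by (rule G1.R.st_alg[OF Qp])
      show "\<theta> \<in> alg_hom K C (stalk_at R Q)" by (rule \<theta>)
      show "\<theta> s \<in> Units (stalk_at R Q)" if "s \<in> carrier C - P" for s using that cP by blast
    qed
    have lA: "G1.pull Q x = frac_lift (stalk_at R Q) \<theta> (SA.smap P x)" if x: "x \<in> carrier (stalk_at A (cA P))" for x
    proof -
      from SA.A.st_cases[OF SA.cut_prime[OF P(1)] x] obtain a s where x: "a \<in> carrier A" "s \<in> carrier A - cA P" "x = germ A (cA P) a s" .
      have s: "s \<in> carrier C - P" using x(2) by simp
      show ?thesis unfolding x(3) SA.smap_germ[OF P(1) x(1,2)] frac_lift_hom.lift_frac[OF F SA.A_C[OF x(1)] s]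
        using G1.pull_germ[OF Q(1) x(1), of s] x(1,2) P(2) by (simp add: \<theta>A)
    qed
    have lB: "G2.pull Q x = frac_lift (stalk_at R Q) \<theta> (SB.smap P x)" if x: "x \<in> carrier (stalk_at B (cB P))" for x
    proof -
      from SB.A.st_cases[OF SB.cut_prime[OF P(1)] x] obtain a s where x: "a \<in> carrier B" "s \<in> carrier B - cB P" "x = germ B (cB P) a s" .
      have s: "s \<in> carrier C - P" using x(2) by simp
      show ?thesis unfolding x(3) SB.smap_germ[OF P(1) x(1,2)] frac_lift_hom.lift_frac[OF F SB.A_C[OF x(1)] s]
        using G2.pull_germ[OF Q(2) x(1), of s] x(1,2) P(3) by (simp add: \<theta>B)
    qed
    show ?thesis using P lA lB by (intro exI[of _ P]) simp
  qed
  show ?thesis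
  proof (rule glue_morphisms[OF chart_left chart_right G1 G2 cover])
    fix Q assume Q: "Q \<in> D1" "Q \<in> D2"
    obtain P where P: "primeideal P C" "G1.ctr Q = cA P" "G2.ctr Q = cB P"
      and eq: "\<And>x y. x \<in> carrier (stalk_at A (cA P)) \<Longrightarrow> y \<in> carrier (stalk_at B (cB P)) \<Longrightarrow> SA.smap P x = SB.smap P y \<Longrightarrow> G1.pull Q x = G2.pull Q y"
      using key[OF Q] by blast
    show "inl (G1.ctr Q) = inr (G2.ctr Q)" unfolding P(2,3) by (rule inl_cA[OF P(1)])
    fix W S assume W: "openin (top_of X) W" and S: "S \<in> carrier (sections X W)" and m: "inl (G1.ctr Q) \<in> W"
    have mA: "cA P \<in> pA W" using m SA.cut_prime[OF P(1)] unfolding P(2) by simp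
    note mB = mA[unfolded same[OF P(1)]]
    show "G1.pull Q (fst S (G1.ctr Q)) = G2.pull Q (snd S (G2.ctr Q))"
      unfolding P(2,3)
      by (rule eq[OF sec_stalk[OF secX_fst[OF W S] mA] sec_stalk[OF secX_snd[OF W S] mB] secX_agree[OF W S P(1) mA]])
  qed
qed

text \<open>Inside \<open>Spec A\<close> the overlap consists of the primes that avoid
  \<open>e\<close>, and avoiding the contraction means becoming a unit in the stalk.\<close>

lemma overlap_unit:
  assumes R: "algebra K R" and f: "f \<in> rmors K (Spec R) X" and Q: "primeideal Q R" and m: "pt f Q \<in> CA.patch"
  shows "CA.chart_hom f Q e \<in> Units (stalk_at R Q) \<longleftrightarrow> pt f Q \<in> CB.patch"
proof -
  interpret F: chart_pt K A X inl fst R f by (intro chart_pt.intro chart_pt_axioms.intro spec_ring.intro chart_left R f)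
  have d: "Q \<in> F.dmn" using Q m by blast
  have "pt f Q \<in> CB.patch \<longleftrightarrow> e \<notin> F.G.ctr Q"
    unfolding F.pt_eq[OF d] by (rule inl_patch[OF F.G.ctr_prime[OF d]])
  also have "\<dots> \<longleftrightarrow> CA.chart_hom f Q e \<in> Units (stalk_at R Q)" using SA.e_A unfolding contr_def by blast
  finally show ?thesis by (rule sym)
qed

text \<open>Functions from different charts can be multiplied over the intersection of the patches.
  The identity is verified there in the stalks of \<open>C\<close>, where it is the assumed
  equation, and the comorphism then carries it to the stalk at \<open>Q\<close>. It will relate the
  two normalizations of coordinates.\<close>

lemma overlap_mult:
  assumes R: "algebra K R" and f: "f \<in> rmors K (Spec R) X" and Q: "primeideal Q R"
    and m: "pt f Q \<in> CA.patch" "pt f Q \<in> CB.patch"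
    and a: "a \<in> carrier A" and b: "b \<in> carrier B" and a': "a' \<in> carrier A" "a \<otimes>\<^bsub>C\<^esub> b = a'"
  shows "CA.chart_hom f Q a \<otimes>\<^bsub>stalk_at R Q\<^esub> CB.chart_hom f Q b = CA.chart_hom f Q a'"
proof -
  interpret FA: chart_pt K A X inl fst R f by (intro chart_pt.intro chart_pt_axioms.intro spec_ring.intro chart_left R f)
  interpret FB: chart_pt K B X inr snd R f by (intro chart_pt.intro chart_pt_axioms.intro spec_ring.intro chart_right R f)
  let ?W = "CA.patch \<inter> CB.patch"
  have W: "openin (top_of X) ?W" using CA.patch_open CB.patch_open by (rule openin_Int)
  have sub: "?W \<subseteq> CA.patch" "?W \<subseteq> CB.patch" by blast+
  have ptW: "pt f Q \<in> ?W" using m by blast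
  let ?a = "restr X CA.patch ?W (CA.chart_sec a)" and ?a' = "restr X CA.patch ?W (CA.chart_sec a')"
    and ?b = "restr X CB.patch ?W (CB.chart_sec b)"
  have c: "?a \<in> carrier (sections X ?W)" "?a' \<in> carrier (sections X ?W)" "?b \<in> carrier (sections X ?W)"
    using CA.restr_closed[OF CA.patch_open W sub(1) CA.chart_sec(1)] CA.restr_closed[OF CB.patch_open W sub(2) CB.chart_sec(1)] a b a' by simp_all
  have "?a \<otimes>\<^bsub>sections X ?W\<^esub> ?b = ?a'"
  proof (rule CA.\<sigma>_inj[OF W sub(1) _ c(2)])
    show "?a \<otimes>\<^bsub>sections X ?W\<^esub> ?b \<in> carrier (sections X ?W)"
      using CA.sec_closed[OF W] c by (simp add: sections_closed_def)
    fix P assume P: "P \<in> pA ?W"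
    then have "inl P \<in> CB.patch" "primeideal P A" by blast+
    then have "e \<notin> P" using inl_patch by blast
    then obtain T where T: "primeideal T C" "P = cA T" using SA.cut_surj[OF \<open>primeideal P A\<close>] by blast
    interpret T: primeideal T C by fact
    note P = P[unfolded T(2)]
    note P' = P[unfolded same[OF T(1)]]
    have PA: "primeideal (cA T) A" and PB: "primeideal (cB T) B" using SA.cut_prime[OF T(1)] SB.cut_prime[OF T(1)] by simp_all
    note hom = stalk_map_hom[OF SA.A.alg SA.C.alg SA.incl T(1)]
    have f1: "fst ?a (cA T) = germ A (cA T) a \<one>\<^bsub>A\<^esub>" and f2: "fst ?a' (cA T) = germ A (cA T) a' \<one>\<^bsub>A\<^esub>"
      and f3: "snd ?b (cB T) = germ B (cB T) b \<one>\<^bsub>B\<^esub>"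
      unfolding X_restr fst_conv snd_conv restrict_apply'[OF P] restrict_apply'[OF P'] CA.chart_sec(2)[OF a] CA.chart_sec(2)[OF a'(1)] CB.chart_sec(2)[OF b]
      using PA PB by simp_all
    have sA: "\<one>\<^bsub>A\<^esub> \<in> carrier A - cA T" "\<one>\<^bsub>B\<^esub> \<in> carrier B - cB T"
      using SA.A.one_closed SB.A.one_closed primeideal.one_notin[OF PA] primeideal.one_notin[OF PB] by (simp_all only: Diff_iff simp_thms)
    have "SA.smap T (fst ?b (cA T)) = germ C T b \<one>\<^bsub>B\<^esub>"
      unfolding secX_agree[OF W c(3) T(1) P] f3 SB.smap_germ[OF T(1) b sA(2)] ..
    then have 1: "SA.smap T (fst ?b (cA T)) = germ C T b \<one>\<^bsub>C\<^esub>" unfolding SB.A_one .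
    have 2: "SA.smap T (germ A (cA T) a \<one>\<^bsub>A\<^esub>) = germ C T a \<one>\<^bsub>C\<^esub>" "SA.smap T (germ A (cA T) a' \<one>\<^bsub>A\<^esub>) = germ C T a' \<one>\<^bsub>C\<^esub>"
      using SA.smap_germ[OF T(1) _ sA(1)] a a' SA.A_one by simp_all
    have g: "germ A (cA T) a \<one>\<^bsub>A\<^esub> \<in> carrier (stalk_at A (cA T))" "germ A (cA T) a' \<one>\<^bsub>A\<^esub> \<in> carrier (stalk_at A (cA T))"
      using SA.A.germ_carrier[OF PA _ sA(1)] a a' by simp_all
    have bb: "fst ?b (cA T) \<in> carrier (stalk_at A (cA T))" by (rule sec_stalk[OF secX_fst[OF W c(3)] P])
    interpret L: cring "stalk_at A (cA T)" by (rule SA.A.st_cring[OF PA])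
    have "fst (?a \<otimes>\<^bsub>sections X ?W\<^esub> ?b) (cA T) = germ A (cA T) a \<one>\<^bsub>A\<^esub> \<otimes>\<^bsub>stalk_at A (cA T)\<^esub> fst ?b (cA T)"
      unfolding X_ops sections_simps(1)[OF P] f1 ..
    also have "\<dots> = germ A (cA T) a' \<one>\<^bsub>A\<^esub>"
    proof (rule SA.smap_inj[OF T(1) L.m_closed[OF g(1) bb] g(2)])
      have oC: "\<one>\<^bsub>C\<^esub> \<in> carrier C - T" using T.one_notin by simp
      show "SA.smap T (germ A (cA T) a \<one>\<^bsub>A\<^esub> \<otimes>\<^bsub>stalk_at A (cA T)\<^esub> fst ?b (cA T)) = SA.smap T (germ A (cA T) a' \<one>\<^bsub>A\<^esub>)"
        unfolding alg_hom_mult[OF hom g(1) bb] 1 2 using SA.C.st_mult[OF T(1) SA.A_C[OF a] oC SB.A_C[OF b] oC] a'(2) by simp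
    qed
    finally show "fst (?a \<otimes>\<^bsub>sections X ?W\<^esub> ?b) P = fst ?a' P" unfolding T(2) f2 .
  qed
  from arg_cong[OF this, of "\<lambda>s. comor f ?W s Q"]
  show ?thesis
    unfolding alg_hom_mult[OF FA.eval_hom[OF W Q ptW] c(1,3)] CA.chart_hom_def CB.chart_hom_def
      FA.comor_restr[OF CA.patch_open W sub(1) CA.chart_sec(1)[OF a] Q ptW]
      FA.comor_restr[OF CA.patch_open W sub(1) CA.chart_sec(1)[OF a'(1)] Q ptW]
      FA.comor_restr[OF CB.patch_open W sub(2) CB.chart_sec(1)[OF b] Q ptW] .
qed

end

section \<open>Laurent polynomial algebras\<close>

lemma (in abelian_monoid) finsum_swap:
  assumes "finite A" "finite B" "\<And>a b. a \<in> A \<Longrightarrow> b \<in> B \<Longrightarrow> f a b \<in> carrier G"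
  shows "(\<Oplus>a\<in>A. \<Oplus>b\<in>B. f a b) = (\<Oplus>b\<in>B. \<Oplus>a\<in>A. f a b)"
  using assms(1,3)
proof (induction A rule: finite_induct)
  case empty show ?case by simp
next
  case (insert x A)
  then have "(\<Oplus>a\<in>insert x A. \<Oplus>b\<in>B. f a b) = (\<Oplus>b\<in>B. f x b) \<oplus> (\<Oplus>b\<in>B. \<Oplus>a\<in>A. f a b)"
    by (subst finsum_insert) (auto intro!: finsum_closed)
  also have "\<dots> = (\<Oplus>b\<in>B. f x b \<oplus> (\<Oplus>a\<in>A. f a b))"
    using insert by (intro finsum_addf[symmetric]) (auto intro!: finsum_closed)
  also have "\<dots> = (\<Oplus>b\<in>B. \<Oplus>a\<in>insert x A. f a b)"
    using insert by (intro finsum_cong') (auto intro!: finsum_closed)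
  finally show ?case .
qed

lemma (in module) finsum_smult_rdistr:
  assumes "finite A" "x \<in> carrier M" "\<And>i. i \<in> A \<Longrightarrow> f i \<in> carrier R"
  shows "(\<Oplus>\<^bsub>R\<^esub>i\<in>A. f i) \<odot>\<^bsub>M\<^esub> x = (\<Oplus>\<^bsub>M\<^esub>i\<in>A. f i \<odot>\<^bsub>M\<^esub> x)"
  using assms(1,3)
proof (induction A rule: finite_induct)
  case empty show ?case using assms(2) by simp
next
  case (insert i A)
  have "f i \<in> carrier R" "(\<Oplus>\<^bsub>R\<^esub>i\<in>A. f i) \<in> carrier R" using insert by (auto intro!: R.finsum_closed)
  then have "(\<Oplus>\<^bsub>R\<^esub>i\<in>insert i A. f i) \<odot>\<^bsub>M\<^esub> x = f i \<odot>\<^bsub>M\<^esub> x \<oplus>\<^bsub>M\<^esub> (\<Oplus>\<^bsub>M\<^esub>i\<in>A. f i \<odot>\<^bsub>M\<^esub> x)"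
    using insert assms(2) by (subst R.finsum_insert) (auto simp: smult_l_distr)
  also have "\<dots> = (\<Oplus>\<^bsub>M\<^esub>i\<in>insert i A. f i \<odot>\<^bsub>M\<^esub> x)"
    using insert assms(2) by (subst M.finsum_insert) auto
  finally show ?case .
qed

lemma (in abelian_monoid) finsum_superset:
  assumes "finite B" "A \<subseteq> B" "\<And>i. i \<in> B - A \<Longrightarrow> f i = \<zero>" "\<And>i. i \<in> A \<Longrightarrow> f i \<in> carrier G"
  shows "finsum G f A = finsum G f B"
proof -
  have "f i \<in> carrier G" if "i \<in> B" for i using that assms(3,4)[of i] by (cases "i \<in> A") auto
  then show ?thesis using assms by (intro add.finprod_mono_neutral_cong_left) auto
qed

abbreviation mon :: "('k, 'm) ring_scheme \<Rightarrow> int \<Rightarrow> int \<Rightarrow> 'k" where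
  "mon K a \<equiv> (\<lambda>b. if b = a then \<one>\<^bsub>K\<^esub> else \<zero>\<^bsub>K\<^esub>)"

abbreviation supp :: "('k, 'm) ring_scheme \<Rightarrow> (int \<Rightarrow> 'k) \<Rightarrow> int set" where
  "supp K f \<equiv> {a. f a \<noteq> \<zero>\<^bsub>K\<^esub>}"

locale laurent = cring K for K :: "('k, 'm) ring_scheme" (structure) +
  fixes S :: "int set"
  assumes S0: "0 \<in> S" and S_add: "a \<in> S \<Longrightarrow> b \<in> S \<Longrightarrow> a + b \<in> S"
begin

abbreviation "L \<equiv> laurent_algebra K S"

lemma L_carrier: "f \<in> carrier L \<longleftrightarrow> (\<forall>a. f a \<in> carrier K) \<and> finite (supp K f) \<and> (\<forall>a. a \<notin> S \<longrightarrow> f a = \<zero>)"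
  by (simp add: laurent_algebra_def)

lemma coeff: "f \<in> carrier L \<Longrightarrow> f a \<in> carrier K"
  and supp_finite: "f \<in> carrier L \<Longrightarrow> finite (supp K f)"
  and supp_sub: "f \<in> carrier L \<Longrightarrow> f a \<noteq> \<zero> \<Longrightarrow> a \<in> S"
  unfolding L_carrier by blast+

lemma L_add: "(f \<oplus>\<^bsub>L\<^esub> g) a = f a \<oplus> g a" and L_smult: "(c \<odot>\<^bsub>L\<^esub> f) a = c \<otimes> f a"
  and L_zero: "\<zero>\<^bsub>L\<^esub> = (\<lambda>a. \<zero>)" and L_one: "\<one>\<^bsub>L\<^esub> = mon K 0"
  by (simp_all add: laurent_algebra_def fun_eq_iff)

text \<open>The freedom in the choice of \<open>F\<close> allows several products to be written as
  sums over one common index set.\<close>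

lemma L_mult:
  assumes f: "f \<in> carrier L" and g: "\<And>a. g a \<in> carrier K" and F: "finite F" "supp K f \<subseteq> F"
  shows "(f \<otimes>\<^bsub>L\<^esub> g) a = (\<Oplus>b\<in>F. f b \<otimes> g (a - b))"
proof -
  note [simp] = coeff[OF f] g
  have "(f \<otimes>\<^bsub>L\<^esub> g) a = (\<Oplus>b\<in>supp K f. f b \<otimes> g (a - b))" by (simp add: laurent_algebra_def)
  also have "\<dots> = (\<Oplus>b\<in>F. f b \<otimes> g (a - b))"
    by (rule finsum_superset) (use assms in auto)
  finally show ?thesis .
qed

lemma L_mult_nonzero:
  assumes f: "f \<in> carrier L" and g: "g \<in> carrier L" and nz: "(f \<otimes>\<^bsub>L\<^esub> g) a \<noteq> \<zero>"
  shows "\<exists>b c. f b \<noteq> \<zero> \<and> g c \<noteq> \<zero> \<and> a = b + c"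
proof (rule ccontr)
  note [simp] = coeff[OF f] coeff[OF g]
  assume n: "\<not> ?thesis"
  have "g (a - b) = \<zero>" if "f b \<noteq> \<zero>" for b using n that by (metis add.commute diff_add_cancel)
  then have "(\<Oplus>b\<in>supp K f. f b \<otimes> g (a - b)) = (\<Oplus>b\<in>supp K f. \<zero>)"
    using f by (intro finsum_cong') auto
  then show False using nz L_mult[OF f coeff[OF g] supp_finite[OF f] order_refl] by simp
qed

lemma L_mult_closed:
  assumes f: "f \<in> carrier L" and g: "g \<in> carrier L"
  shows "f \<otimes>\<^bsub>L\<^esub> g \<in> carrier L"
  unfolding L_carrier
proof (intro conjI allI impI)
  show "(f \<otimes>\<^bsub>L\<^esub> g) a \<in> carrier K" for a
    unfolding L_mult[OF f coeff[OF g] supp_finite[OF f] order_refl] by (intro finsum_closed) (simp add: coeff[OF f] coeff[OF g])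
  have "supp K (f \<otimes>\<^bsub>L\<^esub> g) \<subseteq> (\<lambda>(b, c). b + c) ` (supp K f \<times> supp K g)"
    using L_mult_nonzero[OF f g] by fastforce
  then show "finite (supp K (f \<otimes>\<^bsub>L\<^esub> g))"
    by (rule finite_subset) (use supp_finite[OF f] supp_finite[OF g] in auto)
  show "(f \<otimes>\<^bsub>L\<^esub> g) a = \<zero>" if "a \<notin> S" for a
    using L_mult_nonzero[OF f g, of a] supp_sub[OF f] supp_sub[OF g] S_add that by blast
qed

lemma L_mult_comm:
  assumes f: "f \<in> carrier L" and g: "g \<in> carrier L"
  shows "f \<otimes>\<^bsub>L\<^esub> g = g \<otimes>\<^bsub>L\<^esub> f"
proof
  fix a
  note [simp] = coeff[OF f] coeff[OF g]
  \<comment> \<open>The set contains the support of \<open>f\<close>, and its reflection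
    \<open>b \<mapsto> a - b\<close> contains that of \<open>g\<close>. So either convolution can be
    written as a sum over it or over its reflection.\<close>
  let ?H = "supp K f \<union> (\<lambda>b. a - b) ` supp K g"
  have H: "finite ?H" "supp K f \<subseteq> ?H" by (intro finite_UnI finite_imageI supp_finite f g) auto
  have H': "finite ((\<lambda>b. a - b) ` ?H)" "supp K g \<subseteq> (\<lambda>b. a - b) ` ?H"
    by (intro finite_imageI H(1)) (auto simp: image_Un image_image)
  have "(g \<otimes>\<^bsub>L\<^esub> f) a = (\<Oplus>b\<in>(\<lambda>b. a - b) ` ?H. g b \<otimes> f (a - b))" by (rule L_mult[OF g coeff[OF f] H'])
  also have "\<dots> = (\<Oplus>b\<in>?H. g (a - b) \<otimes> f (a - (a - b)))"
    by (rule finsum_reindex) (use f g in \<open>auto simp: inj_on_def\<close>)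
  also have "\<dots> = (\<Oplus>b\<in>?H. f b \<otimes> g (a - b))"
    by (rule finsum_cong') (use f g in \<open>auto simp: m_comm\<close>)
  also have "\<dots> = (f \<otimes>\<^bsub>L\<^esub> g) a" by (rule L_mult[OF f coeff[OF g] H, symmetric])
  finally show "(f \<otimes>\<^bsub>L\<^esub> g) a = (g \<otimes>\<^bsub>L\<^esub> f) a" by simp
qed

lemma L_mult_assoc:
  assumes f: "f \<in> carrier L" and g: "g \<in> carrier L" and h: "h \<in> carrier L"
  shows "(f \<otimes>\<^bsub>L\<^esub> g) \<otimes>\<^bsub>L\<^esub> h = f \<otimes>\<^bsub>L\<^esub> (g \<otimes>\<^bsub>L\<^esub> h)"
proof
  fix a
  let ?F = "supp K f" and ?G = "supp K g"
  let ?H = "(\<lambda>(b, c). b + c) ` (?F \<times> ?G)"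
  note fin = supp_finite[OF f] supp_finite[OF g]
  have H: "finite ?H" using fin by auto
  have sH: "supp K (f \<otimes>\<^bsub>L\<^esub> g) \<subseteq> ?H" using L_mult_nonzero[OF f g] by fastforce
  note [simp] = coeff[OF f] coeff[OF g] coeff[OF h] coeff[OF L_mult_closed[OF f g]] coeff[OF L_mult_closed[OF g h]]
  have "((f \<otimes>\<^bsub>L\<^esub> g) \<otimes>\<^bsub>L\<^esub> h) a = (\<Oplus>c\<in>?H. (f \<otimes>\<^bsub>L\<^esub> g) c \<otimes> h (a - c))"
    by (rule L_mult[OF L_mult_closed[OF f g] coeff[OF h] H sH])
  also have "\<dots> = (\<Oplus>c\<in>?H. \<Oplus>b\<in>?F. f b \<otimes> g (c - b) \<otimes> h (a - c))"
    by (rule finsum_cong') (auto simp: L_mult[OF f coeff[OF g] fin(1) order_refl] intro!: finsum_ldistr fin finsum_closed)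
  also have "\<dots> = (\<Oplus>b\<in>?F. \<Oplus>c\<in>?H. f b \<otimes> g (c - b) \<otimes> h (a - c))"
    by (rule finsum_swap[OF H fin(1)]) auto
  also have "\<dots> = (\<Oplus>b\<in>?F. f b \<otimes> (g \<otimes>\<^bsub>L\<^esub> h) (a - b))"
  proof (rule finsum_cong')
    fix b assume b: "b \<in> ?F"
    \<comment> \<open>For fixed \<open>b\<close> only the exponents \<open>b + d\<close> with
      \<open>d\<close> in the support of \<open>g\<close> contribute.\<close>
    have "(\<Oplus>c\<in>?H. f b \<otimes> g (c - b) \<otimes> h (a - c)) = (\<Oplus>c\<in>(\<lambda>d. b + d) ` ?G. f b \<otimes> g (c - b) \<otimes> h (a - c))"
    proof (rule finsum_superset[symmetric, OF H])
      show "(\<lambda>d. b + d) ` ?G \<subseteq> ?H" using b by auto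
      fix c assume "c \<in> ?H - (\<lambda>d. b + d) ` ?G"
      then have "g (c - b) = \<zero>" by (metis (mono_tags, lifting) DiffD2 add.commute diff_add_cancel image_eqI mem_Collect_eq)
      then show "f b \<otimes> g (c - b) \<otimes> h (a - c) = \<zero>" by simp
    qed simp
    also have "\<dots> = (\<Oplus>d\<in>?G. f b \<otimes> g (b + d - b) \<otimes> h (a - (b + d)))"
      by (rule finsum_reindex) auto
    also have "\<dots> = (\<Oplus>d\<in>?G. f b \<otimes> (g d \<otimes> h (a - b - d)))"
      by (rule finsum_cong') (auto simp: m_assoc algebra_simps)
    also have "\<dots> = f b \<otimes> (\<Oplus>d\<in>?G. g d \<otimes> h (a - b - d))"
      by (rule finsum_rdistr[symmetric]) (auto intro: fin)
    also have "\<dots> = f b \<otimes> (g \<otimes>\<^bsub>L\<^esub> h) (a - b)"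
      by (simp only: L_mult[OF g coeff[OF h] fin(2) order_refl])
    finally show "(\<Oplus>c\<in>?H. f b \<otimes> g (c - b) \<otimes> h (a - c)) = f b \<otimes> (g \<otimes>\<^bsub>L\<^esub> h) (a - b)" .
  qed (use L_mult_closed[OF g h] in auto)
  also have "\<dots> = (f \<otimes>\<^bsub>L\<^esub> (g \<otimes>\<^bsub>L\<^esub> h)) a"
    by (rule L_mult[OF f coeff[OF L_mult_closed[OF g h]] fin(1) order_refl, symmetric])
  finally show "((f \<otimes>\<^bsub>L\<^esub> g) \<otimes>\<^bsub>L\<^esub> h) a = (f \<otimes>\<^bsub>L\<^esub> (g \<otimes>\<^bsub>L\<^esub> h)) a" .
qed

lemma mono_carrier [simp]: "a \<in> S \<Longrightarrow> mon K a \<in> carrier L"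
  by (auto simp: L_carrier)

lemma mono_mult:
  assumes a: "a \<in> S" and g: "g \<in> carrier L"
  shows "mon K a \<otimes>\<^bsub>L\<^esub> g = (\<lambda>b. g (b - a))"
proof
  fix b
  have "(mon K a \<otimes>\<^bsub>L\<^esub> g) b = (\<Oplus>c\<in>{a}. mon K a c \<otimes> g (b - c))"
    by (rule L_mult[OF mono_carrier[OF a] coeff[OF g]]) auto
  then show "(mon K a \<otimes>\<^bsub>L\<^esub> g) b = g (b - a)" by (simp add: coeff[OF g])
qed

lemma L_add_closed: assumes f: "f \<in> carrier L" and g: "g \<in> carrier L" shows "f \<oplus>\<^bsub>L\<^esub> g \<in> carrier L"
proof -
  note [simp] = coeff[OF f] coeff[OF g]
  have "supp K (f \<oplus>\<^bsub>L\<^esub> g) \<subseteq> supp K f \<union> supp K g" by (auto simp: L_add)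
  then have "finite (supp K (f \<oplus>\<^bsub>L\<^esub> g))" by (rule finite_subset) (use supp_finite[OF f] supp_finite[OF g] in auto)
  then show ?thesis using f g by (simp add: L_carrier L_add)
qed

lemma L_smult_closed: assumes c: "c \<in> carrier K" and f: "f \<in> carrier L" shows "c \<odot>\<^bsub>L\<^esub> f \<in> carrier L"
proof -
  note [simp] = coeff[OF f]
  have "supp K (c \<odot>\<^bsub>L\<^esub> f) \<subseteq> supp K f" using c by (auto simp: L_smult)
  then have "finite (supp K (c \<odot>\<^bsub>L\<^esub> f))" by (rule finite_subset) (use supp_finite[OF f] in auto)
  then show ?thesis using f c by (simp add: L_carrier L_smult)
qed

lemma L_cring: "cring L"
proof (rule cringI)
  show "abelian_group L"
  proof (rule abelian_groupI)
    show "\<zero>\<^bsub>L\<^esub> \<in> carrier L" by (simp add: L_carrier L_zero)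
    fix f assume f: "f \<in> carrier L"
    note [simp] = coeff[OF f]
    show "\<zero>\<^bsub>L\<^esub> \<oplus>\<^bsub>L\<^esub> f = f" using f by (simp add: fun_eq_iff L_add L_zero)
    show "\<exists>g\<in>carrier L. g \<oplus>\<^bsub>L\<^esub> f = \<zero>\<^bsub>L\<^esub>"
    proof (rule bexI)
      have "(\<ominus> \<one>) \<odot>\<^bsub>L\<^esub> f = (\<lambda>a. \<ominus> f a)" using f by (simp add: fun_eq_iff L_smult l_minus)
      then show "(\<lambda>a. \<ominus> f a) \<in> carrier L" using L_smult_closed[OF _ f, of "\<ominus> \<one>"] by simp
      show "(\<lambda>a. \<ominus> f a) \<oplus>\<^bsub>L\<^esub> f = \<zero>\<^bsub>L\<^esub>" using f by (simp add: fun_eq_iff L_add L_zero l_neg)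
    qed
  qed (auto simp: L_add_closed fun_eq_iff L_add a_ac coeff)
  show "comm_monoid L"
  proof (rule comm_monoidI)
    show one: "\<one>\<^bsub>L\<^esub> \<in> carrier L" using S0 by (simp add: L_one)
    show "\<one>\<^bsub>L\<^esub> \<otimes>\<^bsub>L\<^esub> f = f" if "f \<in> carrier L" for f
      using mono_mult[OF S0 that] by (simp add: L_one)
  qed (auto intro: L_mult_closed L_mult_assoc L_mult_comm)
  fix f g h assume f: "f \<in> carrier L" and g: "g \<in> carrier L" and h: "h \<in> carrier L"
  note [simp] = coeff[OF f] coeff[OF g] coeff[OF h]
  show "(f \<oplus>\<^bsub>L\<^esub> g) \<otimes>\<^bsub>L\<^esub> h = f \<otimes>\<^bsub>L\<^esub> h \<oplus>\<^bsub>L\<^esub> g \<otimes>\<^bsub>L\<^esub> h"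
  proof
    fix a
    let ?F = "supp K f \<union> supp K g"
    have F: "finite ?F" "supp K f \<subseteq> ?F" "supp K g \<subseteq> ?F" "supp K (f \<oplus>\<^bsub>L\<^esub> g) \<subseteq> ?F"
      using supp_finite[OF f] supp_finite[OF g] by (auto simp: L_add)
    have "((f \<oplus>\<^bsub>L\<^esub> g) \<otimes>\<^bsub>L\<^esub> h) a = (\<Oplus>b\<in>?F. (f b \<oplus> g b) \<otimes> h (a - b))"
      by (simp only: L_mult[OF L_add_closed[OF f g] coeff[OF h] F(1,4)] L_add)
    also have "\<dots> = (\<Oplus>b\<in>?F. f b \<otimes> h (a - b) \<oplus> g b \<otimes> h (a - b))"
      by (rule finsum_cong') (use f g h in \<open>auto simp: l_distr\<close>)
    also have "\<dots> = (\<Oplus>b\<in>?F. f b \<otimes> h (a - b)) \<oplus> (\<Oplus>b\<in>?F. g b \<otimes> h (a - b))"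
      by (rule finsum_addf) (use f g h in auto)
    finally show "((f \<oplus>\<^bsub>L\<^esub> g) \<otimes>\<^bsub>L\<^esub> h) a = (f \<otimes>\<^bsub>L\<^esub> h \<oplus>\<^bsub>L\<^esub> g \<otimes>\<^bsub>L\<^esub> h) a"
      by (simp only: L_add L_mult[OF f coeff[OF h] F(1,2)] L_mult[OF g coeff[OF h] F(1,3)])
  qed
qed

lemma L_algebra: "algebra K L"
proof (rule algebraI)
  fix c f g assume c: "c \<in> carrier K" and f: "f \<in> carrier L" and g: "g \<in> carrier L"
  note [simp] = coeff[OF f] coeff[OF g] c
  show "(c \<odot>\<^bsub>L\<^esub> f) \<otimes>\<^bsub>L\<^esub> g = c \<odot>\<^bsub>L\<^esub> (f \<otimes>\<^bsub>L\<^esub> g)"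
  proof
    fix a
    have s: "supp K (c \<odot>\<^bsub>L\<^esub> f) \<subseteq> supp K f" using c by (auto simp: L_smult)
    have "((c \<odot>\<^bsub>L\<^esub> f) \<otimes>\<^bsub>L\<^esub> g) a = (\<Oplus>b\<in>supp K f. c \<otimes> f b \<otimes> g (a - b))"
      by (simp only: L_mult[OF L_smult_closed[OF c f] coeff[OF g] supp_finite[OF f] s] L_smult)
    also have "\<dots> = (\<Oplus>b\<in>supp K f. c \<otimes> (f b \<otimes> g (a - b)))"
      by (rule finsum_cong') (use c f g in \<open>auto simp: m_assoc\<close>)
    also have "\<dots> = c \<otimes> (\<Oplus>b\<in>supp K f. f b \<otimes> g (a - b))"
      by (rule finsum_rdistr[symmetric]) (use c f g supp_finite[OF f] in auto)
    finally show "((c \<odot>\<^bsub>L\<^esub> f) \<otimes>\<^bsub>L\<^esub> g) a = (c \<odot>\<^bsub>L\<^esub> (f \<otimes>\<^bsub>L\<^esub> g)) a"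
      by (simp only: L_smult L_mult[OF f coeff[OF g] supp_finite[OF f] order_refl])
  qed
qed (auto simp: L_cring L_smult_closed fun_eq_iff L_smult L_add l_distr r_distr m_assoc coeff intro: is_cring)

lemma incl_alg_hom:
  assumes "S \<subseteq> S'" shows "(\<lambda>f. f) \<in> alg_hom K L (laurent_algebra K S')"
  by (rule alg_homI) (use assms in \<open>auto simp: laurent_algebra_def\<close>)

lemma mono_mono: "a \<in> S \<Longrightarrow> b \<in> S \<Longrightarrow> mon K a \<otimes>\<^bsub>L\<^esub> mon K b = mon K (a + b)"
  by (auto simp: mono_mult fun_eq_iff)

lemma mono_pow: "a \<in> S \<Longrightarrow> int k * a \<in> S \<and> mon K a [^]\<^bsub>L\<^esub> k = mon K (int k * a)"
proof (induction k)
  case 0 then show ?case using S0 by (simp add: L_one)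
next
  case (Suc k)
  then show ?case using S_add[of "int k * a" a] mono_mono[of "int k * a" a]
    by (simp add: algebra_simps)
qed

lemma expand:
  assumes f: "f \<in> carrier L"
  shows "f = (\<Oplus>\<^bsub>L\<^esub>a\<in>supp K f. f a \<odot>\<^bsub>L\<^esub> mon K a)"
proof -
  interpret L: cring L by (rule L_cring)
  have "F \<subseteq> S \<Longrightarrow> (\<Oplus>\<^bsub>L\<^esub>a\<in>F. f a \<odot>\<^bsub>L\<^esub> mon K a) = (\<lambda>b. if b \<in> F then f b else \<zero>)" if "finite F" for F
    using that
  proof (induction F)
    case empty show ?case by (simp add: L_zero)
  next
    case (insert x F)
    then have "(\<Oplus>\<^bsub>L\<^esub>a\<in>insert x F. f a \<odot>\<^bsub>L\<^esub> mon K a) = f x \<odot>\<^bsub>L\<^esub> mon K x \<oplus>\<^bsub>L\<^esub> (\<lambda>b. if b \<in> F then f b else \<zero>)"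
      by (subst L.finsum_insert) (auto intro!: L_smult_closed coeff[OF f])
    then show ?case
      by (simp only:) (rule ext, use insert coeff[OF f] in \<open>simp add: L_add L_smult\<close>)
  qed
  from this[OF supp_finite[OF f]] supp_sub[OF f]
  have "(\<Oplus>\<^bsub>L\<^esub>a\<in>supp K f. f a \<odot>\<^bsub>L\<^esub> mon K a) = (\<lambda>b. if b \<in> supp K f then f b else \<zero>)" by blast
  also have "\<dots> = f" by auto
  finally show ?thesis by simp
qed

text \<open>Makes a homomorphism visible as determined by its values on monomials; the comparison
  lemmas for the two coordinate rings rest on this.\<close>

lemma alg_hom_expand:
  assumes h: "h \<in> alg_hom K L R" and R: "algebra K R" and f: "f \<in> carrier L"
  shows "h f = (\<Oplus>\<^bsub>R\<^esub>a\<in>supp K f. f a \<odot>\<^bsub>R\<^esub> h (mon K a))"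
proof -
  interpret h: ring_hom_cring L R h by (rule alg_hom_ring_hom_cring[OF h L_algebra R])
  interpret R: algebra K R by (rule R)
  have "h f = h (\<Oplus>\<^bsub>L\<^esub>a\<in>supp K f. f a \<odot>\<^bsub>L\<^esub> mon K a)" using expand[OF f] by simp
  also have "\<dots> = (\<Oplus>\<^bsub>R\<^esub>a\<in>supp K f. h (f a \<odot>\<^bsub>L\<^esub> mon K a))"
    using supp_sub[OF f] by (subst h.hom_finsum) (auto intro!: L_smult_closed coeff[OF f] simp: o_def)
  also have "\<dots> = (\<Oplus>\<^bsub>R\<^esub>a\<in>supp K f. f a \<odot>\<^bsub>R\<^esub> h (mon K a))"
    using supp_sub[OF f] by (intro h.S.finsum_cong') (auto simp: alg_hom_smult[OF h coeff[OF f]] coeff[OF f])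
  finally show ?thesis .
qed

section \<open>Homomorphisms out of Laurent algebras from multiplicative maps\<close>

definition ev :: "('k, 'u) module \<Rightarrow> (int \<Rightarrow> 'u) \<Rightarrow> (int \<Rightarrow> 'k) \<Rightarrow> 'u" where
  "ev R m f = (\<Oplus>\<^bsub>R\<^esub>a\<in>supp K f. f a \<odot>\<^bsub>R\<^esub> m a)"

context
  fixes R :: "('k, 'u) module" and m :: "int \<Rightarrow> 'u"
  assumes R: "algebra K R" and m_closed: "\<And>a. a \<in> S \<Longrightarrow> m a \<in> carrier R"
    and m_one: "m 0 = \<one>\<^bsub>R\<^esub>" and m_add: "\<And>a b. a \<in> S \<Longrightarrow> b \<in> S \<Longrightarrow> m (a + b) = m a \<otimes>\<^bsub>R\<^esub> m b"
begin

lemma ev_superset: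
  assumes f: "f \<in> carrier L" and F: "finite F" "supp K f \<subseteq> F" "F \<subseteq> S"
  shows "ev R m f = (\<Oplus>\<^bsub>R\<^esub>a\<in>F. f a \<odot>\<^bsub>R\<^esub> m a)"
proof -
  note [simp] = coeff[OF f]
  interpret R: algebra K R by (rule R)
  have z: "\<zero> \<odot>\<^bsub>R\<^esub> x = \<zero>\<^bsub>R\<^esub>" if "x \<in> carrier R" for x using that by simp
  show ?thesis unfolding ev_def
    by (rule R.finsum_superset) (use F f m_closed in \<open>auto intro!: z R.smult_closed\<close>)
qed

lemma ev_mono: assumes "a \<in> S" shows "ev R m (mon K a) = m a"
proof -
  interpret R: algebra K R by (rule R)
  have "ev R m (mon K a) = (\<Oplus>\<^bsub>R\<^esub>b\<in>{a}. mon K a b \<odot>\<^bsub>R\<^esub> m b)"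
    by (rule ev_superset) (use assms in auto)
  then show ?thesis using m_closed[OF assms] by simp
qed

text \<open>The universal property of a monoid algebra. The product formula reorders the double sum
  over pairs of exponents, and each term splits because \<open>m\<close> is multiplicative on
  \<open>S\<close>.\<close>

lemma ev_hom: "ev R m \<in> alg_hom K L R"
proof -
  interpret R: algebra K R by (rule R)
  show ?thesis
  proof (rule alg_homI)
    fix f assume f: "f \<in> carrier L"
    have fS: "supp K f \<subseteq> S" using supp_sub[OF f] by auto
    note Ff = supp_finite[OF f]
    note [simp] = coeff[OF f]
    show "ev R m f \<in> carrier R" unfolding ev_def using fS m_closed f by (intro R.finsum_closed) auto
    {
      fix c assume c: "c \<in> carrier K"
      have s: "supp K (c \<odot>\<^bsub>L\<^esub> f) \<subseteq> supp K f" using c by (auto simp: L_smult)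
      have "ev R m (c \<odot>\<^bsub>L\<^esub> f) = (\<Oplus>\<^bsub>R\<^esub>a\<in>supp K f. (c \<otimes> f a) \<odot>\<^bsub>R\<^esub> m a)"
        by (simp only: ev_superset[OF L_smult_closed[OF c f] Ff s fS] L_smult)
      also have "\<dots> = (\<Oplus>\<^bsub>R\<^esub>a\<in>supp K f. c \<odot>\<^bsub>R\<^esub> (f a \<odot>\<^bsub>R\<^esub> m a))"
        by (rule R.finsum_cong') (use fS m_closed c f in \<open>auto intro!: R.smult_assoc1 R.smult_closed\<close>)
      also have "\<dots> = c \<odot>\<^bsub>R\<^esub> (\<Oplus>\<^bsub>R\<^esub>a\<in>supp K f. f a \<odot>\<^bsub>R\<^esub> m a)"
        by (rule R.finsum_smult_ldistr[symmetric]) (use fS m_closed c f Ff in auto)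
      finally show "ev R m (c \<odot>\<^bsub>L\<^esub> f) = c \<odot>\<^bsub>R\<^esub> ev R m f" by (simp only: ev_def)
    }
    fix g assume g: "g \<in> carrier L"
    have gS: "supp K g \<subseteq> S" using supp_sub[OF g] by auto
    note Fg = supp_finite[OF g]
    note [simp] = coeff[OF f] coeff[OF g]
    show "ev R m (f \<oplus>\<^bsub>L\<^esub> g) = ev R m f \<oplus>\<^bsub>R\<^esub> ev R m g"
    proof -
      let ?F = "supp K f \<union> supp K g"
      have F: "finite ?F" "supp K f \<subseteq> ?F" "supp K g \<subseteq> ?F" "supp K (f \<oplus>\<^bsub>L\<^esub> g) \<subseteq> ?F" "?F \<subseteq> S"
        using Ff Fg fS gS by (auto simp: L_add)
      have "ev R m (f \<oplus>\<^bsub>L\<^esub> g) = (\<Oplus>\<^bsub>R\<^esub>a\<in>?F. (f a \<oplus> g a) \<odot>\<^bsub>R\<^esub> m a)"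
        by (simp only: ev_superset[OF L_add_closed[OF f g] F(1,4,5)] L_add)
      also have "\<dots> = (\<Oplus>\<^bsub>R\<^esub>a\<in>?F. f a \<odot>\<^bsub>R\<^esub> m a \<oplus>\<^bsub>R\<^esub> g a \<odot>\<^bsub>R\<^esub> m a)"
        by (rule R.finsum_cong') (use F m_closed in \<open>auto intro!: R.smult_l_distr\<close>)
      also have "\<dots> = (\<Oplus>\<^bsub>R\<^esub>a\<in>?F. f a \<odot>\<^bsub>R\<^esub> m a) \<oplus>\<^bsub>R\<^esub> (\<Oplus>\<^bsub>R\<^esub>a\<in>?F. g a \<odot>\<^bsub>R\<^esub> m a)"
        by (rule R.finsum_addf) (use F m_closed in auto)
      finally show ?thesis by (simp only: ev_superset[OF f F(1,2,5)] ev_superset[OF g F(1,3,5)])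
    qed
    show "ev R m (f \<otimes>\<^bsub>L\<^esub> g) = ev R m f \<otimes>\<^bsub>R\<^esub> ev R m g"
    proof -
      let ?F = "supp K f" and ?G = "supp K g"
      let ?H = "(\<lambda>(b, c). b + c) ` (?F \<times> ?G)"
      have H: "finite ?H" using Ff Fg by auto
      have sH: "supp K (f \<otimes>\<^bsub>L\<^esub> g) \<subseteq> ?H" using L_mult_nonzero[OF f g] by fastforce
      have HS: "?H \<subseteq> S" using fS gS S_add by auto
      have mH: "c \<in> ?H \<Longrightarrow> m c \<in> carrier R" for c using HS m_closed by auto
      have "ev R m (f \<otimes>\<^bsub>L\<^esub> g) = (\<Oplus>\<^bsub>R\<^esub>c\<in>?H. (\<Oplus>b\<in>?F. f b \<otimes> g (c - b)) \<odot>\<^bsub>R\<^esub> m c)"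
        by (simp only: ev_superset[OF L_mult_closed[OF f g] H sH HS] L_mult[OF f coeff[OF g] Ff order_refl])
      also have "\<dots> = (\<Oplus>\<^bsub>R\<^esub>c\<in>?H. \<Oplus>\<^bsub>R\<^esub>b\<in>?F. (f b \<otimes> g (c - b)) \<odot>\<^bsub>R\<^esub> m c)"
        by (rule R.finsum_cong') (use mH Ff in \<open>auto intro!: R.finsum_smult_rdistr R.finsum_closed\<close>)
      also have "\<dots> = (\<Oplus>\<^bsub>R\<^esub>b\<in>?F. \<Oplus>\<^bsub>R\<^esub>c\<in>?H. (f b \<otimes> g (c - b)) \<odot>\<^bsub>R\<^esub> m c)"
        by (rule R.finsum_swap[OF H Ff]) (use mH in auto)
      also have "\<dots> = (\<Oplus>\<^bsub>R\<^esub>b\<in>?F. (f b \<odot>\<^bsub>R\<^esub> m b) \<otimes>\<^bsub>R\<^esub> (\<Oplus>\<^bsub>R\<^esub>d\<in>?G. g d \<odot>\<^bsub>R\<^esub> m d))"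
      proof (rule R.finsum_cong')
        fix b assume b: "b \<in> ?F"
        then have bS: "b \<in> S" using fS by auto
        have "(\<Oplus>\<^bsub>R\<^esub>c\<in>?H. (f b \<otimes> g (c - b)) \<odot>\<^bsub>R\<^esub> m c) = (\<Oplus>\<^bsub>R\<^esub>c\<in>(\<lambda>d. b + d) ` ?G. (f b \<otimes> g (c - b)) \<odot>\<^bsub>R\<^esub> m c)"
        proof (rule R.finsum_superset[symmetric, OF H])
          show sub: "(\<lambda>d. b + d) ` ?G \<subseteq> ?H" using b by auto
          fix c assume c: "c \<in> ?H - (\<lambda>d. b + d) ` ?G"
          then have "g (c - b) = \<zero>" by (metis (mono_tags, lifting) DiffD2 add.commute diff_add_cancel image_eqI mem_Collect_eq)
          then show "(f b \<otimes> g (c - b)) \<odot>\<^bsub>R\<^esub> m c = \<zero>\<^bsub>R\<^esub>" using mH[of c] c by simp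
        next
          fix c assume "c \<in> (\<lambda>d. b + d) ` ?G"
          then show "(f b \<otimes> g (c - b)) \<odot>\<^bsub>R\<^esub> m c \<in> carrier R" using S_add[OF bS] gS m_closed by auto
        qed
        also have "\<dots> = (\<Oplus>\<^bsub>R\<^esub>d\<in>?G. (f b \<otimes> g (b + d - b)) \<odot>\<^bsub>R\<^esub> m (b + d))"
          by (rule R.finsum_reindex) (use S_add[OF bS] gS m_closed in auto)
        also have "\<dots> = (\<Oplus>\<^bsub>R\<^esub>d\<in>?G. (f b \<odot>\<^bsub>R\<^esub> m b) \<otimes>\<^bsub>R\<^esub> (g d \<odot>\<^bsub>R\<^esub> m d))"
        proof (rule R.finsum_cong')
          fix d assume "d \<in> ?G"
          then have d: "d \<in> S" using gS by auto
          have "(f b \<odot>\<^bsub>R\<^esub> m b) \<otimes>\<^bsub>R\<^esub> (g d \<odot>\<^bsub>R\<^esub> m d) = f b \<odot>\<^bsub>R\<^esub> ((g d \<odot>\<^bsub>R\<^esub> m d) \<otimes>\<^bsub>R\<^esub> m b)"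
            using m_closed[OF d] m_closed[OF bS] by (simp add: R.smult_assoc2 R.m_comm)
          also have "\<dots> = (f b \<otimes> g d) \<odot>\<^bsub>R\<^esub> (m d \<otimes>\<^bsub>R\<^esub> m b)"
            using m_closed[OF d] m_closed[OF bS] by (simp add: R.smult_assoc2 R.smult_assoc1)
          finally show "(f b \<otimes> g (b + d - b)) \<odot>\<^bsub>R\<^esub> m (b + d) = (f b \<odot>\<^bsub>R\<^esub> m b) \<otimes>\<^bsub>R\<^esub> (g d \<odot>\<^bsub>R\<^esub> m d)"
            using m_closed[OF d] m_closed[OF bS] by (simp add: m_add[OF bS d] R.m_comm)
        qed (use m_closed[OF bS] gS m_closed in auto)
        also have "\<dots> = (f b \<odot>\<^bsub>R\<^esub> m b) \<otimes>\<^bsub>R\<^esub> (\<Oplus>\<^bsub>R\<^esub>d\<in>?G. g d \<odot>\<^bsub>R\<^esub> m d)"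
          by (rule R.finsum_rdistr[symmetric]) (use m_closed[OF bS] gS m_closed Fg in auto)
        finally show "(\<Oplus>\<^bsub>R\<^esub>c\<in>?H. (f b \<otimes> g (c - b)) \<odot>\<^bsub>R\<^esub> m c) = (f b \<odot>\<^bsub>R\<^esub> m b) \<otimes>\<^bsub>R\<^esub> (\<Oplus>\<^bsub>R\<^esub>d\<in>?G. g d \<odot>\<^bsub>R\<^esub> m d)" .
      qed (use fS gS m_closed in \<open>auto intro!: R.m_closed R.finsum_closed\<close>)
      also have "\<dots> = (\<Oplus>\<^bsub>R\<^esub>b\<in>?F. f b \<odot>\<^bsub>R\<^esub> m b) \<otimes>\<^bsub>R\<^esub> (\<Oplus>\<^bsub>R\<^esub>d\<in>?G. g d \<odot>\<^bsub>R\<^esub> m d)"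
        by (rule R.finsum_ldistr[symmetric]) (use fS gS m_closed Ff in \<open>auto intro!: R.finsum_closed\<close>)
      finally show ?thesis by (simp only: ev_def)
    qed
  next
    show "ev R m \<one>\<^bsub>L\<^esub> = \<one>\<^bsub>R\<^esub>" using ev_mono[OF S0] m_one by (simp add: L_one)
  qed
qed

end

text \<open>Inverting the monomial of exponent \<open>s\<close> yields all Laurent polynomials if
  every integer enters \<open>S\<close> after adding enough multiples of \<open>s\<close>. That this
  persists for all larger multiples permits one exponent for the whole finite support.\<close>

lemma loc_sub:
  assumes s: "s \<in> S" and den: "\<And>z. \<exists>k. \<forall>k'\<ge>k. z + int k' * s \<in> S"
  shows "loc_sub K L (laurent_algebra K UNIV) (mon K s)"
proof -
  interpret U: laurent K UNIV by unfold_locales auto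
  show ?thesis
  proof (intro loc_sub.intro loc_sub_axioms.intro spec_ring.intro)
    show "algebra K L" by (rule L_algebra)
    show "algebra K U.L" by (rule U.L_algebra)
    show "(\<lambda>f. f) \<in> alg_hom K L U.L" by (rule incl_alg_hom) simp
    show "mon K s \<in> carrier L" by (rule mono_carrier[OF s])
    interpret C: cring U.L by (rule U.L_cring)
    show "mon K s \<in> Units U.L"
      by (rule C.Units_mult_inv_unique(1)[where v="mon K (- s)"]) (simp_all add: U.mono_mono U.L_one)
    fix c assume c: "c \<in> carrier U.L"
    have "\<exists>k. \<forall>k'\<ge>k. \<forall>z\<in>F. z + int k' * s \<in> S" if "finite F" for F
      using that
    proof (induction F)
      case (insert x F)
      then obtain k where k: "\<forall>k'\<ge>k. \<forall>z\<in>F. z + int k' * s \<in> S" by blast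
      obtain l where l: "\<forall>k'\<ge>l. x + int k' * s \<in> S" using den by blast
      show ?case using k l by (intro exI[of _ "max k l"]) auto
    qed simp
    from this[OF U.supp_finite[OF c]] obtain k where k: "\<forall>z\<in>supp K c. z + int k * s \<in> S" by blast
    have "mon K s [^]\<^bsub>U.L\<^esub> k \<otimes>\<^bsub>U.L\<^esub> c = (\<lambda>b. c (b - int k * s))"
      using U.mono_pow[of s k] U.mono_mult[OF _ c] by simp
    moreover have "(\<lambda>b. c (b - int k * s)) \<in> carrier L"
      unfolding L_carrier
    proof (intro conjI allI impI)
      show "c (a - int k * s) \<in> carrier K" for a by (rule U.coeff[OF c])
      have "supp K (\<lambda>b. c (b - int k * s)) = (\<lambda>z. z + int k * s) ` supp K c"
        by (force simp: image_iff intro: exI[of _ "_ - int k * s"])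
      then show "finite (supp K (\<lambda>b. c (b - int k * s)))" using U.supp_finite[OF c] by simp
      show "c (a - int k * s) = \<zero>" if "a \<notin> S" for a using k that by force
    qed
    ultimately show "\<exists>k::nat. mon K s [^]\<^bsub>U.L\<^esub> k \<otimes>\<^bsub>U.L\<^esub> c \<in> carrier L" by metis
  qed
qed

end

section \<open>Presentation of the semigroup\<close>

text \<open>
  Modulo the relations between the generators, a monomial can be brought into the normal form given
  by the base \<open>p\<close> expansion: each carry replaces \<open>b\<^sub>j\<^sup>p\<close> by \<open>a\<^sup>p\<^sup>-\<^sup>1 b\<^sub>j\<^sub>+\<^sub>1\<close>.
\<close>

lemma (in comm_monoid) monomial_eq:
  fixes b :: "nat \<Rightarrow> 'a" and p :: nat
  assumes p: "p > 0" and a: "a \<in> carrier G"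
  shows "(\<And>j. b j \<in> carrier G) \<Longrightarrow> (\<And>j. j < n \<Longrightarrow> b j [^] p = a [^] (p - 1) \<otimes> b (Suc j)) \<Longrightarrow>
    (\<Sum>j\<le>n. e j * p ^ j) = (\<Sum>j\<le>n. e' j * p ^ j) \<Longrightarrow> (\<Sum>j\<le>n. e j) \<le> m \<Longrightarrow> (\<Sum>j\<le>n. e' j) \<le> m \<Longrightarrow>
    a [^] (m - (\<Sum>j\<le>n. e j)) \<otimes> (\<Otimes>j\<in>{..n}. b j [^] e j) =
    a [^] (m - (\<Sum>j\<le>n. e' j)) \<otimes> (\<Otimes>j\<in>{..n}. b j [^] e' j)"
proof (induction n arbitrary: b e e' m)
  case 0
  then show ?case by simp
next
  case (Suc n)
  \<comment> \<open>One carry: the quotient of the lowest exponent by \<open>p\<close> is added to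
    the next exponent, and the indices drop by one in preparation for the induction.\<close>
  define red where "red e = (\<lambda>j. e (Suc j) + (if j = 0 then e 0 div p else 0))" for e :: "nat \<Rightarrow> nat"
  have sum1: "(\<Sum>j\<le>Suc n. e j * p ^ j) = e 0 mod p + p * (\<Sum>j\<le>n. red e j * p ^ j)" for e
  proof -
    have "(\<Sum>j\<le>n. red e j * p ^ j) = (\<Sum>j\<le>n. e (Suc j) * p ^ j + (if j = 0 then e 0 div p else 0))"
      by (rule sum.cong) (auto simp: red_def)
    also have "\<dots> = (\<Sum>j\<le>n. e (Suc j) * p ^ j) + e 0 div p" by (simp add: sum.distrib)
    finally have "p * (\<Sum>j\<le>n. red e j * p ^ j) = (\<Sum>j\<le>n. e (Suc j) * p ^ Suc j) + p * (e 0 div p)"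
      by (simp add: distrib_left sum_distrib_left mult_ac)
    then show ?thesis by (simp add: sum.atMost_Suc_shift del: sum.atMost_Suc)
  qed
  have sum2: "(\<Sum>j\<le>n. red e j) + e 0 = (\<Sum>j\<le>Suc n. e j) + e 0 div p" for e
  proof -
    have "(\<Sum>j\<le>n. red e j) = (\<Sum>j\<le>n. e (Suc j)) + e 0 div p" by (simp add: red_def sum.distrib)
    then show ?thesis by (simp add: sum.atMost_Suc_shift del: sum.atMost_Suc)
  qed
  define r where "r = e 0 mod p"
  have mod_eq: "(r' + p * k) mod p = r'" if "r' < p" for r' k :: nat using that by simp
  have r: "e' 0 mod p = r" and IHsum: "(\<Sum>j\<le>n. red e j * p ^ j) = (\<Sum>j\<le>n. red e' j * p ^ j)"
  proof -
    have eq: "e 0 mod p + p * (\<Sum>j\<le>n. red e j * p ^ j) = e' 0 mod p + p * (\<Sum>j\<le>n. red e' j * p ^ j)"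
      using Suc.prems(3) unfolding sum1 .
    from arg_cong[OF eq, of "\<lambda>x. x mod p"] have m: "e 0 mod p = e' 0 mod p" by simp
    then show "e' 0 mod p = r" by (simp add: r_def)
    show "(\<Sum>j\<le>n. red e j * p ^ j) = (\<Sum>j\<le>n. red e' j * p ^ j)" using eq m p by simp
  qed
  have b: "b j \<in> carrier G" for j by (rule Suc.prems(1))
  \<comment> \<open>The carry trades \<open>p * q\<close> factors \<open>b 0\<close> for
    \<open>q\<close> factors \<open>b 1\<close> and \<open>(p - 1) * q\<close> factors
    \<open>a\<close>, so the total degree stays \<open>m\<close>. The remaining \<open>r\<close>
    factors \<open>b 0\<close> are split off, which leaves degree \<open>m - r\<close> for the
    induction hypothesis.\<close>
  have key: "a [^] (m - (\<Sum>j\<le>Suc n. e j)) \<otimes> (\<Otimes>j\<in>{..Suc n}. b j [^] e j) =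
      b 0 [^] r \<otimes> (a [^] (m - r - (\<Sum>j\<le>n. red e j)) \<otimes> (\<Otimes>j\<in>{..n}. b (Suc j) [^] red e j)) \<and> (\<Sum>j\<le>n. red e j) \<le> m - r"
    if er: "e 0 mod p = r" and em: "(\<Sum>j\<le>Suc n. e j) \<le> m" for e
  proof -
    define q where "q = e 0 div p"
    have e0: "e 0 = r + p * q" using er mod_mult_div_eq[of "e 0" p] by (simp add: q_def)
    have s2: "(\<Sum>j\<le>n. red e j) + r + p * q = (\<Sum>j\<le>Suc n. e j) + q" using sum2[of e, folded q_def] e0 by linarith
    have qp: "q + (p - 1) * q = p * q" using p by (cases p) auto
    have le: "(\<Sum>j\<le>n. red e j) \<le> m - r" and ex: "m - r - (\<Sum>j\<le>n. red e j) = (m - (\<Sum>j\<le>Suc n. e j)) + (p - 1) * q"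
      using s2 em qp by linarith+
    have P1: "(\<Otimes>j\<in>{..n}. b (Suc j) [^] red e j) = (\<Otimes>j\<in>{..n}. b (Suc j) [^] e (Suc j)) \<otimes> b 1 [^] q"
    proof -
      have "(\<Otimes>j\<in>{..n}. b (Suc j) [^] red e j) = (\<Otimes>j\<in>{..n}. b (Suc j) [^] e (Suc j) \<otimes> (if j = 0 then b (Suc j) [^] q else \<one>))"
        by (rule finprod_cong') (auto simp: red_def q_def b nat_pow_mult)
      also have "\<dots> = (\<Otimes>j\<in>{..n}. b (Suc j) [^] e (Suc j)) \<otimes> (\<Otimes>j\<in>{..n}. if j = 0 then b (Suc j) [^] q else \<one>)"
        by (rule finprod_multf) (auto simp: b)
      also have "(\<Otimes>j\<in>{..n}. if j = 0 then b (Suc j) [^] q else \<one>) = b 1 [^] q"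
        by (subst finprod_singleton_swap) (auto simp: b)
      finally show ?thesis .
    qed
    have P2: "(\<Otimes>j\<in>{..Suc n}. b j [^] e j) = (\<Otimes>j\<in>{..n}. b (Suc j) [^] e (Suc j)) \<otimes> b 0 [^] e 0"
      by (rule finprod_Suc2) (auto simp: b)
    have b0: "b 0 [^] e 0 = b 0 [^] r \<otimes> (a [^] ((p - 1) * q) \<otimes> b 1 [^] q)"
    proof -
      have "b 0 [^] e 0 = b 0 [^] r \<otimes> (b 0 [^] p) [^] q" by (simp add: e0 b nat_pow_mult nat_pow_pow)
      also have "\<dots> = b 0 [^] r \<otimes> (a [^] ((p - 1) * q) \<otimes> b 1 [^] q)"
        using Suc.prems(2)[of 0] by (simp add: a b nat_pow_distrib nat_pow_pow)
      finally show ?thesis .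
    qed
    define P where "P = (\<Otimes>j\<in>{..n}. b (Suc j) [^] e (Suc j))"
    have [simp]: "P \<in> carrier G" unfolding P_def by (rule finprod_closed) (auto simp: b)
    show ?thesis
      unfolding P1 P2 b0 ex P_def[symmetric] using le
      by (simp add: a b nat_pow_mult[symmetric] m_ac)
  qed
  have IH: "a [^] (m - r - (\<Sum>j\<le>n. red e j)) \<otimes> (\<Otimes>j\<in>{..n}. b (Suc j) [^] red e j) =
    a [^] (m - r - (\<Sum>j\<le>n. red e' j)) \<otimes> (\<Otimes>j\<in>{..n}. b (Suc j) [^] red e' j)"
    by (rule Suc.IH) (use b Suc.prems(2) IHsum key[of e] key[of e'] r r_def Suc.prems(4,5) in auto)
  show ?case using key[of e] key[of e'] r Suc.prems(4,5) IH by (simp add: r_def)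
qed

text \<open>The equation says that \<open>c\<close> is the sum of \<open>k\<close> copies of
  \<open>p ^ n\<close> and \<open>e j\<close> copies of \<open>p ^ n - p ^ j\<close>, with the
  subtracted terms moved to the left. The index \<open>j = n\<close> is allowed and stands for the
  trivial generator 0.\<close>

definition gamma_rep :: "nat \<Rightarrow> nat \<Rightarrow> nat \<Rightarrow> (nat \<Rightarrow> nat) \<Rightarrow> nat \<Rightarrow> bool" where
  "gamma_rep p n k e c \<longleftrightarrow> c + (\<Sum>j\<le>n. e j * p ^ j) = (k + (\<Sum>j\<le>n. e j)) * p ^ n"

lemma gamma_rep_add:
  "gamma_rep p n k e c \<Longrightarrow> gamma_rep p n k' e' c' \<Longrightarrow> gamma_rep p n (k + k') (\<lambda>j. e j + e' j) (c + c')"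
  by (simp add: gamma_rep_def sum.distrib algebra_simps)

lemma gamma_rep_gen:
  assumes "j \<le> n" "p > 0"
  shows "gamma_rep p n 0 (\<lambda>i. if i = j then 1 else 0) (p ^ n - p ^ j)"
proof -
  have "(\<Sum>i\<le>n. (if i = j then 1 else 0) * p ^ i) = p ^ j"
    using assms by (simp add: if_distrib[of "\<lambda>x. x * _"] cong: if_cong)
  then show ?thesis using assms power_increasing[of j n p] by (simp add: gamma_rep_def)
qed

lemma gamma_rep_zero: "gamma_rep p n 0 (\<lambda>_. 0) 0" and gamma_rep_top: "gamma_rep p n 1 (\<lambda>_. 0) (p ^ n)"
  by (simp_all add: gamma_rep_def)

lemma Gamma_rep: "c \<in> Gamma p n \<Longrightarrow> p > 0 \<Longrightarrow> \<exists>k e. gamma_rep p n k e c"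
  by (induction rule: Gamma.induct)
     (blast intro: gamma_rep_zero gamma_rep_top gamma_rep_gen gamma_rep_add less_imp_le)+

text \<open>The semigroup is presented by its generators and the relations
  \<open>p (p^n - p^j) = (p-1) p^n + (p^n - p^(j+1))\<close>, so values satisfying the
  multiplicative form of these extend to a homomorphism. An element is sent to the monomial of any
  of its representations, and \<open>monomial_eq\<close> shows that all representations
  agree.\<close>

lemma (in comm_monoid) Gamma_hom:
  fixes b :: "nat \<Rightarrow> 'a" and p n :: nat
  assumes p: "p > 0" and a: "a \<in> carrier G" and b: "\<And>j. b j \<in> carrier G" and bn: "b n = \<one>"
    and rel: "\<And>j. j < n \<Longrightarrow> b j [^] p = a [^] (p - 1) \<otimes> b (Suc j)"
  shows "\<exists>m :: nat \<Rightarrow> 'a. m 0 = \<one> \<and> m (p ^ n) = a \<and> (\<forall>j<n. m (p ^ n - p ^ j) = b j) \<and>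
     (\<forall>c\<in>Gamma p n. m c \<in> carrier G) \<and> (\<forall>c\<in>Gamma p n. \<forall>d\<in>Gamma p n. m (c + d) = m c \<otimes> m d)"
proof -
  define val where "val k e = a [^] k \<otimes> (\<Otimes>j\<in>{..n}. b j [^] e j)" for k :: nat and e :: "nat \<Rightarrow> nat"
  have Pc [simp]: "(\<Otimes>j\<in>{..n}. b j [^] e j) \<in> carrier G" for e :: "nat \<Rightarrow> nat"
    by (rule finprod_closed) (auto simp: b)
  have vc: "val k e \<in> carrier G" for k e by (simp add: val_def a)
  have vadd: "val (k + k') (\<lambda>j. e j + e' j) = val k e \<otimes> val k' e'" for k k' e e'
  proof -
    have "(\<Otimes>j\<in>{..n}. b j [^] (e j + e' j)) = (\<Otimes>j\<in>{..n}. b j [^] e j \<otimes> b j [^] e' j)"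
      by (rule finprod_cong') (auto simp: b nat_pow_mult)
    also have "\<dots> = (\<Otimes>j\<in>{..n}. b j [^] e j) \<otimes> (\<Otimes>j\<in>{..n}. b j [^] e' j)"
      by (rule finprod_multf) (auto simp: b)
    finally show ?thesis by (simp add: val_def a nat_pow_mult[symmetric] m_ac)
  qed
  have single: "(\<Otimes>i\<in>{..n}. b i [^] (if i = j then d else 0)) = b j [^] d" if "j \<le> n" for j and d :: nat
  proof -
    have "(\<Otimes>i\<in>{..n}. b i [^] (if i = j then d else 0)) = (\<Otimes>i\<in>{..n}. if i = j then b i [^] d else \<one>)"
      by (rule finprod_cong') (auto simp: b)
    also have "\<dots> = b j [^] d" by (subst finprod_singleton_swap) (use that b in auto)
    finally show ?thesis .
  qed
  \<comment> \<open>Two representations of \<open>c\<close> may differ in total degree. The one of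
    smaller degree is padded with \<open>d\<close> copies of the trivial generator, whose value
    \<open>b n\<close> is 1. After that the weighted sums agree and \<open>monomial_eq\<close>
    applies.\<close>
  have le: "val k e = val k' e'" if 1: "gamma_rep p n k e c" and 2: "gamma_rep p n k' e' c"
    and le: "k + (\<Sum>j\<le>n. e j) \<le> k' + (\<Sum>j\<le>n. e' j)" for k e k' e' c
  proof -
    obtain d where d: "k' + (\<Sum>j\<le>n. e' j) = k + (\<Sum>j\<le>n. e j) + d" using le by (metis le_Suc_ex)
    let ?d = "\<lambda>j. if j = n then d else 0"
    have sd: "(\<Sum>j\<le>n. e j + ?d j) = (\<Sum>j\<le>n. e j) + d" by (simp add: sum.distrib)
    have "(\<Sum>j\<le>n. ?d j * p ^ j) = d * p ^ n"
      by (simp add: if_distrib[of "\<lambda>x. x * _"] cong: if_cong)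
    then have sp: "(\<Sum>j\<le>n. (e j + ?d j) * p ^ j) = (\<Sum>j\<le>n. e j * p ^ j) + d * p ^ n"
      by (simp add: distrib_right sum.distrib)
    have eq: "(\<Sum>j\<le>n. (e j + ?d j) * p ^ j) = (\<Sum>j\<le>n. e' j * p ^ j)"
      unfolding sp using 1 2 by (simp add: gamma_rep_def d algebra_simps)
    have l: "(\<Sum>j\<le>n. e j + ?d j) \<le> k' + (\<Sum>j\<le>n. e' j)" "(\<Sum>j\<le>n. e' j) \<le> k' + (\<Sum>j\<le>n. e' j)"
      and x: "k' + (\<Sum>j\<le>n. e' j) - (\<Sum>j\<le>n. e j + ?d j) = k" "k' + (\<Sum>j\<le>n. e' j) - (\<Sum>j\<le>n. e' j) = k'"
      using d unfolding sd by linarith+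
    have "val k e = val (k + 0) (\<lambda>j. e j + ?d j)"
      unfolding vadd[of k 0 e ?d] using single[of n d] bn by (simp add: val_def a)
    also have "\<dots> = val k' e'"
      using monomial_eq[where b=b and n=n and e="\<lambda>j. e j + ?d j" and e'=e' and m="k' + (\<Sum>j\<le>n. e' j)", OF p a b rel eq l]
      unfolding val_def x by simp
    finally show ?thesis .
  qed
  have uniq: "val k e = val k' e'" if "gamma_rep p n k e c" "gamma_rep p n k' e' c" for k e k' e' c
    using le[OF that] le[OF that(2,1)] by (metis nat_le_linear)
  define m where "m c = (let (k, e) = SOME (k, e). gamma_rep p n k e c in val k e)" for c
  have m: "m c = val k e" if "gamma_rep p n k e c" for c k e
  proof -
    define z where "z = (SOME (k, e). gamma_rep p n k e c)"
    have "case z of (k, e) \<Rightarrow> gamma_rep p n k e c" unfolding z_def by (rule someI[of _ "(k, e)"]) (simp add: that)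
    then show ?thesis using uniq[OF _ that] by (auto simp: m_def z_def[symmetric] split: prod.splits)
  qed
  have v0: "val k (\<lambda>_. 0) = a [^] k" for k by (simp add: val_def a)
  show ?thesis
  proof (intro exI[of _ m] conjI allI impI ballI)
    show "m 0 = \<one>" using m[OF gamma_rep_zero] by (simp add: v0)
    show "m (p ^ n) = a" using m[OF gamma_rep_top] a by (simp only: v0) simp
    show "m (p ^ n - p ^ j) = b j" if "j < n" for j
      using m[OF gamma_rep_gen[of j n p]] that p single[of j 1] b by (simp add: val_def)
    fix c assume "c \<in> Gamma p n"
    then obtain k e where c: "gamma_rep p n k e c" using Gamma_rep[OF _ p] by blast
    then show "m c \<in> carrier G" by (simp add: m vc)
    fix d assume "d \<in> Gamma p n"
    then obtain k' e' where d: "gamma_rep p n k' e' d" using Gamma_rep[OF _ p] by blast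
    show "m (c + d) = m c \<otimes> m d" using m[OF gamma_rep_add[OF c d]] m[OF c] m[OF d] by (simp add: vadd)
  qed
qed

lemma Gamma_mult: "c \<in> Gamma p n \<Longrightarrow> k * c \<in> Gamma p n"
  by (induction k) (auto intro: Gamma.zero Gamma.add)

text \<open>Both \<open>p^n - 1\<close> and \<open>p^n\<close> lie in the semigroup. With
  \<open>z = q p^n - N\<close> one has \<open>z + k' p^n = N (p^n - 1) + (q + k' - N) p^n\<close>,
  and both coefficients are nonnegative once \<open>k'\<close> is at least
  \<open>N - q\<close>.\<close>

lemma Gamma_cofinal:
  fixes z :: int
  assumes p: "p > 0"
  shows "\<exists>k. \<forall>k'\<ge>k. z + int k' * int (p ^ n) \<in> int ` Gamma p n"
proof -
  define N q where "N = (- z) mod int (p ^ n)" and "q = - ((- z) div int (p ^ n))"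
  have z: "z = q * int (p ^ n) - N"
    using div_mult_mod_eq[of "- z" "int (p ^ n)"] unfolding N_def q_def mult_minus_left by linarith
  have N: "0 \<le> N" "N < int (p ^ n)" unfolding N_def using p by auto
  have "z + int k' * int (p ^ n) \<in> int ` Gamma p n" if "k' \<ge> nat (N - q)" for k'
  proof -
    define l where "l = nat (q + int k' - N)"
    have l: "int l = q + int k' - N" using that by (simp add: l_def)
    \<comment> \<open>For \<open>n = 0\<close> the number is 0; otherwise it is the generator of
      index 0.\<close>
    have "p ^ n - 1 \<in> Gamma p n" using Gamma.gen[of 0 n p] Gamma.zero by (cases "n = 0") auto
    then have "nat N * (p ^ n - 1) + l * p ^ n \<in> Gamma p n"
      by (intro Gamma.add Gamma_mult Gamma.gen_top)
    moreover have "int (nat N * (p ^ n - 1) + l * p ^ n) = z + int k' * int (p ^ n)"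
    proof -
      have "int (p ^ n - 1) = int (p ^ n) - 1" using p by (simp add: of_nat_diff)
      then have "int (nat N * (p ^ n - 1) + l * p ^ n) = N * (int (p ^ n) - 1) + (q + int k' - N) * int (p ^ n)"
        unfolding of_nat_add of_nat_mult l using N by (simp only: int_nat_eq if_True)
      then show ?thesis unfolding z by (simp only: left_diff_distrib right_diff_distrib distrib_right)
    qed
    ultimately show ?thesis by (metis image_eqI)
  qed
  then show ?thesis by blast
qed

section \<open>The Frobenius endomorphism\<close>

lemma (in cring) binomial:
  assumes x: "x \<in> carrier R" and y: "y \<in> carrier R"
  shows "(x \<oplus> y) [^] (n::nat) = (\<Oplus>k\<in>{..n}. [(n choose k)] \<cdot> (x [^] k \<otimes> y [^] (n - k)))"
proof (induction n)
  case 0 show ?case by simp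
next
  case (Suc n)
  define t where "t k l = x [^] (k::nat) \<otimes> y [^] (l::nat)" for k l
  have t [simp]: "t k l \<in> carrier R" for k l using x y by (simp add: t_def)
  have tx: "t k l \<otimes> x = t (Suc k) l" and ty: "t k l \<otimes> y = t k (Suc l)" for k l
    using x y by (simp_all add: t_def m_ac)
  have "(x \<oplus> y) [^] Suc n = (\<Oplus>k\<in>{..n}. [(n choose k)] \<cdot> t k (n - k)) \<otimes> x \<oplus> (\<Oplus>k\<in>{..n}. [(n choose k)] \<cdot> t k (n - k)) \<otimes> y"
    using x y Suc by (simp add: t_def[symmetric] r_distr)
  also have "(\<Oplus>k\<in>{..n}. [(n choose k)] \<cdot> t k (n - k)) \<otimes> x = (\<Oplus>k\<in>{..n}. [(n choose k)] \<cdot> t (Suc k) (n - k))"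
    using x by (subst finsum_ldistr) (auto simp: add_pow_ldistr tx intro!: finsum_cong')
  also have "\<dots> = (\<Oplus>k\<in>{..Suc n}. [(case k of 0 \<Rightarrow> 0 | Suc k \<Rightarrow> n choose k)] \<cdot> t k (Suc n - k))"
    by (subst finsum_Suc2) auto
  also have "(\<Oplus>k\<in>{..n}. [(n choose k)] \<cdot> t k (n - k)) \<otimes> y = (\<Oplus>k\<in>{..n}. [(n choose k)] \<cdot> t k (Suc n - k))"
    using y by (subst finsum_ldistr) (auto simp: add_pow_ldistr ty Suc_diff_le intro!: finsum_cong')
  also have "\<dots> = (\<Oplus>k\<in>{..Suc n}. [(n choose k)] \<cdot> t k (Suc n - k))"
    by (subst finsum_Suc) (auto simp: binomial_eq_0)
  also have "(\<Oplus>k\<in>{..Suc n}. [(case k of 0 \<Rightarrow> 0 | Suc k \<Rightarrow> n choose k)] \<cdot> t k (Suc n - k)) \<oplus> \<dots> =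
      (\<Oplus>k\<in>{..Suc n}. [(case k of 0 \<Rightarrow> 0 | Suc k \<Rightarrow> n choose k)] \<cdot> t k (Suc n - k) \<oplus> [(n choose k)] \<cdot> t k (Suc n - k))"
    by (rule finsum_addf[symmetric]) auto
  also have "\<dots> = (\<Oplus>k\<in>{..Suc n}. [(Suc n choose k)] \<cdot> t k (Suc n - k))"
    by (rule finsum_cong') (auto simp: add.nat_pow_mult split: nat.split)
  finally show ?case by (simp add: t_def)
qed

locale char_p = cring R for R (structure) + fixes p :: nat
  assumes p: "prime p" and char: "[p] \<cdot> \<one> = \<zero>"
begin

lemma p_pos [simp]: "p > 0"
  using p prime_gt_0_nat by blast

lemma char_zero: assumes "x \<in> carrier R" "p dvd k" shows "[k] \<cdot> x = \<zero>"
proof -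
  obtain l where l: "k = p * l" using assms(2) by auto
  have "[p] \<cdot> x = ([p] \<cdot> \<one>) \<otimes> x" using assms(1) by (simp add: add_pow_ldistr del: char)
  then have "[p] \<cdot> x = \<zero>" using assms(1) by (simp add: char)
  then have "[k] \<cdot> x = [l] \<cdot> \<zero>" unfolding l using assms(1) by (simp add: add.nat_pow_pow[symmetric])
  then show ?thesis by simp
qed

lemma frob1_add: assumes x: "x \<in> carrier R" and y: "y \<in> carrier R"
  shows "(x \<oplus> y) [^] p = x [^] p \<oplus> y [^] p"
proof -
  let ?f = "\<lambda>k. [(p choose k)] \<cdot> (x [^] k \<otimes> y [^] (p - k))"
  have "(x \<oplus> y) [^] p = (\<Oplus>k\<in>{..p}. ?f k)" by (rule binomial[OF x y])
  \<comment> \<open>The intermediate binomial coefficients are divisible by the prime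
    \<open>p\<close>, hence act as zero.\<close>
  also have "\<dots> = (\<Oplus>k\<in>{0, p}. ?f k)"
  proof (rule finsum_superset[symmetric])
    fix k assume "k \<in> {..p} - {0, p}"
    then have "p dvd (p choose k)" using p by (intro dvd_choose_prime) auto
    then show "?f k = \<zero>" using x y by (intro char_zero) auto
  qed (use x y in auto)
  also have "\<dots> = x [^] p \<oplus> y [^] p" using x y p_pos by (simp add: a_comm del: p_pos)
  finally show ?thesis .
qed

definition fr :: "nat \<Rightarrow> 'a \<Rightarrow> 'a" where "fr i x = x [^] (p ^ i)"

lemma fr_closed [simp]: "x \<in> carrier R \<Longrightarrow> fr i x \<in> carrier R"
  by (simp add: fr_def)

lemma fr_mult: "x \<in> carrier R \<Longrightarrow> y \<in> carrier R \<Longrightarrow> fr i (x \<otimes> y) = fr i x \<otimes> fr i y"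
  by (simp add: fr_def nat_pow_distrib)

lemma fr_fr: "x \<in> carrier R \<Longrightarrow> fr i (fr j x) = fr (i + j) x"
  by (simp add: fr_def nat_pow_pow power_add mult.commute)

lemma fr_0 [simp]: "x \<in> carrier R \<Longrightarrow> fr 0 x = x"
  by (simp add: fr_def)

lemma fr_one [simp]: "fr i \<one> = \<one>" and fr_zero [simp]: "fr i \<zero> = \<zero>"
  by (simp_all add: fr_def nat_pow_zero)

lemma fr_add: "x \<in> carrier R \<Longrightarrow> y \<in> carrier R \<Longrightarrow> fr i (x \<oplus> y) = fr i x \<oplus> fr i y"
proof (induction i arbitrary: x y)
  case (Suc i)
  have s: "fr (Suc i) z = fr i (z [^] p)" if "z \<in> carrier R" for z
    using that by (simp add: fr_def nat_pow_pow)
  show ?case using Suc by (simp add: s frob1_add)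
qed simp

lemma fr_finsum: "finite A \<Longrightarrow> (\<And>a. a \<in> A \<Longrightarrow> f a \<in> carrier R) \<Longrightarrow> fr i (\<Oplus>a\<in>A. f a) = (\<Oplus>a\<in>A. fr i (f a))"
proof (induction A rule: finite_induct)
  case (insert x A)
  then show ?case
    by (subst (1 2) finsum_insert) (auto simp: fr_add intro!: finsum_closed)
qed simp

lemma fr_minus: "x \<in> carrier R \<Longrightarrow> fr i (\<ominus> x) = \<ominus> fr i x"
  using fr_add[of "\<ominus> x" x i] by (simp add: l_neg minus_equality)

lemma fr_zero_mono: "x \<in> carrier R \<Longrightarrow> fr i x = \<zero> \<Longrightarrow> i \<le> j \<Longrightarrow> fr j x = \<zero>"
  using fr_fr[of x "j - i" i] by simp

end

text \<open>Coefficients of a skew product are sums over \<open>i + l = m\<close>. The lemma turns a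
  sum of such coefficients into an iterated sum over \<open>i\<close> and \<open>l\<close>.\<close>

lemma (in abelian_monoid) finsum_triangle:
  assumes f: "\<And>i l. f i l \<in> carrier G"
  shows "(\<Oplus>m\<in>{..n::nat}. \<Oplus>i\<in>{..m}. f i (m - i)) = (\<Oplus>i\<in>{..n}. \<Oplus>l\<in>{..n - i}. f i l)"
proof (induction n)
  case 0 show ?case using f by simp
next
  case (Suc n)
  have "(\<Oplus>i\<in>{..Suc n}. \<Oplus>l\<in>{..Suc n - i}. f i l) = f (Suc n) 0 \<oplus> (\<Oplus>i\<in>{..n}. \<Oplus>l\<in>{..Suc n - i}. f i l)"
    using f by (subst finsum_Suc) (auto intro!: finsum_closed)
  also have "(\<Oplus>i\<in>{..n}. \<Oplus>l\<in>{..Suc n - i}. f i l) = (\<Oplus>i\<in>{..n}. f i (Suc n - i) \<oplus> (\<Oplus>l\<in>{..n - i}. f i l))"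
  proof (rule finsum_cong')
    fix i assume "i \<in> {..n}"
    then have "Suc n - i = Suc (n - i)" by (simp add: Suc_diff_le)
    then show "(\<Oplus>l\<in>{..Suc n - i}. f i l) = f i (Suc n - i) \<oplus> (\<Oplus>l\<in>{..n - i}. f i l)"
      using f by (simp only:) (subst finsum_Suc, auto)
  qed (use f in \<open>auto intro!: finsum_closed\<close>)
  also have "\<dots> = (\<Oplus>i\<in>{..n}. f i (Suc n - i)) \<oplus> (\<Oplus>i\<in>{..n}. \<Oplus>l\<in>{..n - i}. f i l)"
    using f by (intro finsum_addf) (auto intro!: finsum_closed)
  finally have "(\<Oplus>i\<in>{..Suc n}. \<Oplus>l\<in>{..Suc n - i}. f i l) =
    f (Suc n) 0 \<oplus> (\<Oplus>i\<in>{..n}. f i (Suc n - i)) \<oplus> (\<Oplus>i\<in>{..n}. \<Oplus>l\<in>{..n - i}. f i l)"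
    using f by (simp add: a_assoc finsum_closed)
  also have "f (Suc n) 0 \<oplus> (\<Oplus>i\<in>{..n}. f i (Suc n - i)) = (\<Oplus>i\<in>{..Suc n}. f i (Suc n - i))"
    using f by (subst finsum_Suc) auto
  also have "(\<Oplus>i\<in>{..n}. \<Oplus>l\<in>{..n - i}. f i l) = (\<Oplus>m\<in>{..n}. \<Oplus>i\<in>{..m}. f i (m - i))" by (rule Suc[symmetric])
  also have "(\<Oplus>i\<in>{..Suc n}. f i (Suc n - i)) \<oplus> \<dots> = (\<Oplus>m\<in>{..Suc n}. \<Oplus>i\<in>{..m}. f i (m - i))"
    using f by (intro finsum_Suc[symmetric]) (auto intro!: finsum_closed)
  finally show ?case by simp
qed

text \<open>Truncation at degree \<open>n\<close> does no harm when the terms beyond it vanish. For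
  elements of the group the nilpotency conditions ensure this.\<close>

lemma (in abelian_monoid) finsum_triangle_square:
  assumes f: "\<And>i l. f i l \<in> carrier G" and z: "\<And>i l. i \<le> n \<Longrightarrow> l \<le> n \<Longrightarrow> i + l > n \<Longrightarrow> f i l = \<zero>"
  shows "(\<Oplus>m\<in>{..n::nat}. \<Oplus>i\<in>{..m}. f i (m - i)) = (\<Oplus>i\<in>{..n}. \<Oplus>l\<in>{..n}. f i l)"
proof -
  have "(\<Oplus>m\<in>{..n}. \<Oplus>i\<in>{..m}. f i (m - i)) = (\<Oplus>i\<in>{..n}. \<Oplus>l\<in>{..n - i}. f i l)"
    by (rule finsum_triangle[OF f])
  also have "\<dots> = (\<Oplus>i\<in>{..n}. \<Oplus>l\<in>{..n}. f i l)"
  proof (rule finsum_cong')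
    fix i assume "i \<in> {..n}"
    then show "(\<Oplus>l\<in>{..n - i}. f i l) = (\<Oplus>l\<in>{..n}. f i l)"
      by (intro finsum_superset) (use f z in auto)
  qed (use f in \<open>auto intro!: finsum_closed\<close>)
  finally show ?thesis .
qed

section \<open>The group and its linear action on homogeneous coordinates\<close>

lemma semidirect_group:
  assumes N: "group N" and H: "group H"
    and closed: "\<And>h x. h \<in> carrier H \<Longrightarrow> x \<in> carrier N \<Longrightarrow> \<theta> h x \<in> carrier N"
    and mult: "\<And>h x y. h \<in> carrier H \<Longrightarrow> x \<in> carrier N \<Longrightarrow> y \<in> carrier N \<Longrightarrow> \<theta> h (x \<otimes>\<^bsub>N\<^esub> y) = \<theta> h x \<otimes>\<^bsub>N\<^esub> \<theta> h y"
    and comp: "\<And>h k x. h \<in> carrier H \<Longrightarrow> k \<in> carrier H \<Longrightarrow> x \<in> carrier N \<Longrightarrow> \<theta> (h \<otimes>\<^bsub>H\<^esub> k) x = \<theta> h (\<theta> k x)"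
    and one: "\<And>x. x \<in> carrier N \<Longrightarrow> \<theta> \<one>\<^bsub>H\<^esub> x = x"
  shows "group (semidirect N H \<theta>)"
proof -
  interpret N: group N by fact
  interpret H: group H by fact
  have o: "\<theta> h \<one>\<^bsub>N\<^esub> = \<one>\<^bsub>N\<^esub>" if "h \<in> carrier H" for h
    using mult[OF that N.one_closed N.one_closed] closed[OF that N.one_closed] by simp
  show ?thesis
  proof (rule groupI)
    fix x y z assume "x \<in> carrier (semidirect N H \<theta>)" "y \<in> carrier (semidirect N H \<theta>)" "z \<in> carrier (semidirect N H \<theta>)"
    then show "x \<otimes>\<^bsub>semidirect N H \<theta>\<^esub> y \<otimes>\<^bsub>semidirect N H \<theta>\<^esub> z = x \<otimes>\<^bsub>semidirect N H \<theta>\<^esub> (y \<otimes>\<^bsub>semidirect N H \<theta>\<^esub> z)"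
      by (auto simp: semidirect_def mult comp closed N.m_assoc H.m_assoc)
  next
    fix x assume "x \<in> carrier (semidirect N H \<theta>)"
    then obtain a h where x: "x = (a, h)" "a \<in> carrier N" "h \<in> carrier H" by (auto simp: semidirect_def)
    let ?y = "(\<theta> (inv\<^bsub>H\<^esub> h) (inv\<^bsub>N\<^esub> a), inv\<^bsub>H\<^esub> h)"
    have "\<theta> (inv\<^bsub>H\<^esub> h) (inv\<^bsub>N\<^esub> a) \<otimes>\<^bsub>N\<^esub> \<theta> (inv\<^bsub>H\<^esub> h) a = \<one>\<^bsub>N\<^esub>"
      using x mult[of "inv\<^bsub>H\<^esub> h" "inv\<^bsub>N\<^esub> a" a] o by simp
    then have "?y \<in> carrier (semidirect N H \<theta>) \<and> ?y \<otimes>\<^bsub>semidirect N H \<theta>\<^esub> x = \<one>\<^bsub>semidirect N H \<theta>\<^esub>"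
      using x by (simp add: semidirect_def closed)
    then show "\<exists>y\<in>carrier (semidirect N H \<theta>). y \<otimes>\<^bsub>semidirect N H \<theta>\<^esub> x = \<one>\<^bsub>semidirect N H \<theta>\<^esub>" by blast
  qed (auto simp: semidirect_def closed one)
qed

locale char_p_alg = algebra K R + char_p R p
  for K :: "('k, 'm) ring_scheme" and R :: "('k, 'u) module" (structure) and p :: nat +
  fixes n :: nat
begin

lemma skew_mult: "(u \<otimes>\<^bsub>skew_poly p R\<^esub> v) k = (\<Oplus>i\<in>{..k}. u i \<otimes> fr i (v (k - i)))"
  by (simp add: skew_poly_def fr_def)

lemma U_iff: "u \<in> U_set p n R \<longleftrightarrow> (\<forall>i. u i \<in> carrier R) \<and> u 0 = \<one> \<and> (\<forall>i\<in>{1..n}. fr (n - i + 1) (u i) = \<zero>) \<and> (\<forall>i>n. u i = \<zero>)"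
proof -
  have "finite {i. u i \<noteq> \<zero>}" if "\<forall>i>n. u i = \<zero>"
    by (rule finite_subset[of _ "{..n}"]) (use that in \<open>auto simp: not_less[symmetric]\<close>)
  then show ?thesis by (auto simp: U_set_def skew_poly_def fr_def)
qed

lemma U_closed: "u \<in> U_set p n R \<Longrightarrow> u i \<in> carrier R" and U_0: "u \<in> U_set p n R \<Longrightarrow> u 0 = \<one>"
  by (simp_all add: U_iff)

text \<open>The nilpotency conditions and the vanishing beyond degree \<open>n\<close> in one
  uniform rule: a coefficient of positive index \<open>i\<close> is killed by the
  \<open>p^j\<close>-th power as soon as \<open>i + j\<close> exceeds \<open>n\<close>. All
  vanishing arguments below go through this rule.\<close>

lemma U_nil: "u \<in> U_set p n R \<Longrightarrow> 1 \<le> i \<Longrightarrow> n < i + j \<Longrightarrow> fr j (u i) = \<zero>"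
proof (cases "i \<le> n")
  case True
  assume "u \<in> U_set p n R" "1 \<le> i" "n < i + j"
  then show ?thesis using True by (intro fr_zero_mono[of "u i" "n - i + 1" j]) (auto simp: U_iff)
qed (simp add: U_iff)

lemma skew_closed: "(\<And>i. u i \<in> carrier R) \<Longrightarrow> (\<And>i. v i \<in> carrier R) \<Longrightarrow> (u \<otimes>\<^bsub>skew_poly p R\<^esub> v) k \<in> carrier R"
  unfolding skew_mult by (rule finsum_closed) auto

lemma skew_assoc:
  assumes u: "\<And>i. u i \<in> carrier R" and v: "\<And>i. v i \<in> carrier R" and w: "\<And>i. w i \<in> carrier R"
  shows "(u \<otimes>\<^bsub>skew_poly p R\<^esub> v) \<otimes>\<^bsub>skew_poly p R\<^esub> w = u \<otimes>\<^bsub>skew_poly p R\<^esub> (v \<otimes>\<^bsub>skew_poly p R\<^esub> w)"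
proof
  fix k
  note [simp] = u v w
  let ?f = "\<lambda>i l. u i \<otimes> fr i (v l) \<otimes> fr (i + l) (w (k - (i + l)))"
  have "((u \<otimes>\<^bsub>skew_poly p R\<^esub> v) \<otimes>\<^bsub>skew_poly p R\<^esub> w) k = (\<Oplus>m\<in>{..k}. \<Oplus>i\<in>{..m}. ?f i (m - i))"
    unfolding skew_mult
    by (rule finsum_cong') (auto intro!: finsum_closed simp: finsum_ldistr intro!: finsum_cong')
  also have "\<dots> = (\<Oplus>i\<in>{..k}. \<Oplus>l\<in>{..k - i}. ?f i l)" by (rule finsum_triangle) simp
  also have "\<dots> = (u \<otimes>\<^bsub>skew_poly p R\<^esub> (v \<otimes>\<^bsub>skew_poly p R\<^esub> w)) k"
    unfolding skew_mult
    by (rule finsum_cong')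
       (auto intro!: finsum_closed simp: fr_finsum finsum_rdistr fr_mult fr_fr m_assoc diff_diff_add intro!: finsum_cong')
  finally show "((u \<otimes>\<^bsub>skew_poly p R\<^esub> v) \<otimes>\<^bsub>skew_poly p R\<^esub> w) k = (u \<otimes>\<^bsub>skew_poly p R\<^esub> (v \<otimes>\<^bsub>skew_poly p R\<^esub> w)) k" .
qed

lemma finsum_all_zero: "(\<And>i. i \<in> A \<Longrightarrow> f i = \<zero>) \<Longrightarrow> (\<Oplus>i\<in>A. f i) = \<zero>"
  by (rule add.finprod_one_eqI)

text \<open>The coefficient of \<open>F^k\<close> is a sum of terms
  \<open>u_i v_(k-i)^(p^i)\<close>. For \<open>i = k\<close> the factor from \<open>u\<close> has
  the required nilpotency. Otherwise the factor from \<open>v\<close> has positive index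
  \<open>k - i\<close>, and the Frobenius exponents add up so that \<open>U_nil\<close>
  applies.\<close>

lemma U_mult_closed:
  assumes u: "u \<in> U_set p n R" and v: "v \<in> U_set p n R"
  shows "u \<otimes>\<^bsub>skew_poly p R\<^esub> v \<in> U_set p n R"
  unfolding U_iff
proof (intro conjI allI impI ballI)
  note [simp] = U_closed[OF u] U_closed[OF v]
  show "(u \<otimes>\<^bsub>skew_poly p R\<^esub> v) i \<in> carrier R" for i by (rule skew_closed) auto
  show "(u \<otimes>\<^bsub>skew_poly p R\<^esub> v) 0 = \<one>" by (simp add: skew_mult U_0[OF u] U_0[OF v])
  show "fr (n - k + 1) ((u \<otimes>\<^bsub>skew_poly p R\<^esub> v) k) = \<zero>" if k: "k \<in> {1..n}" for k
    unfolding skew_mult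
  proof (subst fr_finsum)
    show "(\<Oplus>i\<in>{..k}. fr (n - k + 1) (u i \<otimes> fr i (v (k - i)))) = \<zero>"
    proof (rule finsum_all_zero)
      fix i assume i: "i \<in> {..k}"
      show "fr (n - k + 1) (u i \<otimes> fr i (v (k - i))) = \<zero>"
      proof (cases "i = k")
        case True
        then show ?thesis using U_nil[OF u, of k "n - k + 1"] k by (simp add: fr_mult)
      next
        case False
        then show ?thesis using U_nil[OF v, of "k - i" "n - k + 1 + i"] k i by (simp add: fr_mult fr_fr)
      qed
    qed
  qed auto
  show "(u \<otimes>\<^bsub>skew_poly p R\<^esub> v) k = \<zero>" if k: "k > n" for k
    unfolding skew_mult
  proof (rule finsum_all_zero)
    fix i assume i: "i \<in> {..k}"
    show "u i \<otimes> fr i (v (k - i)) = \<zero>"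
    proof (cases "i = k")
      case True then show ?thesis using k u by (simp add: U_iff)
    next
      case False then show ?thesis using U_nil[OF v, of "k - i" i] k i by simp
    qed
  qed
qed

lemma skew_one: "\<one>\<^bsub>skew_poly p R\<^esub> = (\<lambda>i. if i = 0 then \<one> else \<zero>)"
  by (simp add: skew_poly_def)

lemma U_one: "\<one>\<^bsub>skew_poly p R\<^esub> \<in> U_set p n R"
  by (auto simp: U_iff skew_one)

lemma skew_l_one: assumes "\<And>i. u i \<in> carrier R" shows "\<one>\<^bsub>skew_poly p R\<^esub> \<otimes>\<^bsub>skew_poly p R\<^esub> u = u"
proof
  fix k
  have "(\<one>\<^bsub>skew_poly p R\<^esub> \<otimes>\<^bsub>skew_poly p R\<^esub> u) k = (\<Oplus>i\<in>{..k}. if i = 0 then u k else \<zero>)"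
    unfolding skew_mult skew_one by (rule finsum_cong') (use assms in auto)
  then show "(\<one>\<^bsub>skew_poly p R\<^esub> \<otimes>\<^bsub>skew_poly p R\<^esub> u) k = u k"
    using assms by (simp add: add.finprod_singleton_swap)
qed

text \<open>A left inverse: the coefficient of \<open>F^(k+1)\<close> in its product with
  \<open>u\<close> is required to vanish, and since \<open>u 0 = 1\<close> this can be solved for
  the newest coefficient. The guard \<open>i \<le> k\<close> inside the sum makes the termination
  argument go through.\<close>

fun U_inv :: "(nat \<Rightarrow> 'u) \<Rightarrow> nat \<Rightarrow> 'u" where
  "U_inv u 0 = \<one>"
| "U_inv u (Suc k) = \<ominus> (\<Oplus>i\<in>{..k}. (if i \<le> k then U_inv u i else \<zero>) \<otimes> fr i (u (Suc k - i)))"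

text \<open>The nilpotency of the inverse follows without induction: each term of the recursion
  contains a Frobenius power of some coefficient of \<open>u\<close> of positive index, and that
  factor already vanishes by \<open>U_nil\<close>.\<close>

lemma U_inv_ok:
  assumes u: "u \<in> U_set p n R"
  shows "U_inv u k \<in> carrier R"
    "U_inv u (Suc k) = \<ominus> (\<Oplus>i\<in>{..k}. U_inv u i \<otimes> fr i (u (Suc k - i)))"
    "1 \<le> k \<Longrightarrow> n < k + j \<Longrightarrow> fr j (U_inv u k) = \<zero>"
proof -
  note [simp] = U_closed[OF u]
  show c: "U_inv u k \<in> carrier R" for k
  proof (induction k rule: less_induct)
    case (less k) then show ?case by (cases k) (auto intro!: a_inv_closed finsum_closed)
  qed
  show S: "U_inv u (Suc k) = \<ominus> (\<Oplus>i\<in>{..k}. U_inv u i \<otimes> fr i (u (Suc k - i)))" for k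
    unfolding U_inv.simps by (rule arg_cong[where f="a_inv R"], rule finsum_cong') (use c in auto)
  show "1 \<le> k \<Longrightarrow> n < k + j \<Longrightarrow> fr j (U_inv u k) = \<zero>"
  proof (cases k)
    case (Suc l)
    assume kj: "n < k + j"
    have cl: "U_inv u i \<otimes> fr i (u (Suc l - i)) \<in> carrier R" for i using c by simp
    have "fr j (\<Oplus>i\<in>{..l}. U_inv u i \<otimes> fr i (u (Suc l - i))) = (\<Oplus>i\<in>{..l}. fr j (U_inv u i \<otimes> fr i (u (Suc l - i))))"
      using cl by (intro fr_finsum) auto
    also have "\<dots> = \<zero>"
    proof (rule finsum_all_zero)
      fix i assume "i \<in> {..l}"
      then show "fr j (U_inv u i \<otimes> fr i (u (Suc l - i))) = \<zero>"
        using U_nil[OF u, of "Suc l - i" "j + i"] Suc kj c by (simp add: fr_mult fr_fr)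
    qed
    finally show ?thesis using Suc cl by (simp add: S fr_minus finsum_closed del: U_inv.simps)
  qed simp
qed

lemma U_group: "group (U_group p n R)"
proof (rule groupI)
  show "\<one>\<^bsub>U_group p n R\<^esub> \<in> carrier (U_group p n R)"
    using U_one by (simp add: U_group_def units_of_def)
  fix u assume u: "u \<in> carrier (U_group p n R)"
  then have u': "u \<in> U_set p n R" by (simp add: U_group_def)
  show "\<one>\<^bsub>U_group p n R\<^esub> \<otimes>\<^bsub>U_group p n R\<^esub> u = u"
    using skew_l_one[of u] U_closed[OF u'] by (simp add: U_group_def units_of_def)
  have "U_inv u i = \<zero>" if "n < i" for i
    using U_inv_ok(3)[OF u', of i 0] U_inv_ok(1)[OF u', of i] that by simp
  then have "U_inv u \<in> U_set p n R"
    unfolding U_iff using U_inv_ok(1)[OF u'] U_inv_ok(3)[OF u'] by auto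
  moreover have "U_inv u \<otimes>\<^bsub>skew_poly p R\<^esub> u = \<one>\<^bsub>skew_poly p R\<^esub>"
  proof
    fix k
    have c: "U_inv u i \<otimes> fr i (u (k - i)) \<in> carrier R" for i k using U_inv_ok(1)[OF u'] U_closed[OF u'] by simp
    note S = U_inv_ok(2)[OF u']
    show "(U_inv u \<otimes>\<^bsub>skew_poly p R\<^esub> u) k = \<one>\<^bsub>skew_poly p R\<^esub> k"
    proof (cases k)
      case 0 then show ?thesis by (simp add: skew_mult skew_one U_0[OF u'])
    next
      case (Suc l)
      have "(\<Oplus>i\<in>{..Suc l}. U_inv u i \<otimes> fr i (u (Suc l - i))) =
        U_inv u (Suc l) \<oplus> (\<Oplus>i\<in>{..l}. U_inv u i \<otimes> fr i (u (Suc l - i)))"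
        using c U_inv_ok(1)[OF u', of "Suc l"] by (subst finsum_Suc) (auto simp: U_0[OF u'] simp del: U_inv.simps)
      also have "\<dots> = \<zero>" unfolding S using c by (simp add: l_neg finsum_closed)
      finally show ?thesis using Suc by (simp add: skew_mult skew_one)
    qed
  qed
  ultimately show "\<exists>v\<in>carrier (U_group p n R). v \<otimes>\<^bsub>U_group p n R\<^esub> u = \<one>\<^bsub>U_group p n R\<^esub>"
    by (intro bexI[of _ "U_inv u"]) (simp_all add: U_group_def units_of_def)
  fix v assume "v \<in> carrier (U_group p n R)"
  then have v': "v \<in> U_set p n R" by (simp add: U_group_def)
  show "u \<otimes>\<^bsub>U_group p n R\<^esub> v \<in> carrier (U_group p n R)"
    using U_mult_closed[OF u' v'] by (simp add: U_group_def units_of_def)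
  fix w assume "w \<in> carrier (U_group p n R)"
  then have w': "w \<in> U_set p n R" by (simp add: U_group_def)
  show "u \<otimes>\<^bsub>U_group p n R\<^esub> v \<otimes>\<^bsub>U_group p n R\<^esub> w = u \<otimes>\<^bsub>U_group p n R\<^esub> (v \<otimes>\<^bsub>U_group p n R\<^esub> w)"
    using skew_assoc[of u v w] U_closed[OF u'] U_closed[OF v'] U_closed[OF w'] by (simp add: U_group_def units_of_def)
qed

end

lemma alg_hom_pow:
  assumes h: "h \<in> alg_hom K A B" and A: "algebra K A" and B: "algebra K B" and x: "x \<in> carrier A"
  shows "h (x [^]\<^bsub>A\<^esub> (k::nat)) = h x [^]\<^bsub>B\<^esub> k"
proof -
  interpret A: algebra K A by fact
  interpret B: algebra K B by fact
  show ?thesis by (induction k) (simp_all add: alg_hom_one[OF h] alg_hom_mult[OF h] x)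
qed

section \<open>The action on the line, conjugation by homotheties, and the semidirect
  product\<close>

context char_p_alg
begin

lemma U_act_fr: "U_act p n R u \<mu> = (\<Oplus>i\<in>{..n}. u i \<otimes> fr i \<mu>)"
  by (simp add: U_act_def fr_def)

lemma U_act_closed: "u \<in> U_set p n R \<Longrightarrow> \<mu> \<in> carrier R \<Longrightarrow> U_act p n R u \<mu> \<in> carrier R"
  unfolding U_act_fr by (rule finsum_closed) (auto simp: U_closed)

lemma U_act_add:
  assumes u: "u \<in> U_set p n R" and x: "x \<in> carrier R" and y: "y \<in> carrier R"
  shows "U_act p n R u (x \<oplus> y) = U_act p n R u x \<oplus> U_act p n R u y"
proof -
  note [simp] = U_closed[OF u] x y
  have "U_act p n R u (x \<oplus> y) = (\<Oplus>i\<in>{..n}. u i \<otimes> fr i x \<oplus> u i \<otimes> fr i y)"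
    unfolding U_act_fr by (rule finsum_cong') (auto simp: fr_add r_distr)
  also have "\<dots> = U_act p n R u x \<oplus> U_act p n R u y"
    unfolding U_act_fr by (rule finsum_addf) auto
  finally show ?thesis .
qed

text \<open>Substituting one additive polynomial into another gives terms of degree
  \<open>p^(i+l)\<close> with \<open>i\<close> and \<open>l\<close> up to \<open>n\<close>. The
  action of the skew product keeps those with \<open>i + l \<le> n\<close>; in the others the
  Frobenius power of the coefficient of \<open>v\<close> is zero.\<close>

lemma U_act_mult:
  assumes u: "u \<in> U_set p n R" and v: "v \<in> U_set p n R" and x: "x \<in> carrier R"
  shows "U_act p n R (u \<otimes>\<^bsub>skew_poly p R\<^esub> v) x = U_act p n R u (U_act p n R v x)"
proof -
  note [simp] = U_closed[OF u] U_closed[OF v] x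
  let ?f = "\<lambda>i l. u i \<otimes> (fr i (v l) \<otimes> fr (i + l) x)"
  have "U_act p n R (u \<otimes>\<^bsub>skew_poly p R\<^esub> v) x = (\<Oplus>m\<in>{..n}. \<Oplus>i\<in>{..m}. ?f i (m - i))"
    unfolding U_act_fr skew_mult
    by (rule finsum_cong') (auto intro!: finsum_closed simp: finsum_ldistr m_assoc intro!: finsum_cong')
  also have "\<dots> = (\<Oplus>i\<in>{..n}. \<Oplus>l\<in>{..n}. ?f i l)"
  proof (rule finsum_triangle_square)
    fix i l assume "i \<le> n" "l \<le> n" "n < i + l"
    then show "?f i l = \<zero>" using U_nil[OF v, of l i] by simp
  qed simp
  also have "\<dots> = U_act p n R u (U_act p n R v x)"
    unfolding U_act_fr
    by (rule finsum_cong') (auto intro!: finsum_closed simp: fr_finsum finsum_rdistr fr_mult fr_fr intro!: finsum_cong')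
  finally show ?thesis .
qed

lemma U_act_one: "x \<in> carrier R \<Longrightarrow> U_act p n R \<one>\<^bsub>skew_poly p R\<^esub> x = x"
proof -
  assume x: "x \<in> carrier R"
  have "U_act p n R \<one>\<^bsub>skew_poly p R\<^esub> x = (\<Oplus>i\<in>{..n}. if i = 0 then x else \<zero>)"
    unfolding U_act_fr skew_one by (rule finsum_cong') (use x in auto)
  then show ?thesis using x by (simp add: add.finprod_singleton_swap)
qed

text \<open>The conjugate of \<open>u\<close> by the homothety \<open>t\<close>, that is, the
  conjugation formula of \<open>GUG\<close> expressed through \<open>fr\<close>.\<close>

definition tw :: "'u \<Rightarrow> (nat \<Rightarrow> 'u) \<Rightarrow> nat \<Rightarrow> 'u" where
  "tw t u = (\<lambda>i. t \<otimes> u i \<otimes> fr i (inv t))"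

lemma fr_inv: "t \<in> Units R \<Longrightarrow> fr i t \<otimes> fr i (inv t) = \<one>"
  by (simp add: fr_mult[symmetric] Units_closed)

lemma fr_inv_cancel: "t \<in> Units R \<Longrightarrow> z \<in> carrier R \<Longrightarrow> fr i t \<otimes> (fr i (inv t) \<otimes> z) = z"
  "t \<in> Units R \<Longrightarrow> z \<in> carrier R \<Longrightarrow> fr i (inv t) \<otimes> (fr i t \<otimes> z) = z"
  by (simp_all add: m_assoc[symmetric] fr_inv Units_closed) (simp add: m_comm[of "fr i (inv t)"] fr_inv Units_closed)

lemma tw_closed:
  assumes t: "t \<in> Units R" and u: "u \<in> U_set p n R" shows "tw t u \<in> U_set p n R"
  using t U_closed[OF u] U_0[OF u] U_nil[OF u] u
  by (auto simp: U_iff tw_def Units_closed fr_mult)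

lemma tw_mult:
  assumes t: "t \<in> Units R" and u: "u \<in> U_set p n R" and v: "v \<in> U_set p n R"
  shows "tw t (u \<otimes>\<^bsub>skew_poly p R\<^esub> v) = tw t u \<otimes>\<^bsub>skew_poly p R\<^esub> tw t v"
proof
  fix k
  note [simp] = U_closed[OF u] U_closed[OF v] Units_closed[OF t] Units_inv_closed[OF t]
  have "tw t (u \<otimes>\<^bsub>skew_poly p R\<^esub> v) k = (\<Oplus>i\<in>{..k}. t \<otimes> (u i \<otimes> fr i (v (k - i))) \<otimes> fr k (inv t))"
    by (simp add: tw_def skew_mult finsum_ldistr finsum_rdistr Pi_def)
  also have "\<dots> = (tw t u \<otimes>\<^bsub>skew_poly p R\<^esub> tw t v) k"
    unfolding skew_mult tw_def
  proof (rule finsum_cong')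
    fix i assume "i \<in> {..k}"
    then show "t \<otimes> (u i \<otimes> fr i (v (k - i))) \<otimes> fr k (inv t) = t \<otimes> u i \<otimes> fr i (inv t) \<otimes> fr i (t \<otimes> v (k - i) \<otimes> fr (k - i) (inv t))"
      by (simp add: fr_mult fr_fr m_assoc fr_inv_cancel[OF t])
  qed auto
  finally show "tw t (u \<otimes>\<^bsub>skew_poly p R\<^esub> v) k = (tw t u \<otimes>\<^bsub>skew_poly p R\<^esub> tw t v) k" .
qed

lemma U_act_tw:
  assumes t: "t \<in> Units R" and u: "u \<in> U_set p n R" and x: "x \<in> carrier R"
  shows "U_act p n R (tw t u) (t \<otimes> x) = t \<otimes> U_act p n R u x"
proof -
  note [simp] = U_closed[OF u] x Units_closed[OF t] Units_inv_closed[OF t]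
  have "U_act p n R (tw t u) (t \<otimes> x) = (\<Oplus>i\<in>{..n}. t \<otimes> (u i \<otimes> fr i x))"
    unfolding U_act_fr tw_def by (rule finsum_cong') (auto simp: fr_mult m_assoc fr_inv_cancel[OF t])
  then show ?thesis unfolding U_act_fr by (simp add: finsum_rdistr Pi_def)
qed

lemma GUG_tw:
  "GUG p n R = semidirect (semidirect (add_monoid R) (U_group p n R) (U_act p n R)) (units_of R)
     (\<lambda>t (\<alpha>, u). (t \<otimes> \<alpha>, tw t u))"
  by (simp add: GUG_def tw_def fr_def)

lemma GUG_carrier: "((\<alpha>, u), t) \<in> carrier (GUG p n R) \<longleftrightarrow> \<alpha> \<in> carrier R \<and> u \<in> U_set p n R \<and> t \<in> Units R"
  by (auto simp: GUG_def semidirect_def U_group_def units_of_def)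

lemma GUG_mult: "((\<alpha>, u), t) \<otimes>\<^bsub>GUG p n R\<^esub> ((\<beta>, w), s) =
    ((\<alpha> \<oplus> U_act p n R u (t \<otimes> \<beta>), u \<otimes>\<^bsub>skew_poly p R\<^esub> tw t w), t \<otimes> s)"
  by (simp add: GUG_tw semidirect_def U_group_def units_of_def)

lemma GUG_one: "\<one>\<^bsub>GUG p n R\<^esub> = ((\<zero>, \<one>\<^bsub>skew_poly p R\<^esub>), \<one>)"
  by (simp add: GUG_def semidirect_def U_group_def units_of_def)

lemma GUG_group: "group (GUG p n R)"
proof -
  have inner: "group (semidirect (add_monoid R) (U_group p n R) (U_act p n R))"
    by (rule semidirect_group[OF a_group U_group])
       (auto simp: U_group_def units_of_def U_act_closed U_act_add U_act_mult U_act_one)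
  show ?thesis
    unfolding GUG_tw
  proof (rule semidirect_group[OF inner units_group])
    fix t x assume "t \<in> carrier (units_of R)" and x: "x \<in> carrier (semidirect (add_monoid R) (U_group p n R) (U_act p n R))"
    then have t: "t \<in> Units R" by (simp add: units_of_def)
    obtain \<alpha> u where x: "x = (\<alpha>, u)" "\<alpha> \<in> carrier R" "u \<in> U_set p n R"
      using x by (auto simp: semidirect_def U_group_def)
    note [simp] = Units_closed[OF t]
    show "(case x of (\<alpha>, u) \<Rightarrow> (t \<otimes> \<alpha>, tw t u)) \<in> carrier (semidirect (add_monoid R) (U_group p n R) (U_act p n R))"
      using x tw_closed[OF t] by (simp add: semidirect_def U_group_def)
    {
      fix y assume "y \<in> carrier (semidirect (add_monoid R) (U_group p n R) (U_act p n R))"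
      then obtain \<beta> w where y: "y = (\<beta>, w)" "\<beta> \<in> carrier R" "w \<in> U_set p n R"
        by (auto simp: semidirect_def U_group_def)
      show "(case x \<otimes>\<^bsub>semidirect (add_monoid R) (U_group p n R) (U_act p n R)\<^esub> y of (\<alpha>, u) \<Rightarrow> (t \<otimes> \<alpha>, tw t u)) =
        (case x of (\<alpha>, u) \<Rightarrow> (t \<otimes> \<alpha>, tw t u)) \<otimes>\<^bsub>semidirect (add_monoid R) (U_group p n R) (U_act p n R)\<^esub> (case y of (\<alpha>, u) \<Rightarrow> (t \<otimes> \<alpha>, tw t u))"
        using x y t by (simp add: semidirect_def U_group_def units_of_def tw_mult U_act_tw r_distr U_act_closed)
    }
    fix s assume "s \<in> carrier (units_of R)"
    then have s: "s \<in> Units R" by (simp add: units_of_def)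
    have i: "inv (t \<otimes> s) = inv t \<otimes> inv s"
    proof (rule Units_mult_inv_unique(2))
      have "t \<otimes> s \<otimes> (inv t \<otimes> inv s) = (t \<otimes> inv t) \<otimes> (s \<otimes> inv s)"
        using t s by (simp add: m_ac Units_closed del: Units_r_inv Units_l_inv)
      then show "t \<otimes> s \<otimes> (inv t \<otimes> inv s) = \<one>" using t s by simp
      then show "inv t \<otimes> inv s \<otimes> (t \<otimes> s) = \<one>" using t s by (simp add: m_comm Units_closed)
    qed (use t s in \<open>simp_all add: Units_closed\<close>)
    have i': "inv (s \<otimes> t) = inv t \<otimes> inv s" using i t s by (simp add: m_comm Units_closed)
    show "(case x of (\<alpha>, u) \<Rightarrow> ((t \<otimes>\<^bsub>units_of R\<^esub> s) \<otimes> \<alpha>, tw (t \<otimes>\<^bsub>units_of R\<^esub> s) u)) =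
      (case case x of (\<alpha>, u) \<Rightarrow> (s \<otimes> \<alpha>, tw s u) of (\<alpha>, u) \<Rightarrow> (t \<otimes> \<alpha>, tw t u))"
      using x t s U_closed[OF x(3)] by (simp add: units_of_def tw_def i i' fr_mult m_ac fun_eq_iff Units_closed)
  next
    fix x assume x: "x \<in> carrier (semidirect (add_monoid R) (U_group p n R) (U_act p n R))"
    then obtain \<alpha> u where x: "x = (\<alpha>, u)" "\<alpha> \<in> carrier R" "u \<in> U_set p n R"
      by (auto simp: semidirect_def U_group_def)
    show "(case x of (\<alpha>, u) \<Rightarrow> (\<one>\<^bsub>units_of R\<^esub> \<otimes> \<alpha>, tw \<one>\<^bsub>units_of R\<^esub> u)) = x"
      using x U_closed[OF x(3)] by (simp add: units_of_def tw_def)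
  qed
qed

text \<open>
  On the affine line the homogeneous coordinates are \<open>(1, x, x\<^sup>p, \<dots>)\<close>, the exponents being the powers
  of \<open>p\<close> up to \<open>p\<^sup>n\<close>; the following formula is the resulting action on the coordinates.
\<close>

definition lin :: "('u \<times> (nat \<Rightarrow> 'u)) \<times> 'u \<Rightarrow> (nat \<Rightarrow> 'u) \<Rightarrow> nat \<Rightarrow> 'u" where
  "lin = (\<lambda>((\<alpha>, u), t) v k. case k of 0 \<Rightarrow> v 0 | Suc j \<Rightarrow>
     if j \<le> n then fr j \<alpha> \<otimes> v 0 \<oplus> (\<Oplus>i\<in>{..n}. fr j (u i) \<otimes> (fr (i + j) t \<otimes> v (Suc (i + j)))) else \<zero>)"

text \<open>The entry \<open>v 0\<close> is the coordinate \<open>a\<close> and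
  \<open>v (Suc l)\<close> is \<open>b_l\<close>. Setting the entries beyond \<open>Suc n\<close> to
  zero makes equality of vectors an equality of functions and lets the sum in \<open>lin\<close> run
  to \<open>n\<close> in every row.\<close>

definition hvec :: "(nat \<Rightarrow> 'u) \<Rightarrow> bool" where
  "hvec v \<longleftrightarrow> (\<forall>k. v k \<in> carrier R) \<and> (\<forall>k>Suc n. v k = \<zero>) \<and> (v 0 \<in> Units R \<or> v (Suc n) \<in> Units R) \<and>
     (\<forall>j<n. v (Suc j) [^] p = v 0 [^] (p - 1) \<otimes> v (Suc (Suc j)))"

lemma lin_0: "lin g v 0 = v 0"
  by (simp add: lin_def split: prod.splits)

lemma lin_Suc: "lin ((\<alpha>, u), t) v (Suc j) =
   (if j \<le> n then fr j \<alpha> \<otimes> v 0 \<oplus> (\<Oplus>i\<in>{..n}. fr j (u i) \<otimes> (fr (i + j) t \<otimes> v (Suc (i + j)))) else \<zero>)"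
  by (simp add: lin_def)

lemma lin_closed:
  assumes g: "g \<in> carrier (GUG p n R)" and v: "\<And>k. v k \<in> carrier R"
  shows "lin g v k \<in> carrier R"
proof -
  obtain \<alpha> u t where g': "g = ((\<alpha>, u), t)" "\<alpha> \<in> carrier R" "u \<in> U_set p n R" "t \<in> Units R"
    using g by (metis GUG_carrier prod.exhaust)
  show ?thesis
    using g' v U_closed[OF g'(3)] Units_closed[OF g'(4)]
    by (cases k) (auto simp: lin_0 lin_Suc intro!: finsum_closed a_closed)
qed

text \<open>Matrix multiplication against multiplication in the semidirect product. The translation
  parts combine by the semidirect law, and the remaining double sum is that of a skew product of
  \<open>u\<close> with the conjugate of \<open>w\<close>; the inverse powers of \<open>t\<close> in
  the conjugate cancel against those from \<open>t \<otimes> s\<close>.\<close>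

lemma lin_comp:
  assumes g: "g \<in> carrier (GUG p n R)" and h: "h \<in> carrier (GUG p n R)" and v: "\<And>k. v k \<in> carrier R"
  shows "lin (g \<otimes>\<^bsub>GUG p n R\<^esub> h) v = lin g (lin h v)"
proof
  fix k
  obtain \<alpha> u t where g': "g = ((\<alpha>, u), t)" "\<alpha> \<in> carrier R" "u \<in> U_set p n R" "t \<in> Units R"
    using g by (metis GUG_carrier prod.exhaust)
  obtain \<beta> w s where h': "h = ((\<beta>, w), s)" "\<beta> \<in> carrier R" "w \<in> U_set p n R" "s \<in> Units R"
    using h by (metis GUG_carrier prod.exhaust)
  note [simp] = g'(2) h'(2) U_closed[OF g'(3)] U_closed[OF h'(3)] Units_closed[OF g'(4)] Units_closed[OF h'(4)]
    Units_inv_closed[OF g'(4)] v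
  show "lin (g \<otimes>\<^bsub>GUG p n R\<^esub> h) v k = lin g (lin h v) k"
  proof (cases k)
    case 0 then show ?thesis by (simp add: lin_0)
  next
    case (Suc j)
    show ?thesis
    proof (cases "j \<le> n")
      case True
      let ?F = "\<lambda>i l. fr j (u i) \<otimes> (fr (i + j) t \<otimes> (fr (i + j) (w l) \<otimes> (fr (l + (i + j)) s \<otimes> v (Suc (l + (i + j))))))"
      let ?c = "\<lambda>i. fr j (u i) \<otimes> (fr (i + j) t \<otimes> (fr (i + j) \<beta> \<otimes> v 0))"
      have c1: "fr j (\<alpha> \<oplus> U_act p n R u (t \<otimes> \<beta>)) \<otimes> v 0 = fr j \<alpha> \<otimes> v 0 \<oplus> (\<Oplus>i\<in>{..n}. ?c i)"
      proof -
        have "fr j (U_act p n R u (t \<otimes> \<beta>)) \<otimes> v 0 = (\<Oplus>i\<in>{..n}. fr j (u i \<otimes> fr i (t \<otimes> \<beta>)) \<otimes> v 0)"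
          unfolding U_act_fr by (simp add: fr_finsum finsum_ldistr Pi_def)
        also have "\<dots> = (\<Oplus>i\<in>{..n}. ?c i)"
          by (rule finsum_cong') (auto simp: fr_mult fr_fr m_assoc add.commute)
        finally show ?thesis using U_act_closed[OF g'(3), of "t \<otimes> \<beta>"] by (simp add: fr_add l_distr)
      qed
      have c2: "(\<Oplus>m\<in>{..n}. fr j ((u \<otimes>\<^bsub>skew_poly p R\<^esub> tw t w) m) \<otimes> (fr (m + j) (t \<otimes> s) \<otimes> v (Suc (m + j)))) =
          (\<Oplus>m\<in>{..n}. \<Oplus>i\<in>{..m}. ?F i (m - i))"
      proof (rule finsum_cong')
        fix m assume "m \<in> {..n}"
        have tc: "tw t w l \<in> carrier R" for l using U_closed[OF tw_closed[OF g'(4) h'(3)]] .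
        have "fr j ((u \<otimes>\<^bsub>skew_poly p R\<^esub> tw t w) m) \<otimes> (fr (m + j) (t \<otimes> s) \<otimes> v (Suc (m + j))) =
          (\<Oplus>i\<in>{..m}. fr j (u i \<otimes> fr i (tw t w (m - i))) \<otimes> (fr (m + j) (t \<otimes> s) \<otimes> v (Suc (m + j))))"
          unfolding skew_mult using tc by (simp add: fr_finsum finsum_ldistr Pi_def)
        also have "\<dots> = (\<Oplus>i\<in>{..m}. ?F i (m - i))"
        proof (rule finsum_cong')
          fix i assume "i \<in> {..m}"
          then have im: "m - i + (i + j) = m + j" "j + i = i + j" "m - i + (j + i) = m + j" "j + (i + (m - i)) = m + j"
            "i + j + (m - i) = m + j" by auto
          have "fr j (u i \<otimes> fr i (tw t w (m - i))) = fr j (u i) \<otimes> (fr (i + j) t \<otimes> (fr (i + j) (w (m - i)) \<otimes> fr (m + j) (inv t)))"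
            by (simp add: tw_def fr_mult fr_fr im m_assoc)
          then show "fr j (u i \<otimes> fr i (tw t w (m - i))) \<otimes> (fr (m + j) (t \<otimes> s) \<otimes> v (Suc (m + j))) = ?F i (m - i)"
            by (simp add: im fr_mult m_assoc fr_inv_cancel[OF g'(4)])
        qed auto
        finally show "fr j ((u \<otimes>\<^bsub>skew_poly p R\<^esub> tw t w) m) \<otimes> (fr (m + j) (t \<otimes> s) \<otimes> v (Suc (m + j))) = (\<Oplus>i\<in>{..m}. ?F i (m - i))" .
      qed (auto intro!: finsum_closed)
      \<comment> \<open>Beyond the triangle one has \<open>i + l > n\<close>, so the power of
        \<open>w l\<close> already vanishes.\<close>
      also have c3: "\<dots> = (\<Oplus>i\<in>{..n}. \<Oplus>l\<in>{..n}. ?F i l)"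
      proof (rule finsum_triangle_square)
        fix i l assume "i \<le> n" "l \<le> n" "n < i + l"
        then have "fr (i + j) (w l) = \<zero>" by (intro U_nil[OF h'(3)]) auto
        then show "?F i l = \<zero>" by simp
      qed simp
      finally have c23: "(\<Oplus>m\<in>{..n}. fr j ((u \<otimes>\<^bsub>skew_poly p R\<^esub> tw t w) m) \<otimes> (fr (m + j) (t \<otimes> s) \<otimes> v (Suc (m + j)))) =
          (\<Oplus>i\<in>{..n}. \<Oplus>l\<in>{..n}. ?F i l)" .
      \<comment> \<open>For \<open>i + j > n\<close> the entry of \<open>lin h v\<close> is zero by
        definition, which the expression on the right does not show. The factor
        \<open>fr j (u i)\<close> vanishes there and makes both sides zero.\<close>
      have r: "fr j (u i) \<otimes> (fr (i + j) t \<otimes> lin h v (Suc (i + j))) = ?c i \<oplus> (\<Oplus>l\<in>{..n}. ?F i l)" if "i \<in> {..n}" for i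
      proof (cases "i + j \<le> n")
        case True
        then show ?thesis
          by (simp add: h'(1) lin_Suc r_distr finsum_rdistr Pi_def)
      next
        case False
        then have "fr j (u i) = \<zero>" using \<open>j \<le> n\<close> by (intro U_nil[OF g'(3)]) auto
        then show ?thesis using lin_closed[OF h v] by (simp add: finsum_all_zero)
      qed
      have "lin g (lin h v) (Suc j) = fr j \<alpha> \<otimes> v 0 \<oplus> (\<Oplus>i\<in>{..n}. ?c i \<oplus> (\<Oplus>l\<in>{..n}. ?F i l))"
      proof -
        have "(\<Oplus>i\<in>{..n}. fr j (u i) \<otimes> (fr (i + j) t \<otimes> lin h v (Suc (i + j)))) = (\<Oplus>i\<in>{..n}. ?c i \<oplus> (\<Oplus>l\<in>{..n}. ?F i l))"
          by (rule finsum_cong'[OF refl _ r]) (auto intro!: finsum_closed)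
        then show ?thesis using True by (simp add: g'(1) lin_Suc lin_0)
      qed
      also have "(\<Oplus>i\<in>{..n}. ?c i \<oplus> (\<Oplus>l\<in>{..n}. ?F i l)) = (\<Oplus>i\<in>{..n}. ?c i) \<oplus> (\<Oplus>i\<in>{..n}. \<Oplus>l\<in>{..n}. ?F i l)"
        by (rule finsum_addf) (auto intro!: finsum_closed)
      finally have "lin g (lin h v) (Suc j) = fr j \<alpha> \<otimes> v 0 \<oplus> ((\<Oplus>i\<in>{..n}. ?c i) \<oplus> (\<Oplus>i\<in>{..n}. \<Oplus>l\<in>{..n}. ?F i l))" .
      moreover have "lin (g \<otimes>\<^bsub>GUG p n R\<^esub> h) v (Suc j) = (fr j \<alpha> \<otimes> v 0 \<oplus> (\<Oplus>i\<in>{..n}. ?c i)) \<oplus> (\<Oplus>i\<in>{..n}. \<Oplus>l\<in>{..n}. ?F i l)"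
        using True by (simp add: g'(1) h'(1) GUG_mult lin_Suc c1 c23)
      moreover have "(\<Oplus>i\<in>{..n}. ?c i) \<in> carrier R" "(\<Oplus>i\<in>{..n}. \<Oplus>l\<in>{..n}. ?F i l) \<in> carrier R"
        by (auto intro!: finsum_closed)
      ultimately show ?thesis unfolding Suc by (simp add: a_assoc)
    next
      case False then show ?thesis using Suc by (simp add: g'(1) h'(1) GUG_mult lin_Suc)
    qed
  qed
qed

lemma lin_one:
  assumes v: "\<And>k. v k \<in> carrier R" and z: "\<And>k. k > Suc n \<Longrightarrow> v k = \<zero>"
  shows "lin \<one>\<^bsub>GUG p n R\<^esub> v = v"
proof
  fix k
  show "lin \<one>\<^bsub>GUG p n R\<^esub> v k = v k"
  proof (cases k)
    case (Suc j)
    have "(\<Oplus>i\<in>{..n}. fr j (\<one>\<^bsub>skew_poly p R\<^esub> i) \<otimes> (fr (i + j) \<one> \<otimes> v (Suc (i + j)))) =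
      (\<Oplus>i\<in>{..n}. if i = 0 then v (Suc j) else \<zero>)"
      by (rule finsum_cong') (use v in \<open>auto simp: skew_one\<close>)
    also have "\<dots> = v (Suc j)" using v by (simp add: add.finprod_singleton_swap)
    finally show ?thesis using Suc v z by (simp add: GUG_one lin_Suc)
  qed (simp add: lin_0)
qed

text \<open>Homogeneity is what makes the formula act on points: proportional vectors go to
  proportional vectors, with the same factor.\<close>

lemma lin_scale:
  assumes g: "g \<in> carrier (GUG p n R)" and v: "\<And>k. v k \<in> carrier R" and c: "c \<in> carrier R"
  shows "lin g (\<lambda>k. c \<otimes> v k) = (\<lambda>k. c \<otimes> lin g v k)"
proof
  fix k
  obtain \<alpha> u t where g': "g = ((\<alpha>, u), t)" "\<alpha> \<in> carrier R" "u \<in> U_set p n R" "t \<in> Units R"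
    using g by (metis GUG_carrier prod.exhaust)
  note [simp] = g'(2) U_closed[OF g'(3)] Units_closed[OF g'(4)] v c
  show "lin g (\<lambda>k. c \<otimes> v k) k = c \<otimes> lin g v k"
  proof (cases k)
    case (Suc j)
    have "(\<Oplus>i\<in>{..n}. fr j (u i) \<otimes> (fr (i + j) t \<otimes> (c \<otimes> v (Suc (i + j))))) =
      (\<Oplus>i\<in>{..n}. c \<otimes> (fr j (u i) \<otimes> (fr (i + j) t \<otimes> v (Suc (i + j)))))"
      by (rule finsum_cong') (auto simp: m_ac)
    also have "\<dots> = c \<otimes> (\<Oplus>i\<in>{..n}. fr j (u i) \<otimes> (fr (i + j) t \<otimes> v (Suc (i + j))))"
      by (rule finsum_rdistr[symmetric]) auto
    finally show ?thesis using Suc by (simp add: g'(1) lin_Suc r_distr m_lcomm finsum_closed)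
  qed (simp add: lin_0)
qed

text \<open>The link with the given action: the vector of \<open>x\<close> goes to the vector of the
  moved coordinate. It is the reason for the shape of \<open>lin\<close>, and the extension property
  comes from here.\<close>

lemma lin_line:
  assumes g: "g \<in> carrier (GUG p n R)" and x: "x \<in> carrier R"
    and v0: "v 0 = \<one>" and v: "\<And>j. j \<le> n \<Longrightarrow> v (Suc j) = fr j x" and z: "\<And>k. k > Suc n \<Longrightarrow> v k = \<zero>" and j: "j \<le> n"
  shows "lin g v (Suc j) = fr j (GUG_line_act p n R g x)"
proof -
  obtain \<alpha> u t where g': "g = ((\<alpha>, u), t)" "\<alpha> \<in> carrier R" "u \<in> U_set p n R" "t \<in> Units R"
    using g by (metis GUG_carrier prod.exhaust)
  note [simp] = g'(2) U_closed[OF g'(3)] Units_closed[OF g'(4)] x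
  have "fr j (U_act p n R u (t \<otimes> x)) = (\<Oplus>i\<in>{..n}. fr j (u i \<otimes> fr i (t \<otimes> x)))"
    unfolding U_act_fr by (rule fr_finsum) auto
  also have "\<dots> = (\<Oplus>i\<in>{..n}. fr j (u i) \<otimes> (fr (i + j) t \<otimes> v (Suc (i + j))))"
  proof (rule finsum_cong')
    fix i assume "i \<in> {..n}"
    show "fr j (u i \<otimes> fr i (t \<otimes> x)) = fr j (u i) \<otimes> (fr (i + j) t \<otimes> v (Suc (i + j)))"
    proof (cases "i + j \<le> n")
      case True then show ?thesis by (simp add: v fr_mult fr_fr add.commute)
    next
      case False
      then have "fr j (u i) = \<zero>" using j by (intro U_nil[OF g'(3)]) auto
      then show ?thesis using False by (simp add: z fr_mult)
    qed
  next
    show "(\<lambda>i. fr j (u i) \<otimes> (fr (i + j) t \<otimes> v (Suc (i + j)))) \<in> {..n} \<rightarrow> carrier R"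
    proof
      fix i show "fr j (u i) \<otimes> (fr (i + j) t \<otimes> v (Suc (i + j))) \<in> carrier R"
        by (cases "i + j \<le> n") (simp_all add: v z)
    qed
  qed simp
  finally have "fr j (U_act p n R u (t \<otimes> x)) = (\<Oplus>i\<in>{..n}. fr j (u i) \<otimes> (fr (i + j) t \<otimes> v (Suc (i + j))))" .
  then show ?thesis
    using j U_act_closed[OF g'(3), of "t \<otimes> x"] a_comm[OF fr_closed[OF g'(2), of j] fr_closed[OF U_act_closed[OF g'(3) m_closed[OF Units_closed[OF g'(4)] x]], of j]]
    by (simp add: g'(1) lin_Suc v0 GUG_line_act_def fr_add)
qed

text \<open>The relations are preserved because \<open>p\<close>-th powers are additive and every
  term satisfies its own relation. For the unit condition, the last row reduces to
  \<open>\<alpha>^(p^n) a + t^(p^n) b_n\<close>. If \<open>a\<close> is not a unit, then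
  \<open>b_n\<close> is one and \<open>loc\<close>, the local ring property, keeps this sum a
  unit.\<close>

lemma lin_hvec:
  assumes g: "g \<in> carrier (GUG p n R)" and v: "hvec v"
    and loc: "\<And>x y. x \<in> carrier R \<Longrightarrow> x \<notin> Units R \<Longrightarrow> y \<in> Units R \<Longrightarrow> x \<oplus> y \<in> Units R"
  shows "hvec (lin g v)"
proof -
  obtain \<alpha> u t where g': "g = ((\<alpha>, u), t)" "\<alpha> \<in> carrier R" "u \<in> U_set p n R" "t \<in> Units R"
    using g by (metis GUG_carrier prod.exhaust)
  have vc: "v k \<in> carrier R" for k using v by (simp add: hvec_def)
  note [simp] = g'(2) U_closed[OF g'(3)] Units_closed[OF g'(4)] vc
  have rel: "v (Suc j) [^] p = v 0 [^] (p - 1) \<otimes> v (Suc (Suc j))" if "j < n" for j using v that by (simp add: hvec_def)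
  have f1: "x [^] p = fr 1 x" for x by (simp add: fr_def)
  have p1: "fr 1 x = x [^] (p - 1) \<otimes> x" if "x \<in> carrier R" for x
    using that p_pos nat_pow_Suc[of x "p - 1"] by (simp add: fr_def del: nat_pow_Suc)
  show ?thesis unfolding hvec_def
  proof (intro conjI allI impI)
    show "lin g v k \<in> carrier R" for k by (rule lin_closed[OF g vc])
    show "lin g v k = \<zero>" if "k > Suc n" for k using that by (cases k) (auto simp: g'(1) lin_Suc)
    show "lin g v 0 \<in> Units R \<or> lin g v (Suc n) \<in> Units R"
    proof (cases "v 0 \<in> Units R")
      case False
      then have vn: "v (Suc n) \<in> Units R" using v by (simp add: hvec_def)
      have "(\<Oplus>i\<in>{..n}. fr n (u i) \<otimes> (fr (i + n) t \<otimes> v (Suc (i + n)))) =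
        (\<Oplus>i\<in>{..n}. if i = 0 then fr n t \<otimes> v (Suc n) else \<zero>)"
        by (rule finsum_cong') (auto simp: U_0[OF g'(3)] U_nil[OF g'(3)])
      also have "\<dots> = fr n t \<otimes> v (Suc n)" by (simp add: add.finprod_singleton_swap)
      finally have "lin g v (Suc n) = fr n \<alpha> \<otimes> v 0 \<oplus> fr n t \<otimes> v (Suc n)" by (simp add: g'(1) lin_Suc)
      moreover have "fr n t \<in> Units R" using g'(4) by (simp add: fr_def Units_pow_closed)
      ultimately show ?thesis
        using vn False by (simp add: loc Units_prod_iff)
    qed (simp add: lin_0)
    fix j assume j: "j < n"
    have "lin g v (Suc j) [^] p = fr 1 (fr j \<alpha>) \<otimes> fr 1 (v 0) \<oplus> (\<Oplus>i\<in>{..n}. fr 1 (fr j (u i) \<otimes> (fr (i + j) t \<otimes> v (Suc (i + j)))))"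
      unfolding f1 using j by (simp add: g'(1) lin_Suc fr_add fr_mult fr_finsum finsum_closed)
    also have "(\<Oplus>i\<in>{..n}. fr 1 (fr j (u i) \<otimes> (fr (i + j) t \<otimes> v (Suc (i + j))))) =
      (\<Oplus>i\<in>{..n}. v 0 [^] (p - 1) \<otimes> (fr (Suc j) (u i) \<otimes> (fr (i + Suc j) t \<otimes> v (Suc (i + Suc j)))))"
    proof (rule finsum_cong')
      fix i assume "i \<in> {..n}"
      show "fr 1 (fr j (u i) \<otimes> (fr (i + j) t \<otimes> v (Suc (i + j)))) =
        v 0 [^] (p - 1) \<otimes> (fr (Suc j) (u i) \<otimes> (fr (i + Suc j) t \<otimes> v (Suc (i + Suc j))))"
      \<comment> \<open>For \<open>i + j < n\<close> the relation of \<open>v\<close> at index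
        \<open>i + j\<close> is available. Otherwise \<open>U_nil\<close> kills the
        \<open>p^(j+1)\<close>-th power of \<open>u i\<close>, which occurs on both sides.\<close>
      proof (cases "i + j < n")
        case True
        have "fr 1 (v (Suc (i + j))) = v 0 [^] (p - 1) \<otimes> v (Suc (Suc (i + j)))" using rel[OF True] by (simp add: fr_def)
        then show ?thesis by (simp add: fr_mult fr_fr m_ac)
      next
        case False
        then have "fr (Suc j) (u i) = \<zero>" using j by (intro U_nil[OF g'(3)]) auto
        then show ?thesis by (simp add: fr_mult fr_fr)
      qed
    qed auto
    also have "\<dots> = v 0 [^] (p - 1) \<otimes> (\<Oplus>i\<in>{..n}. fr (Suc j) (u i) \<otimes> (fr (i + Suc j) t \<otimes> v (Suc (i + Suc j))))"
      by (rule finsum_rdistr[symmetric]) auto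
    also have "fr 1 (fr j \<alpha>) \<otimes> fr 1 (v 0) = v 0 [^] (p - 1) \<otimes> (fr (Suc j) \<alpha> \<otimes> v 0)"
      by (simp add: fr_fr p1[OF vc, unfolded One_nat_def] m_ac)
    finally show "lin g v (Suc j) [^] p = lin g v 0 [^] (p - 1) \<otimes> lin g v (Suc (Suc j))"
      using j by (simp add: g'(1) lin_0 lin_Suc r_distr finsum_closed)
  qed
qed

end

text \<open>\<open>GUG_map\<close> with different source and target types, as needed for the map to a stalk.\<close>

definition group_map :: "('u \<Rightarrow> 'v) \<Rightarrow> ('u \<times> (nat \<Rightarrow> 'u)) \<times> 'u \<Rightarrow> ('v \<times> (nat \<Rightarrow> 'v)) \<times> 'v" where
  "group_map \<phi> = (\<lambda>((\<alpha>, u), t). ((\<phi> \<alpha>, \<lambda>i. \<phi> (u i)), \<phi> t))"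

lemma GUG_map_eq: "GUG_map = group_map"
  by (simp add: GUG_map_def group_map_def fun_eq_iff)

lemma group_map_closed:
  assumes R: "char_p_alg K R p" and R': "char_p_alg K R' p" and \<phi>: "\<phi> \<in> alg_hom K R R'"
    and g: "g \<in> carrier (GUG p n R)"
  shows "group_map \<phi> g \<in> carrier (GUG p n R')"
proof -
  interpret R: char_p_alg K R p n by fact
  interpret R': char_p_alg K R' p n by fact
  interpret h: ring_hom_cring R R' \<phi> by (rule alg_hom_ring_hom_cring[OF \<phi> R.algebra_axioms R'.algebra_axioms])
  obtain \<alpha> u t where g': "g = ((\<alpha>, u), t)" "\<alpha> \<in> carrier R" "u \<in> U_set p n R" "t \<in> Units R"
    using g by (metis R.GUG_carrier prod.exhaust)
  have fr: "\<phi> (R.fr i x) = R'.fr i (\<phi> x)" if "x \<in> carrier R" for i x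
    using that by (simp add: R.fr_def R'.fr_def alg_hom_pow[OF \<phi> R.algebra_axioms R'.algebra_axioms])
  have "\<phi> t \<in> Units R'" by (rule alg_hom_Units[OF \<phi> R.algebra_axioms R'.algebra_axioms g'(4)])
  moreover have "(\<lambda>i. \<phi> (u i)) \<in> U_set p n R'"
    using g'(3) by (auto simp: R.U_iff R'.U_iff fr[symmetric])
  ultimately show ?thesis using g' by (simp add: group_map_def R'.GUG_carrier)
qed

text \<open>The formula uses only sums, products and powers, so it commutes with homomorphisms. It
  is applied to the maps between stalks.\<close>

lemma lin_natural:
  assumes R: "char_p_alg K R p" and R': "char_p_alg K R' p" and \<phi>: "\<phi> \<in> alg_hom K R R'"
    and g: "g \<in> carrier (GUG p n R)" and v: "\<And>k. v k \<in> carrier R"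
  shows "\<phi> (char_p_alg.lin R p n g v k) = char_p_alg.lin R' p n (group_map \<phi> g) (\<lambda>k. \<phi> (v k)) k"
proof -
  interpret R: char_p_alg K R p n by fact
  interpret R': char_p_alg K R' p n by fact
  interpret h: ring_hom_cring R R' \<phi> by (rule alg_hom_ring_hom_cring[OF \<phi> R.algebra_axioms R'.algebra_axioms])
  obtain \<alpha> u t where g': "g = ((\<alpha>, u), t)" "\<alpha> \<in> carrier R" "u \<in> U_set p n R" "t \<in> Units R"
    using g by (metis R.GUG_carrier prod.exhaust)
  note [simp] = g'(2) R.U_closed[OF g'(3)] R.Units_closed[OF g'(4)] v
  have fr: "\<phi> (R.fr i x) = R'.fr i (\<phi> x)" if "x \<in> carrier R" for i x
    using that by (simp add: R.fr_def R'.fr_def alg_hom_pow[OF \<phi> R.algebra_axioms R'.algebra_axioms])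
  show ?thesis
  proof (cases k)
    case 0 then show ?thesis by (simp add: R.lin_0 R'.lin_0)
  next
    case (Suc j)
    have "\<phi> (\<Oplus>\<^bsub>R\<^esub>i\<in>{..n}. R.fr j (u i) \<otimes>\<^bsub>R\<^esub> (R.fr (i + j) t \<otimes>\<^bsub>R\<^esub> v (Suc (i + j)))) =
      (\<Oplus>\<^bsub>R'\<^esub>i\<in>{..n}. R'.fr j (\<phi> (u i)) \<otimes>\<^bsub>R'\<^esub> (R'.fr (i + j) (\<phi> t) \<otimes>\<^bsub>R'\<^esub> \<phi> (v (Suc (i + j)))))"
      by (subst h.hom_finsum) (auto simp: fr o_def intro!: R'.finsum_cong')
    then show ?thesis
      using Suc by (simp add: g'(1) group_map_def R.lin_Suc R'.lin_Suc fr R.finsum_closed Pi_def)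
  qed
qed

section \<open>Locating a point in the charts, from the right-hand side\<close>

context glue_aff
begin

lemma inr_patch: "primeideal P B \<Longrightarrow> inr P \<in> CA.patch \<longleftrightarrow> d \<notin> P"
  using SB.cut_image_iff[of P] SA.cut_prime by (auto simp: inl_inr image_iff)

lemma overlap_unit_right:
  assumes R: "algebra K R" and f: "f \<in> rmors K (Spec R) X" and Q: "primeideal Q R" and m: "pt f Q \<in> CB.patch"
  shows "CB.chart_hom f Q d \<in> Units (stalk_at R Q) \<longleftrightarrow> pt f Q \<in> CA.patch"
proof -
  interpret F: chart_pt K B X inr snd R f by (intro chart_pt.intro chart_pt_axioms.intro spec_ring.intro chart_right R f)
  have Qd: "Q \<in> F.dmn" using Q m by blast
  have "pt f Q \<in> CA.patch \<longleftrightarrow> d \<notin> F.G.ctr Q"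
    unfolding F.pt_eq[OF Qd] by (rule inr_patch[OF F.G.ctr_prime[OF Qd]])
  also have "\<dots> \<longleftrightarrow> CB.chart_hom f Q d \<in> Units (stalk_at R Q)" using SB.e_A unfolding contr_def by blast
  finally show ?thesis by (rule sym)
qed

lemma pt_patch:
  assumes "f \<in> rmors K (Spec R) X" "cring R" "primeideal Q R"
  shows "pt f Q \<in> CA.patch \<or> pt f Q \<in> CB.patch"
proof -
  have "pt f Q \<in> topspace (top_of X)"
    using rmorsD(2)[OF assms(1)] assms(2,3) by (auto simp: continuous_map_def topspace_Spec)
  then show ?thesis unfolding topspace_X by blast
qed

end

section \<open>Sections given by explicit formulas in the stalks\<close>

context spec_ring
begin

text \<open>This lemma and the following ones restate the closure properties for sections written as
  functions of the prime, so that the regularity of a formula can be derived along its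
  syntax.\<close>

lemma secI_cong: "(\<lambda>Q\<in>U. x Q) \<in> sec A U \<Longrightarrow> (\<And>Q. Q \<in> U \<Longrightarrow> y Q = x Q) \<Longrightarrow> (\<lambda>Q\<in>U. y Q) \<in> sec A U"
  using restrict_ext[of U y x] by simp

lemma secI_mult:
  "spec_open A U \<Longrightarrow> (\<lambda>Q\<in>U. x Q) \<in> sec A U \<Longrightarrow> (\<lambda>Q\<in>U. y Q) \<in> sec A U \<Longrightarrow> (\<lambda>Q\<in>U. x Q \<otimes>\<^bsub>stalk_at A Q\<^esub> y Q) \<in> sec A U"
  using sec_mult[of U "\<lambda>Q\<in>U. x Q" "\<lambda>Q\<in>U. y Q"] by (simp cong: restrict_cong)

lemma secI_add:
  "spec_open A U \<Longrightarrow> (\<lambda>Q\<in>U. x Q) \<in> sec A U \<Longrightarrow> (\<lambda>Q\<in>U. y Q) \<in> sec A U \<Longrightarrow> (\<lambda>Q\<in>U. x Q \<oplus>\<^bsub>stalk_at A Q\<^esub> y Q) \<in> sec A U"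
  using sec_add[of U "\<lambda>Q\<in>U. x Q" "\<lambda>Q\<in>U. y Q"] by (simp cong: restrict_cong)

lemma secI_smult:
  "spec_open A U \<Longrightarrow> (\<lambda>Q\<in>U. x Q) \<in> sec A U \<Longrightarrow> c \<in> carrier K \<Longrightarrow> (\<lambda>Q\<in>U. c \<odot>\<^bsub>stalk_at A Q\<^esub> x Q) \<in> sec A U"
  using sec_smult[of U "\<lambda>Q\<in>U. x Q" c] by (simp cong: restrict_cong)

lemma secI_inv:
  "spec_open A U \<Longrightarrow> (\<lambda>Q\<in>U. x Q) \<in> sec A U \<Longrightarrow> (\<And>Q. Q \<in> U \<Longrightarrow> x Q \<in> Units (stalk_at A Q)) \<Longrightarrow>
   (\<lambda>Q\<in>U. inv\<^bsub>stalk_at A Q\<^esub> x Q) \<in> sec A U"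
  using sec_inv[of U "\<lambda>Q\<in>U. x Q"] by (simp cong: restrict_cong)

lemma secI_one: "spec_open A U \<Longrightarrow> (\<lambda>Q\<in>U. \<one>\<^bsub>stalk_at A Q\<^esub>) \<in> sec A U"
  using sec_const[of U \<one>] by (simp add: st_one[OF open_prime] cong: restrict_cong)

lemma secI_zero: "spec_open A U \<Longrightarrow> (\<lambda>Q\<in>U. \<zero>\<^bsub>stalk_at A Q\<^esub>) \<in> sec A U"
  using sec_const[of U \<zero>] by (simp add: st_zero[OF open_prime] cong: restrict_cong)

lemma sec_val: "(\<lambda>Q\<in>U. x Q) \<in> sec A U \<Longrightarrow> Q \<in> U \<Longrightarrow> x Q \<in> carrier (stalk_at A Q)"
  using sec_stalk[of "\<lambda>Q\<in>U. x Q" A U Q] by simp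

lemma secI_pow:
  assumes "spec_open A U" "(\<lambda>Q\<in>U. x Q) \<in> sec A U"
  shows "(\<lambda>Q\<in>U. x Q [^]\<^bsub>stalk_at A Q\<^esub> (k::nat)) \<in> sec A U"
proof (induction k)
  case 0 show ?case by (rule secI_cong[OF secI_one[OF assms(1)]]) (simp add: nat_pow_def)
next
  case (Suc k) show ?case by (rule secI_cong[OF secI_mult[OF assms(1) Suc assms(2)]]) (simp add: nat_pow_def)
qed

lemma secI_finsum:
  assumes U: "spec_open A U" and "finite I" "\<And>i. i \<in> I \<Longrightarrow> (\<lambda>Q\<in>U. x i Q) \<in> sec A U"
  shows "(\<lambda>Q\<in>U. \<Oplus>\<^bsub>stalk_at A Q\<^esub>i\<in>I. x i Q) \<in> sec A U"
  using assms(2,3)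
proof (induction I rule: finite_induct)
  case empty
  have "(\<Oplus>\<^bsub>stalk_at A Q\<^esub>i\<in>{}. x i Q) = \<zero>\<^bsub>stalk_at A Q\<^esub>" if "Q \<in> U" for Q
    by (rule abelian_monoid.finsum_empty[OF abelian_group.axioms(1)[OF ring.axioms(1)[OF cring.axioms(1)[OF st_cring[OF open_prime[OF U that]]]]]])
  then show ?case by (rule secI_cong[OF secI_zero[OF U]])
next
  case (insert j I)
  have e: "(\<Oplus>\<^bsub>stalk_at A Q\<^esub>i\<in>insert j I. x i Q) = x j Q \<oplus>\<^bsub>stalk_at A Q\<^esub> (\<Oplus>\<^bsub>stalk_at A Q\<^esub>i\<in>I. x i Q)" if Q: "Q \<in> U" for Q
  proof -
    interpret L: cring "stalk_at A Q" by (rule st_cring[OF open_prime[OF U Q]])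
    show ?thesis
    proof (rule L.finsum_insert[OF insert.hyps])
      have c: "x k Q \<in> carrier (stalk_at A Q)" if "k \<in> insert j I" for k
        by (rule sec_val[where x="x k", OF insert.prems[OF that] Q])
      show "(\<lambda>i. x i Q) \<in> I \<rightarrow> carrier (stalk_at A Q)" "x j Q \<in> carrier (stalk_at A Q)" by (rule Pi_I, rule c, simp, rule c, simp)
    qed

  qed
  have j: "(\<lambda>Q\<in>U. x j Q) \<in> sec A U" by (rule insert.prems) simp
  have I: "(\<lambda>Q\<in>U. \<Oplus>\<^bsub>stalk_at A Q\<^esub>i\<in>I. x i Q) \<in> sec A U" by (rule insert.IH, rule insert.prems) simp
  show ?case by (rule secI_cong[OF secI_add[OF U j I] e])
qed

lemma secI_local:
  assumes U: "spec_open A U" and l: "\<And>Q. Q \<in> U \<Longrightarrow> \<exists>V. spec_open A V \<and> Q \<in> V \<and> V \<subseteq> U \<and> (\<lambda>Q\<in>V. x Q) \<in> sec A V"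
  shows "(\<lambda>Q\<in>U. x Q) \<in> sec A U"
proof (rule sec_locI[OF U])
  fix P assume "P \<in> U"
  then obtain V where V: "spec_open A V" "P \<in> V" "V \<subseteq> U" "(\<lambda>Q\<in>V. x Q) \<in> sec A V" using l by meson
  then have "\<forall>Q\<in>V. (\<lambda>Q\<in>U. x Q) Q = (\<lambda>Q\<in>V. x Q) Q" by auto
  with V show "\<exists>V t. spec_open A V \<and> P \<in> V \<and> V \<subseteq> U \<and> t \<in> sec A V \<and> (\<forall>Q\<in>V. (\<lambda>Q\<in>U. x Q) Q = t Q)"
    by (intro exI[of _ V] exI[of _ "\<lambda>Q\<in>V. x Q"]) simp
qed simp

lemma secI_mono:
  assumes s: "(\<lambda>Q\<in>U. x Q) \<in> sec A U" and V: "spec_open A V" "V \<subseteq> U"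
  shows "(\<lambda>Q\<in>V. x Q) \<in> sec A V"
proof -
  have "restrict (\<lambda>Q\<in>U. x Q) V = (\<lambda>Q\<in>V. x Q)" by (rule restrict_ext) (use V(2) in auto)
  then show ?thesis using sec_restrict[OF s V] by simp
qed

lemma secI_open_unit:
  assumes "spec_open A U" "(\<lambda>Q\<in>U. x Q) \<in> sec A U"
  shows "spec_open A {Q \<in> U. x Q \<in> Units (stalk_at A Q)}"
proof -
  have "{Q \<in> U. (\<lambda>Q\<in>U. x Q) Q \<in> Units (stalk_at A Q)} = {Q \<in> U. x Q \<in> Units (stalk_at A Q)}" by auto
  then show ?thesis using open_unit[OF assms] by simp
qed

text \<open>Otherwise \<open>y\<close> would be the difference of two nonunits, and the nonunits of
  a stalk form an ideal. This discharges the hypothesis \<open>loc\<close> of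
  \<open>lin_hvec\<close>.\<close>

lemma stalk_add_unit:
  assumes Q: "primeideal Q A" and x: "x \<in> carrier (stalk_at A Q)" "x \<notin> Units (stalk_at A Q)" and y: "y \<in> Units (stalk_at A Q)"
  shows "x \<oplus>\<^bsub>stalk_at A Q\<^esub> y \<in> Units (stalk_at A Q)"
proof (rule ccontr)
  assume n: "\<not> ?thesis"
  let ?M = "{X \<in> carrier (stalk_at A Q). X \<notin> Units (stalk_at A Q)}"
  interpret L: cring "stalk_at A Q" by (rule st_cring[OF Q])
  have ad: "additive_subgroup ?M (stalk_at A Q)"
    by (rule ideal.axioms(1)[OF primeideal.axioms(1)[OF stalk_nonunits[OF Q]]])
  have yc: "y \<in> carrier (stalk_at A Q)" using y by (rule L.Units_closed)
  have "\<ominus>\<^bsub>stalk_at A Q\<^esub> x \<in> ?M" "x \<oplus>\<^bsub>stalk_at A Q\<^esub> y \<in> ?M"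
    using additive_subgroup.a_inv_closed[OF ad, of x] x yc n by blast+
  then have "(\<ominus>\<^bsub>stalk_at A Q\<^esub> x) \<oplus>\<^bsub>stalk_at A Q\<^esub> (x \<oplus>\<^bsub>stalk_at A Q\<^esub> y) \<in> ?M" by (rule additive_subgroup.a_closed[OF ad])
  moreover have "(\<ominus>\<^bsub>stalk_at A Q\<^esub> x) \<oplus>\<^bsub>stalk_at A Q\<^esub> (x \<oplus>\<^bsub>stalk_at A Q\<^esub> y) = y"
    using x(1) yc by (simp add: L.a_assoc[symmetric] L.l_neg)
  ultimately show False using y by simp
qed

end

section \<open>Points of the curve in homogeneous coordinates\<close>

locale curve_data = K: field K for K :: "('k, 'm) ring_scheme" + fixes p n :: nat
  assumes p: "prime p" and char: "[p] \<cdot>\<^bsub>K\<^esub> \<one>\<^bsub>K\<^esub> = \<zero>\<^bsub>K\<^esub>"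
begin

lemma p_pos: "p > 0"
  using p prime_gt_0_nat by blast

lemma char_alg: assumes "algebra K R" shows "char_p_alg K R p"
proof -
  interpret R: algebra K R by fact
  have "[k] \<cdot>\<^bsub>R\<^esub> \<one>\<^bsub>R\<^esub> = ([k] \<cdot>\<^bsub>K\<^esub> \<one>\<^bsub>K\<^esub>) \<odot>\<^bsub>R\<^esub> \<one>\<^bsub>R\<^esub>" for k :: nat
    by (induction k) (simp_all add: R.smult_l_distr)
  from this[of p] have "[p] \<cdot>\<^bsub>R\<^esub> \<one>\<^bsub>R\<^esub> = \<zero>\<^bsub>R\<^esub>" by (simp add: char)
  then show ?thesis
    by (intro char_p_alg.intro char_p.intro char_p_axioms.intro R.algebra_axioms R.M_cring p)
qed

lemma char_stalk: "algebra K R \<Longrightarrow> primeideal Q R \<Longrightarrow> char_p_alg K (stalk_at R Q) p"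
  by (intro char_alg stalk_algebra)

abbreviation "A \<equiv> semigroup_algebra K (Gamma p n)"
abbreviation "B \<equiv> line_algebra K"
abbreviation "C \<equiv> torus_algebra K"

sublocale LA: laurent K "int ` Gamma p n"
  by unfold_locales (auto simp: image_iff intro: Gamma.zero, metis Gamma.add of_nat_add)

sublocale LB: laurent K "{..0}"
  by unfold_locales auto

sublocale LC: laurent K UNIV
  by unfold_locales auto

lemma alg_A: "algebra K A" and alg_B: "algebra K B" and alg_C: "algebra K C"
  unfolding semigroup_algebra_def line_algebra_def torus_algebra_def
  by (rule LA.L_algebra LB.L_algebra LC.L_algebra)+

text \<open>The overlap is the torus: inverting \<open>T^(p^n)\<close> in the semigroup algebra, or
  \<open>T^-1\<close> in the coordinate ring of the line, yields all Laurent polynomials. For the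
  semigroup algebra this is \<open>Gamma_cofinal\<close>.\<close>

sublocale glue_aff K A B C "mon K (int (p ^ n))" "mon K (- 1)"
proof (rule glue_aff.intro)
  show "loc_sub K A C (mon K (int (p ^ n)))"
    unfolding semigroup_algebra_def torus_algebra_def
    by (rule LA.loc_sub[OF imageI[OF Gamma.gen_top] Gamma_cofinal[OF p_pos]])
  have "\<exists>k. \<forall>k'\<ge>k. z + int k' * - 1 \<in> {..0}" for z :: int
    by (rule exI[of _ "nat z"]) auto
  then show "loc_sub K B C (mon K (- 1))"
    unfolding line_algebra_def torus_algebra_def by (intro LB.loc_sub) auto
qed

lemma X_curve: "X = curve K p n"
  by (simp add: curve_def)

text \<open>The degree in \<open>x\<close> of the homogeneous coordinate of index \<open>k\<close>.
  Divided by the last coordinate, the coordinate becomes \<open>T\<close> to the power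
  \<open>p ^ n - wt k\<close>, an element of the semigroup algebra.\<close>

definition wt :: "nat \<Rightarrow> nat" where "wt k = (if k = 0 then 0 else p ^ (k - 1))"

lemma wt_le: "k \<le> Suc n \<Longrightarrow> wt k \<le> p ^ n"
  using p_pos by (auto simp: wt_def intro: power_increasing)

lemma wt_simps [simp]: "wt 0 = 0" "wt (Suc l) = p ^ l"
  by (simp_all add: wt_def)

lemma gen_Gamma: "k \<le> Suc n \<Longrightarrow> p ^ n - wt k \<in> Gamma p n"
proof (cases k)
  case (Suc j)
  assume "k \<le> Suc n"
  then show ?thesis using Suc Gamma.gen[of j n p] Gamma.zero by (cases "j = n") auto
qed (simp add: Gamma.gen_top)

lemma mon_A: "c \<in> Gamma p n \<Longrightarrow> mon K (int c) \<in> carrier A"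
  unfolding semigroup_algebra_def by (rule LA.mono_carrier) simp

lemma mon_B: "mon K (- int c) \<in> carrier B"
  unfolding line_algebra_def by (rule LB.mono_carrier) simp

lemma mon_A_mult: "c \<in> Gamma p n \<Longrightarrow> c' \<in> Gamma p n \<Longrightarrow> mon K (int c) \<otimes>\<^bsub>A\<^esub> mon K (int c') = mon K (int (c + c'))"
  unfolding semigroup_algebra_def by (subst LA.mono_mono) auto

lemma mon_B_mult: "mon K (- int c) \<otimes>\<^bsub>B\<^esub> mon K (- int c') = mon K (- int (c + c'))"
  unfolding line_algebra_def by (subst LB.mono_mono) auto

lemma mon_C_mult: "mon K a \<otimes>\<^bsub>C\<^esub> mon K b = mon K (a + b)"
  unfolding torus_algebra_def by (rule LC.mono_mono) auto

lemma mon_one: "\<one>\<^bsub>A\<^esub> = mon K 0" "\<one>\<^bsub>B\<^esub> = mon K 0"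
  unfolding semigroup_algebra_def line_algebra_def by (rule LA.L_one LB.L_one)+

lemma mon_A_pow:
  assumes "h \<in> alg_hom K A L" "c \<in> Gamma p n" "algebra K L"
  shows "h (mon K (int c)) [^]\<^bsub>L\<^esub> k = h (mon K (int (k * c)))"
proof -
  interpret L: algebra K L by fact
  show ?thesis
  proof (induction k)
    case 0 show ?case using alg_hom_one[OF assms(1)] by (simp add: mon_one)
  next
    case (Suc k)
    show ?case
      using Suc alg_hom_mult[OF assms(1) mon_A[OF Gamma_mult[OF assms(2), of k]] mon_A[OF assms(2)]]
      by (simp only: L.nat_pow_Suc mon_A_mult[OF Gamma_mult[OF assms(2), of k] assms(2)] mult_Suc add.commute[of c])
  qed
qed

lemma mon_B_pow:
  assumes "h \<in> alg_hom K B L" "algebra K L"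
  shows "h (mon K (- int 1)) [^]\<^bsub>L\<^esub> k = h (mon K (- int k))"
proof -
  interpret L: algebra K L by fact
  show ?thesis
  proof (induction k)
    case 0 show ?case using alg_hom_one[OF assms(1)] by (simp add: mon_one)
  next
    case (Suc k)
    show ?case
      using Suc alg_hom_mult[OF assms(1) mon_B[of k] mon_B[of 1]]
      by (simp only: mon_B_mult L.nat_pow_Suc) simp
  qed
qed

text \<open>The exponents \<open>p ^ n - wt k\<close> are the generators of the semigroup and the
  number 0, so induction over \<open>Gamma\<close> extends the agreement to all monomials, and
  linearity extends it further.\<close>

lemma hom_A_eqI:
  assumes h: "h \<in> alg_hom K A L" "h' \<in> alg_hom K A L" and L: "algebra K L"
    and eq: "\<And>k. k \<le> Suc n \<Longrightarrow> h (mon K (int (p ^ n - wt k))) = h' (mon K (int (p ^ n - wt k)))" and a: "a \<in> carrier A"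
  shows "h a = h' a"
proof -
  have m: "h (mon K (int c)) = h' (mon K (int c))" if "c \<in> Gamma p n" for c
    using that
  proof induction
    case zero
    show ?case using alg_hom_one[OF h(1)] alg_hom_one[OF h(2)] by (simp add: mon_one)
  next
    case gen_top show ?case using eq[of 0] by simp
  next
    case (gen j) then show ?case using eq[of "Suc j"] by simp
  next
    case (add c d)
    then show ?case
      using alg_hom_mult[OF h(1) mon_A mon_A, of c d] alg_hom_mult[OF h(2) mon_A mon_A, of c d] by (simp add: mon_A_mult)
  qed
  interpret L: algebra K L by fact
  have "h a = (\<Oplus>\<^bsub>L\<^esub>b\<in>supp K a. a b \<odot>\<^bsub>L\<^esub> h (mon K b))" "h' a = (\<Oplus>\<^bsub>L\<^esub>b\<in>supp K a. a b \<odot>\<^bsub>L\<^esub> h' (mon K b))"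
    using LA.alg_hom_expand[OF h(1)[unfolded semigroup_algebra_def] L a[unfolded semigroup_algebra_def]]
      LA.alg_hom_expand[OF h(2)[unfolded semigroup_algebra_def] L a[unfolded semigroup_algebra_def]] by simp_all
  moreover have "(\<Oplus>\<^bsub>L\<^esub>b\<in>supp K a. a b \<odot>\<^bsub>L\<^esub> h (mon K b)) = (\<Oplus>\<^bsub>L\<^esub>b\<in>supp K a. a b \<odot>\<^bsub>L\<^esub> h' (mon K b))"
  proof (rule L.finsum_cong')
    fix b assume "b \<in> supp K a"
    then have "b \<in> int ` Gamma p n" using LA.supp_sub[OF a[unfolded semigroup_algebra_def]] by blast
    then show "a b \<odot>\<^bsub>L\<^esub> h (mon K b) = a b \<odot>\<^bsub>L\<^esub> h' (mon K b)" using m by auto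
  next
    show "(\<lambda>b. a b \<odot>\<^bsub>L\<^esub> h' (mon K b)) \<in> supp K a \<rightarrow> carrier L"
    proof
      fix b assume "b \<in> supp K a"
      then have "b \<in> int ` Gamma p n" using LA.supp_sub[OF a[unfolded semigroup_algebra_def]] by blast
      then show "a b \<odot>\<^bsub>L\<^esub> h' (mon K b) \<in> carrier L"
        using LA.coeff[OF a[unfolded semigroup_algebra_def], of b] alg_hom_closed[OF h(2) mon_A] by (auto intro!: L.smult_closed)
    qed
  qed simp
  ultimately show ?thesis by simp
qed

lemma hom_B_eqI:
  assumes h: "h \<in> alg_hom K B L" "h' \<in> alg_hom K B L" and L: "algebra K L"
    and eq: "h (mon K (- 1)) = h' (mon K (- 1))" and a: "a \<in> carrier B"
  shows "h a = h' a"
proof -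
  have m: "h (mon K (- int c)) = h' (mon K (- int c))" for c
    using mon_B_pow[OF h(1) L, of c] mon_B_pow[OF h(2) L, of c] eq by simp
  have m': "h (mon K b) = h' (mon K b)" "mon K b \<in> carrier B" if "b \<in> {..0}" for b
    using m[of "nat (- b)"] mon_B[of "nat (- b)"] that by simp_all
  interpret L: algebra K L by fact
  have "h a = (\<Oplus>\<^bsub>L\<^esub>b\<in>supp K a. a b \<odot>\<^bsub>L\<^esub> h (mon K b))" "h' a = (\<Oplus>\<^bsub>L\<^esub>b\<in>supp K a. a b \<odot>\<^bsub>L\<^esub> h' (mon K b))"
    using LB.alg_hom_expand[OF h(1)[unfolded line_algebra_def] L a[unfolded line_algebra_def]]
      LB.alg_hom_expand[OF h(2)[unfolded line_algebra_def] L a[unfolded line_algebra_def]] by simp_all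
  moreover have "(\<Oplus>\<^bsub>L\<^esub>b\<in>supp K a. a b \<odot>\<^bsub>L\<^esub> h (mon K b)) = (\<Oplus>\<^bsub>L\<^esub>b\<in>supp K a. a b \<odot>\<^bsub>L\<^esub> h' (mon K b))"
  proof (rule L.finsum_cong')
    fix b assume "b \<in> supp K a"
    then have "b \<in> {..0}" using LB.supp_sub[OF a[unfolded line_algebra_def]] by blast
    then show "a b \<odot>\<^bsub>L\<^esub> h (mon K b) = a b \<odot>\<^bsub>L\<^esub> h' (mon K b)" using m' by simp
  next
    show "(\<lambda>b. a b \<odot>\<^bsub>L\<^esub> h' (mon K b)) \<in> supp K a \<rightarrow> carrier L"
    proof
      fix b assume "b \<in> supp K a"
      then have "b \<in> {..0}" using LB.supp_sub[OF a[unfolded line_algebra_def]] by blast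
      then show "a b \<odot>\<^bsub>L\<^esub> h' (mon K b) \<in> carrier L"
        using LB.coeff[OF a[unfolded line_algebra_def], of b] alg_hom_closed[OF h(2) m'(2)] by (intro L.smult_closed) auto
    qed
  qed simp
  ultimately show ?thesis by simp
qed

end

context char_p_alg
begin

text \<open>Both sides of each relation are homogeneous of degree \<open>p\<close>.\<close>

lemma hvec_scale:
  assumes v: "hvec v" and c: "c \<in> Units R"
  shows "hvec (\<lambda>k. c \<otimes> v k)"
proof -
  have vc [simp]: "v k \<in> carrier R" for k using v by (simp add: hvec_def)
  note [simp] = Units_closed[OF c]
  have pc: "x [^] p = x [^] (p - 1) \<otimes> x" if "x \<in> carrier R" for x
    using that p_pos nat_pow_Suc[of x "p - 1"] by (simp del: nat_pow_Suc)
  have "(c \<otimes> v (Suc l)) [^] p = (c \<otimes> v 0) [^] (p - 1) \<otimes> (c \<otimes> v (Suc (Suc l)))" if "l < n" for l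
  proof -
    have "(c \<otimes> v (Suc l)) [^] p = (c [^] (p - 1) \<otimes> c) \<otimes> (v 0 [^] (p - 1) \<otimes> v (Suc (Suc l)))"
      using v that pc[of c] by (simp add: hvec_def nat_pow_distrib)
    then show ?thesis by (simp add: nat_pow_distrib m_ac)
  qed
  then show ?thesis using v c by (simp add: hvec_def Units_prod_iff)
qed

end

text \<open>The relations between coordinates, read in the exponents of \<open>T\<close> in the
  chart at infinity.\<close>

lemma (in curve_data) rel_exponent:
  assumes "l < n" shows "p * (p ^ n - p ^ l) = (p - 1) * p ^ n + (p ^ n - p ^ Suc l)"
proof -
  have "p ^ Suc l \<le> p ^ n" using assms p_pos by (intro power_increasing) auto
  moreover have "p * p ^ n = (p - 1) * p ^ n + p ^ n" using p_pos by (cases p) auto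
  ultimately show ?thesis by (simp add: diff_mult_distrib2)
qed

section \<open>Coordinate vectors of a morphism at a prime\<close>

locale point_at = curve_data K p n + R: spec_ring K R
  for K :: "('k, 'm) ring_scheme" and p n :: nat and R :: "('k, 'u) module" +
  fixes f :: "('u set, 'u set \<Rightarrow> ('u \<times> 'u) set, 'k curve_pt, 'k curve_sec) rmor" and Q :: "'u set"
  assumes f: "f \<in> rmors K (Spec R) X" and Q: "primeideal Q R"
begin

abbreviation "S \<equiv> stalk_at R Q"

sublocale S: char_p_alg K "stalk_at R Q" p n
  by (rule char_stalk[OF R.alg Q])

sublocale FA: chart_pt K A X inl fst R f
  by (intro chart_pt.intro chart_pt_axioms.intro spec_ring.intro chart_left R.alg f)

sublocale FB: chart_pt K B X inr snd R f
  by (intro chart_pt.intro chart_pt_axioms.intro spec_ring.intro chart_right R.alg f)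

text \<open>The coordinates read in the chart at infinity, normalized so that the last one is 1.
  \<open>vB\<close> is the counterpart on the line, where the coordinate of index 0 is 1.\<close>

definition vA :: "nat \<Rightarrow> ('u \<times> 'u) set" where
  "vA k = (if k \<le> Suc n then CA.chart_hom f Q (mon K (int (p ^ n - wt k))) else \<zero>\<^bsub>S\<^esub>)"

definition vB :: "nat \<Rightarrow> ('u \<times> 'u) set" where
  "vB k = (if k \<le> Suc n then CB.chart_hom f Q (mon K (- int (wt k))) else \<zero>\<^bsub>S\<^esub>)"

text \<open>\<open>v\<close> is a vector of homogeneous coordinates of \<open>f\<close> in the stalk
  at \<open>Q\<close>. Over the overlap both alternatives apply; they describe the same vectors,
  since the two normalizations are proportional there.\<close>

definition coords :: "(nat \<Rightarrow> ('u \<times> 'u) set) \<Rightarrow> bool" where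
  "coords v \<longleftrightarrow> (\<exists>c\<in>Units S. (pt f Q \<in> CA.patch \<and> v = (\<lambda>k. c \<otimes>\<^bsub>S\<^esub> vA k)) \<or> (pt f Q \<in> CB.patch \<and> v = (\<lambda>k. c \<otimes>\<^bsub>S\<^esub> vB k)))"

lemma homA: "pt f Q \<in> CA.patch \<Longrightarrow> CA.chart_hom f Q \<in> alg_hom K A S"
  and homB: "pt f Q \<in> CB.patch \<Longrightarrow> CB.chart_hom f Q \<in> alg_hom K B S"
  using FA.G.th[of Q] FB.G.th[of Q] Q by blast+

lemma alg_S: "algebra K S"
  by (rule R.st_alg[OF Q])

lemma vA_closed: "pt f Q \<in> CA.patch \<Longrightarrow> vA k \<in> carrier S"
  unfolding vA_def using alg_hom_closed[OF homA mon_A[OF gen_Gamma]] by simp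

lemma vB_closed: "pt f Q \<in> CB.patch \<Longrightarrow> vB k \<in> carrier S"
  unfolding vB_def using alg_hom_closed[OF homB mon_B] by simp

lemma vA_last: "pt f Q \<in> CA.patch \<Longrightarrow> vA (Suc n) = \<one>\<^bsub>S\<^esub>"
  using alg_hom_one[OF homA] by (simp add: vA_def mon_one)

lemma vB_0: "pt f Q \<in> CB.patch \<Longrightarrow> vB 0 = \<one>\<^bsub>S\<^esub>"
  using alg_hom_one[OF homB] by (simp add: vB_def mon_one)

lemma vB_Suc: "pt f Q \<in> CB.patch \<Longrightarrow> l \<le> n \<Longrightarrow> vB (Suc l) = vB (Suc 0) [^]\<^bsub>S\<^esub> (p ^ l)"
  using mon_B_pow[OF homB alg_S, of "p ^ l"] by (simp add: vB_def)

lemma hvec_vA: assumes m: "pt f Q \<in> CA.patch" shows "S.hvec vA"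
  unfolding S.hvec_def
proof (intro conjI allI impI)
  show "vA k \<in> carrier S" for k by (rule vA_closed[OF m])
  show "k > Suc n \<Longrightarrow> vA k = \<zero>\<^bsub>S\<^esub>" for k by (simp add: vA_def)
  show "vA 0 \<in> Units S \<or> vA (Suc n) \<in> Units S" using vA_last[OF m] by simp
  note h = homA[OF m]
  fix l assume l: "l < n"
  have G: "p ^ n - p ^ l \<in> Gamma p n" "p ^ n - p ^ Suc l \<in> Gamma p n"
    using gen_Gamma[of "Suc l"] gen_Gamma[of "Suc (Suc l)"] l by simp_all
  have "vA (Suc l) [^]\<^bsub>S\<^esub> p = CA.chart_hom f Q (mon K (int ((p - 1) * p ^ n + (p ^ n - p ^ Suc l))))"
    using mon_A_pow[OF h G(1) alg_S, of p] l unfolding rel_exponent[OF l] by (simp add: vA_def)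
  also have "\<dots> = CA.chart_hom f Q (mon K (int ((p - 1) * p ^ n))) \<otimes>\<^bsub>S\<^esub> CA.chart_hom f Q (mon K (int (p ^ n - p ^ Suc l)))"
    using alg_hom_mult[OF h mon_A[OF Gamma_mult[OF Gamma.gen_top]] mon_A[OF G(2)], of "p - 1"]
    unfolding mon_A_mult[OF Gamma_mult[OF Gamma.gen_top] G(2)] .
  also have "CA.chart_hom f Q (mon K (int ((p - 1) * p ^ n))) = vA 0 [^]\<^bsub>S\<^esub> (p - 1)"
    using mon_A_pow[OF h Gamma.gen_top alg_S, of "p - 1"] by (simp add: vA_def)
  also have "CA.chart_hom f Q (mon K (int (p ^ n - p ^ Suc l))) = vA (Suc (Suc l))"
    using l by (simp add: vA_def)
  finally show "vA (Suc l) [^]\<^bsub>S\<^esub> p = vA 0 [^]\<^bsub>S\<^esub> (p - 1) \<otimes>\<^bsub>S\<^esub> vA (Suc (Suc l))" .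
qed

lemma hvec_vB: assumes m: "pt f Q \<in> CB.patch" shows "S.hvec vB"
  unfolding S.hvec_def
proof (intro conjI allI impI)
  show c: "vB k \<in> carrier S" for k by (rule vB_closed[OF m])
  show "k > Suc n \<Longrightarrow> vB k = \<zero>\<^bsub>S\<^esub>" for k by (simp add: vB_def)
  show "vB 0 \<in> Units S \<or> vB (Suc n) \<in> Units S" using vB_0[OF m] by simp
  fix l assume l: "l < n"
  have "vB (Suc (Suc l)) = vB (Suc 0) [^]\<^bsub>S\<^esub> (p ^ Suc l)" "vB (Suc l) = vB (Suc 0) [^]\<^bsub>S\<^esub> (p ^ l)"
    using vB_Suc[OF m, of "Suc l"] vB_Suc[OF m, of l] l by simp_all
  then show "vB (Suc l) [^]\<^bsub>S\<^esub> p = vB 0 [^]\<^bsub>S\<^esub> (p - 1) \<otimes>\<^bsub>S\<^esub> vB (Suc (Suc l))"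
    using c by (simp add: vB_0[OF m] S.nat_pow_pow mult.commute)
qed

text \<open>On the overlap \<open>T^(p^n)\<close> is a unit, and multiplying it by
  \<open>x^(wt k)\<close> gives \<open>T^(p^n - wt k)\<close>. The coordinate \<open>vA 0\<close> is
  therefore the factor between the two normalizations.\<close>

lemma overlap:
  assumes m: "pt f Q \<in> CA.patch" "pt f Q \<in> CB.patch"
  shows "vA 0 \<in> Units S" "vA k = vA 0 \<otimes>\<^bsub>S\<^esub> vB k"
proof -
  show u: "vA 0 \<in> Units S"
    using overlap_unit[OF R.alg f Q m(1)] m(2) by (simp add: vA_def)
  show "vA k = vA 0 \<otimes>\<^bsub>S\<^esub> vB k"
  proof (cases "k \<le> Suc n")
    case True
    have "mon K (int (p ^ n)) \<otimes>\<^bsub>C\<^esub> mon K (- int (wt k)) = mon K (int (p ^ n - wt k))"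
      using wt_le[OF True] by (simp add: mon_C_mult of_nat_diff)
    from overlap_mult[OF R.alg f Q m mon_A[OF Gamma.gen_top] mon_B mon_A[OF gen_Gamma[OF True]] this]
    show ?thesis using True by (simp add: vA_def vB_def)
  next
    case False then show ?thesis using S.Units_closed[OF u] by (simp add: vA_def vB_def)
  qed
qed

lemma coords_A:
  assumes m: "pt f Q \<in> CA.patch" and v: "coords v"
  shows "\<exists>c\<in>Units S. v = (\<lambda>k. c \<otimes>\<^bsub>S\<^esub> vA k)"
proof -
  from v obtain c where c: "c \<in> Units S" and
    "v = (\<lambda>k. c \<otimes>\<^bsub>S\<^esub> vA k) \<or> (pt f Q \<in> CB.patch \<and> v = (\<lambda>k. c \<otimes>\<^bsub>S\<^esub> vB k))" unfolding coords_def by blast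
  then consider "v = (\<lambda>k. c \<otimes>\<^bsub>S\<^esub> vA k)" | "pt f Q \<in> CB.patch" "v = (\<lambda>k. c \<otimes>\<^bsub>S\<^esub> vB k)" by blast
  then show ?thesis
  proof cases
    case 1 then show ?thesis using c by blast
  next
    case 2
    note o = overlap[OF m 2(1)]
    have "v k = (c \<otimes>\<^bsub>S\<^esub> inv\<^bsub>S\<^esub> vA 0) \<otimes>\<^bsub>S\<^esub> vA k" for k
      using c o(1) vB_closed[OF 2(1)] unfolding 2(2) o(2)[of k]
      by (simp add: S.m_assoc S.Units_closed S.Units_cancel)
    then show ?thesis using c o(1) by (intro bexI[of _ "c \<otimes>\<^bsub>S\<^esub> inv\<^bsub>S\<^esub> vA 0"]) auto
  qed
qed

lemma coords_B:
  assumes m: "pt f Q \<in> CB.patch" and v: "coords v"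
  shows "\<exists>c\<in>Units S. v = (\<lambda>k. c \<otimes>\<^bsub>S\<^esub> vB k)"
proof -
  from v obtain c where c: "c \<in> Units S" and
    "(pt f Q \<in> CA.patch \<and> v = (\<lambda>k. c \<otimes>\<^bsub>S\<^esub> vA k)) \<or> v = (\<lambda>k. c \<otimes>\<^bsub>S\<^esub> vB k)" unfolding coords_def by blast
  then consider "v = (\<lambda>k. c \<otimes>\<^bsub>S\<^esub> vB k)" | "pt f Q \<in> CA.patch" "v = (\<lambda>k. c \<otimes>\<^bsub>S\<^esub> vA k)" by blast
  then show ?thesis
  proof cases
    case 1 then show ?thesis using c by blast
  next
    case 2
    note o = overlap[OF 2(1) m]
    have "v k = (c \<otimes>\<^bsub>S\<^esub> vA 0) \<otimes>\<^bsub>S\<^esub> vB k" for k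
      using c o(1) vB_closed[OF m] unfolding 2(2) o(2)[of k]
      by (simp add: S.m_assoc S.Units_closed)
    then show ?thesis using c o(1) by (intro bexI[of _ "c \<otimes>\<^bsub>S\<^esub> vA 0"]) auto
  qed
qed

lemma patch_cases: "pt f Q \<in> CA.patch \<or> pt f Q \<in> CB.patch"
  by (rule pt_patch[OF f R.cring_A Q])

lemma coords_hvec: assumes "coords v" shows "S.hvec v"
  using patch_cases
proof
  assume m: "pt f Q \<in> CA.patch"
  from coords_A[OF this assms] obtain c where "c \<in> Units S" "v = (\<lambda>k. c \<otimes>\<^bsub>S\<^esub> vA k)" by (elim bexE)
  with S.hvec_scale[OF hvec_vA[OF m]] show ?thesis by simp
next
  assume m: "pt f Q \<in> CB.patch"
  from coords_B[OF this assms] obtain c where "c \<in> Units S" "v = (\<lambda>k. c \<otimes>\<^bsub>S\<^esub> vB k)" by (elim bexE)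
  with S.hvec_scale[OF hvec_vB[OF m]] show ?thesis by simp
qed

lemma coords_ex: "\<exists>v. coords v"
proof -
  have "(pt f Q \<in> CA.patch \<and> (\<lambda>k. \<one>\<^bsub>S\<^esub> \<otimes>\<^bsub>S\<^esub> vA k) = (\<lambda>k. \<one>\<^bsub>S\<^esub> \<otimes>\<^bsub>S\<^esub> vA k)) \<or> (pt f Q \<in> CB.patch \<and> (\<lambda>k. \<one>\<^bsub>S\<^esub> \<otimes>\<^bsub>S\<^esub> vB k) = (\<lambda>k. \<one>\<^bsub>S\<^esub> \<otimes>\<^bsub>S\<^esub> vB k))"
    using patch_cases by blast
  then show ?thesis unfolding coords_def using S.Units_one_closed by blast
qed

lemma coords_vA: "pt f Q \<in> CA.patch \<Longrightarrow> coords vA"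
  unfolding coords_def using vA_closed by (intro bexI[of _ "\<one>\<^bsub>S\<^esub>"] disjI1) auto

lemma coords_vB: "pt f Q \<in> CB.patch \<Longrightarrow> coords vB"
  unfolding coords_def using vB_closed by (intro bexI[of _ "\<one>\<^bsub>S\<^esub>"] disjI2) auto

lemma coords_unique:
  assumes v: "coords v" and w: "coords w"
  shows "\<exists>c\<in>Units S. w = (\<lambda>k. c \<otimes>\<^bsub>S\<^esub> v k)"
proof -
  have *: "\<exists>c\<in>Units S. w = (\<lambda>k. c \<otimes>\<^bsub>S\<^esub> v k)" if "a \<in> Units S" "b \<in> Units S" "v = (\<lambda>k. a \<otimes>\<^bsub>S\<^esub> x k)" "w = (\<lambda>k. b \<otimes>\<^bsub>S\<^esub> x k)"
    "\<And>k. x k \<in> carrier S" for a b x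
  proof -
    have "b \<otimes>\<^bsub>S\<^esub> x k = (b \<otimes>\<^bsub>S\<^esub> inv\<^bsub>S\<^esub> a) \<otimes>\<^bsub>S\<^esub> (a \<otimes>\<^bsub>S\<^esub> x k)" for k
      using that(1,2,5) by (simp add: S.m_assoc S.Units_closed S.Units_cancel)
    then show ?thesis using that by (intro bexI[of _ "b \<otimes>\<^bsub>S\<^esub> inv\<^bsub>S\<^esub> a"]) auto
  qed
  show ?thesis
    using patch_cases
  proof
    assume m: "pt f Q \<in> CA.patch"
    from coords_A[OF m v] obtain a where a: "a \<in> Units S" "v = (\<lambda>k. a \<otimes>\<^bsub>S\<^esub> vA k)" by (elim bexE)
    from coords_A[OF m w] obtain b where b: "b \<in> Units S" "w = (\<lambda>k. b \<otimes>\<^bsub>S\<^esub> vA k)" by (elim bexE)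
    show ?thesis by (rule *[OF a(1) b(1) a(2) b(2) vA_closed[OF m]])
  next
    assume m: "pt f Q \<in> CB.patch"
    from coords_B[OF m v] obtain a where a: "a \<in> Units S" "v = (\<lambda>k. a \<otimes>\<^bsub>S\<^esub> vB k)" by (elim bexE)
    from coords_B[OF m w] obtain b where b: "b \<in> Units S" "w = (\<lambda>k. b \<otimes>\<^bsub>S\<^esub> vB k)" by (elim bexE)
    show ?thesis by (rule *[OF a(1) b(1) a(2) b(2) vB_closed[OF m]])
  qed
qed

lemma coords_scale:
  assumes v: "coords v" and a: "a \<in> Units S"
  shows "coords (\<lambda>k. a \<otimes>\<^bsub>S\<^esub> v k)"
proof -
  from v obtain c where c: "c \<in> Units S" and
    d: "(pt f Q \<in> CA.patch \<and> v = (\<lambda>k. c \<otimes>\<^bsub>S\<^esub> vA k)) \<or> (pt f Q \<in> CB.patch \<and> v = (\<lambda>k. c \<otimes>\<^bsub>S\<^esub> vB k))" unfolding coords_def by blast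
  have "(pt f Q \<in> CA.patch \<and> (\<lambda>k. a \<otimes>\<^bsub>S\<^esub> v k) = (\<lambda>k. (a \<otimes>\<^bsub>S\<^esub> c) \<otimes>\<^bsub>S\<^esub> vA k)) \<or> (pt f Q \<in> CB.patch \<and> (\<lambda>k. a \<otimes>\<^bsub>S\<^esub> v k) = (\<lambda>k. (a \<otimes>\<^bsub>S\<^esub> c) \<otimes>\<^bsub>S\<^esub> vB k))"
    using d a c vA_closed vB_closed by (auto simp: S.m_assoc S.Units_closed)
  then show ?thesis unfolding coords_def using a c by blast
qed

lemma coords_unit_0: assumes v: "coords v" and u: "v 0 \<in> Units S" shows "pt f Q \<in> CB.patch"
proof (rule ccontr)
  assume n: "pt f Q \<notin> CB.patch"
  then have m: "pt f Q \<in> CA.patch" using patch_cases by blast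
  from coords_A[OF m v] obtain c where c: "c \<in> Units S" "v = (\<lambda>k. c \<otimes>\<^bsub>S\<^esub> vA k)" by blast
  then have "vA 0 \<in> Units S" using u vA_closed[OF m] by (simp add: S.Units_prod_iff S.Units_closed)
  then show False using overlap_unit[OF R.alg f Q m] n by (simp add: vA_def)
qed

text \<open>On the line the last coordinate is the \<open>p^n\<close>-th power of \<open>x\<close>.
  A positive power is a unit only if its base is, and where \<open>x\<close> is a unit the point
  lies in the overlap.\<close>

lemma coords_unit_last: assumes v: "coords v" and u: "v (Suc n) \<in> Units S" shows "pt f Q \<in> CA.patch"
proof (rule ccontr)
  assume no: "pt f Q \<notin> CA.patch"
  then have m: "pt f Q \<in> CB.patch" using patch_cases by blast
  from coords_B[OF m v] obtain c where c: "c \<in> Units S" "v = (\<lambda>k. c \<otimes>\<^bsub>S\<^esub> vB k)" by blast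
  then have "vB (Suc n) \<in> Units S" using u vB_closed[OF m] by (simp add: S.Units_prod_iff S.Units_closed)
  then have "vB (Suc 0) [^]\<^bsub>S\<^esub> (p ^ n) \<in> Units S" by (simp add: vB_Suc[OF m, of n])
  moreover obtain l where "p ^ n = Suc l" using p_pos by (metis gr0_conv_Suc zero_less_power)
  ultimately have "vB (Suc 0) \<in> Units S" using vB_closed[OF m] by (simp add: S.Units_prod_iff)
  then show False using overlap_unit_right[OF R.alg f Q m] no by (simp add: vB_def)
qed

end

text \<open>A common coordinate vector determines the chart: one of its extreme entries is a unit.
  Dividing by that entry recovers the values of the chart homomorphisms on generators, and
  \<open>chart_unique\<close> concludes.\<close>

lemma (in curve_data) points_eqI:
  assumes R: "algebra K R" and f: "f \<in> rmors K (Spec R) X" and g: "g \<in> rmors K (Spec R) X"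
    and eq: "\<And>Q. primeideal Q R \<Longrightarrow> \<exists>v. point_at.coords K p n R f Q v \<and> point_at.coords K p n R g Q v"
  shows "f = g"
proof (rule rmors_eqI[OF algebra.M_cring[OF R] f g])
  fix Q assume Q: "primeideal Q R"
  interpret F: point_at K p n R f Q
    by (intro point_at.intro point_at_axioms.intro spec_ring.intro curve_data_axioms R f Q)
  interpret G: point_at K p n R g Q
    by (intro point_at.intro point_at_axioms.intro spec_ring.intro curve_data_axioms R g Q)
  obtain v where v: "F.coords v" "G.coords v" using eq[OF Q] by blast
  have cancel: "x = y" if "c \<in> Units F.S" "c \<otimes>\<^bsub>F.S\<^esub> x = c \<otimes>\<^bsub>F.S\<^esub> y" "x \<in> carrier F.S" "y \<in> carrier F.S" for c x y
    using that by simp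
  have "pt f Q = pt g Q \<and> (\<forall>W s. openin (top_of X) W \<longrightarrow> pt f Q \<in> W \<longrightarrow> s \<in> carrier (sections X W) \<longrightarrow> comor f W s Q = comor g W s Q)"
  proof (cases "v 0 \<in> Units F.S")
    case True
    have m: "pt f Q \<in> CB.patch" "pt g Q \<in> CB.patch" using F.coords_unit_0[OF v(1) True] G.coords_unit_0[OF v(2) True] .
    obtain c c' where c: "c \<in> Units F.S" "v = (\<lambda>k. c \<otimes>\<^bsub>F.S\<^esub> F.vB k)" "c' \<in> Units F.S" "v = (\<lambda>k. c' \<otimes>\<^bsub>F.S\<^esub> G.vB k)"
      using F.coords_B[OF m(1) v(1)] G.coords_B[OF m(2) v(2)] by (elim bexE)
    have e: "c \<otimes>\<^bsub>F.S\<^esub> F.vB k = c' \<otimes>\<^bsub>F.S\<^esub> G.vB k" for k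
      using fun_cong[OF c(2), of k] fun_cong[OF c(4), of k] by (rule trans[OF sym])
    \<comment> \<open>The coordinate normalized to 1 in both vectors shows that the two factors are
      equal.\<close>
    have cc: "c = c'" using e[of 0] F.S.Units_closed[OF c(1)] F.S.Units_closed[OF c(3)] by (simp add: F.vB_0[OF m(1)] G.vB_0[OF m(2)])
    have "F.vB 1 = G.vB 1" by (rule cancel[OF c(1) e[of 1, folded cc] F.vB_closed[OF m(1)] G.vB_closed[OF m(2)]])
    then have "CB.chart_hom f Q (mon K (- 1)) = CB.chart_hom g Q (mon K (- 1))" by (simp add: F.vB_def G.vB_def)
    then have "CB.chart_hom f Q b = CB.chart_hom g Q b" if "b \<in> carrier B" for b
      by (rule hom_B_eqI[OF F.homB[OF m(1)] G.homB[OF m(2)] F.alg_S _ that])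
    note U = CB.chart_unique[OF R f g Q m this]
    show ?thesis using U by blast
  next
    case False
    then have True: "v (Suc n) \<in> Units F.S" using F.coords_hvec[OF v(1)] by (simp add: F.S.hvec_def)
    have m: "pt f Q \<in> CA.patch" "pt g Q \<in> CA.patch" using F.coords_unit_last[OF v(1) True] G.coords_unit_last[OF v(2) True] .
    obtain c c' where c: "c \<in> Units F.S" "v = (\<lambda>k. c \<otimes>\<^bsub>F.S\<^esub> F.vA k)" "c' \<in> Units F.S" "v = (\<lambda>k. c' \<otimes>\<^bsub>F.S\<^esub> G.vA k)"
      using F.coords_A[OF m(1) v(1)] G.coords_A[OF m(2) v(2)] by (elim bexE)
    have e: "c \<otimes>\<^bsub>F.S\<^esub> F.vA k = c' \<otimes>\<^bsub>F.S\<^esub> G.vA k" for k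
      using fun_cong[OF c(2), of k] fun_cong[OF c(4), of k] by (rule trans[OF sym])
    have cc: "c = c'" using e[of "Suc n"] F.S.Units_closed[OF c(1)] F.S.Units_closed[OF c(3)] by (simp add: F.vA_last[OF m(1)] G.vA_last[OF m(2)])
    have "F.vA k = G.vA k" for k
      by (rule cancel[OF c(1) e[of k, folded cc] F.vA_closed[OF m(1)] G.vA_closed[OF m(2)]])
    then have "CA.chart_hom f Q (mon K (int (p ^ n - wt k))) = CA.chart_hom g Q (mon K (int (p ^ n - wt k)))" if "k \<le> Suc n" for k
      using that by (metis F.vA_def G.vA_def)
    then have "CA.chart_hom f Q a = CA.chart_hom g Q a" if "a \<in> carrier A" for a
      by (rule hom_A_eqI[OF F.homA[OF m(1)] G.homA[OF m(2)] F.alg_S _ that])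
    note U = CA.chart_unique[OF R f g Q m this]
    show ?thesis using U by blast
  qed
  then show "pt f Q = pt g Q" "openin (top_of X) W \<Longrightarrow> pt f Q \<in> W \<Longrightarrow> s \<in> carrier (sections X W) \<Longrightarrow> comor f W s Q = comor g W s Q" for W s
    by blast+
qed

context char_p_alg
begin

lemma hvec_line:
  assumes v: "hvec v" and v0: "v 0 = \<one>" and l: "l \<le> n"
  shows "v (Suc l) = v (Suc 0) [^] (p ^ l)"
  using l
proof (induction l)
  case 0 then show ?case using v by (simp add: hvec_def)
next
  case (Suc l)
  have vc: "v k \<in> carrier R" for k using v by (simp add: hvec_def)
  have "v (Suc l) [^] p = v (Suc (Suc l))" using v v0 Suc.prems by (simp add: hvec_def)
  then show ?case using Suc vc by (simp add: nat_pow_pow mult.commute)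
qed

end

section \<open>Existence of a morphism with prescribed coordinates\<close>

context curve_data
begin

text \<open>The converse of reading off coordinates. The vectors \<open>v Q\<close> may vary
  arbitrarily by units from prime to prime; only proportionality to a local vector of sections is
  assumed. Dividing by the entry that is a unit removes this ambiguity and yields honest sections,
  out of which the homomorphisms into the stalks are built on either chart.\<close>

lemma points_exist:
  assumes R: "algebra K R"
    and v: "\<And>Q. primeideal Q R \<Longrightarrow> char_p_alg.hvec (stalk_at R Q) p n (v Q)"
    and loc: "\<And>Q. primeideal Q R \<Longrightarrow> \<exists>U w. spec_open R U \<and> Q \<in> U \<and> (\<forall>k. (\<lambda>Q\<in>U. w k Q) \<in> sec R U) \<and>
      (\<forall>Q\<in>U. \<exists>c\<in>Units (stalk_at R Q). \<forall>k. v Q k = c \<otimes>\<^bsub>stalk_at R Q\<^esub> w k Q)"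
  shows "\<exists>f \<in> rmors K (Spec R) X. \<forall>Q. primeideal Q R \<longrightarrow> point_at.coords K p n R f Q (v Q)"
proof -
  interpret R: spec_ring K R by (rule spec_ring.intro[OF R])
  have St: "char_p_alg K (stalk_at R Q) p" "algebra K (stalk_at R Q)" if "primeideal Q R" for Q
    using char_stalk[OF R that] R.st_alg[OF that] .
  have vc: "v Q k \<in> carrier (stalk_at R Q)" if "primeideal Q R" for Q k
    using v[OF that] unfolding char_p_alg.hvec_def[OF St(1)[OF that]] by blast
  define D where "D m = {Q \<in> primes R. v Q m \<in> Units (stalk_at R Q)}" for m
  \<comment> \<open>The unknown unit \<open>c\<close> cancels in a quotient of two coordinates, so
    the quotient equals that of the local sections \<open>w\<close>.\<close>
  have ratio: "spec_open R (D m)" "(\<lambda>Q\<in>D m. v Q k \<otimes>\<^bsub>stalk_at R Q\<^esub> inv\<^bsub>stalk_at R Q\<^esub> v Q m) \<in> sec R (D m)" for m k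
  proof -
    have *: "\<exists>V. spec_open R V \<and> Q \<in> V \<and> V \<subseteq> D m \<and> (\<lambda>Q\<in>V. v Q k \<otimes>\<^bsub>stalk_at R Q\<^esub> inv\<^bsub>stalk_at R Q\<^esub> v Q m) \<in> sec R V"
      if "Q \<in> D m" for Q k
    proof -
      have Q: "primeideal Q R" "v Q m \<in> Units (stalk_at R Q)" using that by (simp_all add: D_def)
      from loc[OF Q(1)] obtain U w where U: "spec_open R U" "Q \<in> U" and w: "\<And>k. (\<lambda>Q\<in>U. w k Q) \<in> sec R U"
        and vw: "\<And>Q. Q \<in> U \<Longrightarrow> \<exists>c\<in>Units (stalk_at R Q). \<forall>k. v Q k = c \<otimes>\<^bsub>stalk_at R Q\<^esub> w k Q" by blast
      have iff: "v Q' m \<in> Units (stalk_at R Q') \<longleftrightarrow> w m Q' \<in> Units (stalk_at R Q')"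
        and rat: "w m Q' \<in> Units (stalk_at R Q') \<Longrightarrow> v Q' k \<otimes>\<^bsub>stalk_at R Q'\<^esub> inv\<^bsub>stalk_at R Q'\<^esub> v Q' m = w k Q' \<otimes>\<^bsub>stalk_at R Q'\<^esub> inv\<^bsub>stalk_at R Q'\<^esub> w m Q'"
        if Q': "Q' \<in> U" for Q'
      proof -
        interpret L: cring "stalk_at R Q'" by (rule R.st_cring[OF R.open_prime[OF U(1) Q']])
        obtain c where c: "c \<in> Units (stalk_at R Q')" "\<And>k. v Q' k = c \<otimes>\<^bsub>stalk_at R Q'\<^esub> w k Q'" using vw[OF Q'] by blast
        have wc: "w k Q' \<in> carrier (stalk_at R Q')" for k by (rule R.sec_val[where x="w k", OF w Q'])
        show "v Q' m \<in> Units (stalk_at R Q') \<longleftrightarrow> w m Q' \<in> Units (stalk_at R Q')"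
          using c wc by (simp add: L.Units_prod_iff L.Units_closed)
        assume u: "w m Q' \<in> Units (stalk_at R Q')"
        have "inv\<^bsub>stalk_at R Q'\<^esub> (c \<otimes>\<^bsub>stalk_at R Q'\<^esub> w m Q') = inv\<^bsub>stalk_at R Q'\<^esub> c \<otimes>\<^bsub>stalk_at R Q'\<^esub> inv\<^bsub>stalk_at R Q'\<^esub> w m Q'"
        proof (rule L.Units_mult_inv_unique(2))
          have "c \<otimes>\<^bsub>stalk_at R Q'\<^esub> w m Q' \<otimes>\<^bsub>stalk_at R Q'\<^esub> (inv\<^bsub>stalk_at R Q'\<^esub> c \<otimes>\<^bsub>stalk_at R Q'\<^esub> inv\<^bsub>stalk_at R Q'\<^esub> w m Q') =
            (c \<otimes>\<^bsub>stalk_at R Q'\<^esub> inv\<^bsub>stalk_at R Q'\<^esub> c) \<otimes>\<^bsub>stalk_at R Q'\<^esub> (w m Q' \<otimes>\<^bsub>stalk_at R Q'\<^esub> inv\<^bsub>stalk_at R Q'\<^esub> w m Q')"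
            using c(1) u by (simp add: L.m_ac L.Units_closed del: L.Units_r_inv L.Units_l_inv)
          then show 1: "c \<otimes>\<^bsub>stalk_at R Q'\<^esub> w m Q' \<otimes>\<^bsub>stalk_at R Q'\<^esub> (inv\<^bsub>stalk_at R Q'\<^esub> c \<otimes>\<^bsub>stalk_at R Q'\<^esub> inv\<^bsub>stalk_at R Q'\<^esub> w m Q') = \<one>\<^bsub>stalk_at R Q'\<^esub>"
            using c(1) u by simp
          then show "inv\<^bsub>stalk_at R Q'\<^esub> c \<otimes>\<^bsub>stalk_at R Q'\<^esub> inv\<^bsub>stalk_at R Q'\<^esub> w m Q' \<otimes>\<^bsub>stalk_at R Q'\<^esub> (c \<otimes>\<^bsub>stalk_at R Q'\<^esub> w m Q') = \<one>\<^bsub>stalk_at R Q'\<^esub>"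
            using c(1) u by (simp add: L.m_comm L.Units_closed)
        qed (use c(1) u in \<open>simp_all add: L.Units_closed\<close>)
        then show "v Q' k \<otimes>\<^bsub>stalk_at R Q'\<^esub> inv\<^bsub>stalk_at R Q'\<^esub> v Q' m = w k Q' \<otimes>\<^bsub>stalk_at R Q'\<^esub> inv\<^bsub>stalk_at R Q'\<^esub> w m Q'"
          using c(1) u wc[of k] unfolding c(2)
          by (simp only: L.m_assoc L.m_lcomm[of _ "inv\<^bsub>stalk_at R Q'\<^esub> c"] L.Units_closed L.Units_inv_closed L.m_closed L.Units_cancel)
      qed
      let ?V = "{Q \<in> U. w m Q \<in> Units (stalk_at R Q)}"
      have V: "spec_open R ?V" by (rule R.secI_open_unit[OF U(1) w])
      have sub: "?V \<subseteq> U" by blast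
      have s: "(\<lambda>Q\<in>?V. w k Q \<otimes>\<^bsub>stalk_at R Q\<^esub> inv\<^bsub>stalk_at R Q\<^esub> w m Q) \<in> sec R ?V"
        by (rule R.secI_mult[OF V R.secI_mono[OF w V sub] R.secI_inv[OF V R.secI_mono[OF w V sub]]]) blast
      have "Q \<in> ?V" using U(2) Q(2) iff by blast
      moreover have "?V \<subseteq> D m" using iff R.open_prime[OF U(1)] by (auto simp: D_def)
      moreover have "(\<lambda>Q\<in>?V. v Q k \<otimes>\<^bsub>stalk_at R Q\<^esub> inv\<^bsub>stalk_at R Q\<^esub> v Q m) \<in> sec R ?V"
        by (rule R.secI_cong[OF s]) (use rat in blast)
      ultimately show ?thesis using V by blast
    qed
    show o: "spec_open R (D m)"
      by (subst openin_subopen) (use * in blast)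
    show "(\<lambda>Q\<in>D m. v Q k \<otimes>\<^bsub>stalk_at R Q\<^esub> inv\<^bsub>stalk_at R Q\<^esub> v Q m) \<in> sec R (D m)"
      by (rule R.secI_local[OF o]) (rule *)
  qed
  define nv where "nv m Q k = inv\<^bsub>stalk_at R Q\<^esub> v Q m \<otimes>\<^bsub>stalk_at R Q\<^esub> v Q k" for m Q k
  have nv_sec: "(\<lambda>Q\<in>D m. nv m Q k) \<in> sec R (D m)" for m k
  proof (rule R.secI_cong[OF ratio(2)])
    fix Q assume "Q \<in> D m"
    then have Q: "primeideal Q R" "v Q m \<in> Units (stalk_at R Q)" by (simp_all add: D_def)
    interpret L: cring "stalk_at R Q" by (rule R.st_cring[OF Q(1)])
    show "nv m Q k = v Q k \<otimes>\<^bsub>stalk_at R Q\<^esub> inv\<^bsub>stalk_at R Q\<^esub> v Q m"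
      using Q(2) vc[OF Q(1)] by (simp add: nv_def L.m_comm)
  qed
  have nv: "char_p_alg.hvec (stalk_at R Q) p n (nv m Q)" "nv m Q m = \<one>\<^bsub>stalk_at R Q\<^esub>"
    "v Q k = v Q m \<otimes>\<^bsub>stalk_at R Q\<^esub> nv m Q k" "nv m Q k \<in> carrier (stalk_at R Q)"
    if "Q \<in> D m" for Q m k
  proof -
    have Q: "primeideal Q R" "v Q m \<in> Units (stalk_at R Q)" using that by (simp_all add: D_def)
    interpret L: char_p_alg K "stalk_at R Q" p n by (rule St(1)[OF Q(1)])
    have "nv m Q = (\<lambda>k. inv\<^bsub>stalk_at R Q\<^esub> v Q m \<otimes>\<^bsub>stalk_at R Q\<^esub> v Q k)" by (rule ext) (simp add: nv_def)
    then show "L.hvec (nv m Q)" using L.hvec_scale[OF v[OF Q(1)] L.Units_inv_Units[OF Q(2)]] by simp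
    show "nv m Q m = \<one>\<^bsub>stalk_at R Q\<^esub>" using Q(2) by (simp add: nv_def)
    show "v Q k = v Q m \<otimes>\<^bsub>stalk_at R Q\<^esub> nv m Q k" using Q(2) vc[OF Q(1)] by (simp add: nv_def L.Units_cancel)
    show "nv m Q k \<in> carrier (stalk_at R Q)" using Q(2) vc[OF Q(1)] by (simp add: nv_def)
  qed
  define mB where "mB Q a = nv 0 Q (Suc 0) [^]\<^bsub>stalk_at R Q\<^esub> nat (- a)" for Q and a :: int
  define thB where "thB Q = LB.ev (stalk_at R Q) (mB Q)" for Q
  have mB: "mB Q (a + b) = mB Q a \<otimes>\<^bsub>stalk_at R Q\<^esub> mB Q b" "mB Q a \<in> carrier (stalk_at R Q)" "mB Q 0 = \<one>\<^bsub>stalk_at R Q\<^esub>"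
    if "Q \<in> D 0" "a \<in> {..0}" "b \<in> {..0}" for Q a b
  proof -
    interpret L: cring "stalk_at R Q" by (rule R.st_cring) (use that in \<open>simp add: D_def\<close>)
    have "nat (- (a + b)) = nat (- a) + nat (- b)" using that by simp
    then show "mB Q (a + b) = mB Q a \<otimes>\<^bsub>stalk_at R Q\<^esub> mB Q b" using nv(4)[OF that(1)] by (simp only: mB_def L.nat_pow_mult)
    show "mB Q a \<in> carrier (stalk_at R Q)" "mB Q 0 = \<one>\<^bsub>stalk_at R Q\<^esub>" using nv(4)[OF that(1)] by (simp_all add: mB_def)
  qed
  have thB_hom: "thB Q \<in> alg_hom K B (stalk_at R Q)" and thB_mon: "a \<in> {..0} \<Longrightarrow> thB Q (mon K a) = mB Q a"
    if Q: "Q \<in> D 0" for Q a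
  proof -
    have Qp: "primeideal Q R" using Q by (simp add: D_def)
    show "thB Q \<in> alg_hom K B (stalk_at R Q)"
      unfolding thB_def line_algebra_def by (rule LB.ev_hom[OF St(2)[OF Qp]]) (use mB[OF Q] mB(3)[OF Q, of 0 0] in auto)
    show "a \<in> {..0} \<Longrightarrow> thB Q (mon K a) = mB Q a"
      unfolding thB_def by (rule LB.ev_mono[OF St(2)[OF Qp]]) (use mB[OF Q] mB(3)[OF Q, of 0 0] in auto)
  qed
  \<comment> \<open>Where the last coordinate is a unit, the normalized vector has
    \<open>b_n = 1\<close> and satisfies the relations of \<open>hvec\<close>. These are the
    hypotheses of \<open>Gamma_hom\<close>.\<close>
  have "\<exists>m. m 0 = \<one>\<^bsub>stalk_at R Q\<^esub> \<and> m (p ^ n) = nv (Suc n) Q 0 \<and> (\<forall>j<n. m (p ^ n - p ^ j) = nv (Suc n) Q (Suc j)) \<and>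
     (\<forall>c\<in>Gamma p n. m c \<in> carrier (stalk_at R Q)) \<and> (\<forall>c\<in>Gamma p n. \<forall>d\<in>Gamma p n. m (c + d) = m c \<otimes>\<^bsub>stalk_at R Q\<^esub> m d)"
    if Q: "Q \<in> D (Suc n)" for Q
  proof -
    have Qp: "primeideal Q R" using Q by (simp add: D_def)
    interpret L: char_p_alg K "stalk_at R Q" p n by (rule St(1)[OF Qp])
    show ?thesis
      by (rule L.Gamma_hom[of p _ "\<lambda>j. nv (Suc n) Q (Suc j)"])
         (use nv[OF Q] p_pos in \<open>simp_all add: L.hvec_def\<close>)
  qed
  then obtain mA where mA: "\<And>Q. Q \<in> D (Suc n) \<Longrightarrow> mA Q 0 = \<one>\<^bsub>stalk_at R Q\<^esub> \<and> mA Q (p ^ n) = nv (Suc n) Q 0 \<and>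
     (\<forall>j<n. mA Q (p ^ n - p ^ j) = nv (Suc n) Q (Suc j)) \<and>
     (\<forall>c\<in>Gamma p n. mA Q c \<in> carrier (stalk_at R Q)) \<and> (\<forall>c\<in>Gamma p n. \<forall>d\<in>Gamma p n. mA Q (c + d) = mA Q c \<otimes>\<^bsub>stalk_at R Q\<^esub> mA Q d)"
    by metis
  have mA_gen: "mA Q (p ^ n - wt k) = nv (Suc n) Q k" if "Q \<in> D (Suc n)" "k \<le> Suc n" for Q k
  proof (cases k)
    case 0 then show ?thesis using mA[OF that(1)] by simp
  next
    case (Suc l)
    show ?thesis
    proof (cases "l < n")
      case True then show ?thesis using mA[OF that(1)] Suc by simp
    next
      case False
      then have "l = n" using Suc that(2) by simp
      then show ?thesis using mA[OF that(1)] nv(2)[OF that(1)] Suc by simp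
    qed
  qed
  define thA where "thA Q = LA.ev (stalk_at R Q) (\<lambda>a. mA Q (nat a))" for Q
  have thA_hom: "thA Q \<in> alg_hom K A (stalk_at R Q)" and thA_mon: "c \<in> Gamma p n \<Longrightarrow> thA Q (mon K (int c)) = mA Q c"
    if Q: "Q \<in> D (Suc n)" for Q c
  proof -
    have Qp: "primeideal Q R" using Q by (simp add: D_def)
    have add: "mA Q (nat (a + b)) = mA Q (nat a) \<otimes>\<^bsub>stalk_at R Q\<^esub> mA Q (nat b)" if ab: "a \<in> int ` Gamma p n" "b \<in> int ` Gamma p n" for a b
      using ab mA[OF Q] by (auto simp: nat_add_distrib)
    show "thA Q \<in> alg_hom K A (stalk_at R Q)"
      unfolding thA_def semigroup_algebra_def by (rule LA.ev_hom[OF St(2)[OF Qp]]) (use mA[OF Q] add in auto)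
    have "c \<in> Gamma p n \<Longrightarrow> thA Q (mon K (int c)) = mA Q (nat (int c))"
      unfolding thA_def by (rule LA.ev_mono[OF St(2)[OF Qp]]) (use mA[OF Q] add in auto)
    then show "c \<in> Gamma p n \<Longrightarrow> thA Q (mon K (int c)) = mA Q c" by simp
  qed
  have GB: "germ_hom K B R (D 0) thB"
  proof (intro germ_hom.intro germ_hom_axioms.intro spec_ring.intro)
    show "spec_open R (D 0)" by (rule ratio(1))
    fix b assume b: "b \<in> carrier B"
    note b' = b[unfolded line_algebra_def]
    show "(\<lambda>Q\<in>D 0. thB Q b) \<in> sec R (D 0)"
      unfolding thB_def LB.ev_def mB_def
      by (intro R.secI_finsum[OF ratio(1)] R.secI_smult[OF ratio(1)] R.secI_pow[OF ratio(1)] nv_sec LB.supp_finite[OF b'] LB.coeff[OF b'])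
  qed (auto simp: alg_B R thB_hom)
  \<comment> \<open>The maps \<open>mA Q\<close> were chosen separately for each prime. Their values
    are nevertheless products of normalized coordinates, hence sections, by induction over the
    semigroup.\<close>
  have mA_sec: "(\<lambda>Q\<in>D (Suc n). mA Q c) \<in> sec R (D (Suc n))" if "c \<in> Gamma p n" for c
    using that
  proof induction
    case zero show ?case by (rule R.secI_cong[OF R.secI_one[OF ratio(1)]]) (use mA in blast)
  next
    case gen_top show ?case by (rule R.secI_cong[OF nv_sec[of "Suc n" 0]]) (use mA in blast)
  next
    case (gen l) then show ?case by (intro R.secI_cong[OF nv_sec[of "Suc n" "Suc l"]]) (use mA in blast)
  next
    case (add c d) show ?case by (rule R.secI_cong[OF R.secI_mult[OF ratio(1) add.IH]]) (use mA add.hyps in blast)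
  qed
  have GA: "germ_hom K A R (D (Suc n)) thA"
  proof (intro germ_hom.intro germ_hom_axioms.intro spec_ring.intro)
    show "spec_open R (D (Suc n))" by (rule ratio(1))
    fix a assume a: "a \<in> carrier A"
    note a' = a[unfolded semigroup_algebra_def]
    show "(\<lambda>Q\<in>D (Suc n). thA Q a) \<in> sec R (D (Suc n))"
      unfolding thA_def LA.ev_def
    proof (intro R.secI_finsum[OF ratio(1)] R.secI_smult[OF ratio(1)] LA.supp_finite[OF a'] LA.coeff[OF a'])
      fix c assume "c \<in> supp K a"
      then have "c \<in> int ` Gamma p n" using LA.supp_sub[OF a'] by blast
      then show "(\<lambda>Q\<in>D (Suc n). mA Q (nat c)) \<in> sec R (D (Suc n))" using mA_sec by auto
    qed
  qed (auto simp: alg_A R thA_hom)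
  have cover: "D (Suc n) \<union> D 0 = primes R"
  proof -
    have "v Q 0 \<in> Units (stalk_at R Q) \<or> v Q (Suc n) \<in> Units (stalk_at R Q)" if "primeideal Q R" for Q
      using v[OF that] unfolding char_p_alg.hvec_def[OF St(1)[OF that]] by blast
    then show ?thesis by (auto simp: D_def)
  qed
  \<comment> \<open>Where both extreme coordinates are units, \<open>x\<close> is one as well, being
    the base of a unit power. Hence Laurent monomials can be evaluated too, which provides the
    common extension to \<open>C\<close>.\<close>
  have compat: "\<exists>\<theta> \<in> alg_hom K C (stalk_at R Q). (\<forall>a\<in>carrier A. \<theta> a = thA Q a) \<and> (\<forall>b\<in>carrier B. \<theta> b = thB Q b)"
    if QA: "Q \<in> D (Suc n)" and QB: "Q \<in> D 0" for Q
  proof -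
    have Qp: "primeideal Q R" using QA by (simp add: D_def)
    interpret L: char_p_alg K "stalk_at R Q" p n by (rule St(1)[OF Qp])
    let ?S = "stalk_at R Q"
    let ?x = "nv 0 Q (Suc 0)"
    have x: "?x \<in> carrier ?S" by (rule nv(4)[OF QB])
    have xk: "nv 0 Q (Suc l) = ?x [^]\<^bsub>?S\<^esub> (p ^ l)" if "l \<le> n" for l
      by (rule L.hvec_line[OF nv(1)[OF QB] nv(2)[OF QB] that])
    have u0: "v Q 0 \<in> Units ?S" "v Q (Suc n) \<in> Units ?S" using QA QB by (simp_all add: D_def)
    have "nv 0 Q (Suc n) \<in> Units ?S" using u0 by (simp add: nv_def)
    moreover obtain l where "p ^ n = Suc l" using p_pos by (metis gr0_conv_Suc zero_less_power)
    ultimately have xu: "?x \<in> Units ?S" using xk[of n] x by (simp add: L.Units_prod_iff)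
    let ?t = "inv\<^bsub>?S\<^esub> ?x"
    have t: "?t \<in> carrier ?S" using xu by simp
    have tx: "?t [^]\<^bsub>?S\<^esub> k \<otimes>\<^bsub>?S\<^esub> ?x [^]\<^bsub>?S\<^esub> k = \<one>\<^bsub>?S\<^esub>" for k :: nat
      using x t xu by (simp add: L.nat_pow_distrib[symmetric])
    \<comment> \<open>The integer power of \<open>?t\<close>: since \<open>nat\<close> truncates at
      0, at most one of the two factors is nontrivial.\<close>
    define m where "m a = ?t [^]\<^bsub>?S\<^esub> nat a \<otimes>\<^bsub>?S\<^esub> ?x [^]\<^bsub>?S\<^esub> nat (- a)" for a
    have mc: "m a \<in> carrier ?S" for a using x t by (simp add: m_def)
    have m_add: "m (a + b) = m a \<otimes>\<^bsub>?S\<^esub> m b" for a b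
    proof -
      \<comment> \<open>When the signs of \<open>a\<close> and \<open>b\<close> differ, truncation
        loses the same amount \<open>k\<close> from both exponents; the lost factor
        \<open>?t\<close> to the \<open>k\<close> times \<open>?x\<close> to the \<open>k\<close> is
        1.\<close>
      have "\<exists>k. nat a + nat b = nat (a + b) + k \<and> nat (- a) + nat (- b) = nat (- (a + b)) + k"
        by (rule exI[of _ "nat a + nat b - nat (a + b)"]) linarith
      then obtain k where k: "nat a + nat b = nat (a + b) + k" "nat (- a) + nat (- b) = nat (- (a + b)) + k" by blast
      have "m a \<otimes>\<^bsub>?S\<^esub> m b = ?t [^]\<^bsub>?S\<^esub> (nat a + nat b) \<otimes>\<^bsub>?S\<^esub> ?x [^]\<^bsub>?S\<^esub> (nat (- a) + nat (- b))"
        using x t by (simp add: m_def L.nat_pow_mult[symmetric] L.m_ac)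
      also have "\<dots> = m (a + b) \<otimes>\<^bsub>?S\<^esub> (?t [^]\<^bsub>?S\<^esub> k \<otimes>\<^bsub>?S\<^esub> ?x [^]\<^bsub>?S\<^esub> k)"
        unfolding k using x t by (simp only: m_def L.nat_pow_mult[symmetric] L.m_ac L.nat_pow_closed L.m_closed)
      finally show ?thesis using mc by (simp add: tx)
    qed
    have m0: "m 0 = \<one>\<^bsub>?S\<^esub>" by (simp add: m_def)
    let ?th = "LC.ev ?S m"
    have th: "?th \<in> alg_hom K C ?S"
      unfolding torus_algebra_def by (rule LC.ev_hom[OF St(2)[OF Qp] mc m0 m_add])
    have th_mon: "?th (mon K a) = m a" for a
      by (rule LC.ev_mono[OF St(2)[OF Qp] mc m0 m_add]) simp
    have thA': "?th \<in> alg_hom K A ?S" and thB': "?th \<in> alg_hom K B ?S"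
      using alg_hom_comp[OF th SA.incl] alg_hom_comp[OF th SB.incl] by simp_all
    have "?th b = thB Q b" if "b \<in> carrier B" for b
      by (rule hom_B_eqI[OF thB' thB_hom[OF QB] St(2)[OF Qp] _ that])
         (use x in \<open>simp add: th_mon thB_mon[OF QB] m_def mB_def\<close>)
    moreover have "?th a = thA Q a" if "a \<in> carrier A" for a
    proof (rule hom_A_eqI[OF thA' thA_hom[OF QA] St(2)[OF Qp] _ that])
      fix k assume k: "k \<le> Suc n"
      have "thA Q (mon K (int (p ^ n - wt k))) = nv (Suc n) Q k"
        by (simp only: thA_mon[OF QA gen_Gamma[OF k]] mA_gen[OF QA k])
      moreover have "nv (Suc n) Q k = ?t [^]\<^bsub>?S\<^esub> (p ^ n - wt k)"
      proof -
        have nk: "nv 0 Q k = ?x [^]\<^bsub>?S\<^esub> wt k"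
        proof (cases k)
          case 0 then show ?thesis using nv(2)[OF QB] by simp
        next
          case (Suc l) then show ?thesis using xk[of l] k by simp
        qed
        have nc: "nv (Suc n) Q k \<in> carrier ?S" by (rule nv(4)[OF QA])
        \<comment> \<open>The two normalizations of the vector differ by the factor
          \<open>nv 0 Q (Suc n)\<close>, which is the \<open>p^n\<close>-th power of
          \<open>?x\<close>.\<close>
        have "nv (Suc n) Q k \<otimes>\<^bsub>?S\<^esub> ?x [^]\<^bsub>?S\<^esub> (p ^ n) = ?x [^]\<^bsub>?S\<^esub> wt k"
        proof -
          have "nv (Suc n) Q k \<otimes>\<^bsub>?S\<^esub> nv 0 Q (Suc n) = nv 0 Q k"
            using u0 vc[OF Qp, of k] vc[OF Qp, of "Suc n"] vc[OF Qp, of 0]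
            by (simp add: nv_def L.m_ac L.Units_cancel)
          then show ?thesis using xk[of n] nk by simp
        qed
        then have "nv (Suc n) Q k = ?x [^]\<^bsub>?S\<^esub> wt k \<otimes>\<^bsub>?S\<^esub> ?t [^]\<^bsub>?S\<^esub> (p ^ n)"
          using nc x t tx[of "p ^ n"] by (metis L.m_assoc L.m_comm L.nat_pow_closed L.r_one)
        also have "\<dots> = ?x [^]\<^bsub>?S\<^esub> wt k \<otimes>\<^bsub>?S\<^esub> (?t [^]\<^bsub>?S\<^esub> wt k \<otimes>\<^bsub>?S\<^esub> ?t [^]\<^bsub>?S\<^esub> (p ^ n - wt k))"
          using wt_le[OF k] t by (simp add: L.nat_pow_mult)
        also have "\<dots> = (?t [^]\<^bsub>?S\<^esub> wt k \<otimes>\<^bsub>?S\<^esub> ?x [^]\<^bsub>?S\<^esub> wt k) \<otimes>\<^bsub>?S\<^esub> ?t [^]\<^bsub>?S\<^esub> (p ^ n - wt k)"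
          using x t by (simp only: L.m_ac L.nat_pow_closed L.m_closed)
        finally show ?thesis using t by (simp add: tx)
      qed
      moreover have "?th (mon K (int (p ^ n - wt k))) = ?t [^]\<^bsub>?S\<^esub> (p ^ n - wt k)"
        using t by (simp add: th_mon m_def)
      ultimately show "?th (mon K (int (p ^ n - wt k))) = thA Q (mon K (int (p ^ n - wt k)))" by simp
    qed
    ultimately show ?thesis using th by blast
  qed
  from glue_exists[OF GA GB cover compat] obtain f where f: "f \<in> rmors K (Spec R) X"
    and fAB: "(\<forall>Q\<in>D (Suc n). pt f Q \<in> CA.patch \<and> (\<forall>a\<in>carrier A. CA.chart_hom f Q a = thA Q a)) \<and>
      (\<forall>Q\<in>D 0. pt f Q \<in> CB.patch \<and> (\<forall>b\<in>carrier B. CB.chart_hom f Q b = thB Q b))"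
    by (rule bexE)
  note fA = bspec[OF conjunct1[OF fAB]] and fB = bspec[OF conjunct2[OF fAB]]
  have "point_at.coords K p n R f Q (v Q)" if Q: "primeideal Q R" for Q
  proof -
    interpret F: point_at K p n R f Q
      by (intro point_at.intro point_at_axioms.intro spec_ring.intro curve_data_axioms R f Q)
    have vz: "v Q k = \<zero>\<^bsub>F.S\<^esub>" if "k > Suc n" for k using v[OF Q] that by (simp add: F.S.hvec_def)
    show ?thesis
    proof (cases "Q \<in> D (Suc n)")
      case True
      have "v Q k = v Q (Suc n) \<otimes>\<^bsub>F.S\<^esub> F.vA k" for k
      proof (cases "k \<le> Suc n")
        case k: True
        have "F.vA k = nv (Suc n) Q k"
          using fA[OF True] k mon_A[OF gen_Gamma[OF k]] by (simp add: F.vA_def thA_mon[OF True gen_Gamma[OF k]] mA_gen[OF True k])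
        then show ?thesis using nv(3)[OF True, of k] by simp
      next
        case False then show ?thesis using vz[of k] vc[OF Q, of "Suc n"] by (simp add: F.vA_def)
      qed
      then have e: "v Q = (\<lambda>k. v Q (Suc n) \<otimes>\<^bsub>F.S\<^esub> F.vA k)" by (rule ext)
      have u: "v Q (Suc n) \<in> Units F.S" using True by (simp add: D_def)
      show ?thesis unfolding F.coords_def
      proof (rule bexI[OF _ u])
        show "(pt f Q \<in> CA.patch \<and> v Q = (\<lambda>k'. v Q (Suc n) \<otimes>\<^bsub>F.S\<^esub> F.vA k')) \<or> (pt f Q \<in> CB.patch \<and> v Q = (\<lambda>k'. v Q (Suc n) \<otimes>\<^bsub>F.S\<^esub> F.vB k'))"
          by (rule disjI1[OF conjI[OF conjunct1[OF fA[OF True]] e]])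
      qed
    next
      case False
      then have True: "Q \<in> D 0" using cover Q by blast
      have "v Q k = v Q 0 \<otimes>\<^bsub>F.S\<^esub> F.vB k" for k
      proof (cases "k \<le> Suc n")
        case k: True
        have "F.vB k = mB Q (- int (wt k))"
          using fB[OF True] k mon_B[of "wt k"] by (simp add: F.vB_def thB_mon[OF True])
        also have "\<dots> = nv 0 Q k"
        proof (cases k)
          case 0 then show ?thesis using nv(2)[OF True] by (simp add: mB_def)
        next
          case (Suc l) then show ?thesis using F.S.hvec_line[OF nv(1,2)[OF True], of l] k
            by (simp only: mB_def minus_minus nat_int) (simp del: of_nat_power)
        qed
        finally show ?thesis using nv(3)[OF True, of k] by simp
      next
        case False then show ?thesis using vz[of k] vc[OF Q, of 0] by (simp add: F.vB_def)
      qed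
      then have e: "v Q = (\<lambda>k. v Q 0 \<otimes>\<^bsub>F.S\<^esub> F.vB k)" by (rule ext)
      have u: "v Q 0 \<in> Units F.S" using True by (simp add: D_def)
      show ?thesis unfolding F.coords_def
      proof (rule bexI[OF _ u])
        show "(pt f Q \<in> CA.patch \<and> v Q = (\<lambda>k'. v Q 0 \<otimes>\<^bsub>F.S\<^esub> F.vA k')) \<or> (pt f Q \<in> CB.patch \<and> v Q = (\<lambda>k'. v Q 0 \<otimes>\<^bsub>F.S\<^esub> F.vB k'))"
          by (rule disjI2[OF conjI[OF conjunct1[OF fB[OF True]] e]])
      qed
    qed
  qed
  then show ?thesis using f by blast
qed

end

section \<open>Functoriality of the group and of its action on the line\<close>

lemma group_actionI:
  assumes G: "group G" and cl: "\<And>g x. g \<in> carrier G \<Longrightarrow> x \<in> E \<Longrightarrow> r g x \<in> E"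
    and one: "\<And>x. x \<in> E \<Longrightarrow> r \<one>\<^bsub>G\<^esub> x = x"
    and mult: "\<And>g h x. g \<in> carrier G \<Longrightarrow> h \<in> carrier G \<Longrightarrow> x \<in> E \<Longrightarrow> r (g \<otimes>\<^bsub>G\<^esub> h) x = r g (r h x)"
  shows "group_action G E (\<lambda>g. \<lambda>x\<in>E. r g x)"
proof -
  interpret group G by fact
  have inv: "r (inv\<^bsub>G\<^esub> g) (r g x) = x" "r g (r (inv\<^bsub>G\<^esub> g) x) = x" if "g \<in> carrier G" "x \<in> E" for g x
    using that mult[of "inv\<^bsub>G\<^esub> g" g x] mult[of g "inv\<^bsub>G\<^esub> g" x] one by simp_all
  have bij: "(\<lambda>x\<in>E. r g x) \<in> Bij E" if g: "g \<in> carrier G" for g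
  proof -
    have "bij_betw (\<lambda>x\<in>E. r g x) E E"
      by (rule bij_betw_byWitness[where f'="\<lambda>x\<in>E. r (inv\<^bsub>G\<^esub> g) x"]) (use g inv cl in auto)
    then show ?thesis by (simp add: Bij_def)
  qed
  show ?thesis
  proof (intro group_action.intro group_hom.intro group_hom_axioms.intro)
    show "group G" ..
    show "group (BijGroup E)" by (rule group_BijGroup)
    show "(\<lambda>g. \<lambda>x\<in>E. r g x) \<in> hom G (BijGroup E)"
    proof (rule homI)
      fix g h assume g: "g \<in> carrier G" and h: "h \<in> carrier G"
      show "(\<lambda>x\<in>E. r (g \<otimes>\<^bsub>G\<^esub> h) x) = (\<lambda>x\<in>E. r g x) \<otimes>\<^bsub>BijGroup E\<^esub> (\<lambda>x\<in>E. r h x)"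
        using bij[OF g] bij[OF h] g h mult cl by (auto simp: BijGroup_def compose_def fun_eq_iff)
    qed (simp add: BijGroup_def bij)
  qed
qed

text \<open>The semidirect product is given by polynomial formulas and the inverse of
  \<open>t\<close>, all of which a homomorphism preserves. It allows group identities over
  \<open>R\<close> to be used in the stalks.\<close>

lemma group_map_mult:
  assumes R: "char_p_alg K R p" and R': "char_p_alg K R' p" and \<phi>: "\<phi> \<in> alg_hom K R R'"
    and g: "g \<in> carrier (GUG p n R)" and h: "h \<in> carrier (GUG p n R)"
  shows "group_map \<phi> (g \<otimes>\<^bsub>GUG p n R\<^esub> h) = group_map \<phi> g \<otimes>\<^bsub>GUG p n R'\<^esub> group_map \<phi> h"
proof -
  interpret R: char_p_alg K R p n by fact
  interpret R': char_p_alg K R' p n by fact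
  interpret h: ring_hom_cring R R' \<phi> by (rule alg_hom_ring_hom_cring[OF \<phi> R.algebra_axioms R'.algebra_axioms])
  obtain \<alpha> u t where g': "g = ((\<alpha>, u), t)" "\<alpha> \<in> carrier R" "u \<in> U_set p n R" "t \<in> Units R"
    using g by (metis R.GUG_carrier prod.exhaust)
  obtain \<beta> w s where h': "h = ((\<beta>, w), s)" "\<beta> \<in> carrier R" "w \<in> U_set p n R" "s \<in> Units R"
    using h by (metis R.GUG_carrier prod.exhaust)
  note [simp] = g'(2) h'(2) R.U_closed[OF g'(3)] R.U_closed[OF h'(3)] R.Units_closed[OF g'(4)] R.Units_closed[OF h'(4)]
    R.Units_inv_closed[OF g'(4)]
  have fr: "\<phi> (R.fr i x) = R'.fr i (\<phi> x)" if "x \<in> carrier R" for i x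
    using that by (simp add: R.fr_def R'.fr_def alg_hom_pow[OF \<phi> R.algebra_axioms R'.algebra_axioms])
  have inv: "\<phi> (inv\<^bsub>R\<^esub> t) = inv\<^bsub>R'\<^esub> (\<phi> t)"
    by (rule alg_hom_Units(2)[OF \<phi> R.algebra_axioms R'.algebra_axioms g'(4)])
  have U: "\<phi> (U_act p n R u x) = U_act p n R' (\<lambda>i. \<phi> (u i)) (\<phi> x)" if "x \<in> carrier R" for x
    unfolding R.U_act_fr R'.U_act_fr using that by (subst h.hom_finsum) (auto simp: fr o_def intro!: R'.finsum_cong')
  have tw: "\<phi> (R.tw t w i) = R'.tw (\<phi> t) (\<lambda>i. \<phi> (w i)) i" for i
    by (simp add: R.tw_def R'.tw_def fr inv)
  have twc: "R.tw t w i \<in> carrier R" for i by (rule R.U_closed[OF R.tw_closed[OF g'(4) h'(3)]])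
  have sk: "\<phi> ((u \<otimes>\<^bsub>skew_poly p R\<^esub> R.tw t w) k) = ((\<lambda>i. \<phi> (u i)) \<otimes>\<^bsub>skew_poly p R'\<^esub> R'.tw (\<phi> t) (\<lambda>i. \<phi> (w i))) k" for k
    unfolding R.skew_mult R'.skew_mult using twc
    by (subst h.hom_finsum) (auto simp: fr o_def tw[symmetric] intro!: R'.finsum_cong')
  have Uc: "U_act p n R u (t \<otimes>\<^bsub>R\<^esub> \<beta>) \<in> carrier R" by (rule R.U_act_closed[OF g'(3)]) simp
  show ?thesis
    using Uc by (simp add: g'(1) h'(1) group_map_def R.GUG_mult R'.GUG_mult U sk fun_eq_iff)
qed

lemma group_map_one:
  assumes R: "char_p_alg K R p" and R': "char_p_alg K R' p" and \<phi>: "\<phi> \<in> alg_hom K R R'"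
  shows "group_map \<phi> \<one>\<^bsub>GUG p n R\<^esub> = \<one>\<^bsub>GUG p n R'\<^esub>"
proof -
  interpret R: char_p_alg K R p n by fact
  interpret R': char_p_alg K R' p n by fact
  show ?thesis
    using alg_hom_zero[OF \<phi> R.algebra_axioms R'.algebra_axioms] alg_hom_one[OF \<phi>]
    by (simp add: group_map_def R.GUG_one R'.GUG_one R.skew_one R'.skew_one fun_eq_iff)
qed

lemma GUG_line_act_natural:
  assumes R: "char_p_alg K R p" and R': "char_p_alg K R' p" and \<phi>: "\<phi> \<in> alg_hom K R R'"
    and g: "g \<in> carrier (GUG p n R)" and x: "x \<in> carrier R"
  shows "\<phi> (GUG_line_act p n R g x) = GUG_line_act p n R' (group_map \<phi> g) (\<phi> x)"
proof -
  interpret R: char_p_alg K R p n by fact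
  interpret R': char_p_alg K R' p n by fact
  interpret h: ring_hom_cring R R' \<phi> by (rule alg_hom_ring_hom_cring[OF \<phi> R.algebra_axioms R'.algebra_axioms])
  obtain \<alpha> u t where g': "g = ((\<alpha>, u), t)" "\<alpha> \<in> carrier R" "u \<in> U_set p n R" "t \<in> Units R"
    using g by (metis R.GUG_carrier prod.exhaust)
  note [simp] = g'(2) R.U_closed[OF g'(3)] R.Units_closed[OF g'(4)] x
  have fr: "\<phi> (R.fr i x) = R'.fr i (\<phi> x)" if "x \<in> carrier R" for i x
    using that by (simp add: R.fr_def R'.fr_def alg_hom_pow[OF \<phi> R.algebra_axioms R'.algebra_axioms])
  have "\<phi> (U_act p n R u (t \<otimes>\<^bsub>R\<^esub> x)) = U_act p n R' (\<lambda>i. \<phi> (u i)) (\<phi> t \<otimes>\<^bsub>R'\<^esub> \<phi> x)"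
    unfolding R.U_act_fr R'.U_act_fr by (subst h.hom_finsum) (auto simp: fr o_def intro!: R'.finsum_cong')
  then show ?thesis
    using R.U_act_closed[OF g'(3), of "t \<otimes>\<^bsub>R\<^esub> x"] by (simp add: g'(1) group_map_def GUG_line_act_def)
qed

lemma GUG_line_act_closed:
  assumes R: "char_p_alg K R p" and g: "g \<in> carrier (GUG p n R)" and x: "x \<in> carrier R"
  shows "GUG_line_act p n R g x \<in> carrier R"
proof -
  interpret R: char_p_alg K R p n by fact
  obtain \<alpha> u t where g': "g = ((\<alpha>, u), t)" "\<alpha> \<in> carrier R" "u \<in> U_set p n R" "t \<in> Units R"
    using g by (metis R.GUG_carrier prod.exhaust)
  then show ?thesis using x R.U_act_closed[OF g'(3)] by (simp add: GUG_line_act_def R.Units_closed)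
qed

section \<open>The action on the points of the curve\<close>

context curve_data
begin

abbreviation "coords R f Q v \<equiv> point_at.coords K p n R f Q v"

abbreviation germ_group :: "('k, 'u) module \<Rightarrow> 'u set \<Rightarrow> ('u \<times> (nat \<Rightarrow> 'u)) \<times> 'u \<Rightarrow>
    (('u \<times> 'u) set \<times> (nat \<Rightarrow> ('u \<times> 'u) set)) \<times> ('u \<times> 'u) set" where
  "germ_group R Q g \<equiv> group_map (\<lambda>r. germ R Q r \<one>\<^bsub>R\<^esub>) g"

abbreviation "stalk_lin R Q g \<equiv> char_p_alg.lin (stalk_at R Q) p n (germ_group R Q g)"

lemma point_at_intro: "algebra K R \<Longrightarrow> f \<in> rmors K (Spec R) X \<Longrightarrow> primeideal Q R \<Longrightarrow> point_at K p n R f Q"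
  by (intro point_at.intro point_at_axioms.intro spec_ring.intro curve_data_axioms)

lemma germ_group_closed:
  assumes R: "algebra K R" and Q: "primeideal Q R" and g: "g \<in> carrier (GUG p n R)"
  shows "germ_group R Q g \<in> carrier (GUG p n (stalk_at R Q))"
  by (rule group_map_closed[OF char_alg[OF R] char_stalk[OF R Q] spec_ring.germ_hom[OF spec_ring.intro[OF R] Q] g])

text \<open>Each entry of \<open>lin\<close> is a finite sum of products of powers of sections, so
  the transformed vectors remain locally regular, as \<open>points_exist\<close> requires.\<close>

lemma sec_lin:
  assumes R: "algebra K R" and g: "g \<in> carrier (GUG p n R)" and U: "spec_open R U"
    and w: "\<And>k. (\<lambda>Q\<in>U. w Q k) \<in> sec R U"
  shows "(\<lambda>Q\<in>U. stalk_lin R Q g (w Q) k) \<in> sec R U"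
proof -
  interpret R: spec_ring K R by (rule spec_ring.intro[OF R])
  interpret C: char_p_alg K R p n by (rule char_alg[OF R])
  obtain \<alpha> u t where g': "g = ((\<alpha>, u), t)" "\<alpha> \<in> carrier R" "u \<in> U_set p n R" "t \<in> Units R"
    using g by (metis C.GUG_carrier prod.exhaust)
  have St: "char_p_alg K (stalk_at R Q) p" if "Q \<in> U" for Q using char_stalk[OF R R.open_prime[OF U that]] .
  note cc = g'(2) C.U_closed[OF g'(3)] R.Units_closed[OF g'(4)]
  show ?thesis
  proof (cases k)
    case 0
    show ?thesis by (rule R.secI_cong[OF w[of 0]]) (simp add: 0 char_p_alg.lin_0[OF St])
  next
    case (Suc l)
    show ?thesis
    proof (cases "l \<le> n")
      case True
      have "(\<lambda>Q\<in>U. germ R Q \<alpha> \<one>\<^bsub>R\<^esub> [^]\<^bsub>stalk_at R Q\<^esub> (p ^ l) \<otimes>\<^bsub>stalk_at R Q\<^esub> w Q 0 \<oplus>\<^bsub>stalk_at R Q\<^esub>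
        (\<Oplus>\<^bsub>stalk_at R Q\<^esub>i\<in>{..n}. germ R Q (u i) \<one>\<^bsub>R\<^esub> [^]\<^bsub>stalk_at R Q\<^esub> (p ^ l) \<otimes>\<^bsub>stalk_at R Q\<^esub>
          (germ R Q t \<one>\<^bsub>R\<^esub> [^]\<^bsub>stalk_at R Q\<^esub> (p ^ (i + l)) \<otimes>\<^bsub>stalk_at R Q\<^esub> w Q (Suc (i + l))))) \<in> sec R U"
        by (intro R.secI_add[OF U] R.secI_mult[OF U] R.secI_pow[OF U] R.secI_finsum[OF U] R.sec_const[OF U] w cc) simp
      then show ?thesis
        by (rule R.secI_cong) (simp add: Suc True g'(1) group_map_def char_p_alg.lin_Suc[OF St] char_p.fr_def[OF char_p_alg.axioms(2)[OF St]])
    next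
      case False
      show ?thesis
        by (rule R.secI_cong[OF R.secI_zero[OF U]]) (simp add: Suc False g'(1) group_map_def char_p_alg.lin_Suc[OF St])
    qed
  qed
qed

text \<open>Over the preimage of a chart the normalized coordinates are pullbacks of functions on
  that chart, hence sections.\<close>

lemma local_coords:
  assumes R: "algebra K R" and f: "f \<in> rmors K (Spec R) X" and Q: "primeideal Q R"
  shows "\<exists>U w. spec_open R U \<and> Q \<in> U \<and> (\<forall>k. (\<lambda>Q\<in>U. w Q k) \<in> sec R U) \<and> (\<forall>Q\<in>U. coords R f Q (w Q))"
proof -
  interpret R: spec_ring K R by (rule spec_ring.intro[OF R])
  interpret P: point_at K p n R f Q by (rule point_at_intro[OF R f Q])
  note PI = point_at_intro[OF R f]
  show ?thesis
    using P.patch_cases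
  proof
    assume m: "pt f Q \<in> CA.patch"
    let ?U = "{Q \<in> primes R. pt f Q \<in> CA.patch}"
    have U: "spec_open R ?U" by (rule P.FA.G.D)
    have Qp: "primeideal Q R" if "Q \<in> ?U" for Q using that by blast
    have "(\<lambda>Q\<in>?U. point_at.vA K p n R f Q k) \<in> sec R ?U" for k
    proof (cases "k \<le> Suc n")
      case True
      show ?thesis
        by (rule R.secI_cong[OF P.FA.G.th_sec[OF mon_A[OF gen_Gamma[OF True]]]])
           (simp only: point_at.vA_def[OF PI[OF Qp]] True if_True)
    next
      case False
      show ?thesis
        by (rule R.secI_cong[OF R.secI_zero[OF U]]) (simp only: point_at.vA_def[OF PI[OF Qp]] False if_False)
    qed
    moreover have "\<forall>Q\<in>?U. coords R f Q (point_at.vA K p n R f Q)"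
      using point_at.coords_vA[OF PI] by blast
    moreover have "Q \<in> ?U" using Q m by blast
    ultimately show ?thesis using U by (intro exI[of _ ?U] exI[of _ "point_at.vA K p n R f"]) blast
  next
    assume m: "pt f Q \<in> CB.patch"
    let ?U = "{Q \<in> primes R. pt f Q \<in> CB.patch}"
    have U: "spec_open R ?U" by (rule P.FB.G.D)
    have Qp: "primeideal Q R" if "Q \<in> ?U" for Q using that by blast
    have "(\<lambda>Q\<in>?U. point_at.vB K p n R f Q k) \<in> sec R ?U" for k
    proof (cases "k \<le> Suc n")
      case True
      show ?thesis
        by (rule R.secI_cong[OF P.FB.G.th_sec[OF mon_B]])
           (simp only: point_at.vB_def[OF PI[OF Qp]] True if_True)
    next
      case False
      show ?thesis
        by (rule R.secI_cong[OF R.secI_zero[OF U]]) (simp only: point_at.vB_def[OF PI[OF Qp]] False if_False)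
    qed
    moreover have "\<forall>Q\<in>?U. coords R f Q (point_at.vB K p n R f Q)"
      using point_at.coords_vB[OF PI] by blast
    moreover have "Q \<in> ?U" using Q m by blast
    ultimately show ?thesis using U by (intro exI[of _ ?U] exI[of _ "point_at.vB K p n R f"]) blast
  qed
qed

text \<open>The graph of the action of \<open>g\<close>, described through coordinates at every
  prime. Asking it for all vectors \<open>v\<close> of the point is consistent because
  \<open>lin\<close> is homogeneous.\<close>

definition moves :: "('k, 'u) module \<Rightarrow> ('u \<times> (nat \<Rightarrow> 'u)) \<times> 'u \<Rightarrow>
    ('u aff_pt, 'u aff_sec, 'k curve_pt, 'k curve_sec) rmor \<Rightarrow> ('u aff_pt, 'u aff_sec, 'k curve_pt, 'k curve_sec) rmor \<Rightarrow> bool" where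
  "moves R g f f' \<longleftrightarrow> (\<forall>Q v. primeideal Q R \<longrightarrow> coords R f Q v \<longrightarrow> coords R f' Q (stalk_lin R Q g v))"

text \<open>The transformed vectors satisfy \<open>hvec\<close> because stalks are local rings, and
  they are locally proportional to transforms of the regular vectors of \<open>local_coords\<close>.
  So \<open>points_exist\<close> yields the morphism.\<close>

lemma moves_ex:
  assumes R: "algebra K R" and g: "g \<in> carrier (GUG p n R)" and f: "f \<in> rmors K (Spec R) X"
  shows "\<exists>f' \<in> rmors K (Spec R) X. moves R g f f'"
proof -
  interpret R: spec_ring K R by (rule spec_ring.intro[OF R])
  note PI = point_at_intro[OF R f]
  \<comment> \<open>An arbitrary vector at each prime, with no regularity in \<open>Q\<close>.
    \<open>sc\<close> compares any two choices.\<close>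
  define v0 where "v0 Q = (SOME v. coords R f Q v)" for Q
  have v0: "coords R f Q (v0 Q)" if "primeideal Q R" for Q
    unfolding v0_def by (rule someI_ex[OF point_at.coords_ex[OF PI[OF that]]])
  define v where "v Q = stalk_lin R Q g (v0 Q)" for Q
  have sc: "\<exists>c\<in>Units (stalk_at R Q). stalk_lin R Q g y = (\<lambda>k. c \<otimes>\<^bsub>stalk_at R Q\<^esub> stalk_lin R Q g x k)"
    if Q: "primeideal Q R" and x: "coords R f Q x" and y: "coords R f Q y" for Q x y
  proof -
    interpret P: point_at K p n R f Q by (rule PI[OF Q])
    obtain c where c: "c \<in> Units P.S" "y = (\<lambda>k. c \<otimes>\<^bsub>P.S\<^esub> x k)" using P.coords_unique[OF x y] by (rule bexE)
    have xc: "x k \<in> carrier P.S" for k using P.coords_hvec[OF x] by (simp add: P.S.hvec_def)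
    show ?thesis
      unfolding c(2) P.S.lin_scale[OF germ_group_closed[OF R Q g] xc P.S.Units_closed[OF c(1)]] by (rule bexI[OF refl c(1)])
  qed
  have "\<exists>f' \<in> rmors K (Spec R) X. \<forall>Q. primeideal Q R \<longrightarrow> coords R f' Q (v Q)"
  proof (rule points_exist[OF R])
    fix Q assume Q: "primeideal Q R"
    interpret P: point_at K p n R f Q by (rule PI[OF Q])
    show "P.S.hvec (v Q)" unfolding v_def
      by (rule P.S.lin_hvec[OF germ_group_closed[OF R Q g] P.coords_hvec[OF v0[OF Q]] R.stalk_add_unit[OF Q]])
    from local_coords[OF R f Q] obtain U w where U: "spec_open R U" "Q \<in> U" and w: "\<And>k. (\<lambda>Q\<in>U. w Q k) \<in> sec R U"
      and wc: "\<And>Q. Q \<in> U \<Longrightarrow> coords R f Q (w Q)" by blast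
    have "(\<lambda>Q\<in>U. stalk_lin R Q g (w Q) k) \<in> sec R U" for k by (rule sec_lin[OF R g U(1) w])
    moreover have "\<exists>c\<in>Units (stalk_at R Q'). \<forall>k. v Q' k = c \<otimes>\<^bsub>stalk_at R Q'\<^esub> stalk_lin R Q' g (w Q') k" if Q': "Q' \<in> U" for Q'
    proof -
      have Qp': "primeideal Q' R" by (rule R.open_prime[OF U(1) Q'])
      from sc[OF Qp' wc[OF Q'] v0[OF Qp']] obtain c where c: "c \<in> Units (stalk_at R Q')"
        "v Q' = (\<lambda>k. c \<otimes>\<^bsub>stalk_at R Q'\<^esub> stalk_lin R Q' g (w Q') k)" unfolding v_def by (rule bexE)
      show ?thesis by (rule bexI[OF _ c(1)]) (simp add: c(2))
    qed
    ultimately show "\<exists>U w. spec_open R U \<and> Q \<in> U \<and> (\<forall>k. (\<lambda>Q\<in>U. w k Q) \<in> sec R U) \<and>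
      (\<forall>Q\<in>U. \<exists>c\<in>Units (stalk_at R Q). \<forall>k. v Q k = c \<otimes>\<^bsub>stalk_at R Q\<^esub> w k Q)"
      using U by (intro exI[of _ U] exI[of _ "\<lambda>k Q. stalk_lin R Q g (w Q) k"] conjI allI ballI)
  qed
  then obtain f' where f': "f' \<in> rmors K (Spec R) X" and cf: "\<And>Q. primeideal Q R \<Longrightarrow> coords R f' Q (v Q)" by blast
  have "moves R g f f'" unfolding moves_def
  proof (intro allI impI)
    fix Q y assume Q: "primeideal Q R" and y: "coords R f Q y"
    obtain c where c: "c \<in> Units (stalk_at R Q)" "stalk_lin R Q g y = (\<lambda>k. c \<otimes>\<^bsub>stalk_at R Q\<^esub> v Q k)"
      using sc[OF Q v0[OF Q] y] unfolding v_def by (rule bexE)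
    show "coords R f' Q (stalk_lin R Q g y)"
      unfolding c(2) by (rule point_at.coords_scale[OF point_at_intro[OF R f' Q] cf[OF Q] c(1)])
  qed
  with f' show ?thesis by blast
qed

lemma moves_unique:
  assumes R: "algebra K R" and f: "f \<in> rmors K (Spec R) X" and f1: "f1 \<in> rmors K (Spec R) X" "moves R g f f1"
    and f2: "f2 \<in> rmors K (Spec R) X" "moves R g f f2"
  shows "f1 = f2"
proof (rule points_eqI[OF R f1(1) f2(1)])
  fix Q assume Q: "primeideal Q R"
  obtain v where "coords R f Q v" using point_at.coords_ex[OF point_at_intro[OF R f Q]] by blast
  then show "\<exists>v. coords R f1 Q v \<and> coords R f2 Q v" using f1(2) f2(2) Q unfolding moves_def by blast
qed

definition act :: "('k, 'u) module \<Rightarrow> ('u \<times> (nat \<Rightarrow> 'u)) \<times> 'u \<Rightarrow>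
    ('u aff_pt, 'u aff_sec, 'k curve_pt, 'k curve_sec) rmor \<Rightarrow> ('u aff_pt, 'u aff_sec, 'k curve_pt, 'k curve_sec) rmor" where
  "act R g f = (SOME f'. f' \<in> rmors K (Spec R) X \<and> moves R g f f')"

lemma act:
  assumes "algebra K R" "g \<in> carrier (GUG p n R)" "f \<in> rmors K (Spec R) X"
  shows "act R g f \<in> rmors K (Spec R) X" "moves R g f (act R g f)"
  using someI_ex[OF moves_ex[OF assms, unfolded Bex_def]] unfolding act_def[symmetric] by simp_all

lemma act_eqI:
  assumes "algebra K R" "g \<in> carrier (GUG p n R)" "f \<in> rmors K (Spec R) X" "f' \<in> rmors K (Spec R) X" "moves R g f f'"
  shows "act R g f = f'"
  by (rule moves_unique[OF assms(1,3) act[OF assms(1-3)] assms(4,5)])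

text \<open>As for the other identities of the action, the expected result is shown to satisfy
  \<open>moves\<close>, which reduces the claim to an identity for \<open>lin\<close>; uniqueness of
  the moved point does the rest.\<close>

lemma act_one:
  assumes R: "algebra K R" and f: "f \<in> rmors K (Spec R) X"
  shows "act R \<one>\<^bsub>GUG p n R\<^esub> f = f"
proof (rule act_eqI[OF R _ f f])
  interpret C: char_p_alg K R p n by (rule char_alg[OF R])
  interpret G: group "GUG p n R" by (rule C.GUG_group)
  show "\<one>\<^bsub>GUG p n R\<^esub> \<in> carrier (GUG p n R)" by simp
  show "moves R \<one>\<^bsub>GUG p n R\<^esub> f f" unfolding moves_def
  proof (intro allI impI)
    fix Q v assume Q: "primeideal Q R" and v: "coords R f Q v"
    interpret P: point_at K p n R f Q by (rule point_at_intro[OF R f Q])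
    have "P.S.lin \<one>\<^bsub>GUG p n P.S\<^esub> v = v"
      by (rule P.S.lin_one) (use P.coords_hvec[OF v] in \<open>simp_all add: P.S.hvec_def\<close>)
    then show "coords R f Q (stalk_lin R Q \<one>\<^bsub>GUG p n R\<^esub> v)"
      using v by (simp only: group_map_one[OF char_alg[OF R] char_stalk[OF R Q] P.R.germ_hom[OF Q]])
  qed
qed

lemma act_mult:
  assumes R: "algebra K R" and g: "g \<in> carrier (GUG p n R)" and h: "h \<in> carrier (GUG p n R)" and f: "f \<in> rmors K (Spec R) X"
  shows "act R (g \<otimes>\<^bsub>GUG p n R\<^esub> h) f = act R g (act R h f)"
proof -
  interpret C: char_p_alg K R p n by (rule char_alg[OF R])
  interpret G: group "GUG p n R" by (rule C.GUG_group)
  note hf = act[OF R h f]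
  note ghf = act[OF R g hf(1)]
  show ?thesis
  proof (rule act_eqI[OF R _ f ghf(1)])
    show "g \<otimes>\<^bsub>GUG p n R\<^esub> h \<in> carrier (GUG p n R)" using g h by simp
    show "moves R (g \<otimes>\<^bsub>GUG p n R\<^esub> h) f (act R g (act R h f))" unfolding moves_def
    proof (intro allI impI)
      fix Q v assume Q: "primeideal Q R" and v: "coords R f Q v"
      interpret P: point_at K p n R f Q by (rule point_at_intro[OF R f Q])
      have vc: "v k \<in> carrier P.S" for k using P.coords_hvec[OF v] by (simp add: P.S.hvec_def)
      have "coords R (act R g (act R h f)) Q (stalk_lin R Q g (stalk_lin R Q h v))"
        using ghf(2) hf(2) Q v unfolding moves_def by blast
      then show "coords R (act R g (act R h f)) Q (stalk_lin R Q (g \<otimes>\<^bsub>GUG p n R\<^esub> h) v)"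
        by (simp only: group_map_mult[OF char_alg[OF R] char_stalk[OF R Q] P.R.germ_hom[OF Q] g h]
            P.S.lin_comp[OF germ_group_closed[OF R Q g] germ_group_closed[OF R Q h] vc])
    qed
  qed
qed

end

section \<open>Base change of points along algebra homomorphisms\<close>

lemma (in chart) chart_hom_pullback:
  assumes R: "algebra K R" and R': "algebra K R'" and \<phi>: "\<phi> \<in> alg_hom K R R'" and f: "f \<in> rmors K (Spec R) X"
    and Q: "primeideal Q R'" and m: "pt f {r \<in> carrier R. \<phi> r \<in> Q} \<in> patch" and a: "a \<in> carrier A"
  shows "chart_hom (rcomp (Spec R') (Spec R) X f (Spec_map R R' \<phi>)) Q a =
    stalk_map R' \<phi> Q (chart_hom f {r \<in> carrier R. \<phi> r \<in> Q} a)"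
proof -
  have P: "{r \<in> carrier R. \<phi> r \<in> Q} \<in> preim (Spec R) f patch"
    using m alg_hom_vimage_prime[OF \<phi> R R' Q] by (simp add: preim_def topspace_Spec[OF algebra.M_cring[OF R]])
  have "chart_hom (rcomp (Spec R') (Spec R) X f (Spec_map R R' \<phi>)) Q a =
    comor (Spec_map R R' \<phi>) (preim (Spec R) f patch) (comor f patch (chart_sec a)) Q"
    using patch_open chart_sec(1)[OF a] by (simp add: chart_hom_def rcomp_def)
  then show ?thesis
    unfolding Spec_map_comor[OF algebra.M_cring[OF R'] preim_open[OF f patch_open]
      alg_hom_closed[OF rmorsD(4)[OF f patch_open] chart_sec(1)[OF a]] Q P] chart_hom_def .
qed

lemma (in glue_aff) glue_inr_rmors: "glue_inr (Spec A) (Spec B) (Spec C) i j \<in> rmors K (Spec B) X" (is "?r \<in> _")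
proof -
  have pt: "pt ?r P = inr P" if "primeideal P B" for P using that by (simp add: glue_inr_def SB.A.topspace)
  have pre: "preim (Spec B) ?r W = pB W" for W
    unfolding preim_def SB.A.topspace by (rule Collect_cong, rule conj_cong) (simp_all add: pt)
  have com: "comor ?r W S = snd S" if "openin (top_of X) W" "S \<in> carrier (sections X W)" for W S
    using that by (simp add: glue_inr_def)
  show ?thesis
  proof (rule rmorsI)
    show "pt ?r \<in> extensional (topspace (top_of (Spec B)))" "comor ?r \<in> extensional {V. openin (top_of X) V}"
      by (simp_all add: glue_inr_def)
    show "continuous_map (top_of (Spec B)) (top_of X) (pt ?r)"
      unfolding continuous_map_def
    proof (intro conjI allI impI Pi_I)
      fix P assume "P \<in> topspace (top_of (Spec B))"
      then show "pt ?r P \<in> topspace (top_of X)" unfolding topspace_X SB.A.topspace by (simp add: pt)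
    next
      fix W assume "openin (top_of X) W"
      then show "spec_open B {P \<in> topspace (top_of (Spec B)). pt ?r P \<in> W}"
        using CB.open_pre[of W] pre[of W] unfolding preim_def by simp
    qed
  next
    fix W assume W: "openin (top_of X) W"
    show "comor ?r W \<in> alg_hom K (sections X W) (sections (Spec B) (preim (Spec B) ?r W))"
      unfolding pre by (rule alg_hom_restrict[OF CB.\<sigma>_hom[OF W] CB.sec_closed[OF W] com[OF W]])
    show "comor ?r W \<in> extensional (carrier (sections X W))" using W by (simp add: glue_inr_def)
    fix W' S assume W': "openin (top_of X) W'" "W' \<subseteq> W" and S: "S \<in> carrier (sections X W)"
    show "comor ?r W' (restr X W W' S) = restr (Spec B) (preim (Spec B) ?r W) (preim (Spec B) ?r W') (comor ?r W S)"
    proof -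
      have "comor ?r W' (restr X W W' S) = snd (restr X W W' S)" by (rule com[OF W'(1) CB.restr_closed[OF W W' S]])
      then show ?thesis unfolding com[OF W S] pre restr_Spec by (simp only: X_restr snd_conv)
    qed
  next
    fix W S P assume W: "openin (top_of X) W" and S: "S \<in> carrier (sections X W)" and P: "P \<in> preim (Spec B) ?r W"
      and u: "germ_unit (Spec B) (preim (Spec B) ?r W) (comor ?r W S) P"
    have P': "P \<in> pB W" using P unfolding pre .
    have "snd S P \<in> Units (stalk_at B P)"
      using u unfolding pre com[OF W S] SB.A.germ_unit_iff[OF CB.open_pre[OF W] CB.\<sigma>_sec[OF W S] P'] .
    then have "germ_unit X W S (inr P)" unfolding CB.chart_unit[OF W S P'] .
    then show "germ_unit X W S (pt ?r P)" using P' by (simp add: pt)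
  qed
qed

context curve_data
begin

abbreviation "pullback R R' \<phi> f \<equiv> rcomp (Spec R') (Spec R) X f (Spec_map R R' \<phi>)"

lemma pullback_rmors:
  "algebra K R \<Longrightarrow> algebra K R' \<Longrightarrow> \<phi> \<in> alg_hom K R R' \<Longrightarrow> f \<in> rmors K (Spec R) X \<Longrightarrow> pullback R R' \<phi> f \<in> rmors K (Spec R') X"
  by (rule rcomp_rmors[OF Spec_map_rmors _ X_presheaf])

lemma pullback_pt:
  "algebra K R' \<Longrightarrow> primeideal Q R' \<Longrightarrow> pt (pullback R R' \<phi> f) Q = pt f {r \<in> carrier R. \<phi> r \<in> Q}"
  by (simp add: rcomp_def topspace_Spec Spec_map_pt algebra.M_cring)

text \<open>The stalk map sends the normalized vector of \<open>f\<close> at the contracted prime to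
  the normalized vector of the pullback, and it sends the unit factor to a unit.\<close>

lemma coords_pullback:
  assumes R: "algebra K R" and R': "algebra K R'" and \<phi>: "\<phi> \<in> alg_hom K R R'" and f: "f \<in> rmors K (Spec R) X"
    and Q: "primeideal Q R'" and v: "coords R f {r \<in> carrier R. \<phi> r \<in> Q} v"
  shows "coords R' (pullback R R' \<phi> f) Q (\<lambda>k. stalk_map R' \<phi> Q (v k))"
proof -
  define P where "P = {r \<in> carrier R. \<phi> r \<in> Q}"
  note P = alg_hom_vimage_prime[OF \<phi> R R' Q, folded P_def]
  note h = stalk_map_hom[OF R R' \<phi> Q, folded P_def]
  note pt = pullback_pt[OF R' Q, where R=R and \<phi>=\<phi> and f=f, folded P_def]
  let ?h = "stalk_map R' \<phi> Q"
  interpret F: point_at K p n R f P by (rule point_at_intro[OF R f P])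
  interpret G: point_at K p n R' "pullback R R' \<phi> f" Q
    by (rule point_at_intro[OF R' pullback_rmors[OF R R' \<phi> f] Q])
  note v = v[folded P_def]
  note sA = char_stalk[OF R P] and sB = char_stalk[OF R' Q]
  have hz: "?h \<zero>\<^bsub>F.S\<^esub> = \<zero>\<^bsub>G.S\<^esub>" by (rule alg_hom_zero[OF h F.alg_S G.alg_S])
  note hu = alg_hom_Units(1)[OF h F.alg_S G.alg_S]
  show ?thesis using F.patch_cases
  proof
    assume m: "pt f P \<in> CA.patch"
    have m': "pt (pullback R R' \<phi> f) Q \<in> CA.patch" unfolding pt by (rule m)
    obtain c where c: "c \<in> Units F.S" "v = (\<lambda>k. c \<otimes>\<^bsub>F.S\<^esub> F.vA k)" using F.coords_A[OF m v] by (rule bexE)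
    have "?h (F.vA k) = G.vA k" for k
      using CA.chart_hom_pullback[OF R R' \<phi> f Q, folded P_def, OF m mon_A[OF gen_Gamma]]
      by (simp add: F.vA_def G.vA_def hz)
    then have "(\<lambda>k. ?h (v k)) = (\<lambda>k. ?h c \<otimes>\<^bsub>G.S\<^esub> G.vA k)"
      unfolding c(2) using alg_hom_mult[OF h F.S.Units_closed[OF c(1)] F.vA_closed[OF m]] by simp
    then show ?thesis using G.coords_scale[OF G.coords_vA[OF m'] hu[OF c(1)]] by (simp only:)
  next
    assume m: "pt f P \<in> CB.patch"
    have m': "pt (pullback R R' \<phi> f) Q \<in> CB.patch" unfolding pt by (rule m)
    obtain c where c: "c \<in> Units F.S" "v = (\<lambda>k. c \<otimes>\<^bsub>F.S\<^esub> F.vB k)" using F.coords_B[OF m v] by (rule bexE)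
    have "?h (F.vB k) = G.vB k" for k
      using CB.chart_hom_pullback[OF R R' \<phi> f Q, folded P_def, OF m mon_B]
      by (simp add: F.vB_def G.vB_def hz)
    then have "(\<lambda>k. ?h (v k)) = (\<lambda>k. ?h c \<otimes>\<^bsub>G.S\<^esub> G.vB k)"
      unfolding c(2) using alg_hom_mult[OF h F.S.Units_closed[OF c(1)] F.vB_closed[OF m]] by simp
    then show ?thesis using G.coords_scale[OF G.coords_vB[OF m'] hu[OF c(1)]] by (simp only:)
  qed
qed

text \<open>By homogeneity one vector at each prime is enough, so a convenient normalization may be
  used.\<close>

lemma movesI:
  assumes R: "algebra K R" and g: "g \<in> carrier (GUG p n R)" and f: "f \<in> rmors K (Spec R) X" and f': "f' \<in> rmors K (Spec R) X"
    and ex: "\<And>Q. primeideal Q R \<Longrightarrow> \<exists>v. coords R f Q v \<and> coords R f' Q (stalk_lin R Q g v)"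
  shows "moves R g f f'"
  unfolding moves_def
proof (intro allI impI)
  fix Q w assume Q: "primeideal Q R" and w: "coords R f Q w"
  interpret F: point_at K p n R f Q by (rule point_at_intro[OF R f Q])
  interpret G: point_at K p n R f' Q by (rule point_at_intro[OF R f' Q])
  obtain v where v: "F.coords v" "G.coords (stalk_lin R Q g v)" using ex[OF Q] by blast
  obtain c where c: "c \<in> Units F.S" "w = (\<lambda>k. c \<otimes>\<^bsub>F.S\<^esub> v k)" using F.coords_unique[OF v(1) w] by (rule bexE)
  have vc: "v k \<in> carrier F.S" for k using F.coords_hvec[OF v(1)] by (simp add: F.S.hvec_def)
  show "G.coords (stalk_lin R Q g w)"
    unfolding c(2) F.S.lin_scale[OF germ_group_closed[OF R Q g] vc F.S.Units_closed[OF c(1)]]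
    by (rule G.coords_scale[OF v(2) c(1)])
qed

text \<open>The map from the stalk at the contracted prime to the stalk at \<open>Q\<close> commutes
  with \<open>lin\<close> by \<open>lin_natural\<close>, and coordinates are compatible with
  pullback. So the pullback of the moved point satisfies the condition that characterizes moving the
  pullback.\<close>

lemma act_natural:
  assumes R: "algebra K R" and R': "algebra K R'" and \<phi>: "\<phi> \<in> alg_hom K R R'"
    and g: "g \<in> carrier (GUG p n R)" and f: "f \<in> rmors K (Spec R) X"
  shows "pullback R R' \<phi> (act R g f) = act R' (group_map \<phi> g) (pullback R R' \<phi> f)"
proof -
  interpret C: char_p_alg K R p n by (rule char_alg[OF R])
  obtain \<alpha> u t where g': "g = ((\<alpha>, u), t)" "\<alpha> \<in> carrier R" "u \<in> U_set p n R" "t \<in> Units R"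
    using g by (metis C.GUG_carrier prod.exhaust)
  note gf = act[OF R g f]
  note g2 = group_map_closed[OF char_alg[OF R] char_alg[OF R'] \<phi> g]
  note pf = pullback_rmors[OF R R' \<phi> f] and pgf = pullback_rmors[OF R R' \<phi> gf(1)]
  have "moves R' (group_map \<phi> g) (pullback R R' \<phi> f) (pullback R R' \<phi> (act R g f))"
  proof (rule movesI[OF R' g2 pf pgf])
    fix Q assume Q: "primeideal Q R'"
    define P where "P = {r \<in> carrier R. \<phi> r \<in> Q}"
    note P = alg_hom_vimage_prime[OF \<phi> R R' Q, folded P_def]
    note h = stalk_map_hom[OF R R' \<phi> Q, folded P_def]
    interpret F: point_at K p n R f P by (rule point_at_intro[OF R f P])
    obtain v where v: "F.coords v" using F.coords_ex by (rule exE)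
    have vc: "v k \<in> carrier F.S" for k using F.coords_hvec[OF v] by (simp add: F.S.hvec_def)
    have gv: "coords R (act R g f) P (stalk_lin R P g v)" using gf(2) P v unfolding moves_def by blast
    have germ: "stalk_map R' \<phi> Q (germ R P r \<one>\<^bsub>R\<^esub>) = germ R' Q (\<phi> r) \<one>\<^bsub>R'\<^esub>" if "r \<in> carrier R" for r
      using stalk_map_germ[OF R R' \<phi> Q that, of "\<one>\<^bsub>R\<^esub>", folded P_def] alg_hom_one[OF \<phi>]
        primeideal.I_notcarr[OF Q] ideal.one_imp_carrier[OF primeideal.axioms(1)[OF Q]] by auto
    \<comment> \<open>Both sides are the image of \<open>g\<close> in the stalk at \<open>Q\<close>:
      through \<open>R'\<close>, or through the stalk at the contracted prime.\<close>
    have "germ_group R' Q (group_map \<phi> g) = group_map (stalk_map R' \<phi> Q) (germ_group R P g)"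
      using g' by (simp add: group_map_def germ C.U_closed C.Units_closed)
    then have "stalk_lin R' Q (group_map \<phi> g) (\<lambda>k. stalk_map R' \<phi> Q (v k)) = (\<lambda>k. stalk_map R' \<phi> Q (stalk_lin R P g v k))"
      using lin_natural[OF char_stalk[OF R P] char_stalk[OF R' Q] h germ_group_closed[OF R P g] vc]
      by (simp add: fun_eq_iff)
    then show "\<exists>w. coords R' (pullback R R' \<phi> f) Q w \<and>
        coords R' (pullback R R' \<phi> (act R g f)) Q (stalk_lin R' Q (group_map \<phi> g) w)"
      using coords_pullback[OF R R' \<phi> f Q, folded P_def, OF v]
        coords_pullback[OF R R' \<phi> gf(1) Q, folded P_def, OF gv]
      by (intro exI[of _ "\<lambda>k. stalk_map R' \<phi> Q (v k)"]) (simp only: simp_thms)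
  qed
  from act_eqI[OF R' g2 pf pgf this] show ?thesis by (rule sym)
qed

section \<open>Points of the affine line inside the curve\<close>

lemma line_eval_hom:
  assumes R: "algebra K R" and x: "x \<in> carrier R"
  shows "line_eval K R x \<in> alg_hom K B R" "line_eval K R x (mon K (- int k)) = x [^]\<^bsub>R\<^esub> k"
proof -
  interpret R: algebra K R by fact
  let ?m = "\<lambda>a. x [^]\<^bsub>R\<^esub> nat (- a)"
  have m: "?m (a + b) = ?m a \<otimes>\<^bsub>R\<^esub> ?m b" if "a \<in> {..0}" "b \<in> {..0}" for a b :: int
  proof -
    have "nat (- (a + b)) = nat (- a) + nat (- b)" using that by simp
    then show ?thesis using x by (simp only: R.nat_pow_mult)
  qed
  have mc: "?m a \<in> carrier R" for a by (rule R.nat_pow_closed[OF x])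
  have m1: "?m 0 = \<one>\<^bsub>R\<^esub>" by simp
  have e: "line_eval K R x = LB.ev R ?m" by (simp add: line_eval_def LB.ev_def fun_eq_iff)
  show "line_eval K R x \<in> alg_hom K B R"
    unfolding e line_algebra_def by (rule LB.ev_hom[OF R mc m1 m])
  have "LB.ev R ?m (mon K (- int k)) = ?m (- int k)"
    by (rule LB.ev_mono[OF R mc m1 m]) auto
  then show "line_eval K R x (mon K (- int k)) = x [^]\<^bsub>R\<^esub> k" unfolding e by simp
qed

lemma curve_point_rmors:
  assumes R: "algebra K R" and x: "x \<in> carrier R"
  shows "curve_point K p n R x \<in> rmors K (Spec R) X"
  unfolding curve_point_def X_curve[symmetric] line_in_curve_def line_point_def
  by (rule rcomp_rmors[OF Spec_map_rmors[OF alg_B R line_eval_hom(1)[OF R x]] glue_inr_rmors X_presheaf])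

text \<open>In the chart of the line the point is evaluation at \<open>x\<close> followed by the
  germ. Its normalized vector is therefore the one to which \<open>lin_line\<close> applies.\<close>

lemma curve_point_chart:
  assumes R: "algebra K R" and x: "x \<in> carrier R" and Q: "primeideal Q R"
  shows "pt (curve_point K p n R x) Q \<in> CB.patch"
    "b \<in> carrier B \<Longrightarrow> CB.chart_hom (curve_point K p n R x) Q b = germ R Q (line_eval K R x b) \<one>\<^bsub>R\<^esub>"
proof -
  let ?l = "line_eval K R x" and ?r = "glue_inr (Spec A) (Spec B) (Spec C) i j"
  note l = line_eval_hom(1)[OF R x]
  define P where "P = {b \<in> carrier B. ?l b \<in> Q}"
  note P = alg_hom_vimage_prime[OF l alg_B R Q, folded P_def]
  have c: "curve_point K p n R x = rcomp (Spec R) (Spec B) X ?r (Spec_map B R ?l)"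
    unfolding curve_point_def X_curve[symmetric] line_in_curve_def line_point_def ..
  have pt: "pt ?r P = inr P" using P by (simp add: glue_inr_def SB.A.topspace)
  show "pt (curve_point K p n R x) Q \<in> CB.patch"
    using Q P unfolding c by (simp add: rcomp_def topspace_Spec Spec_map_pt algebra.M_cring[OF R] P_def[symmetric] pt)
  assume b: "b \<in> carrier B"
  note s = CB.chart_sec[OF b]
  have pP: "P \<in> preim (Spec B) ?r CB.patch" using P pt by (simp add: preim_def SB.A.topspace)
  have "comor ?r CB.patch (CB.chart_sec b) = snd (CB.chart_sec b)"
    using CB.patch_open s(1) by (simp add: glue_inr_def)
  then have cs: "comor ?r CB.patch (CB.chart_sec b) P = germ B P b \<one>\<^bsub>B\<^esub>" using s(2) P by simp
  have "CB.chart_hom (curve_point K p n R x) Q b = comor (Spec_map B R ?l) (preim (Spec B) ?r CB.patch) (comor ?r CB.patch (CB.chart_sec b)) Q"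
    using CB.patch_open s(1) unfolding c by (simp add: CB.chart_hom_def rcomp_def)
  also have "\<dots> = stalk_map R ?l Q (germ B P b \<one>\<^bsub>B\<^esub>)"
    unfolding Spec_map_comor[OF algebra.M_cring[OF R] preim_open[OF glue_inr_rmors CB.patch_open]
      alg_hom_closed[OF rmorsD(4)[OF glue_inr_rmors CB.patch_open] s(1)] Q pP[unfolded P_def]]
    unfolding P_def[symmetric] cs ..
  also have "\<dots> = germ R Q (?l b) \<one>\<^bsub>R\<^esub>"
    using stalk_map_germ[OF alg_B R l Q b SB.A.one_closed, folded P_def] alg_hom_one[OF l]
      primeideal.I_notcarr[OF Q] ideal.one_imp_carrier[OF primeideal.axioms(1)[OF Q]] by auto
  finally show "CB.chart_hom (curve_point K p n R x) Q b = germ R Q (?l b) \<one>\<^bsub>R\<^esub>" .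
qed

text \<open>By \<open>lin_line\<close>, applied in the stalk, the normalized vector of
  \<open>x\<close> goes to that of the moved element. Taking germs commutes with the action on the
  line by \<open>GUG_line_act_natural\<close>.\<close>

lemma act_curve_point:
  assumes R: "algebra K R" and g: "g \<in> carrier (GUG p n R)" and x: "x \<in> carrier R"
  shows "act R g (curve_point K p n R x) = curve_point K p n R (GUG_line_act p n R g x)"
proof -
  let ?y = "GUG_line_act p n R g x"
  have y: "?y \<in> carrier R" by (rule GUG_line_act_closed[OF char_alg[OF R] g x])
  note f = curve_point_rmors[OF R x] and f' = curve_point_rmors[OF R y]
  have vB: "point_at.vB K p n R (curve_point K p n R z) Q k =
      (if k \<le> Suc n then germ R Q z \<one>\<^bsub>R\<^esub> [^]\<^bsub>stalk_at R Q\<^esub> wt k else \<zero>\<^bsub>stalk_at R Q\<^esub>)"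
    if z: "z \<in> carrier R" and Q: "primeideal Q R" for z Q k
    unfolding point_at.vB_def[OF point_at_intro[OF R curve_point_rmors[OF R z] Q]]
      curve_point_chart(2)[OF R z Q mon_B] line_eval_hom(2)[OF R z]
      alg_hom_pow[OF spec_ring.germ_hom[OF spec_ring.intro[OF R] Q] R stalk_algebra[OF R Q] z] ..
  have "moves R g (curve_point K p n R x) (curve_point K p n R ?y)"
  proof (rule movesI[OF R g f f'])
    fix Q assume Q: "primeideal Q R"
    interpret F: point_at K p n R "curve_point K p n R x" Q by (rule point_at_intro[OF R f Q])
    interpret G: point_at K p n R "curve_point K p n R ?y" Q by (rule point_at_intro[OF R f' Q])
    note m = curve_point_chart(1)[OF R x Q] and m' = curve_point_chart(1)[OF R y Q]
    note gg = germ_group_closed[OF R Q g]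
    let ?x = "germ R Q x \<one>\<^bsub>R\<^esub>"
    have xc: "?x \<in> carrier F.S" by (rule alg_hom_closed[OF F.R.germ_hom[OF Q] x])
    have "stalk_lin R Q g F.vB k = G.vB k" for k
    proof (cases k)
      case 0
      then show ?thesis using F.vB_0[OF m] G.vB_0[OF m'] by (simp add: F.S.lin_0)
    next
      case (Suc l)
      show ?thesis
      proof (cases "l \<le> n")
        case True
        have "stalk_lin R Q g F.vB (Suc l) = F.S.fr l (GUG_line_act p n F.S (germ_group R Q g) ?x)"
          by (rule F.S.lin_line[where v=F.vB and j=l, OF gg xc F.vB_0[OF m] _ _ True]) (simp_all add: vB[OF x Q] F.S.fr_def)
        also have "GUG_line_act p n F.S (germ_group R Q g) ?x = germ R Q ?y \<one>\<^bsub>R\<^esub>"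
          by (rule GUG_line_act_natural[OF char_alg[OF R] char_stalk[OF R Q] F.R.germ_hom[OF Q] g x, symmetric])
        finally show ?thesis using True by (simp add: Suc vB[OF y Q] F.S.fr_def)
      next
        case False
        then have k: "k > Suc n" using Suc by simp
        have "F.S.hvec (stalk_lin R Q g F.vB)"
          by (rule F.S.lin_hvec[OF gg F.hvec_vB[OF m] F.R.stalk_add_unit[OF Q]])
        then show ?thesis using k by (simp add: F.S.hvec_def vB[OF y Q])
      qed
    qed
    then have "stalk_lin R Q g F.vB = G.vB" by (rule ext)
    then show "\<exists>v. F.coords v \<and> G.coords (stalk_lin R Q g v)"
      using F.coords_vB[OF m] G.coords_vB[OF m'] by (intro exI[of _ F.vB]) simp
  qed
  then show ?thesis by (rule act_eqI[OF R g f f'])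
qed

end

text \<open>The multiple \<open>[k] \<cdot> \<one>\<close> vanishes exactly when \<open>p\<close>
  divides \<open>k\<close>. Since \<open>([a] \<cdot> \<one>) \<otimes> ([b] \<cdot> \<one>) =
  [(a * b)] \<cdot> \<one>\<close>, the absence of zero divisors makes \<open>p\<close> a
  prime.\<close>

lemma (in domain) prime_characteristic:
  assumes p: "p > 0" and ord: "group.ord (add_monoid R) \<one> = p"
  shows "prime p" "[p] \<cdot> \<one> = \<zero>"
proof -
  have dv: "[k] \<cdot> \<one> = \<zero> \<longleftrightarrow> p dvd k" for k :: nat
    using group.pow_eq_id[OF a_group, of \<one> k] ord by (simp add: add_pow_def)
  show "[p] \<cdot> \<one> = \<zero>" by (simp add: dv)
  have mult: "([a] \<cdot> \<one>) \<otimes> ([b] \<cdot> \<one>) = [(a * b)] \<cdot> \<one>" for a b :: nat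
    using add_pow_ldistr[of \<one> "[b] \<cdot> \<one>" a] add.nat_pow_pow[of \<one> a b] add.nat_pow_pow[of \<one> b a] by (simp add: mult.commute)
  have "prime_elem p" unfolding prime_elem_def
  proof (intro conjI allI impI)
    show "p \<noteq> 0" using p by simp
    show "\<not> p dvd 1" using dv[of 1] by simp
    fix a b :: nat assume "p dvd a * b"
    then have "([a] \<cdot> \<one>) \<otimes> ([b] \<cdot> \<one>) = \<zero>" by (simp only: mult dv)
    then have "[a] \<cdot> \<one> = \<zero> \<or> [b] \<cdot> \<one> = \<zero>" by (rule integral) simp_all
    then show "p dvd a \<or> p dvd b" unfolding dv .
  qed
  then show "prime p" by simp
qed

text \<open>The second conjunct expresses the extension property: on points with values in any
  \<open>R\<close>, the open immersion of the line into the curve is equivariant. Both conjuncts are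
  read off from \<open>act\<close>.\<close>

theorem theorem5p4:
  fixes K :: "('k, 'm) ring_scheme" and p n :: nat
  assumes "field K"
    and "p > 0" and "group.ord (add_monoid K) \<one>\<^bsub>K\<^esub> = p"
  shows "\<exists>\<rho> :: ('k, 'u) module \<Rightarrow> ('u \<times> (nat \<Rightarrow> 'u)) \<times> 'u \<Rightarrow>
              ('u aff_pt, 'u aff_sec, 'k curve_pt, 'k curve_sec) rmor \<Rightarrow>
              ('u aff_pt, 'u aff_sec, 'k curve_pt, 'k curve_sec) rmor.
     group_functor_action K (GUG p n) GUG_map (curve K p n) \<rho> \<and>
     (\<forall>R. algebra K R \<longrightarrow>
        (\<forall>g \<in> carrier (GUG p n R). \<forall>\<mu> \<in> carrier R.
           \<rho> R g (curve_point K p n R \<mu>) = curve_point K p n R (GUG_line_act p n R g \<mu>)))"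
proof -
  interpret K: field K by fact
  interpret curve_data K p n
    by (intro curve_data.intro curve_data_axioms.intro assms(1) K.prime_characteristic[OF assms(2,3)])
  \<comment> \<open>Restricting to the set of points makes \<open>\<rho> R g\<close> extensional, as
    membership in the group of bijections demands.\<close>
  define \<rho> where "\<rho> R g = (\<lambda>f\<in>rmors K (Spec R) X. act R g f)" for R :: "('k, 'u) module" and g
  have "group_functor_action K (GUG p n) GUG_map X \<rho>"
    unfolding group_functor_action_def points_def points_map_def
  proof (intro conjI allI impI ballI)
    fix R :: "('k, 'u) module" assume R: "algebra K R"
    show "group_action (GUG p n R) (rmors K (Spec R) X) (\<rho> R)"
      unfolding \<rho>_def[abs_def]
      by (rule group_actionI[OF char_p_alg.GUG_group[OF char_alg[OF R]] act(1)[OF R] act_one[OF R] act_mult[OF R]])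
  next
    fix R R' :: "('k, 'u) module" and \<phi> g f
    assume A: "algebra K R \<and> algebra K R'" "\<phi> \<in> alg_hom K R R'" "g \<in> carrier (GUG p n R)" "f \<in> rmors K (Spec R) X"
    then show "pullback R R' \<phi> (\<rho> R g f) = \<rho> R' (GUG_map \<phi> g) (pullback R R' \<phi> f)"
      using act_natural[of R R' \<phi> g f] pullback_rmors[of R R' \<phi> f] by (simp add: \<rho>_def GUG_map_eq)
  qed
  moreover have "\<rho> R g (curve_point K p n R x) = curve_point K p n R (GUG_line_act p n R g x)"
    if "algebra K R" "g \<in> carrier (GUG p n R)" "x \<in> carrier R" for R g x
    using act_curve_point[OF that] curve_point_rmors[OF that(1,3)] by (simp add: \<rho>_def)
  ultimately show ?thesis unfolding X_curve by blast
qed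

end
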